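(* Let $N\in\mathbb{N}$, $T>0$, let $a_2,a_{1,1},\dots,a_{1,N},a_0\in C([0,T];\mathbb{C})$ and consider on $[0,T]\times\mathbb{T}^N$ the operator $$P(t,D_x,D_t)=D_t-a_2(t)\Delta_x+\sum_{j=1}^N a_{1,j}(t)D_{x_j}+a_0(t)$$ and the Cauchy problem $$(\mathrm{CP})\qquad Pu(t,x)=f(t,x),\quad u(0,x)=g(x),\qquad t\in[0,T],\ x\in\mathbb{T}^N .$$ Write $c_2=\operatorname{Im}a_2$ and $c_{1,j}=\operatorname{Im}a_{1,j}$. Assume: (1) $c_2(t)\le 0$ for every $t\in[0,T]$. (2) There is a finite set $\{t_1,t_2,\dots,t_m\}\subset[0,T]$, with $t_1<t_2<\dots<t_m$, such that $c_2(t)=0$ if and only if $t\in\{t_1,\dots,t_m\}$. (3) There exists $\delta>0$ such that for every $k\in\{1,\dots,m\}$ one can write $c_2(t)=\alpha^k(t)\,|t-t_k|^{p_k}$ for all $t\in[t_k-\delta,t_k+\delta]\cap[0,T]$, where $p_k>0$, $\alpha^k$ is bounded and there exists $\varepsilon>0$ such that $\alpha^k\le-\varepsilon$ on this set. (4) For each $j\in\{1,\dots,N\}$ and $k\in\{1,\dots,m\}$ one can write $c_{1,j}(t)=\beta^{j,k}(t)\,|t-t_k|^{q_{j,k}}$ for all $t\in[t_k-\delta,t_k+\delta]\cap[0,T]$ (same $\delta$), where $q_{j,k}\ge0$ and $\beta^{j,k}$ is a bounded function that does not vanish on this set. For each $k\in\{1,\dots,m\}$ set $q_k=\min\{q_{1,k},\dots,q_{N,k}\}$.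 Then: (I) If $p_k\le 2q_k+1$ for every $k\in\{1,\dots,m\}$, then (CP) is well-posed in $H^r$. (II) Suppose $p_k>2q_k+1$ for some $k\in\{1,\dots,m\}$. Then (CP) is ill-posed (i.e. not well-posed) in $C^\infty$. Furthermore, if $\mathscr{K}=\{1\le k\le m:\ p_k>2q_k+1\}$, then (CP) is well-posed in $G^\tau$ (where $\tau\ge1$) if and only if $$\tau<\min_{k\in\mathscr{K}}\left(\frac{p_k-q_k}{p_k-2q_k-1}\right).$$
   Context: $\mathbb{T}^N=\mathbb{R}^N/2\pi\mathbb{Z}^N$, $D_t=\frac1i\partial_t$, $D_{x_j}=\frac1i\partial_{x_j}$, $\Delta_x=\sum_j\partial_{x_j}^2$. Spaces. For a distribution $u$ on $\mathbb{T}^N$ its Fourier coefficients are $\widehat u(\xi)=\langle u,e^{-ix\xi}\rangle$, $\xi\in\mathbb{Z}^N$, normalized so that $u=\sum_\xi\widehat u(\xi)e^{ix\xi}$. For $r\in\mathbb{R}$, $H^r(\mathbb{T}^N)$ is the set of distributions with $\|u\|_{H^r}^2=\sum_{\xi}|\widehat u(\xi)|^2(1+|\xi|)^{2r}<\infty$. $C^\infty(\mathbb{T}^N)=\bigcap_r H^r(\mathbb{T}^N)$ carries the projective limit topology. For $s\ge1$, $G^s(\mathbb{T}^N)$ is the set of $f\in C^\infty(\mathbb{T}^N)$ for which there are $C,h>0$ with $|D^\alpha f(x)|\le Ch^{|\alpha|}|\alpha|!^s$ for all multi-indices $\alpha$ and all $x$. With $\|f\|_{h,s}=\sup_\alpha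 \|D^\alpha f\|_\infty/(h^{|\alpha|}|\alpha|!^s)$ and $G^s_h(\mathbb{T}^N)=\{f:\|f\|_{h,s}<\infty\}$, $G^s(\mathbb{T}^N)$ carries the (locally convex) inductive limit topology of the Banach spaces $G^s_h(\mathbb{T}^N)$, $h\to\infty$. $C([0,T];X)$ denotes the continuous maps $[0,T]\to X$. Solutions. $u\in C([0,T];H^\rho(\mathbb{T}^N))$ (some $\rho\in\mathbb{R}$) solves the Cauchy problem if $u(0)=g$ and $Pu=f$ holds with $D_tu$ understood as the weak derivative in $t$ on $(0,T)$: $\langle D_tu,\varphi\rangle=\int_0^T u(t)(-D_t\varphi(t))\,dt$ for $\varphi\in C_c^\infty((0,T))$. Well-posedness. The Cauchy problem is well-posed in $H^r$ if for every $r\in\mathbb{R}$, $f\in C([0,T];H^r(\mathbb{T}^N))$ and $g\in H^r(\mathbb{T}^N)$ there is a unique solution $u\in C([0,T];H^r(\mathbb{T}^N))$. It is well-posed in $C^\infty$ (resp. in $G^s$, for a fixed $s\ge1$) if for every $f\in C([0,T];X)$ and $g\in X$ there is a unique solution $u\in C([0,T];X)$, where $X=C^\infty(\mathbb{T}^N)$ (resp. $X=G^s(\mathbb{T}^N)$).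
   Formalization: In part (II), "does not vanish" in (4) is strengthened: each |β^{j,k}| is bounded below by a positive constant on the set. Otherwise (II) fails, e.g. N=1, a_2=-it^6, a_1=it^5, t_1=0 with q=2, β=t^3 for t>0, β(0)=1. Part (I) keeps (4) as stated. *)

theory Defs
  imports "HOL-Analysis.Analysis"
begin

section \<open>Smooth functions on the torus\<close>

text \<open>Functions on the torus are functions on \<open>real^'n\<close> that are \<open>2 * pi\<close>-periodic in
  each coordinate. A multi-index \<open>\<alpha>\<close> is represented by a list of coordinate directions containing
  each \<open>j\<close> exactly \<open>\<alpha>\<^sub>j\<close> times, so that \<open>|\<alpha>|\<close> is the length of the list. For smooth functions
  the order of the directions is irrelevant (Schwarz).\<close>

definition partial_deriv :: "'n::finite \<Rightarrow> (real^'n \<Rightarrow> complex) \<Rightarrow> real^'n \<Rightarrow> complex" where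
  "partial_deriv j f x = vector_derivative (\<lambda>h. f (x + h *\<^sub>R axis j 1)) (at 0)"

definition partial_derivs :: "'n::finite list \<Rightarrow> (real^'n \<Rightarrow> complex) \<Rightarrow> real^'n \<Rightarrow> complex" where
  "partial_derivs js f = foldr partial_deriv js f"

definition smooth_fun :: "(real^'n::finite \<Rightarrow> complex) \<Rightarrow> bool" where
  "smooth_fun f \<longleftrightarrow> (\<forall>js. continuous_on UNIV (partial_derivs js f) \<and>
     (\<forall>j x. (\<lambda>h. partial_derivs js f (x + h *\<^sub>R axis j 1)) differentiable (at (0::real))))"

definition torus_smooth :: "(real^'n::finite \<Rightarrow> complex) set" where
  "torus_smooth = {f. smooth_fun f \<and> (\<forall>x j. f (x + (2 * pi) *\<^sub>R axis j 1) = f x)}"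

section \<open>Distributions on the torus\<close>

type_synonym 'n functional = "(real^'n \<Rightarrow> complex) \<Rightarrow> complex"

text \<open>Continuous linear functionals on the smooth functions. Continuity is the usual
  seminorm estimate for the Frechet topology. The value \<open>0\<close> outside the test functions
  only serves to make equality of distributions coincide with equality of HOL functions.\<close>

definition distributions :: "'n::finite functional set" where
  "distributions = {u.
     (\<forall>\<phi>. \<phi> \<notin> torus_smooth \<longrightarrow> u \<phi> = 0) \<and>
     (\<forall>\<phi>\<in>torus_smooth. \<forall>\<psi>\<in>torus_smooth. u (\<lambda>x. \<phi> x + \<psi> x) = u \<phi> + u \<psi>) \<and>
     (\<forall>c. \<forall>\<phi>\<in>torus_smooth. u (\<lambda>x. c * \<phi> x) = c * u \<phi>) \<and>
     (\<exists>C k. \<forall>\<phi>\<in>torus_smooth. \<forall>B.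
        (\<forall>js x. length js \<le> k \<longrightarrow> norm (partial_derivs js \<phi> x) \<le> B) \<longrightarrow> norm (u \<phi>) \<le> C * B)}"

text \<open>The factor \<open>(2 * pi) ^ (-N)\<close> is forced by the normalization of the Fourier coefficients:
  the function \<open>exp (\<i> x \<xi>)\<close> has \<open>\<xi>\<close>-th coefficient \<open>1\<close>.\<close>

definition distr_of_fun :: "(real^'n::finite \<Rightarrow> complex) \<Rightarrow> 'n functional" where
  "distr_of_fun f = (\<lambda>\<phi>. if \<phi> \<in> torus_smooth
     then integral (cbox 0 (\<chi> j. 2 * pi)) (\<lambda>x. f x * \<phi> x) / of_real ((2 * pi) ^ CARD('n)) else 0)"

definition fourier_coeff :: "'n::finite functional \<Rightarrow> int^'n \<Rightarrow> complex" where
  "fourier_coeff u \<xi> = u (\<lambda>x. exp (- \<i> * of_real (\<Sum>j\<in>UNIV. x $ j * of_int (\<xi> $ j))))"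

definition distr_partial :: "'n::finite \<Rightarrow> 'n functional \<Rightarrow> 'n functional" where
  "distr_partial j u = (\<lambda>\<phi>. if \<phi> \<in> torus_smooth then - u (partial_deriv j \<phi>) else 0)"

definition distr_D :: "'n::finite \<Rightarrow> 'n functional \<Rightarrow> 'n functional" where
  "distr_D j u = (\<lambda>\<phi>. (1 / \<i>) * distr_partial j u \<phi>)"

definition distr_laplacian :: "'n::finite functional \<Rightarrow> 'n functional" where
  "distr_laplacian u = (\<lambda>\<phi>. \<Sum>j\<in>UNIV. distr_partial j (distr_partial j u) \<phi>)"

section \<open>Topologies given by seminorms\<close>

definition seminorm_on :: "'n functional set \<Rightarrow> ('n functional \<Rightarrow> real) \<Rightarrow> bool" where
  "seminorm_on X p \<longleftrightarrow>
     (\<forall>u\<in>X. 0 \<le> p u) \<and>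
     (\<forall>u\<in>X. \<forall>v\<in>X. p (\<lambda>\<phi>. u \<phi> + v \<phi>) \<le> p u + p v) \<and>
     (\<forall>c. \<forall>u\<in>X. p (\<lambda>\<phi>. c * u \<phi>) = norm c * p u)"

text \<open>The topology on \<open>X\<close> generated by a family \<open>Q\<close> of seminorms; for \<open>Q = {p}\<close> with a norm \<open>p\<close>
  this is the norm topology.\<close>

definition seminorm_topology ::
    "'n functional set \<Rightarrow> ('n functional \<Rightarrow> real) set \<Rightarrow> 'n functional topology" where
  "seminorm_topology X Q = topology_generated_by
     (insert X {{v\<in>X. p (\<lambda>\<phi>. v \<phi> - u \<phi>) < e} | u p e. u \<in> X \<and> p \<in> Q \<and> 0 < e})"

definition locally_convex_topology :: "'n functional set \<Rightarrow> 'n functional topology \<Rightarrow> bool" where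
  "locally_convex_topology X \<tau> \<longleftrightarrow>
     (\<exists>Q. (\<forall>p\<in>Q. seminorm_on X p) \<and> \<tau> = seminorm_topology X Q)"

section \<open>Function spaces\<close>

definition sobolev_weight :: "real \<Rightarrow> 'n::finite functional \<Rightarrow> int^'n \<Rightarrow> real" where
  "sobolev_weight r u \<xi> =
     (norm (fourier_coeff u \<xi>))\<^sup>2 * (1 + norm (\<chi> j. real_of_int (\<xi> $ j))) powr (2 * r)"

definition sobolev :: "real \<Rightarrow> 'n::finite functional set" where
  "sobolev r = {u \<in> distributions. sobolev_weight r u summable_on UNIV}"

definition sobolev_norm :: "real \<Rightarrow> 'n::finite functional \<Rightarrow> real" where
  "sobolev_norm r u = sqrt (infsum (sobolev_weight r u) UNIV)"

definition sobolev_top :: "real \<Rightarrow> 'n::finite functional topology" where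
  "sobolev_top r = seminorm_topology (sobolev r) {sobolev_norm r}"

definition Cinf :: "'n::finite functional set" where
  "Cinf = (\<Inter>r. sobolev r)"

text \<open>Projective limit topology: the coarsest topology for which all the inclusions into
  the Sobolev spaces are continuous.\<close>

definition Cinf_top :: "'n::finite functional topology" where
  "Cinf_top = topology_generated_by {Cinf \<inter> U | r U. openin (sobolev_top r) U}"

text \<open>The smooth function representing an element of \<open>Cinf\<close>.\<close>

definition smooth_rep :: "'n::finite functional \<Rightarrow> real^'n \<Rightarrow> complex" where
  "smooth_rep u = the_inv_into torus_smooth distr_of_fun u"

text \<open>Since \<open>D\<^sub>j = (1/\<i>) \<partial>\<^sub>j\<close>, the absolute values of \<open>D\<^sup>\<alpha> f\<close> and \<open>\<partial>\<^sup>\<alpha> f\<close> agree.\<close>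

definition gevrey :: "real \<Rightarrow> 'n::finite functional set" where
  "gevrey s = {u \<in> Cinf. \<exists>C>0. \<exists>h>0. \<forall>js x.
     norm (partial_derivs js (smooth_rep u) x) \<le> C * h ^ length js * fact (length js) powr s}"

definition gevrey_quotient ::
    "real \<Rightarrow> real \<Rightarrow> 'n::finite functional \<Rightarrow> 'n list \<times> (real^'n) \<Rightarrow> real" where
  "gevrey_quotient h s u = (\<lambda>(js, x).
     norm (partial_derivs js (smooth_rep u) x) / (h ^ length js * fact (length js) powr s))"

definition gevrey_h :: "real \<Rightarrow> real \<Rightarrow> 'n::finite functional set" where
  "gevrey_h h s = {u \<in> Cinf. bdd_above (range (gevrey_quotient h s u))}"

definition gevrey_h_norm :: "real \<Rightarrow> real \<Rightarrow> 'n::finite functional \<Rightarrow> real" where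
  "gevrey_h_norm h s u = Sup (range (gevrey_quotient h s u))"

definition gevrey_h_top :: "real \<Rightarrow> real \<Rightarrow> 'n::finite functional topology" where
  "gevrey_h_top h s = seminorm_topology (gevrey_h h s) {gevrey_h_norm h s}"

text \<open>Locally convex inductive limit topology: the finest locally convex topology for which all
  the inclusions of the Banach spaces \<open>gevrey_h h s\<close> are continuous, obtained as the supremum
  of all locally convex topologies with this property.\<close>

definition gevrey_top :: "real \<Rightarrow> 'n::finite functional topology" where
  "gevrey_top s = topology_generated_by {U. \<exists>\<tau>. locally_convex_topology (gevrey s) \<tau> \<and>
     (\<forall>h>0. continuous_map (gevrey_h_top h s) \<tau> (\<lambda>u. u)) \<and> openin \<tau> U}"

section \<open>The Cauchy problem\<close>

definition time_cont :: "real \<Rightarrow> 'n functional topology \<Rightarrow> (real \<Rightarrow> 'n functional) \<Rightarrow> bool" where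
  "time_cont T X u \<longleftrightarrow> continuous_map (top_of_set {0..T}) X u"

definition time_test :: "real \<Rightarrow> (real \<Rightarrow> complex) set" where
  "time_test T = {\<phi>. (\<forall>k t. ((\<lambda>f s. vector_derivative f (at s)) ^^ k) \<phi> differentiable (at t)) \<and>
     closure {t. \<phi> t \<noteq> 0} \<subseteq> {0<..<T}}"

text \<open>Integrals of distribution-valued functions of time are taken in the weak sense, i.e.
  after evaluation at each test function in \<open>x\<close>.\<close>

definition distr_integral :: "real \<Rightarrow> (real \<Rightarrow> 'n functional) \<Rightarrow> 'n functional" where
  "distr_integral T F = (\<lambda>\<psi>. integral {0..T} (\<lambda>t. F t \<psi>))"

definition weak_Dt :: "real \<Rightarrow> (real \<Rightarrow> 'n functional) \<Rightarrow> (real \<Rightarrow> complex) \<Rightarrow> 'n functional" where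
  "weak_Dt T u \<phi> = distr_integral T
     (\<lambda>t \<psi>. - ((1 / \<i>) * vector_derivative \<phi> (at t)) * u t \<psi>)"

definition spatial_op ::
    "(real \<Rightarrow> complex) \<Rightarrow> ('n::finite \<Rightarrow> real \<Rightarrow> complex) \<Rightarrow> (real \<Rightarrow> complex) \<Rightarrow>
     real \<Rightarrow> 'n functional \<Rightarrow> 'n functional" where
  "spatial_op a2 a1 a0 t v = (\<lambda>\<psi>. - a2 t * distr_laplacian v \<psi>
     + (\<Sum>j\<in>UNIV. a1 j t * distr_D j v \<psi>) + a0 t * v \<psi>)"

text \<open>The equation \<open>P u = f\<close> holds between distributions in time on \<open>(0, T)\<close>, that is, after
  pairing with every \<open>\<phi>\<close> in \<open>time_test T\<close>.\<close>

definition solves_CP ::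
    "real \<Rightarrow> (real \<Rightarrow> complex) \<Rightarrow> ('n::finite \<Rightarrow> real \<Rightarrow> complex) \<Rightarrow> (real \<Rightarrow> complex) \<Rightarrow>
     (real \<Rightarrow> 'n functional) \<Rightarrow> 'n functional \<Rightarrow> (real \<Rightarrow> 'n functional) \<Rightarrow> bool" where
  "solves_CP T a2 a1 a0 f g u \<longleftrightarrow>
     (\<exists>\<rho>. time_cont T (sobolev_top \<rho>) u) \<and> u 0 = g \<and>
     (\<forall>\<phi>\<in>time_test T.
        (\<lambda>\<psi>. weak_Dt T u \<phi> \<psi> + distr_integral T (\<lambda>t \<psi>. \<phi> t * spatial_op a2 a1 a0 t (u t) \<psi>) \<psi>)
        = distr_integral T (\<lambda>t \<psi>. \<phi> t * f t \<psi>))"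

definition well_posed_in ::
    "'n::finite functional topology \<Rightarrow> real \<Rightarrow> (real \<Rightarrow> complex) \<Rightarrow> ('n \<Rightarrow> real \<Rightarrow> complex) \<Rightarrow>
     (real \<Rightarrow> complex) \<Rightarrow> bool" where
  "well_posed_in X T a2 a1 a0 \<longleftrightarrow>
     (\<forall>f g. time_cont T X f \<and> g \<in> topspace X \<longrightarrow>
        (\<exists>u. time_cont T X u \<and> solves_CP T a2 a1 a0 f g u \<and>
           (\<forall>v. time_cont T X v \<and> solves_CP T a2 a1 a0 f g v \<longrightarrow> (\<forall>t\<in>{0..T}. v t = u t))))"

definition well_posed_Hr where
  "well_posed_Hr T a2 a1 a0 \<longleftrightarrow> (\<forall>r. well_posed_in (sobolev_top r) T a2 a1 a0)"

definition well_posed_Cinf where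
  "well_posed_Cinf T a2 a1 a0 \<longleftrightarrow> well_posed_in Cinf_top T a2 a1 a0"

definition well_posed_Gevrey where
  "well_posed_Gevrey s T a2 a1 a0 \<longleftrightarrow> well_posed_in (gevrey_top s) T a2 a1 a0"

text \<open>Real powers of nonnegative reals with the convention \<open>0\<^sup>0 = 1\<close>; in contrast,
  \<open>0 powr 0 = 0\<close>.\<close>

definition rpow :: "real \<Rightarrow> real \<Rightarrow> real" where
  "rpow x a = (if a = 0 then 1 else x powr a)"

end

theory Submission
  imports Defs "HOL-Computational_Algebra.Polynomial"
begin

text \<open>On the Fourier side the problem decouples into scalar equations
  \<open>D\<^sub>t u + symb \<xi> t u = f\<close>, whose solution operators from time \<open>s\<close> to time \<open>t\<close> have size
  \<open>exp (\<integral>\<^sub>s\<^sup>t Im (symb \<xi>))\<close>. Near a zero \<open>t\<^sub>k\<close> of \<open>Im a\<^sub>2\<close> the exponent is dominated by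
  \<open>- r\<^sup>p |\<xi>|\<^sup>2 + C r\<^sup>q |\<xi>|\<close> with \<open>r = |t - t\<^sub>k|\<close>, which is positive only for
  \<open>r\<close> up to a multiple of \<open>|\<xi>|\<close> to the power \<open>-1/(p - q)\<close>. Hence its integral is bounded by
  a multiple of \<open>|\<xi>|\<close> to the power \<open>\<sigma> = (p - 2 q - 1)/(p - q)\<close>, and is bounded if
  \<open>p \<le> 2 q + 1\<close>. If \<open>\<tau> < 1/\<sigma>\<close>, the decay of the coefficients of Gevrey data of order \<open>\<tau>\<close>
  absorbs this growth. Conversely the growth is attained along a coordinate axis, so that the
  source term with coefficients of size \<open>exp (- h |\<xi>|\<^sup>\<sigma>)\<close>, \<open>h\<close> small and phases in resonance,
  is Gevrey of order \<open>1/\<sigma>\<close> but admits no solution with values in any Sobolev space.\<close>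

section \<open>Characters of the torus\<close>

text \<open>The counterexample is a source term with zero initial datum because
  \<open>Im (a2 s)\<close> may be strictly negative before a degenerate time: a datum given at time
  \<open>0\<close> is then damped like a Gaussian in |\<xi>| before any growth sets in. A source can
  act inside the growth window itself. That window lies at a distance from \<open>t k\<close>
  comparable to its own length; its shrinking costs only a power of |\<xi>|, which the exponential
  outweighs.

  The lower bound on |\<beta>| in the negative half makes q the true order of vanishing: a bounded
  function without zeros may still tend to 0 at \<open>t k\<close>, and the first order term would
  then be weaker than r to the power q.

  The other obstacle is translation. Continuity in time refers to topologies on functionals. The
  scalar estimates become usable once continuity into \<open>sobolev_top r\<close> is known to mean
  continuous coefficients with uniformly small tails, and continuity into
  \<open>gevrey_top s\<close> continuous coefficients with one decay rate for all times. The
  equation holds only weakly in time, so the solution formula must itself be derived for each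
  frequency.\<close>

definition dotp :: "real^'n::finite \<Rightarrow> int^'n \<Rightarrow> real" where
  "dotp x \<xi> = (\<Sum>j\<in>UNIV. x $ j * of_int (\<xi> $ j))"

definition expo :: "int^'n::finite \<Rightarrow> real^'n \<Rightarrow> complex" where
  "expo \<xi> x = exp (\<i> * of_real (dotp x \<xi>))"

definition wt :: "int^'n::finite \<Rightarrow> real" where
  "wt \<xi> = 1 + norm (\<chi> j. real_of_int (\<xi> $ j))"

lemma wt_ge_1: "1 \<le> wt \<xi>" and wt_pos [simp]: "0 < wt \<xi>" and wt_nonneg [simp]: "0 \<le> wt \<xi>"
  by (auto simp: wt_def add_pos_nonneg add_nonneg_nonneg)

lemma component_le_wt: "1 + \<bar>real_of_int (\<xi> $ j)\<bar> \<le> wt \<xi>"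
  using component_le_norm_cart[of "\<chi> j. real_of_int (\<xi> $ j)" j] by (simp add: wt_def)

lemma wt_le_sum: "wt \<xi> \<le> 1 + (\<Sum>j\<in>UNIV. \<bar>real_of_int (\<xi> $ j)\<bar>)"
  using norm_le_l1_cart[of "\<chi> j. real_of_int (\<xi> $ j)"] by (simp add: wt_def)

lemma wt_uminus [simp]: "wt (-\<xi>) = wt \<xi>"
proof -
  have "(\<chi> j. real_of_int ((-\<xi>) $ j)) = - (\<chi> j. real_of_int (\<xi> $ j))"
    by (simp add: vec_eq_iff)
  then show ?thesis by (simp only: wt_def norm_minus_cancel)
qed

text \<open>The largest component dominates \<open>wt \<xi>\<close> up to the factor 1 + N. Hence
  pure derivatives in the coordinate directions control the full weight, and the constant is only
  geometric in \<open>M\<close>, which is what a Gevrey estimate can tolerate.\<close>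

lemma wt_power_le:
  fixes \<xi> :: "int^'n::finite"
  shows "wt \<xi> ^ M \<le> (1 + real CARD('n)) ^ M * (1 + (\<Sum>j\<in>UNIV. \<bar>real_of_int (\<xi> $ j)\<bar> ^ M))"
proof -
  define a where "a = Max (range (\<lambda>j. \<bar>real_of_int (\<xi> $ j)\<bar>))"
  have a: "\<bar>real_of_int (\<xi> $ j)\<bar> \<le> a" for j
    unfolding a_def by (rule Max_ge) auto
  have "a \<in> range (\<lambda>j. \<bar>real_of_int (\<xi> $ j)\<bar>)"
    unfolding a_def by (rule Max_in) auto
  then obtain j where j: "a = \<bar>real_of_int (\<xi> $ j)\<bar>" by auto
  have a0: "0 \<le> a" using j by simp
  have "wt \<xi> \<le> 1 + real CARD('n) * a"
    using wt_le_sum[of \<xi>] sum_bounded_above[of UNIV "\<lambda>j. \<bar>real_of_int (\<xi> $ j)\<bar>" a] a by simp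
  also have "\<dots> \<le> (1 + real CARD('n)) * max 1 a"
    using a0 by (simp add: distrib_right add_mono mult_left_mono)
  finally have "wt \<xi> ^ M \<le> ((1 + real CARD('n)) * max 1 a) ^ M"
    by (intro power_mono) auto
  also have "\<dots> = (1 + real CARD('n)) ^ M * max 1 a ^ M" by (simp add: power_mult_distrib)
  also have "max 1 a ^ M \<le> 1 + a ^ M" using a0 by (simp add: max_def)
  also have "a ^ M \<le> (\<Sum>j\<in>UNIV. \<bar>real_of_int (\<xi> $ j)\<bar> ^ M)"
    unfolding j by (rule member_le_sum) auto
  finally show ?thesis by (simp add: mult_left_mono)
qed

lemma summable_on_int_inverse_square: "(\<lambda>k::int. 1 / (1 + \<bar>real_of_int k\<bar>)^2) summable_on UNIV"
proof -
  have s: "summable (\<lambda>n. 1 / (1 + real n)^2)"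
    using summable_Suc_iff[of "\<lambda>n. inverse (real n ^ 2)"] inverse_power_summable[of 2, where ?'a = real]
    by (simp add: inverse_eq_divide add.commute)
  have "(\<lambda>n. 1 / (1 + real n)^2) summable_on UNIV"
    by (rule norm_summable_imp_summable_on) (use s in simp)
  then have 1: "(\<lambda>k::int. 1 / (1 + \<bar>real_of_int k\<bar>)^2) summable_on range int"
    and 2: "(\<lambda>k::int. 1 / (1 + \<bar>real_of_int k\<bar>)^2) summable_on range (\<lambda>n. - int n)"
    by (subst summable_on_reindex; auto simp: inj_on_def o_def)+
  have "k \<in> range int \<union> range (\<lambda>n. - int n)" for k
    by (cases k rule: int_cases2) auto
  then have "range int \<union> range (\<lambda>n. - int n) = UNIV" by blast
  with summable_on_union[OF 1 2] show ?thesis by simp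
qed

lemma summable_on_wt:
  "(\<lambda>\<xi>::int^'n::finite. 1 / wt \<xi> ^ (2 * CARD('n))) summable_on UNIV"
proof -
  define h where "h = (\<lambda>k::int. 1 / (1 + \<bar>real_of_int k\<bar>)^2)"
  define A where "A = infsum h UNIV"
  have h0: "0 \<le> h k" for k by (simp add: h_def)
  have hA: "sum h B \<le> A" if "finite B" for B
    unfolding A_def using summable_on_int_inverse_square h0 that
    by (intro finite_sum_le_infsum) (auto simp: h_def)
  have le: "1 / wt \<xi> ^ (2 * CARD('n)) \<le> (\<Prod>j\<in>UNIV. h (\<xi> $ j))" for \<xi> :: "int^'n"
  proof -
    have "(\<Prod>j\<in>(UNIV::'n set). (1 + \<bar>real_of_int (\<xi> $ j)\<bar>)^2) \<le> (\<Prod>j\<in>(UNIV::'n set). wt \<xi> ^ 2)"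
      by (intro prod_mono conjI power_mono component_le_wt) auto
    also have "\<dots> = wt \<xi> ^ (2 * CARD('n))" by (simp add: power_mult)
    finally have "1 / wt \<xi> ^ (2 * CARD('n)) \<le> 1 / (\<Prod>j\<in>(UNIV::'n set). (1 + \<bar>real_of_int (\<xi> $ j)\<bar>)^2)"
      by (intro divide_left_mono mult_pos_pos prod_pos) (auto simp: add_pos_nonneg)
    then show ?thesis by (simp add: h_def prod_dividef)
  qed
  have "sum (\<lambda>\<xi>::int^'n. 1 / wt \<xi> ^ (2 * CARD('n))) G \<le> A ^ CARD('n)" if "finite G" for G
  proof -
    define B where "B = (\<Union>j. (\<lambda>\<xi>. \<xi> $ j) ` G)"
    have fB: "finite B" using that by (auto simp: B_def)
    have "sum (\<lambda>\<xi>::int^'n. 1 / wt \<xi> ^ (2 * CARD('n))) G \<le> (\<Sum>\<xi>\<in>G. \<Prod>j\<in>UNIV. h (\<xi> $ j))"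
      by (intro sum_mono le)
    also have "\<dots> = (\<Sum>f\<in>(\<lambda>\<xi>. vec_nth \<xi>) ` G. \<Prod>j\<in>UNIV. h (f j))"
      by (subst sum.reindex) (auto simp: inj_on_def vec_nth_inject)
    also have "\<dots> \<le> (\<Sum>f\<in>Pi\<^sub>E (UNIV::'n set) (\<lambda>_. B). \<Prod>j\<in>UNIV. h (f j))"
      by (intro sum_mono2 finite_PiE prod_nonneg) (use fB h0 in \<open>auto simp: B_def\<close>)
    also have "\<dots> = (\<Prod>j\<in>(UNIV::'n set). \<Sum>k\<in>B. h k)"
      by (rule prod_sum_PiE[symmetric]) (use fB in auto)
    also have "\<dots> \<le> (\<Prod>j\<in>(UNIV::'n set). A)"
      by (intro prod_mono conjI sum_nonneg hA fB h0)
    finally show ?thesis by simp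
  qed
  then show ?thesis
    by (intro nonneg_bdd_above_summable_on bdd_aboveI2[where M = "A ^ CARD('n)"]) auto
qed

lemma dotp_add: "dotp (x + y) \<xi> = dotp x \<xi> + dotp y \<xi>"
  by (simp add: dotp_def sum.distrib algebra_simps)

lemma dotp_scaleR_axis: "dotp (h *\<^sub>R axis j 1) \<xi> = h * of_int (\<xi> $ j)"
proof -
  have "dotp (h *\<^sub>R axis j 1) \<xi> = (\<Sum>i\<in>UNIV. if i = j then h * of_int (\<xi> $ j) else 0)"
    unfolding dotp_def by (intro sum.cong) (auto simp: axis_def)
  then show ?thesis by simp
qed

lemma continuous_on_dotp [continuous_intros]:
  "continuous_on S f \<Longrightarrow> continuous_on S (\<lambda>x. dotp (f x) \<xi>)"
  unfolding dotp_def by (intro continuous_intros)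

lemma continuous_on_expo [continuous_intros]:
  "continuous_on S f \<Longrightarrow> continuous_on S (\<lambda>x. expo \<xi> (f x))"
  unfolding expo_def by (intro continuous_intros)

lemma norm_expo [simp]: "norm (expo \<xi> x) = 1"
  by (simp add: expo_def)

lemma expo_add_axis: "expo \<xi> (x + h *\<^sub>R axis j 1) = exp (\<i> * of_real (h * of_int (\<xi> $ j))) * expo \<xi> x"
  by (simp add: expo_def dotp_add dotp_scaleR_axis exp_add[symmetric] distrib_left add.commute)

lemma expo_periodic [simp]: "expo \<xi> (x + (2 * pi) *\<^sub>R axis j 1) = expo \<xi> x"
proof -
  have "exp (\<i> * of_real (2 * pi * of_int (\<xi> $ j))) = 1"
    using exp_integer_2pi[of "of_int (\<xi> $ j)"] by (simp add: mult_ac)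
  then show ?thesis by (simp add: expo_add_axis)
qed

lemma expo_mult: "expo \<xi> x * expo \<eta> x = expo (\<xi> + \<eta>) x"
  by (simp add: expo_def dotp_def exp_add[symmetric] distrib_left sum.distrib)

lemma expo_0 [simp]: "expo 0 x = 1"
  by (simp add: expo_def dotp_def)

lemma expo_uminus: "expo (-\<xi>) x = exp (- \<i> * of_real (\<Sum>j\<in>UNIV. x $ j * of_int (\<xi> $ j)))"
  by (simp add: expo_def dotp_def sum_negf)

lemma has_vector_derivative_expo:
  "((\<lambda>h. expo \<xi> (x + h *\<^sub>R axis j 1)) has_vector_derivative \<i> * of_int (\<xi> $ j) * expo \<xi> x) (at 0)"
proof -
  have "((\<lambda>h. exp ((\<i> * of_int (\<xi> $ j)) * of_real h) * expo \<xi> x) has_vector_derivative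
      \<i> * of_int (\<xi> $ j) * expo \<xi> x) (at 0)"
    by (rule has_vector_derivative_real_field) (auto intro!: derivative_eq_intros)
  then show ?thesis by (simp add: expo_add_axis mult_ac)
qed

lemma partial_deriv_expo: "partial_deriv j (expo \<xi>) = (\<lambda>x. \<i> * of_int (\<xi> $ j) * expo \<xi> x)"
  by (rule ext) (simp add: partial_deriv_def vector_derivative_at has_vector_derivative_expo)

section \<open>Integration over the torus and orthogonality of characters\<close>

abbreviation torus_cube :: "(real^'n::finite) set" where
  "torus_cube \<equiv> cbox 0 (\<chi> j. 2 * pi)"

definition periodic :: "(real^'n::finite \<Rightarrow> complex) \<Rightarrow> bool" where
  "periodic f \<longleftrightarrow> (\<forall>x j. f (x + (2 * pi) *\<^sub>R axis j 1) = f x)"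

text \<open>The translated cube sticks out beyond \<open>2 * pi\<close> in direction
  \<open>j\<close> only; that slab is the missing slab next to \<open>0\<close>, moved by one
  period.\<close>

lemma integral_torus_translate:
  fixes f :: "real^'n::finite \<Rightarrow> complex"
  assumes f: "continuous_on UNIV f" "periodic f" and h: "0 \<le> h" "h \<le> 2 * pi"
  shows "integral torus_cube (\<lambda>x. f (x + h *\<^sub>R axis j 1)) = integral torus_cube f"
proof -
  let ?e = "axis j 1 :: real^'n" and ?b = "(\<chi> j. 2 * pi) :: real^'n"
  have int: "f integrable_on cbox a b" for a b
    by (intro integrable_continuous continuous_on_subset[OF f(1)]) auto
  have eB: "?e \<in> Basis" by (simp add: axis_in_Basis_iff)
  have inner_e: "x \<bullet> ?e = x $ j" for x :: "real^'n" by (simp add: inner_axis)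
  have split: "integral (cbox a b) f =
      integral (cbox a b \<inter> {x. x $ j \<le> c}) f + integral (cbox a b \<inter> {x. c \<le> x $ j}) f" for a b c
    using integral_split[OF int eB, of a b c] by (simp add: inner_e)
  have cb: "x \<in> cbox a b \<longleftrightarrow> (\<forall>i. a $ i \<le> x $ i \<and> x $ i \<le> b $ i)" for x a b :: "real^'n"
    by (simp add: mem_box_cart)
  have "integral torus_cube (\<lambda>x. f (x + h *\<^sub>R ?e)) = integral (cbox (h *\<^sub>R ?e) (?b + h *\<^sub>R ?e)) f"
    using integral_shift_cbox[of "h *\<^sub>R ?e" "h *\<^sub>R ?e" "?b + h *\<^sub>R ?e" f] by simp
  also have "\<dots> = integral (cbox (h *\<^sub>R ?e) (?b + h *\<^sub>R ?e) \<inter> {x. x $ j \<le> 2 * pi}) f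
      + integral (cbox (h *\<^sub>R ?e) (?b + h *\<^sub>R ?e) \<inter> {x. 2 * pi \<le> x $ j}) f"
    by (rule split)
  also have "cbox (h *\<^sub>R ?e) (?b + h *\<^sub>R ?e) \<inter> {x. x $ j \<le> 2 * pi} = torus_cube \<inter> {x. h \<le> x $ j}"
  proof -
    have "(\<forall>i. (h *\<^sub>R ?e) $ i \<le> x $ i \<and> x $ i \<le> (?b + h *\<^sub>R ?e) $ i) \<and> x $ j \<le> 2 * pi
        \<longleftrightarrow> (\<forall>i. 0 \<le> x $ i \<and> x $ i \<le> 2 * pi) \<and> h \<le> x $ j" for x
    proof -
      have "((h *\<^sub>R ?e) $ i \<le> x $ i \<and> x $ i \<le> (?b + h *\<^sub>R ?e) $ i) \<longleftrightarrow>
          (if i = j then h \<le> x $ j \<and> x $ j \<le> 2 * pi + h else 0 \<le> x $ i \<and> x $ i \<le> 2 * pi)" for i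
        by (simp add: axis_def)
      then show ?thesis using h by (smt (verit))
    qed
    then show ?thesis by (auto simp: cb set_eq_iff)
  qed
  also have "cbox (h *\<^sub>R ?e) (?b + h *\<^sub>R ?e) \<inter> {x. 2 * pi \<le> x $ j}
      = cbox ((2 * pi) *\<^sub>R ?e) (\<chi> i. if i = j then h + 2 * pi else 2 * pi)"
  proof -
    have "((h *\<^sub>R ?e) $ i \<le> x $ i \<and> x $ i \<le> (?b + h *\<^sub>R ?e) $ i) \<longleftrightarrow>
        (if i = j then h \<le> x $ j \<and> x $ j \<le> 2 * pi + h else 0 \<le> x $ i \<and> x $ i \<le> 2 * pi)" for i x
      by (simp add: axis_def)
    moreover have "(((2 * pi) *\<^sub>R ?e) $ i \<le> x $ i \<and> x $ i \<le> (\<chi> i. if i = j then h + 2 * pi else 2 * pi) $ i) \<longleftrightarrow>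
        (if i = j then 2 * pi \<le> x $ j \<and> x $ j \<le> 2 * pi + h else 0 \<le> x $ i \<and> x $ i \<le> 2 * pi)" for i x
      by (simp add: axis_def add.commute)
    ultimately show ?thesis using h unfolding set_eq_iff Int_iff cb by (smt (verit) mem_Collect_eq)
  qed
  also have "integral \<dots> f = integral (cbox 0 (\<chi> i. if i = j then h else 2 * pi)) f"
  proof -
    have "(\<chi> i. if i = j then h + 2 * pi else 2 * pi) - (2 * pi) *\<^sub>R ?e = (\<chi> i. if i = j then h else 2 * pi)"
      by (auto simp: vec_eq_iff axis_def)
    then show ?thesis
      using integral_shift_cbox[of "(2 * pi) *\<^sub>R ?e" "(2 * pi) *\<^sub>R ?e"
          "(\<chi> i. if i = j then h + 2 * pi else 2 * pi)" f] f(2)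
      by (simp add: periodic_def)
  qed
  also have "cbox 0 (\<chi> i. if i = j then h else 2 * pi) = torus_cube \<inter> {x. x $ j \<le> h}"
  proof -
    have "(0 $ i \<le> x $ i \<and> x $ i \<le> (\<chi> i. if i = j then h else 2 * pi) $ i) \<longleftrightarrow>
        (if i = j then 0 \<le> x $ j \<and> x $ j \<le> h else 0 \<le> x $ i \<and> x $ i \<le> 2 * pi)" for i x
      by simp
    moreover have "(0 $ i \<le> x $ i \<and> x $ i \<le> ?b $ i) \<longleftrightarrow> 0 \<le> x $ i \<and> x $ i \<le> 2 * pi" for i x
      by simp
    ultimately show ?thesis using h unfolding set_eq_iff Int_iff cb by (smt (verit) mem_Collect_eq)
  qed
  finally show ?thesis using split[of 0 ?b h] by simp
qed

text \<open>Integration by parts without Fubini: the integral over the translates of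
  \<open>f\<close> does not depend on \<open>h\<close>, and differentiating it under the integral
  sign at \<open>h = 0\<close> gives the integral of \<open>g\<close>. Translation invariance is
  available for \<open>h\<close> in [0, 2 pi], so the derivative is one-sided.\<close>

lemma integral_partial_deriv_periodic:
  fixes f g :: "real^'n::finite \<Rightarrow> complex"
  assumes f: "continuous_on UNIV f" "periodic f" and g: "continuous_on UNIV g"
    and d: "\<And>x. ((\<lambda>h. f (x + h *\<^sub>R axis j 1)) has_vector_derivative g x) (at 0)"
  shows "integral torus_cube g = 0"
proof -
  let ?e = "axis j 1 :: real^'n"
  have d': "((\<lambda>h. f (x + h *\<^sub>R ?e)) has_vector_derivative g (x + s *\<^sub>R ?e)) (at s within S)" for x s S
  proof -
    have "((\<lambda>h. f ((x + s *\<^sub>R ?e) + h *\<^sub>R ?e)) \<circ> (\<lambda>r. r - s) has_vector_derivative (1 *\<^sub>R g (x + s *\<^sub>R ?e))) (at s)"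
      by (rule vector_diff_chain_at) (auto intro!: derivative_eq_intros d)
    then show ?thesis
      by (simp add: o_def algebra_simps scaleR_diff_left has_vector_derivative_at_within)
  qed
  have "((\<lambda>h. integral torus_cube (\<lambda>x. f (x + h *\<^sub>R ?e))) has_vector_derivative
      integral torus_cube (\<lambda>x. g (x + 0 *\<^sub>R ?e))) (at 0 within {0..2*pi})"
  proof (rule leibniz_rule_vector_derivative)
    show "continuous_on ({0..2 * pi} \<times> torus_cube) (\<lambda>(h, x). g (x + h *\<^sub>R ?e))"
      unfolding split_beta
      by (intro continuous_on_compose2[OF g] continuous_intros) auto
    show "(\<lambda>x. f (x + h *\<^sub>R ?e)) integrable_on torus_cube" for h
      by (intro integrable_continuous continuous_on_compose2[OF f(1)] continuous_intros) auto
  qed (auto intro: d')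
  moreover have "((\<lambda>h. integral torus_cube (\<lambda>x. f (x + h *\<^sub>R ?e))) has_vector_derivative 0) (at 0 within {0..2*pi})"
    by (rule has_vector_derivative_transform[OF _ _ has_vector_derivative_const[of "integral torus_cube f"]])
       (auto simp: integral_torus_translate[OF f])
  ultimately show ?thesis
    using vector_derivative_unique_within[of 0 "{0..2*pi}"] by (auto simp: at_within_Icc_at_right)
qed

text \<open>For \<xi> different from 0 the character is, up to a nonzero factor, a partial
  derivative of itself, so its integral vanishes.\<close>

lemma integral_expo:
  "integral torus_cube (expo (\<xi>::int^'n::finite)) = (if \<xi> = 0 then of_real ((2 * pi) ^ CARD('n)) else 0)"
proof (cases "\<xi> = 0")
  case True
  have "expo (0::int^'n) = (\<lambda>x. 1)" by auto
  moreover have "measure lborel (torus_cube :: (real^'n) set) = (2 * pi) ^ CARD('n)"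
    by (subst content_cbox_cart) (auto simp: interval_eq_empty_cart)
  ultimately show ?thesis using True by (simp add: of_real_def)
next
  case False
  then obtain j where j: "\<xi> $ j \<noteq> 0" by (auto simp: vec_eq_iff)
  have "integral torus_cube (\<lambda>x. \<i> * of_int (\<xi> $ j) * expo \<xi> x) = 0"
    by (rule integral_partial_deriv_periodic[OF _ _ _ has_vector_derivative_expo])
      (auto simp: periodic_def intro!: continuous_intros)
  then show ?thesis using False j by (simp add: integral_mult_right)
qed

section \<open>Uniqueness of Fourier coefficients\<close>

lemma measure_torus_cube: "measure lborel (torus_cube :: (real^'n::finite) set) = (2 * pi) ^ CARD('n)"
  by (subst content_cbox_cart) (auto simp: interval_eq_empty_cart)

definition fcoef :: "(real^'n::finite \<Rightarrow> complex) \<Rightarrow> int^'n \<Rightarrow> complex" where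
  "fcoef f \<xi> = integral torus_cube (\<lambda>x. f x * expo (-\<xi>) x) / of_real ((2 * pi) ^ CARD('n))"

lemma integrable_on_torus: "continuous_on UNIV f \<Longrightarrow> f integrable_on torus_cube"
  for f :: "real^'n::finite \<Rightarrow> complex"
  by (rule integrable_continuous, erule continuous_on_subset) simp

lemma norm_fcoef_le:
  fixes f :: "real^'n::finite \<Rightarrow> complex"
  assumes "continuous_on UNIV f" "\<And>x. norm (f x) \<le> B"
  shows "norm (fcoef f \<xi>) \<le> B"
proof -
  have B: "0 \<le> B" using assms(2)[of 0] norm_ge_zero order_trans by blast
  have "((\<lambda>x. f x * expo (-\<xi>) x) has_integral integral torus_cube (\<lambda>x. f x * expo (-\<xi>) x)) torus_cube"
    by (intro integrable_integral integrable_on_torus continuous_intros assms)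
  then have "norm (integral torus_cube (\<lambda>x. f x * expo (-\<xi>) x)) \<le> B * (2 * pi) ^ CARD('n)"
    unfolding measure_torus_cube[symmetric]
    by (rule has_integral_bound[OF B]) (simp add: norm_mult assms)
  then show ?thesis
    by (simp add: fcoef_def norm_divide norm_power norm_mult power_mult_distrib field_simps)
qed

inductive trigpoly :: "(real^'n::finite \<Rightarrow> complex) \<Rightarrow> bool" where
  expo: "trigpoly (\<lambda>x. c * expo \<xi> x)"
| add: "trigpoly f \<Longrightarrow> trigpoly g \<Longrightarrow> trigpoly (\<lambda>x. f x + g x)"

lemma trigpoly_const: "trigpoly (\<lambda>x. c)"
  using trigpoly.expo[of c 0] by simp

lemma trigpoly_mult: "trigpoly f \<Longrightarrow> trigpoly g \<Longrightarrow> trigpoly (\<lambda>x. f x * g x)"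
proof (induction rule: trigpoly.induct)
  case (expo c \<xi>)
  from expo show ?case
  proof (induction rule: trigpoly.induct)
    case (expo d \<eta>)
    have "(\<lambda>x. c * expo \<xi> x * (d * expo \<eta> x)) = (\<lambda>x. (c * d) * expo (\<xi> + \<eta>) x)"
      by (simp add: expo_mult[symmetric] mult_ac)
    then show ?case by (simp only: trigpoly.expo)
  next
    case (add f g)
    then show ?case using trigpoly.add by (simp add: distrib_left)
  qed
next
  case (add f g)
  then show ?case using trigpoly.add by (simp add: distrib_right)
qed

lemma trigpoly_sum: "(\<And>i. i \<in> S \<Longrightarrow> trigpoly (f i)) \<Longrightarrow> trigpoly (\<lambda>x. \<Sum>i\<in>S. f i x)"
  by (induction S rule: infinite_finite_induct) (auto intro: trigpoly_const trigpoly.add)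

lemma trigpoly_power: "trigpoly f \<Longrightarrow> trigpoly (\<lambda>x. f x ^ m)"
  by (induction m) (auto intro: trigpoly_const trigpoly_mult)

lemma dotp_axis: "dotp x (axis j 1) = x $ j"
proof -
  have "dotp x (axis j 1) = (\<Sum>i\<in>UNIV. if i = j then x $ j else 0)"
    unfolding dotp_def by (intro sum.cong) (auto simp: axis_def)
  then show ?thesis by simp
qed

lemma dotp_uminus: "dotp x (-\<xi>) = - dotp x \<xi>"
  by (simp add: dotp_def sum_negf)

lemma trigpoly_cos: "trigpoly (\<lambda>x. of_real (cos (x $ j - a)))"
proof -
  have "(\<lambda>x. of_real (cos (x $ j - a))) =
     (\<lambda>x. (exp (- \<i> * of_real a) / 2) * expo (axis j 1) x + (exp (\<i> * of_real a) / 2) * expo (- axis j 1) x)"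
    by (auto simp: expo_def dotp_axis dotp_uminus cos_of_real[symmetric] cos_exp_eq exp_add[symmetric] field_simps
        simp del: cos_of_real)
  then show ?thesis by (simp only: trigpoly.intros)
qed

text \<open>Continuity of \<open>g\<close> is carried along in the conclusion because the induction
  step splits the integral of a sum and needs both summands integrable.\<close>

lemma integral_trigpoly_eq_0:
  fixes f :: "real^'n::finite \<Rightarrow> complex"
  assumes f: "continuous_on UNIV f" and 0: "\<And>\<xi>. fcoef f \<xi> = 0" and g: "trigpoly g"
  shows "integral torus_cube (\<lambda>x. f x * g x) = 0 \<and> continuous_on UNIV g"
  using g
proof induction
  case (expo c \<xi>)
  have "integral torus_cube (\<lambda>x. f x * expo \<xi> x) = 0"
    using 0[of "-\<xi>"] by (simp add: fcoef_def)
  then have "integral torus_cube (\<lambda>x. c * (f x * expo \<xi> x)) = 0"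
    by (simp add: integral_mult_right)
  then show ?case by (auto simp: mult_ac intro!: continuous_intros)
next
  case (add g h)
  have "integral torus_cube (\<lambda>x. f x * g x + f x * h x) = 0"
    using add by (subst integral_add) (auto intro!: integrable_on_torus continuous_intros f)
  then show ?case using add by (auto simp: distrib_left intro!: continuous_intros)
qed

lemma periodic_shift_int:
  assumes "periodic f"
  shows "f (x + (2 * pi * of_int k) *\<^sub>R axis j 1) = f x"
proof (induction k rule: int_induct[where k = 0])
  case base
  then show ?case by simp
next
  case (step1 i)
  have "x + (2 * pi * of_int (i + 1)) *\<^sub>R axis j 1 =
      (x + (2 * pi * of_int i) *\<^sub>R axis j 1) + (2 * pi) *\<^sub>R axis j 1"
    by (simp add: algebra_simps scaleR_add_left)
  then show ?case using step1 assms by (simp only: periodic_def)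
next
  case (step2 i)
  have "x + (2 * pi * of_int i) *\<^sub>R axis j 1 =
      (x + (2 * pi * of_int (i - 1)) *\<^sub>R axis j 1) + (2 * pi) *\<^sub>R axis j 1"
    by (simp add: algebra_simps scaleR_diff_left)
  then show ?case using step2 assms by (metis periodic_def)
qed

lemma periodic_shift_ints:
  assumes "periodic f"
  shows "f (x + (\<Sum>j\<in>S. (2 * pi * of_int (k j)) *\<^sub>R axis j 1)) = f x"
proof (induction S rule: infinite_finite_induct)
  case (insert j S)
  have "x + (\<Sum>j\<in>insert j S. (2 * pi * of_int (k j)) *\<^sub>R axis j 1) =
     (x + (\<Sum>j\<in>S. (2 * pi * of_int (k j)) *\<^sub>R axis j 1)) + (2 * pi * of_int (k j)) *\<^sub>R axis j 1"
    using insert by (simp add: add_ac)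
  then show ?case using insert periodic_shift_int[OF assms] by (simp only:)
qed auto

lemma periodic_reduce:
  fixes x :: "real^'n::finite"
  obtains x' where "x' \<in> torus_cube" "\<And>f. periodic f \<Longrightarrow> f x' = f x"
proof
  define k where "k = (\<lambda>j. - \<lfloor>x $ j / (2 * pi)\<rfloor>)"
  define x' where "x' = x + (\<Sum>j\<in>UNIV. (2 * pi * of_int (k j)) *\<^sub>R axis j 1)"
  have comp: "x' $ i = x $ i + 2 * pi * of_int (k i)" for i
  proof -
    have "(\<Sum>j\<in>UNIV. ((2 * pi * of_int (k j)) *\<^sub>R axis j 1 :: real^'n) $ i) =
        (\<Sum>j\<in>UNIV. if j = i then 2 * pi * of_int (k i) else 0)"
      by (intro sum.cong) (auto simp: axis_def)
    then show ?thesis by (simp add: x'_def)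
  qed
  have "0 \<le> x' $ i \<and> x' $ i \<le> 2 * pi" for i
  proof -
    have "x' $ i = 2 * pi * frac (x $ i / (2 * pi))"
      by (simp add: comp k_def frac_def field_simps)
    then show ?thesis using frac_lt_1[of "x $ i / (2 * pi)"] by simp
  qed
  then show "x' \<in> torus_cube" by (simp add: mem_box_cart)
  show "f x' = f x" if "periodic f" for f
    unfolding x'_def by (rule periodic_shift_ints[OF that])
qed

text \<open>Localisation with the powers of a trigonometric polynomial that exceeds \<open>1\<close> near \<open>y\<close> and
  stays in \<open>[0, 1]\<close> away from \<open>y\<close>.\<close>

lemma fcoef_eq_0_interior:
  fixes f :: "real^'n::finite \<Rightarrow> complex"
  assumes f: "continuous_on UNIV f" and 0: "\<And>\<xi>. fcoef f \<xi> = 0"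
    and y: "\<And>j. 0 < y $ j \<and> y $ j < 2 * pi"
  shows "f y = 0"
proof (rule ccontr)
  assume fy: "f y \<noteq> 0"
  \<comment> \<open>Multiplying by the conjugate of \<open>f y\<close> rotates the value at
    \<open>y\<close> onto the positive axis, so that one real function can be bounded from
    below.\<close>
  define u where "u x = Re (cnj (f y) * f x)" for x
  have u_cont: "continuous_on UNIV u" unfolding u_def by (intro continuous_intros f)
  have uy: "u y > 0" 
  proof -
    have "u y = (norm (f y))\<^sup>2" unfolding u_def cmod_power2 by (simp add: power2_eq_square)
    then show ?thesis using fy by simp
  qed
  define \<eta> where "\<eta> = u y / 2"
  have \<eta>: "\<eta> > 0" using uy by (simp add: \<eta>_def)
  define N where "N = real CARD('n)"
  have N: "N \<ge> 1" by (simp add: N_def Suc_le_eq)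
  obtain \<rho>' where \<rho>': "\<rho>' > 0" "\<And>x. dist x y < \<rho>' \<Longrightarrow> dist (u x) (u y) < \<eta>"
    using u_cont \<eta> unfolding continuous_on_iff by (metis UNIV_I)
  have near: "dist x y < e" if "\<And>j. \<bar>x $ j - y $ j\<bar> \<le> e / (2 * N)" "e > 0" for x e
  proof -
    have "dist x y \<le> (\<Sum>j\<in>UNIV. \<bar>(x - y) $ j\<bar>)" unfolding dist_norm by (rule norm_le_l1_cart)
    also have "\<dots> \<le> of_nat CARD('n) * (e / (2 * N))" by (rule sum_bounded_above) (use that in auto)
    also have "\<dots> = e / 2" using N by (simp add: N_def)
    finally show ?thesis using that by simp
  qed
  \<comment> \<open>Small enough for three purposes: the cosine decreases on [0, \<rho>],
    \<open>u\<close> stays above \<eta> on the cube of half-width \<rho> around \<open>y\<close>,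
    and this cube lies inside the fundamental domain.\<close>
  define \<rho> where "\<rho> = Min ({pi, \<rho>' / (2 * N)} \<union> range (\<lambda>j. y $ j) \<union> range (\<lambda>j. 2 * pi - y $ j))"
  have "finite ({pi, \<rho>' / (2 * N)} \<union> range (\<lambda>j. y $ j) \<union> range (\<lambda>j. 2 * pi - y $ j))" by simp
  note Min_le[OF this, folded \<rho>_def] 
  then have \<rho>1: "\<rho> \<le> pi" "\<rho> \<le> \<rho>' / (2 * N)" "\<And>j. \<rho> \<le> y $ j" "\<And>j. \<rho> \<le> 2 * pi - y $ j" by auto
  have \<rho>0: "\<rho> > 0" unfolding \<rho>_def using \<rho>'(1) N y by (subst Min_gr_iff) auto
  define \<theta> where "\<theta> = 1 - cos \<rho>"
  have \<theta>0: "\<theta> > 0"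
    using cos_monotone_0_pi[of 0 \<rho>] \<rho>0 \<rho>1 by (simp add: \<theta>_def)
  define C where "C x = (\<Sum>j\<in>UNIV. 1 - cos (x $ j - y $ j))" for x
  \<comment> \<open>Since \<open>C\<close> is at most 2 N, this factor keeps \<open>q\<close>
    nonnegative everywhere; \<open>q\<close> exceeds 1 exactly where \<open>C\<close> is below
    \<theta>/2.\<close>
  define \<kappa> where "\<kappa> = 1 / (2 * N)"
  have \<kappa>: "\<kappa> > 0" using N by (simp add: \<kappa>_def)
  define q where "q x = 1 + \<kappa> * (\<theta> / 2 - C x)" for x
  have C_le: "C x \<le> 2 * N" for x
    unfolding C_def N_def using sum_bounded_above[of UNIV "\<lambda>j. 1 - cos (x $ j - y $ j)" 2]
    by (simp add: mult.commute) 
  have q_ge0: "q x \<ge> 0" for x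
  proof -
    have "\<kappa> * C x \<le> \<kappa> * (2 * N)" using C_le \<kappa> by (intro mult_left_mono) auto
    also have "\<dots> = 1" using N by (simp add: \<kappa>_def)
    finally show ?thesis using mult_pos_pos[OF \<kappa> \<theta>0] by (simp add: q_def right_diff_distrib)
  qed
  \<comment> \<open>Being far from \<open>y\<close> in one coordinate must also mean being far on
    the circle. The choice of \<rho> gives \<rho> \<le> d \<le> 2 pi - \<rho>, so cos d \<le> cos
    \<rho> on both sides of pi.\<close>
  have q_off: "q x \<le> 1" if "x \<in> torus_cube" "\<bar>x $ j - y $ j\<bar> > \<rho>" for x j
  proof -
    define d where "d = \<bar>x $ j - y $ j\<bar>"
    have x: "0 \<le> x $ j" "x $ j \<le> 2 * pi" using that(1) by (auto simp: mem_box_cart)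
    have d: "\<rho> \<le> d" "d \<le> 2 * pi - \<rho>" using that(2) x \<rho>1(3)[of j] \<rho>1(4)[of j] by (auto simp: d_def)
    have "cos d \<le> cos \<rho>"
    proof (cases "d \<le> pi")
      case True
      then show ?thesis using d \<rho>0 by (intro cos_monotone_0_pi_le) auto
    next
      case False
      have "cos d = cos (2 * pi - d)" by (simp add: cos_diff)
      also have "\<dots> \<le> cos \<rho>" using d \<rho>0 False by (intro cos_monotone_0_pi_le) auto
      finally show ?thesis .
    qed
    moreover have "cos d = cos (x $ j - y $ j)" by (simp add: d_def)
    ultimately have "\<theta> \<le> 1 - cos (x $ j - y $ j)" by (simp add: \<theta>_def)
    also have "\<dots> \<le> C x" unfolding C_def by (rule member_le_sum) auto
    finally have "\<theta> / 2 - C x \<le> 0" using \<theta>0 by simp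
    then have "\<kappa> * (\<theta> / 2 - C x) \<le> 0" using \<kappa> by (simp add: mult_le_0_iff)
    then show ?thesis by (simp add: q_def)
  qed
  have C_cont: "continuous_on UNIV C" unfolding C_def by (intro continuous_intros)
  have Cy: "C y = 0" by (simp add: C_def)
  obtain \<sigma>' where \<sigma>': "\<sigma>' > 0" "\<And>x. dist x y < \<sigma>' \<Longrightarrow> dist (C x) (C y) < \<theta> / 4"
    using C_cont \<theta>0 unfolding continuous_on_iff by (metis UNIV_I zero_less_divide_iff zero_less_numeral)
  define \<sigma> where "\<sigma> = min \<rho> (\<sigma>' / (2 * N))"
  have \<sigma>: "\<sigma> > 0" "\<sigma> \<le> \<rho>" "\<sigma> \<le> \<sigma>' / (2 * N)" using \<rho>0 \<sigma>' N by (auto simp: \<sigma>_def)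
  define B' where "B' = cbox (y - (\<chi> j. \<sigma>)) (y + (\<chi> j. \<sigma>))"
  have B': "x \<in> B' \<longleftrightarrow> (\<forall>j. \<bar>x $ j - y $ j\<bar> \<le> \<sigma>)" for x
    by (auto simp: B'_def mem_box_cart abs_le_iff algebra_simps)
  have B'_sub: "B' \<subseteq> torus_cube"
  proof
    fix x assume "x \<in> B'"
    then have "\<bar>x $ j - y $ j\<bar> \<le> \<rho>" for j using \<sigma> by (auto simp: B' intro: order_trans)
    then have "0 \<le> x $ j \<and> x $ j \<le> 2 * pi" for j using \<rho>1(3)[of j] \<rho>1(4)[of j] by (smt (verit))
    then show "x \<in> torus_cube" by (simp add: mem_box_cart)
  qed
  define r where "r = 1 + \<kappa> * (\<theta> / 4)"
  have r1: "r > 1" using \<kappa> \<theta>0 by (simp add: r_def)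
  have q_near: "q x \<ge> r" if "x \<in> B'" for x
  proof -
    have "dist x y < \<sigma>'" using that \<sigma> \<sigma>'(1) by (intro near) (auto simp: B' intro: order_trans)
    from \<sigma>'(2)[OF this] have "\<theta> / 4 \<le> \<theta> / 2 - C x" by (simp add: Cy dist_real_def)
    then show ?thesis using \<kappa> by (simp add: q_def r_def)
  qed
  have u_near: "u x \<ge> \<eta>" if "\<And>j. \<bar>x $ j - y $ j\<bar> \<le> \<rho>" for x
  proof -
    have "dist x y < \<rho>'" using that \<rho>1(2) \<rho>'(1) by (intro near) (auto intro: order_trans)
    from \<rho>'(2)[OF this] have "\<bar>u x - u y\<bar> < u y / 2" by (simp add: dist_real_def \<eta>_def)
    then show ?thesis unfolding \<eta>_def by linarith
  qed
  have "bounded (u ` torus_cube)"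
    by (intro compact_imp_bounded compact_continuous_image continuous_on_subset[OF u_cont]) auto
  then obtain M where M: "M > 0" "\<And>x. x \<in> torus_cube \<Longrightarrow> \<bar>u x\<bar> \<le> M"
    unfolding bounded_pos by auto
  \<comment> \<open>The powers of \<open>q\<close> blow up on the small cube \<open>B'\<close>, are
    harmless where \<open>u\<close> is nonnegative, and are at most 1 where the sign of
    \<open>u\<close> is unknown.\<close>
  have lower: "- M + (if x \<in> B' then \<eta> * r ^ m else 0) \<le> u x * q x ^ m" if x: "x \<in> torus_cube" for x m
  proof (cases "\<forall>j. \<bar>x $ j - y $ j\<bar> \<le> \<rho>")
    case True
    then have ux: "\<eta> \<le> u x" by (intro u_near) auto
    show ?thesis
    proof (cases "x \<in> B'")
      case True
      have "\<eta> * r ^ m \<le> u x * q x ^ m"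
        using ux \<eta> r1 q_near[OF True] by (intro mult_mono power_mono) auto
      then show ?thesis using True M by simp
    next
      case False
      have "0 \<le> u x * q x ^ m" using ux \<eta> q_ge0 by simp
      then show ?thesis using False M by simp
    qed
  next
    case False
    then obtain j where j: "\<bar>x $ j - y $ j\<bar> > \<rho>" by (auto simp: not_le)
    then have "x \<notin> B'" using \<sigma> by (auto simp: B' not_le intro!: exI[of _ j])
    moreover have "\<bar>u x * q x ^ m\<bar> \<le> M * 1"
      unfolding abs_mult using M(2)[OF x] q_off[OF x j] q_ge0[of x] by (intro mult_mono) (auto simp: power_le_one)
    ultimately show ?thesis by simp
  qed
  have tp: "trigpoly (\<lambda>x. of_real (q x) ^ m)" for m
  proof -
    have "trigpoly (\<lambda>x. of_real (1 + \<kappa> * (\<theta> / 2)) + of_real (-\<kappa>) * (\<Sum>j\<in>UNIV. 1 + (-1) * of_real (cos (x $ j - y $ j))))"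
      by (intro trigpoly.add trigpoly_const trigpoly_mult trigpoly_sum trigpoly_cos)
    also have "(\<lambda>x. of_real (1 + \<kappa> * (\<theta> / 2)) + of_real (-\<kappa>) * (\<Sum>j\<in>UNIV. 1 + (-1) * of_real (cos (x $ j - y $ j)))) = (\<lambda>x. complex_of_real (q x))"
      by (auto simp: q_def C_def algebra_simps)
    finally show ?thesis by (rule trigpoly_power)
  qed
  define V where "V = measure lborel B'"
  have V: "V > 0" unfolding V_def B'_def using \<sigma>
    by (intro content_pos_lt) (auto simp: Basis_vec_def inner_axis)
  \<comment> \<open>All moments of \<open>f\<close> against trigonometric polynomials vanish, so the
    integral of \<open>u * q ^ m\<close> is 0. Integrating the pointwise lower bound then bounds a
    quantity growing like \<open>r ^ m\<close> by a constant, which fails for large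
    \<open>m\<close>.\<close>
  have ub: "\<eta> * r ^ m * V \<le> M * (2 * pi) ^ CARD('n)" for m
  proof -
    note tpm = integral_trigpoly_eq_0[OF f 0 tp[of m]]
    have "((\<lambda>x. f x * of_real (q x) ^ m) has_integral integral torus_cube (\<lambda>x. f x * of_real (q x) ^ m)) torus_cube"
      by (rule integrable_integral, rule integrable_on_torus, rule continuous_on_mult[OF f conjunct2[OF tpm]])
    then have "((\<lambda>x. f x * of_real (q x) ^ m) has_integral 0) torus_cube"
      by (simp only: conjunct1[OF tpm])
    then have "((\<lambda>x. cnj (f y) * (f x * of_real (q x) ^ m)) has_integral cnj (f y) * 0) torus_cube"
      by (rule has_integral_mult_right)
    then have "((\<lambda>x. Re (cnj (f y) * (f x * of_real (q x) ^ m))) has_integral 0) torus_cube"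
      by (drule_tac has_integral_linear[OF _ bounded_linear_Re]) (simp add: o_def)
    moreover have "Re (cnj (f y) * (f x * of_real (q x) ^ m)) = u x * q x ^ m" for x
      by (simp add: u_def algebra_simps flip: of_real_power)
    ultimately have 1: "((\<lambda>x. u x * q x ^ m) has_integral 0) torus_cube" by simp
    have "((\<lambda>x. if x \<in> B' then \<eta> * r ^ m else 0) has_integral V *\<^sub>R (\<eta> * r ^ m)) torus_cube"
      unfolding has_integral_restrict[OF B'_sub] V_def unfolding B'_def by (rule has_integral_const)
    from has_integral_add[OF has_integral_const[of "-M"] this]
    have 2: "((\<lambda>x. - M + (if x \<in> B' then \<eta> * r ^ m else 0)) has_integral
        ((2 * pi) ^ CARD('n) *\<^sub>R (- M) + V *\<^sub>R (\<eta> * r ^ m))) torus_cube"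
      by (simp add: measure_torus_cube)
    from has_integral_le[OF 2 1 lower] show ?thesis by (simp add: algebra_simps)
  qed
  obtain m where "M * (2 * pi) ^ CARD('n) / (\<eta> * V) < r ^ m"
    using real_arch_pow[OF r1] by blast
  then have "M * (2 * pi) ^ CARD('n) < \<eta> * r ^ m * V"
    using \<eta> V by (simp add: field_simps)
  with ub[of m] show False by simp
qed

text \<open>Every point can be moved into the closed cube by periods, and the interior statement
  extends to the boundary of the cube by continuity.\<close>

lemma fcoef_eq_0_imp_eq_0:
  fixes f :: "real^'n::finite \<Rightarrow> complex"
  assumes f: "continuous_on UNIV f" "periodic f" and 0: "\<And>\<xi>. fcoef f \<xi> = 0"
  shows "f x = 0"
proof -
  let ?b = "(\<chi> j. 2 * pi) :: real^'n"
  have "box 0 ?b \<noteq> {}" by (simp add: interval_ne_empty_cart)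
  then have cl: "closure (box 0 ?b) = torus_cube" by (rule closure_box)
  obtain x' where x': "x' \<in> torus_cube" "f x' = f x"
    using periodic_reduce[of x] f(2) by metis
  have "f x' = 0"
  proof (rule continuous_constant_on_closure[where S = "box 0 ?b"])
    show "continuous_on (closure (box 0 ?b)) f" by (rule continuous_on_subset[OF f(1)]) simp
    show "f y = 0" if "y \<in> box 0 ?b" for y
      using that by (intro fcoef_eq_0_interior[OF f(1) 0]) (auto simp: mem_box_cart)
  qed (use x' cl in auto)
  then show ?thesis using x' by simp
qed

section \<open>Fourier series of smooth functions\<close>

lemma torus_smoothD:
  assumes "f \<in> torus_smooth"
  shows continuous_on_partial_derivs: "continuous_on S (partial_derivs js f)"
    and has_vector_derivative_partial_derivs:
      "((\<lambda>h. partial_derivs js f (x + h *\<^sub>R axis j 1)) has_vector_derivative partial_derivs (j # js) f x) (at 0)"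
    and torus_smooth_periodic: "periodic f"
  using assms
  by (auto simp: torus_smooth_def smooth_fun_def periodic_def partial_derivs_def partial_deriv_def
      vector_derivative_works intro: continuous_on_subset[of UNIV])

lemma partial_derivs_Nil [simp]: "partial_derivs [] f = f"
  and partial_derivs_Cons: "partial_derivs (j # js) f = partial_deriv j (partial_derivs js f)"
  and partial_derivs_append: "partial_derivs (js @ ks) f = partial_derivs js (partial_derivs ks f)"
  by (auto simp: partial_derivs_def)

lemma torus_smooth_partial_deriv:
  assumes "f \<in> torus_smooth"
  shows "partial_deriv j f \<in> torus_smooth"
proof -
  have "partial_derivs js (partial_deriv j f) = partial_derivs (js @ [j]) f" for js
    by (simp add: partial_derivs_def)
  moreover have "partial_deriv j f (x + (2 * pi) *\<^sub>R axis i 1) = partial_deriv j f x" for x i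
  proof -
    have "f (x + (2 * pi) *\<^sub>R axis i 1 + h *\<^sub>R axis j 1) = f (x + h *\<^sub>R axis j 1)" for h
      using assms by (simp add: torus_smooth_def add.assoc add.commute[of "(2 * pi) *\<^sub>R axis i 1"])
        (simp flip: add.assoc)
    then show ?thesis by (simp add: partial_deriv_def)
  qed
  ultimately show ?thesis
    using assms by (simp add: torus_smooth_def smooth_fun_def)
qed

lemma torus_smooth_partial_derivs: "f \<in> torus_smooth \<Longrightarrow> partial_derivs js f \<in> torus_smooth"
  by (induction js) (auto simp: partial_derivs_Cons torus_smooth_partial_deriv)

lemma torus_smooth_continuous: "f \<in> torus_smooth \<Longrightarrow> continuous_on S f"
  using continuous_on_partial_derivs[of f S "[]"] by simp

lemma periodic_bounded:
  assumes "continuous_on UNIV f" "periodic f"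
  obtains B where "\<And>x. norm (f x) \<le> B"
proof -
  have "bounded (f ` torus_cube)"
    by (intro compact_imp_bounded compact_continuous_image continuous_on_subset[OF assms(1)]) auto
  then obtain B where B: "\<And>x. x \<in> torus_cube \<Longrightarrow> norm (f x) \<le> B"
    unfolding bounded_iff by auto
  have "norm (f x) \<le> B" for x
    using periodic_reduce[of x] B assms(2) by metis
  then show ?thesis by (rule that)
qed

lemma torus_smooth_derivs_bounded:
  assumes "f \<in> torus_smooth"
  obtains B where "\<And>js x. length js \<le> k \<Longrightarrow> norm (partial_derivs js f x) \<le> B"
proof -
  have "\<exists>B. \<forall>x. norm (partial_derivs js f x) \<le> B" for js
    using torus_smooth_partial_derivs[OF assms]
    by (metis periodic_bounded torus_smooth_continuous torus_smooth_periodic)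
  then obtain B where B: "norm (partial_derivs js f x) \<le> B js" for js x by metis
  have fin: "finite {js :: 'a list. length js \<le> k}"
    using finite_lists_length_le[of "UNIV :: 'a set" k] by simp
  have "norm (partial_derivs js f x) \<le> Max (B ` {js. length js \<le> k})" if "length js \<le> k" for js x
    using B[of js x] Max_ge[OF finite_imageI[OF fin], of "B js" B] that by force
  then show ?thesis by (rule that)
qed

text \<open>The Fourier multiplier of \<open>partial_derivs js\<close>, in multi-index notation the
  monomial (i \<xi>) to the power \<alpha>.\<close>

definition isym :: "'n::finite list \<Rightarrow> int^'n \<Rightarrow> complex" where
  "isym js \<xi> = (\<Prod>j\<leftarrow>js. \<i> * of_int (\<xi> $ j))"

lemma norm_isym_le: "norm (isym js \<xi>) \<le> wt \<xi> ^ length js"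
proof (induction js)
  case (Cons j js)
  have "\<bar>real_of_int (\<xi> $ j)\<bar> \<le> wt \<xi>" using component_le_wt[of \<xi> j] by simp
  with Cons show ?case by (simp add: isym_def norm_mult mult_mono)
qed (simp add: isym_def)

lemma fcoef_partial_deriv:
  assumes f: "f \<in> torus_smooth"
  shows "fcoef (partial_deriv j f) \<xi> = \<i> * of_int (\<xi> $ j) * fcoef f \<xi>"
proof -
  let ?g = "\<lambda>x. partial_deriv j f x * expo (-\<xi>) x + f x * (\<i> * of_int ((-\<xi>) $ j) * expo (-\<xi>) x)"
  have cont: "continuous_on UNIV f" "continuous_on UNIV (partial_deriv j f)"
    using torus_smooth_continuous f torus_smooth_partial_deriv by blast+
  have "integral torus_cube ?g = 0"
  proof (rule integral_partial_deriv_periodic[where f = "\<lambda>x. f x * expo (-\<xi>) x" and j = j])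
    show "periodic (\<lambda>x. f x * expo (- \<xi>) x)"
      using torus_smooth_periodic[OF f] by (simp add: periodic_def)
    show "((\<lambda>h. f (x + h *\<^sub>R axis j 1) * expo (- \<xi>) (x + h *\<^sub>R axis j 1)) has_vector_derivative ?g x) (at 0)" for x
      using has_vector_derivative_mult[OF has_vector_derivative_partial_derivs[OF f, of "[]" x j]
          has_vector_derivative_expo[of "-\<xi>" x j]]
      by (simp add: partial_derivs_Cons add.commute)
  qed (intro continuous_intros cont)+
  also have "integral torus_cube ?g = integral torus_cube (\<lambda>x. partial_deriv j f x * expo (-\<xi>) x)
      + integral torus_cube (\<lambda>x. (- \<i> * of_int (\<xi> $ j)) * (f x * expo (-\<xi>) x))"
  proof (subst integral_add[symmetric])
    show "(\<lambda>x. partial_deriv j f x * expo (-\<xi>) x) integrable_on torus_cube"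
      "(\<lambda>x. - \<i> * of_int (\<xi> $ j) * (f x * expo (-\<xi>) x)) integrable_on torus_cube"
      by (intro integrable_on_torus continuous_intros cont)+
  qed (simp add: algebra_simps)
  finally show ?thesis
    unfolding integral_mult_right fcoef_def by (simp add: field_simps)
qed

lemma fcoef_partial_derivs:
  "f \<in> torus_smooth \<Longrightarrow> fcoef (partial_derivs js f) \<xi> = isym js \<xi> * fcoef f \<xi>"
  by (induction js)
    (auto simp: partial_derivs_Cons fcoef_partial_deriv torus_smooth_partial_derivs isym_def)

lemma norm_fcoef_component_le:
  assumes f: "f \<in> torus_smooth" and B: "\<And>js x. length js = M \<Longrightarrow> norm (partial_derivs js f x) \<le> B"
  shows "\<bar>real_of_int (\<xi> $ j)\<bar> ^ M * norm (fcoef f \<xi>) \<le> B"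
proof -
  have "norm (isym (replicate M j) \<xi>) = \<bar>real_of_int (\<xi> $ j)\<bar> ^ M"
    by (induction M) (auto simp: isym_def norm_mult)
  moreover have "norm (fcoef (partial_derivs (replicate M j) f) \<xi>) \<le> B"
    by (intro norm_fcoef_le continuous_on_partial_derivs f B) simp
  ultimately show ?thesis by (simp add: fcoef_partial_derivs[OF f] norm_mult)
qed

text \<open>Only \<open>f\<close> itself and its pure derivatives of order \<open>M\<close> enter,
  one for each direction; these 1 + N terms account for the last factor in the constant.\<close>

lemma norm_fcoef_decay:
  fixes f :: "real^'n::finite \<Rightarrow> complex"
  assumes f: "f \<in> torus_smooth" and B: "\<And>js x. length js \<le> M \<Longrightarrow> norm (partial_derivs js f x) \<le> B"
  shows "norm (fcoef f \<xi>) * wt \<xi> ^ M \<le> (1 + real CARD('n)) ^ Suc M * B"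
proof -
  have "norm (fcoef f \<xi>) * wt \<xi> ^ M \<le>
     (1 + real CARD('n)) ^ M * (norm (fcoef f \<xi>) + (\<Sum>j\<in>UNIV. \<bar>real_of_int (\<xi> $ j)\<bar> ^ M * norm (fcoef f \<xi>)))"
    using mult_left_mono[OF wt_power_le[of \<xi> M], of "norm (fcoef f \<xi>)"]
    by (simp add: algebra_simps sum_distrib_left)
  also have "\<dots> \<le> (1 + real CARD('n)) ^ M * (B + (\<Sum>j\<in>(UNIV::'n set). B))"
    using norm_fcoef_le[OF torus_smooth_continuous[OF f], of B] B[of "[]"]
    by (intro mult_left_mono add_mono sum_mono norm_fcoef_component_le f B) auto
  finally show ?thesis by (simp add: algebra_simps)
qed

section \<open>Rapidly decreasing coefficients and the functions they synthesise\<close>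

definition rapid :: "(int^'n::finite \<Rightarrow> complex) \<Rightarrow> bool" where
  "rapid c \<longleftrightarrow> (\<forall>M. \<exists>B. \<forall>\<xi>. norm (c \<xi>) * wt \<xi> ^ M \<le> B)"

lemma rapid_fcoef: "f \<in> torus_smooth \<Longrightarrow> rapid (fcoef f)"
  unfolding rapid_def by (metis norm_fcoef_decay torus_smooth_derivs_bounded)

lemma summable_on_wt_bound:
  fixes g :: "int^'n::finite \<Rightarrow> real"
  assumes "\<And>\<xi>. 0 \<le> g \<xi>" "\<And>\<xi>. g \<xi> * wt \<xi> ^ (2 * CARD('n)) \<le> B"
  shows "g summable_on UNIV" "infsum g UNIV \<le> B * infsum (\<lambda>\<xi>::int^'n. 1 / wt \<xi> ^ (2 * CARD('n))) UNIV"
proof -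
  have *: "g \<xi> \<le> B * (1 / wt \<xi> ^ (2 * CARD('n)))" for \<xi>
    using assms(2)[of \<xi>] by (simp add: field_simps)
  have s: "(\<lambda>\<xi>::int^'n. B * (1 / wt \<xi> ^ (2 * CARD('n)))) summable_on UNIV"
    by (intro summable_on_cmult_right summable_on_wt)
  show g: "g summable_on UNIV"
    by (rule summable_on_comparison_test[OF s *]) (use assms in auto)
  show "infsum g UNIV \<le> B * infsum (\<lambda>\<xi>::int^'n. 1 / wt \<xi> ^ (2 * CARD('n))) UNIV"
    using infsum_mono[OF g s *] by (simp add: infsum_cmult_right' del: times_divide_eq_right)
qed

lemma rapid_summable:
  assumes "rapid c"
  shows "(\<lambda>\<xi>. norm (c \<xi>) * wt \<xi> ^ M) summable_on UNIV"
proof -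
  obtain B where "norm (c \<xi>) * wt \<xi> ^ (M + 2 * CARD('a)) \<le> B" for \<xi>
    using assms unfolding rapid_def by blast
  then show ?thesis
    by (intro summable_on_wt_bound(1)[where B = B]) (auto simp: power_add mult_ac)
qed

lemma rapid_abs_summable: "rapid c \<Longrightarrow> (\<lambda>\<xi>. norm (c \<xi>)) summable_on UNIV"
  using rapid_summable[of c 0] by simp

lemma rapid_isym_mult:
  assumes "rapid c"
  shows "rapid (\<lambda>\<xi>. isym js \<xi> * c \<xi>)"
  unfolding rapid_def
proof
  fix M
  obtain B where B: "norm (c \<xi>) * wt \<xi> ^ (length js + M) \<le> B" for \<xi>
    using assms unfolding rapid_def by blast
  have "norm (isym js \<xi> * c \<xi>) * wt \<xi> ^ M \<le> B" for \<xi>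
  proof -
    have "norm (isym js \<xi> * c \<xi>) * wt \<xi> ^ M \<le> wt \<xi> ^ length js * norm (c \<xi>) * wt \<xi> ^ M"
      unfolding norm_mult by (intro mult_right_mono norm_isym_le) auto
    also have "\<dots> \<le> B" using B[of \<xi>] by (simp add: power_add mult_ac)
    finally show ?thesis .
  qed
  then show "\<exists>B. \<forall>\<xi>. norm (isym js \<xi> * c \<xi>) * wt \<xi> ^ M \<le> B" by blast
qed

definition synth :: "(int^'n::finite \<Rightarrow> complex) \<Rightarrow> real^'n \<Rightarrow> complex" where
  "synth c x = infsum (\<lambda>\<xi>. c \<xi> * expo \<xi> x) UNIV"

lemma abs_summable_on_synth:
  assumes "(\<lambda>\<xi>. norm (c \<xi>)) summable_on UNIV"
  shows "(\<lambda>\<xi>. norm (c \<xi> * expo \<xi> x)) summable_on UNIV" "(\<lambda>\<xi>. c \<xi> * expo \<xi> x) summable_on UNIV"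
proof -
  show "(\<lambda>\<xi>. norm (c \<xi> * expo \<xi> x)) summable_on UNIV" using assms by (simp add: norm_mult)
  then show "(\<lambda>\<xi>. c \<xi> * expo \<xi> x) summable_on UNIV" by (rule abs_summable_summable)
qed

lemma norm_synth_le:
  assumes "(\<lambda>\<xi>. norm (c \<xi>)) summable_on UNIV"
  shows "norm (synth c x) \<le> infsum (\<lambda>\<xi>. norm (c \<xi>)) UNIV"
  unfolding synth_def using norm_infsum_bound[OF abs_summable_on_synth(1)[OF assms]] by (simp add: norm_mult)

lemma uniform_limit_synth:
  assumes "(\<lambda>\<xi>. norm (c \<xi>)) summable_on UNIV"
  shows "uniform_limit S (\<lambda>F x. \<Sum>\<xi>\<in>F. c \<xi> * expo \<xi> x) (synth c) (finite_subsets_at_top UNIV)"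
  unfolding synth_def[abs_def]
  by (rule Weierstrass_m_test_general[OF _ assms]) (simp add: norm_mult)

lemma continuous_on_synth:
  assumes "(\<lambda>\<xi>. norm (c \<xi>)) summable_on UNIV"
  shows "continuous_on S (synth c)"
  by (rule uniform_limit_theorem[OF _ uniform_limit_synth[OF assms]])
    (auto intro!: always_eventually continuous_intros)

lemma periodic_synth: "periodic (synth c)"
  by (simp add: periodic_def synth_def)

lemma fcoef_expo: "fcoef (expo \<eta>) \<xi> = (if \<eta> = \<xi> then 1 else 0)"
proof -
  have "(\<lambda>x. expo \<eta> x * expo (-\<xi>) x) = expo (\<eta> - \<xi>)" by (auto simp: expo_mult)
  then show ?thesis by (simp add: fcoef_def integral_expo)
qed

text \<open>The series converges uniformly, so it may be integrated term by term. By orthogonality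
  the integrals of the finite partial sums are constant as soon as the index set contains
  \<eta>.\<close>

lemma fcoef_synth:
  fixes c :: "int^'n::finite \<Rightarrow> complex"
  assumes "(\<lambda>\<xi>. norm (c \<xi>)) summable_on UNIV"
  shows "fcoef (synth c) \<eta> = c \<eta>"
proof -
  let ?A = "of_real ((2 * pi) ^ CARD('n)) :: complex"
  have "uniform_limit torus_cube (\<lambda>F x. (\<Sum>\<xi>\<in>F. c \<xi> * expo \<xi> x) * expo (-\<eta>) x)
      (\<lambda>x. synth c x * expo (-\<eta>) x) (finite_subsets_at_top UNIV)"
    by (intro uniform_lim_mult uniform_limit_synth assms uniform_limit_const
        compact_imp_bounded compact_continuous_image continuous_on_synth continuous_intros) auto
  note lim = uniform_limit_integral_cbox[OF this]
  have continuous_on_terms: "continuous_on torus_cube (\<lambda>x. (\<Sum>\<xi>\<in>F. c \<xi> * expo \<xi> x) * expo (-\<eta>) x)" for F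
    by (intro continuous_intros)
  from lim
  obtain I J where IJ: "\<And>F. ((\<lambda>x. (\<Sum>\<xi>\<in>F. c \<xi> * expo \<xi> x) * expo (-\<eta>) x) has_integral I F) torus_cube"
     "((\<lambda>x. synth c x * expo (-\<eta>) x) has_integral J) torus_cube"
     "(I \<longlongrightarrow> J) (finite_subsets_at_top UNIV)"
    using continuous_on_terms finite_subsets_at_top_neq_bot by blast
  have I: "I F = (\<Sum>\<xi>\<in>F. if \<xi> = \<eta> then c \<eta> * ?A else 0)" if "finite F" for F
  proof -
    have e: "((\<lambda>x. expo \<xi> x * expo (-\<eta>) x) has_integral (if \<xi> = \<eta> then ?A else 0)) torus_cube" for \<xi>
    proof -
      have eq: "(\<lambda>x. expo \<xi> x * expo (-\<eta>) x) = expo (\<xi> - \<eta>)" by (auto simp: expo_mult)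
      have "(expo (\<xi> - \<eta>) has_integral integral torus_cube (expo (\<xi> - \<eta>))) torus_cube"
        by (intro integrable_integral integrable_on_torus continuous_intros)
      then show ?thesis unfolding eq by (simp add: integral_expo)
    qed
    have "((\<lambda>x. c \<xi> * (expo \<xi> x * expo (-\<eta>) x)) has_integral (if \<xi> = \<eta> then c \<eta> * ?A else 0)) torus_cube" for \<xi>
    proof -
      have "c \<xi> * (if \<xi> = \<eta> then ?A else 0) = (if \<xi> = \<eta> then c \<eta> * ?A else 0)" by simp
      with has_integral_mult_right[OF e, of "c \<xi>" \<xi>] show ?thesis by (simp only:)
    qed
    then have "((\<lambda>x. \<Sum>\<xi>\<in>F. c \<xi> * (expo \<xi> x * expo (-\<eta>) x)) has_integral (\<Sum>\<xi>\<in>F. if \<xi> = \<eta> then c \<eta> * ?A else 0)) torus_cube"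
      by (intro has_integral_sum that) auto
    then show ?thesis
      using IJ(1)[of F] by (simp add: sum_distrib_right mult.assoc has_integral_unique)
  qed
  have "(I \<longlongrightarrow> c \<eta> * ?A) (finite_subsets_at_top UNIV)"
  proof (rule tendsto_eventually)
    show "\<forall>\<^sub>F F in finite_subsets_at_top UNIV. I F = c \<eta> * ?A"
      unfolding eventually_finite_subsets_at_top
      by (rule exI[of _ "{\<eta>}"]) (auto simp: I)
  qed
  then have "J = c \<eta> * ?A" using IJ(3) by (metis tendsto_unique finite_subsets_at_top_neq_bot)
  with IJ(2) show ?thesis by (simp add: fcoef_def integral_unique)
qed

lemma fcoef_diff:
  assumes "continuous_on UNIV f" "continuous_on UNIV g"
  shows "fcoef (\<lambda>x. f x - g x) \<xi> = fcoef f \<xi> - fcoef g \<xi>"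
proof -
  have "integral torus_cube (\<lambda>x. f x * expo (-\<xi>) x - g x * expo (-\<xi>) x) =
      integral torus_cube (\<lambda>x. f x * expo (-\<xi>) x) - integral torus_cube (\<lambda>x. g x * expo (-\<xi>) x)"
    by (intro integral_diff integrable_on_torus continuous_intros assms)
  then show ?thesis by (simp add: fcoef_def left_diff_distrib diff_divide_distrib)
qed

text \<open>The difference of both sides is continuous and periodic with vanishing coefficients,
  hence zero by \<open>fcoef_eq_0_imp_eq_0\<close>.\<close>

theorem fourier_inversion:
  assumes "f \<in> torus_smooth"
  shows "f = synth (fcoef f)"
proof
  fix x
  have s: "(\<lambda>\<xi>. norm (fcoef f \<xi>)) summable_on UNIV"
    using rapid_abs_summable rapid_fcoef assms by blast
  have c: "continuous_on UNIV f" "continuous_on UNIV (synth (fcoef f))"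
    using assms s torus_smooth_continuous continuous_on_synth by blast+
  have "f x - synth (fcoef f) x = 0"
  proof (rule fcoef_eq_0_imp_eq_0)
    show "periodic (\<lambda>x. f x - synth (fcoef f) x)"
      using torus_smooth_periodic[OF assms] periodic_synth[of "fcoef f"] by (simp add: periodic_def)
    show "fcoef (\<lambda>x. f x - synth (fcoef f) x) \<xi> = 0" for \<xi>
      by (simp add: fcoef_diff[OF c] fcoef_synth[OF s])
  qed (intro continuous_intros c)
  then show "f x = synth (fcoef f) x" by simp
qed

lemma norm_iexp_approx:
  fixes r :: real
  shows "norm (exp (\<i> * of_real r) - 1 - \<i> * of_real r) \<le> r\<^sup>2"
  using Taylor_exp[of "\<i> * of_real r" 1] by (simp add: norm_mult power2_eq_square algebra_simps)

lemma has_vector_derivative_synth: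
  assumes c: "rapid c"
  shows "((\<lambda>h. synth c (x + h *\<^sub>R axis j 1)) has_vector_derivative synth (\<lambda>\<xi>. isym [j] \<xi> * c \<xi>) x) (at 0)"
proof -
  define K where "K = infsum (\<lambda>\<xi>. norm (c \<xi>) * wt \<xi> ^ 2) UNIV"
  let ?d = "\<lambda>\<xi>. isym [j] \<xi> * c \<xi>"
  have sc: "(\<lambda>\<xi>. norm (c \<xi>)) summable_on UNIV" and sd: "(\<lambda>\<xi>. norm (?d \<xi>)) summable_on UNIV"
    using rapid_abs_summable c rapid_isym_mult by blast+
  have bd: "norm (synth c (x + h *\<^sub>R axis j 1) - synth c x - h *\<^sub>R synth ?d x) \<le> h\<^sup>2 * K" for h
  proof -
    have "((\<lambda>\<xi>. c \<xi> * expo \<xi> (x + h *\<^sub>R axis j 1) - c \<xi> * expo \<xi> x - h *\<^sub>R (?d \<xi> * expo \<xi> x))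
        has_sum (synth c (x + h *\<^sub>R axis j 1) - synth c x - h *\<^sub>R synth ?d x)) UNIV"
      unfolding diff_conv_add_uminus
      by (intro has_sum_add has_sum_uminusI has_sum_scaleR)
        (simp_all add: synth_def summable_iff_has_sum_infsum[symmetric] abs_summable_on_synth(2) sc sd)
    moreover have "((\<lambda>\<xi>. h\<^sup>2 * (norm (c \<xi>) * wt \<xi> ^ 2)) has_sum h\<^sup>2 * K) UNIV"
      unfolding K_def by (intro has_sum_cmult_right has_sum_infsum rapid_summable c)
    ultimately show ?thesis
    proof (rule norm_infsum_le)
      fix \<xi>
      let ?r = "h * of_int (\<xi> $ j)"
      have "c \<xi> * expo \<xi> (x + h *\<^sub>R axis j 1) - c \<xi> * expo \<xi> x - h *\<^sub>R (?d \<xi> * expo \<xi> x)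
         = c \<xi> * expo \<xi> x * (exp (\<i> * of_real ?r) - 1 - \<i> * of_real ?r)"
        by (simp add: expo_add_axis isym_def scaleR_conv_of_real[where 'a = complex] algebra_simps)
      then have "norm (c \<xi> * expo \<xi> (x + h *\<^sub>R axis j 1) - c \<xi> * expo \<xi> x - h *\<^sub>R (?d \<xi> * expo \<xi> x))
         \<le> norm (c \<xi>) * ?r\<^sup>2"
        using norm_iexp_approx[of ?r] by (simp add: norm_mult mult_left_mono)
      also have "norm (c \<xi>) * ?r\<^sup>2 \<le> norm (c \<xi>) * (h\<^sup>2 * (wt \<xi>)\<^sup>2)"
      proof -
        have "\<bar>real_of_int (\<xi> $ j)\<bar>\<^sup>2 \<le> (wt \<xi>)\<^sup>2" using component_le_wt[of \<xi> j] by (intro power_mono) auto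
        then show ?thesis by (intro mult_left_mono) (auto simp: power_mult_distrib mult_left_mono)
      qed
      finally show "norm (c \<xi> * expo \<xi> (x + h *\<^sub>R axis j 1) - c \<xi> * expo \<xi> x - h *\<^sub>R (?d \<xi> * expo \<xi> x))
          \<le> h\<^sup>2 * (norm (c \<xi>) * wt \<xi> ^ 2)"
        by (simp add: mult_ac)
    qed
  qed
  show ?thesis
    unfolding has_vector_derivative_def
  proof (rule has_derivativeI_sandwich[where e = 1 and H = "\<lambda>h. \<bar>h\<bar> * K"])
    show "((\<lambda>h. \<bar>h\<bar> * K) \<longlongrightarrow> 0) (at (0::real))"
      by (rule tendsto_eq_intros refl | simp)+
    show "norm (synth c (x + y *\<^sub>R axis j 1) - synth c (x + 0 *\<^sub>R axis j 1) - (y - 0) *\<^sub>R synth ?d x) / norm (y - 0)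
       \<le> \<bar>y\<bar> * K" if "y \<noteq> 0" for y
      using bd[of y] that by (simp add: divide_le_eq power2_eq_square mult_ac)
  qed (auto intro: bounded_linear_scaleR_left)
qed

lemma partial_derivs_synth:
  assumes "rapid c"
  shows "partial_derivs js (synth c) = synth (\<lambda>\<xi>. isym js \<xi> * c \<xi>)"
proof (induction js)
  case (Cons j js)
  have "partial_deriv j (synth (\<lambda>\<xi>. isym js \<xi> * c \<xi>)) x = synth (\<lambda>\<xi>. isym [j] \<xi> * (isym js \<xi> * c \<xi>)) x" for x
    unfolding partial_deriv_def
    by (rule vector_derivative_at has_vector_derivative_synth rapid_isym_mult assms)+
  then show ?case using Cons by (auto simp: partial_derivs_Cons isym_def mult_ac)
qed (simp add: isym_def)

lemma torus_smooth_synth: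
  assumes c: "rapid c"
  shows "synth c \<in> torus_smooth"
  unfolding torus_smooth_def smooth_fun_def
proof (safe, goal_cases)
  case (1 js)
  show ?case unfolding partial_derivs_synth[OF c]
    by (intro continuous_on_synth rapid_abs_summable rapid_isym_mult c)
next
  case (2 js j x)
  show ?case unfolding partial_derivs_synth[OF c]
    by (rule differentiableI_vector has_vector_derivative_synth rapid_isym_mult c)+
next
  case (3 x j)
  show ?case using periodic_synth[of c] by (simp add: periodic_def)
qed

section \<open>Fourier series of distributions\<close>

lemma partial_derivs_expo: "partial_derivs js (expo \<xi>) = (\<lambda>x. isym js \<xi> * expo \<xi> x)"
proof (induction js)
  case (Cons j js)
  have "partial_deriv j (\<lambda>x. isym js \<xi> * expo \<xi> x) x = isym js \<xi> * (\<i> * of_int (\<xi> $ j) * expo \<xi> x)" for x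
    unfolding partial_deriv_def
    by (intro vector_derivative_at has_vector_derivative_mult_right has_vector_derivative_expo)
  with Cons show ?case by (auto simp: partial_derivs_Cons isym_def mult_ac)
qed (simp add: isym_def)

lemma torus_smooth_cmult_expo: "(\<lambda>x. c * expo \<xi> x) \<in> torus_smooth"
  and partial_derivs_cmult_expo: "partial_derivs js (\<lambda>x. c * expo \<xi> x) = (\<lambda>x. c * isym js \<xi> * expo \<xi> x)"
proof -
  have d: "((\<lambda>h. (c * isym js \<xi>) * expo \<xi> (x + h *\<^sub>R axis j 1)) has_vector_derivative
      (c * isym js \<xi>) * (\<i> * of_int (\<xi> $ j) * expo \<xi> x)) (at 0)" for js j x
    by (intro has_vector_derivative_mult_right has_vector_derivative_expo)
  show eq: "partial_derivs js (\<lambda>x. c * expo \<xi> x) = (\<lambda>x. c * isym js \<xi> * expo \<xi> x)" for js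
  proof (induction js)
    case (Cons j js)
    then show ?case
      using vector_derivative_at[OF d] by (auto simp: partial_derivs_Cons partial_deriv_def isym_def mult_ac)
  qed (simp add: isym_def)
  show "(\<lambda>x. c * expo \<xi> x) \<in> torus_smooth"
    unfolding torus_smooth_def mem_Collect_eq smooth_fun_def eq
    by (intro conjI allI continuous_intros differentiableI_vector[OF d]) simp
qed

lemma torus_smooth_expo [simp]: "expo \<xi> \<in> torus_smooth"
  using torus_smooth_cmult_expo[of 1 \<xi>] by simp

lemma fourier_coeff_eq: "fourier_coeff u \<xi> = u (expo (-\<xi>))"
proof -
  have "expo (-\<xi>) = (\<lambda>x. exp (- \<i> * of_real (\<Sum>j\<in>UNIV. x $ j * of_int (\<xi> $ j))))"
    by (rule ext) (rule expo_uminus)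
  then show ?thesis unfolding fourier_coeff_def by simp
qed

lemma
  assumes f: "f \<in> torus_smooth" and g: "g \<in> torus_smooth"
  shows torus_smooth_add: "(\<lambda>x. f x + g x) \<in> torus_smooth"
    and partial_derivs_add: "partial_derivs js (\<lambda>x. f x + g x) = (\<lambda>x. partial_derivs js f x + partial_derivs js g x)"
proof -
  note d = has_vector_derivative_add[OF has_vector_derivative_partial_derivs[OF f] has_vector_derivative_partial_derivs[OF g]]
  show eq: "partial_derivs js (\<lambda>x. f x + g x) = (\<lambda>x. partial_derivs js f x + partial_derivs js g x)" for js
  proof (induction js)
    case (Cons j js)
    then show ?case
      using vector_derivative_at[OF d[of js _ j js]] by (auto simp: partial_derivs_Cons partial_deriv_def)
  qed simp
  show "(\<lambda>x. f x + g x) \<in> torus_smooth"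
    using f g d unfolding torus_smooth_def mem_Collect_eq smooth_fun_def eq
    by (auto intro!: continuous_intros differentiableI_vector)
qed

lemma
  assumes f: "f \<in> torus_smooth"
  shows torus_smooth_cmult: "(\<lambda>x. c * f x) \<in> torus_smooth"
    and partial_derivs_cmult: "partial_derivs js (\<lambda>x. c * f x) = (\<lambda>x. c * partial_derivs js f x)"
proof -
  note d = has_vector_derivative_mult_right[OF has_vector_derivative_partial_derivs[OF f], of c]
  show eq: "partial_derivs js (\<lambda>x. c * f x) = (\<lambda>x. c * partial_derivs js f x)" for js
  proof (induction js)
    case (Cons j js)
    then show ?case
      using vector_derivative_at[OF d[of js _ j]] by (auto simp: partial_derivs_Cons partial_deriv_def)
  qed simp
  show "(\<lambda>x. c * f x) \<in> torus_smooth"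
    using f d unfolding torus_smooth_def mem_Collect_eq smooth_fun_def eq
    by (auto intro!: continuous_intros differentiableI_vector)
qed

lemma torus_smooth_sum:
  assumes "\<And>i. i \<in> F \<Longrightarrow> f i \<in> torus_smooth"
  shows "(\<lambda>x. \<Sum>i\<in>F. f i x) \<in> torus_smooth"
  using assms
proof (induction F rule: infinite_finite_induct)
  case (insert i F)
  then show ?case using torus_smooth_add[of "f i"] by simp
qed (use torus_smooth_cmult_expo[of 0] in auto)

lemma fcoef_add:
  assumes f: "f \<in> torus_smooth" and g: "g \<in> torus_smooth"
  shows "fcoef (\<lambda>x. f x + g x) \<xi> = fcoef f \<xi> + fcoef g \<xi>"
proof -
  have "integral torus_cube (\<lambda>x. f x * expo (-\<xi>) x + g x * expo (-\<xi>) x) =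
      integral torus_cube (\<lambda>x. f x * expo (-\<xi>) x) + integral torus_cube (\<lambda>x. g x * expo (-\<xi>) x)"
    by (intro integral_add integrable_on_torus continuous_intros torus_smooth_continuous assms)
  then show ?thesis by (simp add: fcoef_def distrib_right add_divide_distrib)
qed

lemma fcoef_cmult: "fcoef (\<lambda>x. c * f x) \<xi> = c * fcoef f \<xi>"
  by (simp add: fcoef_def mult.assoc)

lemma distributionsD:
  assumes "u \<in> distributions"
  shows distr_not_smooth: "\<phi> \<notin> torus_smooth \<Longrightarrow> u \<phi> = 0"
    and distr_add: "\<phi> \<in> torus_smooth \<Longrightarrow> \<psi> \<in> torus_smooth \<Longrightarrow> u (\<lambda>x. \<phi> x + \<psi> x) = u \<phi> + u \<psi>"
    and distr_cmult: "\<phi> \<in> torus_smooth \<Longrightarrow> u (\<lambda>x. c * \<phi> x) = c * u \<phi>"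
  using assms by (auto simp: distributions_def)

lemma distr_bound:
  assumes "u \<in> distributions"
  obtains C k where "C \<ge> 0" "\<And>\<phi> B. \<phi> \<in> torus_smooth \<Longrightarrow>
    (\<And>js x. length js \<le> k \<Longrightarrow> norm (partial_derivs js \<phi> x) \<le> B) \<Longrightarrow> norm (u \<phi>) \<le> C * B"
proof -
  obtain C k where C: "\<And>\<phi> B. \<phi> \<in> torus_smooth \<Longrightarrow>
    (\<And>js x. length js \<le> k \<Longrightarrow> norm (partial_derivs js \<phi> x) \<le> B) \<Longrightarrow> norm (u \<phi>) \<le> C * B"
    using assms unfolding distributions_def by blast
  have "norm (u \<phi>) \<le> \<bar>C\<bar> * B" if "\<phi> \<in> torus_smooth"
    "\<And>js x. length js \<le> k \<Longrightarrow> norm (partial_derivs js \<phi> x) \<le> B" for \<phi> B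
  proof -
    have "0 \<le> B" using order_trans[OF norm_ge_zero that(2)[of "[]" 0]] by simp
    then have "C * B \<le> \<bar>C\<bar> * B" by (intro mult_right_mono) auto
    then show ?thesis using C[OF that] by linarith
  qed
  then show ?thesis by (intro that[of "\<bar>C\<bar>" k]) auto
qed

lemma distr_zero: "u \<in> distributions \<Longrightarrow> u (\<lambda>x. 0) = 0"
  using distr_cmult[of u "expo 0" 0] by simp

lemma distr_diff:
  assumes "u \<in> distributions" "\<phi> \<in> torus_smooth" "\<psi> \<in> torus_smooth"
  shows "u (\<lambda>x. \<phi> x - \<psi> x) = u \<phi> - u \<psi>"
  using distr_add[OF assms(1,2) torus_smooth_cmult[OF assms(3), of "-1"]] distr_cmult[OF assms(1,3), of "-1"]
  by simp

lemma distr_sum: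
  assumes "u \<in> distributions" "\<And>i. i \<in> F \<Longrightarrow> \<phi> i \<in> torus_smooth"
  shows "u (\<lambda>x. \<Sum>i\<in>F. \<phi> i x) = (\<Sum>i\<in>F. u (\<phi> i))"
  using assms(2)
proof (induction F rule: infinite_finite_induct)
  case (insert i F)
  then show ?case using distr_add[OF assms(1), of "\<phi> i"] torus_smooth_sum[of F \<phi>] by simp
qed (use distr_zero[OF assms(1)] in auto)

lemma fourier_coeff_bound:
  assumes "u \<in> distributions"
  obtains C k where "C \<ge> 0" "\<And>\<xi>. norm (fourier_coeff u \<xi>) \<le> C * wt \<xi> ^ k"
proof -
  obtain C k where C: "C \<ge> 0" "\<And>\<phi> B. \<phi> \<in> torus_smooth \<Longrightarrow>
    (\<And>js x. length js \<le> k \<Longrightarrow> norm (partial_derivs js \<phi> x) \<le> B) \<Longrightarrow> norm (u \<phi>) \<le> C * B"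
    using distr_bound[OF assms] by blast
  have "norm (fourier_coeff u \<xi>) \<le> C * wt \<xi> ^ k" for \<xi>
    unfolding fourier_coeff_eq
  proof (rule C(2))
    fix js :: "'a list" and x :: "real^'a"
    assume "length js \<le> k"
    then have "wt (-\<xi>) ^ length js \<le> wt (-\<xi>) ^ k" by (intro power_increasing wt_ge_1)
    then show "norm (partial_derivs js (expo (-\<xi>)) x) \<le> wt \<xi> ^ k"
      using norm_isym_le[of js "-\<xi>"] by (simp add: partial_derivs_expo norm_mult)
  qed simp
  with C(1) show ?thesis by (rule that)
qed

lemma synth_diff:
  assumes "(\<lambda>\<xi>. norm (c \<xi>)) summable_on UNIV" "(\<lambda>\<xi>. norm (d \<xi>)) summable_on UNIV"
  shows "synth (\<lambda>\<xi>. c \<xi> - d \<xi>) x = synth c x - synth d x"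
proof -
  have "((\<lambda>\<xi>. c \<xi> * expo \<xi> x + - (d \<xi> * expo \<xi> x)) has_sum synth c x + - synth d x) UNIV"
    unfolding synth_def by (intro has_sum_add has_sum_uminusI has_sum_infsum abs_summable_on_synth(2) assms)
  then show ?thesis by (simp add: synth_def infsumI left_diff_distrib)
qed

lemma synth_finite:
  assumes "finite F"
  shows "synth (\<lambda>\<xi>. if \<xi> \<in> F then c \<xi> else 0) x = (\<Sum>\<xi>\<in>F. c \<xi> * expo \<xi> x)"
proof -
  have "infsum (\<lambda>\<xi>. (if \<xi> \<in> F then c \<xi> else 0) * expo \<xi> x) UNIV = infsum (\<lambda>\<xi>. c \<xi> * expo \<xi> x) F"
    by (intro infsum_cong_neutral) auto
  then show ?thesis using assms by (simp add: synth_def)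
qed

text \<open>The functional is applied to the partial sums of the Fourier series of \<psi>. The
  remainder is small in the finitely many seminorms that bound \<open>u\<close>, because its
  derivatives up to order \<open>k\<close> are dominated by a tail of the summable family
  \<open>w\<close>.\<close>

theorem distr_has_sum:
  assumes u: "u \<in> distributions" and f: "\<psi> \<in> torus_smooth"
  shows "((\<lambda>\<xi>. fcoef \<psi> (-\<xi>) * fourier_coeff u \<xi>) has_sum u \<psi>) UNIV"
proof -
  obtain C k where C: "C \<ge> 0" "\<And>\<phi> B. \<phi> \<in> torus_smooth \<Longrightarrow>
    (\<And>js x. length js \<le> k \<Longrightarrow> norm (partial_derivs js \<phi> x) \<le> B) \<Longrightarrow> norm (u \<phi>) \<le> C * B"
    using distr_bound[OF u] by blast
  define c where "c = fcoef \<psi>"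
  have c: "rapid c" unfolding c_def by (rule rapid_fcoef[OF f])
  define w where "w \<xi> = norm (c \<xi>) * wt \<xi> ^ k" for \<xi>
  have w: "w summable_on UNIV" unfolding w_def by (rule rapid_summable[OF c])
  have bd: "norm (u \<psi> - (\<Sum>\<xi>\<in>F. c \<xi> * u (expo \<xi>))) \<le> C * (infsum w UNIV - sum w F)" if F: "finite F" for F
  proof -
    \<comment> \<open>\<open>d\<close> is the truncation of the coefficients to \<open>F\<close> and
      \<open>e\<close> the remainder, so that the error of the partial sum is itself a synthesised
      smooth function.\<close>
    define d where "d \<xi> = (if \<xi> \<in> F then c \<xi> else 0)" for \<xi>
    define e where "e \<xi> = c \<xi> - d \<xi>" for \<xi>
    have ed: "norm (d \<xi>) \<le> norm (c \<xi>)" "norm (e \<xi>) \<le> norm (c \<xi>)" for \<xi> by (auto simp: d_def e_def)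
    have rapid_mono: "rapid e'" if "\<And>\<xi>. norm (e' \<xi>) \<le> norm (c \<xi>)" for e'
      using c that unfolding rapid_def
      by (meson mult_right_mono order_trans wt_nonneg zero_le_power)
    have rd: "rapid d" "rapid e" by (auto intro: rapid_mono ed)
    have eq: "(\<lambda>x. \<psi> x - (\<Sum>\<xi>\<in>F. c \<xi> * expo \<xi> x)) = synth e"
    proof
      fix x
      have "synth e x = synth c x - synth d x"
        unfolding e_def[abs_def] by (intro synth_diff rapid_abs_summable c rd)
      moreover have "synth d x = (\<Sum>\<xi>\<in>F. c \<xi> * expo \<xi> x)"
        unfolding d_def[abs_def] by (rule synth_finite[OF F])
      moreover have "synth c x = \<psi> x" unfolding c_def by (simp flip: fourier_inversion[OF f])
      ultimately show "\<psi> x - (\<Sum>\<xi>\<in>F. c \<xi> * expo \<xi> x) = synth e x" by simp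
    qed
    have "u \<psi> - (\<Sum>\<xi>\<in>F. c \<xi> * u (expo \<xi>)) = u (\<lambda>x. \<psi> x - (\<Sum>\<xi>\<in>F. c \<xi> * expo \<xi> x))"
      by (simp add: distr_diff[OF u f torus_smooth_sum] distr_sum[OF u] torus_smooth_cmult_expo
          distr_cmult[OF u])
    also have "norm \<dots> \<le> C * (infsum w UNIV - sum w F)"
      unfolding eq
    proof (rule C(2))
      show "synth e \<in> torus_smooth" by (rule torus_smooth_synth[OF rd(2)])
      fix js :: "'a list" and x :: "real^'a"
      assume js: "length js \<le> k"
      have s: "(\<lambda>\<xi>. norm (isym js \<xi> * e \<xi>)) summable_on UNIV"
        by (intro rapid_abs_summable rapid_isym_mult rd)
      have "norm (partial_derivs js (synth e) x) \<le> infsum (\<lambda>\<xi>. norm (isym js \<xi> * e \<xi>)) UNIV"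
        unfolding partial_derivs_synth[OF rd(2)] by (rule norm_synth_le[OF s])
      also have "\<dots> \<le> infsum (\<lambda>\<xi>. norm (e \<xi>) * wt \<xi> ^ k) UNIV"
      proof (rule infsum_mono[OF s rapid_summable[OF rd(2)]])
        fix \<xi>
        have "norm (isym js \<xi>) \<le> wt \<xi> ^ k"
          using norm_isym_le[of js \<xi>] power_increasing[OF js wt_ge_1[of \<xi>]] by linarith
        then show "norm (isym js \<xi> * e \<xi>) \<le> norm (e \<xi>) * wt \<xi> ^ k"
          by (simp add: norm_mult mult.commute mult_left_mono)
      qed
      also have "\<dots> = infsum w (UNIV - F)"
        by (intro infsum_cong_neutral) (auto simp: w_def e_def d_def)
      also have "\<dots> = infsum w UNIV - infsum w F"
        by (intro infsum_Diff w) (use F in auto)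
      finally show "norm (partial_derivs js (synth e) x) \<le> infsum w UNIV - sum w F" using F by simp
    qed
    finally show ?thesis .
  qed
  have "((\<lambda>F. C * (infsum w UNIV - sum w F)) \<longlongrightarrow> C * (infsum w UNIV - infsum w UNIV)) (finite_subsets_at_top UNIV)"
    by (intro tendsto_intros infsum_tendsto w)
  then have lim0: "((\<lambda>F. C * (infsum w UNIV - sum w F)) \<longlongrightarrow> 0) (finite_subsets_at_top UNIV)" by simp
  have "((\<lambda>F. u \<psi> - (\<Sum>\<xi>\<in>F. c \<xi> * u (expo \<xi>))) \<longlongrightarrow> 0) (finite_subsets_at_top UNIV)"
    by (rule Lim_null_comparison[OF _ lim0])
      (auto simp: eventually_finite_subsets_at_top intro!: exI[of _ "{}"] bd)
  then have "((\<lambda>F. \<Sum>\<xi>\<in>F. c \<xi> * u (expo \<xi>)) \<longlongrightarrow> u \<psi>) (finite_subsets_at_top UNIV)"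
    using tendsto_diff[OF tendsto_const[of "u \<psi>"]] by fastforce
  then have "((\<lambda>\<xi>. c \<xi> * u (expo \<xi>)) has_sum u \<psi>) UNIV" by (simp add: has_sum_def)
  \<comment> \<open>The coefficient of \<open>u\<close> at \<xi> is obtained by testing with the
    character of frequency -\<xi>, whence the reflection of the index.\<close>
  moreover have "bij_betw uminus (UNIV :: (int^'a) set) UNIV"
    by (intro bij_betwI[of _ _ _ uminus]) auto
  ultimately have "((\<lambda>\<xi>. c (-\<xi>) * u (expo (-\<xi>))) has_sum u \<psi>) UNIV"
    using has_sum_reindex_bij_betw[of uminus UNIV UNIV "\<lambda>\<xi>. c \<xi> * u (expo \<xi>)"] by blast
  then show ?thesis by (simp add: c_def fourier_coeff_eq)
qed

lemma distr_eqI: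
  assumes "u \<in> distributions" "v \<in> distributions" "\<And>\<xi>. fourier_coeff u \<xi> = fourier_coeff v \<xi>"
  shows "u = v"
proof
  fix \<psi>
  show "u \<psi> = v \<psi>"
  proof (cases "\<psi> \<in> torus_smooth")
    case True
    show ?thesis
      using distr_has_sum[OF assms(1) True] distr_has_sum[OF assms(2) True] assms(3)
      by (simp add: has_sum_unique)
  qed (use distr_not_smooth[OF assms(1)] distr_not_smooth[OF assms(2)] in auto)
qed

text \<open>Polynomial growth of order \<open>k\<close> is beaten by the decay of the coefficients
  of \<psi> of order \<open>k + 2 * CARD('n)\<close>, the surplus being what
  \<open>summable_on_wt\<close> needs. The bound is linear in \<open>A\<close> and in
  \<open>B\<close>, so it yields both continuity in \<psi> and uniformity over families of
  coefficients.\<close>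

lemma pairing_bound:
  fixes c :: "int^'n::finite \<Rightarrow> complex" and k :: nat
  defines "K \<equiv> (1 + real CARD('n)) ^ Suc (k + 2 * CARD('n)) * infsum (\<lambda>\<xi>::int^'n. 1 / wt \<xi> ^ (2 * CARD('n))) UNIV"
  assumes c: "\<And>\<xi>. norm (c \<xi>) \<le> A * wt \<xi> ^ k" and A: "A \<ge> 0" and f: "\<psi> \<in> torus_smooth"
    and B: "\<And>js x. length js \<le> k + 2 * CARD('n) \<Longrightarrow> norm (partial_derivs js \<psi> x) \<le> B"
  shows "(\<lambda>\<xi>. norm (fcoef \<psi> (-\<xi>) * c \<xi>)) summable_on UNIV"
    and "norm (infsum (\<lambda>\<xi>. fcoef \<psi> (-\<xi>) * c \<xi>) UNIV) \<le> A * K * B"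
proof -
  have *: "norm (fcoef \<psi> (-\<xi>) * c \<xi>) * wt \<xi> ^ (2 * CARD('n)) \<le> A * (1 + real CARD('n)) ^ Suc (k + 2 * CARD('n)) * B" for \<xi>
  proof -
    have "norm (fcoef \<psi> (-\<xi>) * c \<xi>) * wt \<xi> ^ (2 * CARD('n))
        \<le> norm (fcoef \<psi> (-\<xi>)) * (A * wt \<xi> ^ k) * wt \<xi> ^ (2 * CARD('n))"
      unfolding norm_mult by (intro mult_right_mono mult_left_mono c) auto
    also have "\<dots> = A * (norm (fcoef \<psi> (-\<xi>)) * wt (-\<xi>) ^ (k + 2 * CARD('n)))"
      by (simp add: power_add mult_ac)
    also have "\<dots> \<le> A * ((1 + real CARD('n)) ^ Suc (k + 2 * CARD('n)) * B)"
      by (intro mult_left_mono norm_fcoef_decay f B A)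
    finally show ?thesis by (simp add: mult_ac)
  qed
  note s = summable_on_wt_bound[OF norm_ge_zero *]
  show "(\<lambda>\<xi>. norm (fcoef \<psi> (-\<xi>) * c \<xi>)) summable_on UNIV" by (rule s(1))
  from norm_infsum_bound[OF this] s(2)
  show "norm (infsum (\<lambda>\<xi>. fcoef \<psi> (-\<xi>) * c \<xi>) UNIV) \<le> A * K * B"
    by (simp add: K_def mult_ac)
qed

text \<open>The series of \<open>distr_has_sum\<close> read as a definition. It inverts
  \<open>fourier_coeff\<close> on families of polynomial growth.\<close>

definition distr_of_coeffs :: "(int^'n::finite \<Rightarrow> complex) \<Rightarrow> 'n functional" where
  "distr_of_coeffs c = (\<lambda>\<psi>. if \<psi> \<in> torus_smooth then infsum (\<lambda>\<xi>. fcoef \<psi> (-\<xi>) * c \<xi>) UNIV else 0)"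

lemma
  fixes c :: "int^'n::finite \<Rightarrow> complex"
  assumes c: "\<And>\<xi>. norm (c \<xi>) \<le> A * wt \<xi> ^ k"
  shows distr_of_coeffs_in: "distr_of_coeffs c \<in> distributions"
    and fourier_coeff_distr_of_coeffs: "fourier_coeff (distr_of_coeffs c) \<xi> = c \<xi>"
proof -
  have A: "A \<ge> 0" using order_trans[OF norm_ge_zero c[of 0]] by (simp add: zero_le_mult_iff)
    (smt (verit) wt_pos zero_less_power)
  have s: "(\<lambda>\<xi>. fcoef \<psi> (-\<xi>) * c \<xi>) summable_on UNIV" if "\<psi> \<in> torus_smooth" for \<psi>
  proof -
    obtain B where "\<And>js x. length js \<le> k + 2 * CARD('n) \<Longrightarrow> norm (partial_derivs js \<psi> x) \<le> B"
      using torus_smooth_derivs_bounded[OF \<open>\<psi> \<in> torus_smooth\<close>] by blast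
    from pairing_bound(1)[OF c A that this] show ?thesis by (rule abs_summable_summable)
  qed
  show "distr_of_coeffs c \<in> distributions"
    unfolding distributions_def
  proof (rule CollectI, intro conjI ballI allI impI)
    fix \<phi> \<psi> :: "real^'n \<Rightarrow> complex" assume *: "\<phi> \<in> torus_smooth" "\<psi> \<in> torus_smooth"
    show "distr_of_coeffs c (\<lambda>x. \<phi> x + \<psi> x) = distr_of_coeffs c \<phi> + distr_of_coeffs c \<psi>"
      using * by (simp add: distr_of_coeffs_def torus_smooth_add fcoef_add distrib_right infsum_add s)
  next
    fix \<phi> :: "real^'n \<Rightarrow> complex" and a assume *: "\<phi> \<in> torus_smooth"
    show "distr_of_coeffs c (\<lambda>x. a * \<phi> x) = a * distr_of_coeffs c \<phi>"
      using * by (simp add: distr_of_coeffs_def torus_smooth_cmult fcoef_cmult mult.assoc infsum_cmult_right')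
  next
    show "\<exists>C k. \<forall>\<phi>\<in>torus_smooth. \<forall>B. (\<forall>js x. length js \<le> k \<longrightarrow> norm (partial_derivs js \<phi> x) \<le> B)
        \<longrightarrow> norm (distr_of_coeffs c \<phi>) \<le> C * B"
    proof (intro exI ballI allI impI)
      fix \<phi> :: "real^'n \<Rightarrow> complex" and B
      assume *: "\<phi> \<in> torus_smooth" "\<forall>js x. length js \<le> k + 2 * CARD('n) \<longrightarrow> norm (partial_derivs js \<phi> x) \<le> B"
      show "norm (distr_of_coeffs c \<phi>) \<le> (A * ((1 + real CARD('n)) ^ Suc (k + 2 * CARD('n)) *
          infsum (\<lambda>\<xi>::int^'n. 1 / wt \<xi> ^ (2 * CARD('n))) UNIV)) * B"
        using pairing_bound(2)[OF c A *(1) *(2)[rule_format]] *(1) by (simp add: distr_of_coeffs_def)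
    qed
  qed (simp add: distr_of_coeffs_def)
  have "(\<Sum>\<^sub>\<infinity>\<eta>. fcoef (expo (-\<xi>)) (-\<eta>) * c \<eta>) = (\<Sum>\<^sub>\<infinity>\<eta>\<in>{\<xi>}. c \<eta>)"
    by (intro infsum_cong_neutral) (auto simp: fcoef_expo)
  then show "fourier_coeff (distr_of_coeffs c) \<xi> = c \<xi>"
    by (simp add: fourier_coeff_eq distr_of_coeffs_def)
qed

lemma
  assumes f: "f \<in> torus_smooth"
  shows distr_of_fun_in: "distr_of_fun f \<in> distributions"
    and fourier_coeff_distr_of_fun: "fourier_coeff (distr_of_fun f) \<xi> = fcoef f \<xi>"
proof -
  have int: "(\<lambda>x. f x * \<psi> x) integrable_on torus_cube" if "\<psi> \<in> torus_smooth" for \<psi>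
    by (intro integrable_on_torus continuous_intros torus_smooth_continuous f that)
  obtain C where C: "norm (f x) \<le> C" for x
    using periodic_bounded[OF torus_smooth_continuous[OF f] torus_smooth_periodic[OF f]] by blast
  have C0: "0 \<le> C" using order_trans[OF norm_ge_zero C] .
  show "distr_of_fun f \<in> distributions"
    unfolding distributions_def
  proof (rule CollectI, intro conjI ballI allI impI)
    fix \<phi> \<psi> :: "real^'a \<Rightarrow> complex" assume *: "\<phi> \<in> torus_smooth" "\<psi> \<in> torus_smooth"
    show "distr_of_fun f (\<lambda>x. \<phi> x + \<psi> x) = distr_of_fun f \<phi> + distr_of_fun f \<psi>"
      using * by (simp add: distr_of_fun_def torus_smooth_add distrib_left integral_add int add_divide_distrib)
  next
    fix \<phi> :: "real^'a \<Rightarrow> complex" and a assume *: "\<phi> \<in> torus_smooth"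
    have "(\<lambda>x. f x * (a * \<phi> x)) = (\<lambda>x. a * (f x * \<phi> x))" by (simp add: mult_ac)
    then show "distr_of_fun f (\<lambda>x. a * \<phi> x) = a * distr_of_fun f \<phi>"
      using * by (simp add: distr_of_fun_def torus_smooth_cmult)
  next
    have "norm (distr_of_fun f \<phi>) \<le> C * B"
      if *: "\<phi> \<in> torus_smooth" "\<forall>js x. length js \<le> 0 \<longrightarrow> norm (partial_derivs js \<phi> x) \<le> B" for \<phi> B
    proof -
      have "norm (f x * \<phi> x * expo (-0) x) \<le> C * B" for x
        using *(2)[rule_format, of "[]" x] C[of x] C0 by (simp add: norm_mult mult_mono)
      then have "norm (fcoef (\<lambda>x. f x * \<phi> x) 0) \<le> C * B"
        by (intro norm_fcoef_le continuous_intros torus_smooth_continuous f *) simp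
      then show ?thesis using * by (simp add: fcoef_def distr_of_fun_def)
    qed
    then show "\<exists>C k. \<forall>\<phi>\<in>torus_smooth. \<forall>B. (\<forall>js x. length js \<le> k \<longrightarrow> norm (partial_derivs js \<phi> x) \<le> B)
        \<longrightarrow> norm (distr_of_fun f \<phi>) \<le> C * B" by blast
  qed (simp add: distr_of_fun_def)
  show "fourier_coeff (distr_of_fun f) \<xi> = fcoef f \<xi>"
    by (simp add: fourier_coeff_eq distr_of_fun_def fcoef_def)
qed

text \<open>\<open>smooth_rep\<close> is an inverse function, so its value can only be identified
  once \<open>distr_of_fun\<close> is known to be injective on smooth functions, which is the
  inversion theorem.\<close>

lemma smooth_rep_eq:
  assumes u: "u \<in> distributions" and c: "rapid (fourier_coeff u)"
  shows "smooth_rep u = synth (fourier_coeff u)"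
proof -
  have inj: "inj_on distr_of_fun (torus_smooth :: (real^'a \<Rightarrow> complex) set)"
  proof (rule inj_onI)
    fix f g :: "real^'a \<Rightarrow> complex" assume fg: "f \<in> torus_smooth" "g \<in> torus_smooth" "distr_of_fun f = distr_of_fun g"
    then have "fcoef f = fcoef g" by (metis fourier_coeff_distr_of_fun ext)
    then show "f = g" using fg by (metis fourier_inversion)
  qed
  have s: "synth (fourier_coeff u) \<in> torus_smooth" by (rule torus_smooth_synth[OF c])
  have "distr_of_fun (synth (fourier_coeff u)) = u"
    by (rule distr_eqI[OF distr_of_fun_in[OF s] u])
      (simp add: fourier_coeff_distr_of_fun[OF s] fcoef_synth[OF rapid_abs_summable[OF c]])
  then show ?thesis unfolding smooth_rep_def using the_inv_into_f_f[OF inj s] by simp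
qed

lemma
  assumes u: "u \<in> distributions"
  shows distr_partial_in: "distr_partial j u \<in> distributions"
    and fourier_coeff_distr_partial: "fourier_coeff (distr_partial j u) \<xi> = \<i> * of_int (\<xi> $ j) * fourier_coeff u \<xi>"
proof -
  have add: "partial_deriv j (\<lambda>x. \<phi> x + \<psi> x) = (\<lambda>x. partial_deriv j \<phi> x + partial_deriv j \<psi> x)"
    if "\<phi> \<in> torus_smooth" "\<psi> \<in> torus_smooth" for \<phi> \<psi>
    using partial_derivs_add[OF that, of "[j]"] by (simp add: partial_derivs_Cons)
  have mult: "partial_deriv j (\<lambda>x. a * \<phi> x) = (\<lambda>x. a * partial_deriv j \<phi> x)" if "\<phi> \<in> torus_smooth" for \<phi> a
    using partial_derivs_cmult[OF that, of "[j]"] by (simp add: partial_derivs_Cons)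
  obtain C k where C: "C \<ge> 0" "\<And>\<phi> B. \<phi> \<in> torus_smooth \<Longrightarrow>
    (\<And>js x. length js \<le> k \<Longrightarrow> norm (partial_derivs js \<phi> x) \<le> B) \<Longrightarrow> norm (u \<phi>) \<le> C * B"
    using distr_bound[OF u] by blast
  show "distr_partial j u \<in> distributions"
    unfolding distributions_def
  proof (rule CollectI, intro conjI ballI allI impI)
    have "norm (distr_partial j u \<phi>) \<le> C * B"
      if *: "\<phi> \<in> torus_smooth" "\<forall>js x. length js \<le> Suc k \<longrightarrow> norm (partial_derivs js \<phi> x) \<le> B" for \<phi> B
    proof -
      have "norm (u (partial_deriv j \<phi>)) \<le> C * B"
      proof (intro C(2) torus_smooth_partial_deriv *)
        fix js :: "'a list" and x assume "length js \<le> k"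
        then show "norm (partial_derivs js (partial_deriv j \<phi>) x) \<le> B"
          using *(2)[rule_format, of "js @ [j]" x] by (simp add: partial_derivs_append partial_derivs_Cons)
      qed
      then show ?thesis using * by (simp add: distr_partial_def)
    qed
    then show "\<exists>C k. \<forall>\<phi>\<in>torus_smooth. \<forall>B. (\<forall>js x. length js \<le> k \<longrightarrow> norm (partial_derivs js \<phi> x) \<le> B)
        \<longrightarrow> norm (distr_partial j u \<phi>) \<le> C * B" by blast
  qed (auto simp: distr_partial_def torus_smooth_add torus_smooth_cmult add mult
      distr_add[OF u] distr_cmult[OF u] torus_smooth_partial_deriv)
  show "fourier_coeff (distr_partial j u) \<xi> = \<i> * of_int (\<xi> $ j) * fourier_coeff u \<xi>"
    using distr_cmult[OF u torus_smooth_expo, of "- (\<i> * of_int (\<xi> $ j))" "-\<xi>"]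
    by (simp add: fourier_coeff_eq distr_partial_def partial_deriv_expo)
qed

lemma
  assumes u: "u \<in> distributions" and v: "v \<in> distributions"
  shows distributions_add: "(\<lambda>\<phi>. u \<phi> + v \<phi>) \<in> distributions"
proof -
  obtain C k where C: "C \<ge> 0" "\<And>\<phi> B. \<phi> \<in> torus_smooth \<Longrightarrow>
    (\<And>js x. length js \<le> k \<Longrightarrow> norm (partial_derivs js \<phi> x) \<le> B) \<Longrightarrow> norm (u \<phi>) \<le> C * B"
    using distr_bound[OF u] by blast
  obtain D l where D: "D \<ge> 0" "\<And>\<phi> B. \<phi> \<in> torus_smooth \<Longrightarrow>
    (\<And>js x. length js \<le> l \<Longrightarrow> norm (partial_derivs js \<phi> x) \<le> B) \<Longrightarrow> norm (v \<phi>) \<le> D * B"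
    using distr_bound[OF v] by blast
  have "norm (u \<phi> + v \<phi>) \<le> (C + D) * B"
    if *: "\<phi> \<in> torus_smooth" "\<forall>js x. length js \<le> max k l \<longrightarrow> norm (partial_derivs js \<phi> x) \<le> B" for \<phi> B
    using C(2)[OF *(1), of B] D(2)[OF *(1), of B] *(2) norm_triangle_ineq[of "u \<phi>" "v \<phi>"]
    by (simp add: distrib_right)
  then have "\<exists>C k. \<forall>\<phi>\<in>torus_smooth. \<forall>B. (\<forall>js x. length js \<le> k \<longrightarrow> norm (partial_derivs js \<phi> x) \<le> B)
        \<longrightarrow> norm (u \<phi> + v \<phi>) \<le> C * B" by blast
  then show ?thesis
    using distr_not_smooth[OF u] distr_not_smooth[OF v]
    by (auto simp: distributions_def distr_add[OF u] distr_add[OF v] distr_cmult[OF u] distr_cmult[OF v] algebra_simps)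
qed

lemma distributions_cmult:
  assumes u: "u \<in> distributions"
  shows "(\<lambda>\<phi>. c * u \<phi>) \<in> distributions"
proof -
  obtain C k where C: "C \<ge> 0" "\<And>\<phi> B. \<phi> \<in> torus_smooth \<Longrightarrow>
    (\<And>js x. length js \<le> k \<Longrightarrow> norm (partial_derivs js \<phi> x) \<le> B) \<Longrightarrow> norm (u \<phi>) \<le> C * B"
    using distr_bound[OF u] by blast
  have "norm (c * u \<phi>) \<le> (norm c * C) * B"
    if *: "\<phi> \<in> torus_smooth" "\<forall>js x. length js \<le> k \<longrightarrow> norm (partial_derivs js \<phi> x) \<le> B" for \<phi> B
    using mult_left_mono[OF C(2)[OF *(1), of B], of "norm c"] *(2) by (simp add: norm_mult mult.assoc)
  then have "\<exists>C k. \<forall>\<phi>\<in>torus_smooth. \<forall>B. (\<forall>js x. length js \<le> k \<longrightarrow> norm (partial_derivs js \<phi> x) \<le> B)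
        \<longrightarrow> norm (c * u \<phi>) \<le> C * B" by blast
  then show ?thesis
    using distr_not_smooth[OF u]
    by (auto simp: distributions_def distr_add[OF u] distr_cmult[OF u] algebra_simps)
qed

lemma distributions_diff:
  "u \<in> distributions \<Longrightarrow> v \<in> distributions \<Longrightarrow> (\<lambda>\<phi>. u \<phi> - v \<phi>) \<in> distributions"
  using distributions_add[OF _ distributions_cmult[of v "-1"]] by simp

lemma fourier_coeff_linear [simp]:
  "fourier_coeff (\<lambda>\<phi>. u \<phi> + v \<phi>) \<xi> = fourier_coeff u \<xi> + fourier_coeff v \<xi>"
  "fourier_coeff (\<lambda>\<phi>. u \<phi> - v \<phi>) \<xi> = fourier_coeff u \<xi> - fourier_coeff v \<xi>"
  "fourier_coeff (\<lambda>\<phi>. c * u \<phi>) \<xi> = c * fourier_coeff u \<xi>"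
  by (simp_all add: fourier_coeff_def)

section \<open>Seminorm topologies and Sobolev spaces\<close>

lemma topspace_seminorm_topology [simp]: "topspace (seminorm_topology X Q) = X"
  by (auto simp: seminorm_topology_def)

lemma openin_seminorm_ball:
  "u \<in> X \<Longrightarrow> p \<in> Q \<Longrightarrow> 0 < e \<Longrightarrow> openin (seminorm_topology X Q) {v\<in>X. p (\<lambda>\<phi>. v \<phi> - u \<phi>) < e}"
  unfolding seminorm_topology_def by (rule topology_generated_by_Basis) auto

text \<open>The generating balls have arbitrary centres; the triangle inequality reduces membership
  in one of them to smallness of the seminorm of \<open>f y - f x\<close>.\<close>

lemma continuous_map_seminorm_topologyI:
  assumes f: "f ` topspace Y \<subseteq> X"
    and diff: "\<And>u v. u \<in> X \<Longrightarrow> v \<in> X \<Longrightarrow> (\<lambda>\<phi>. u \<phi> - v \<phi>) \<in> X"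
    and sn: "\<And>p. p \<in> Q \<Longrightarrow> seminorm_on X p"
    and cont: "\<And>x p e. x \<in> topspace Y \<Longrightarrow> p \<in> Q \<Longrightarrow> 0 < e \<Longrightarrow>
      \<exists>U. openin Y U \<and> x \<in> U \<and> (\<forall>y\<in>U. p (\<lambda>\<phi>. f y \<phi> - f x \<phi>) < e)"
  shows "continuous_map Y (seminorm_topology X Q) f"
  unfolding seminorm_topology_def
proof (rule continuous_on_generated_topo)
  show "f ` topspace Y \<subseteq> \<Union> (insert X {{v \<in> X. p (\<lambda>\<phi>. v \<phi> - u \<phi>) < e} |u p e. u \<in> X \<and> p \<in> Q \<and> 0 < e})"
    using f by auto
  fix V assume "V \<in> insert X {{v \<in> X. p (\<lambda>\<phi>. v \<phi> - u \<phi>) < e} |u p e. u \<in> X \<and> p \<in> Q \<and> 0 < e}"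
  then consider "V = X" | u p e where "V = {v \<in> X. p (\<lambda>\<phi>. v \<phi> - u \<phi>) < e}" "u \<in> X" "p \<in> Q" "0 < e"
    by blast
  then show "openin Y (f -` V \<inter> topspace Y)"
  proof cases
    case 1
    then have "f -` V \<inter> topspace Y = topspace Y" using f by auto
    then show ?thesis by simp
  next
    case 2
    have "\<exists>U. openin Y U \<and> x \<in> U \<and> U \<subseteq> f -` V \<inter> topspace Y" if x: "x \<in> f -` V \<inter> topspace Y" for x
    proof -
      define r where "r = e - p (\<lambda>\<phi>. f x \<phi> - u \<phi>)"
      have "r > 0" using x 2 by (auto simp: r_def)
      then obtain U where U: "openin Y U" "x \<in> U" "\<And>y. y \<in> U \<Longrightarrow> p (\<lambda>\<phi>. f y \<phi> - f x \<phi>) < r"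
        using cont[of x p r] x 2 by blast
      have "y \<in> f -` V \<inter> topspace Y" if y: "y \<in> U" for y
      proof -
        have yY: "y \<in> topspace Y" using U(1) y openin_subset by blast
        have fX: "f y \<in> X" "f x \<in> X" using f yY x by auto
        have "\<forall>v\<in>X. \<forall>w\<in>X. p (\<lambda>\<phi>. v \<phi> + w \<phi>) \<le> p v + p w"
          using sn[OF 2(3)] by (simp add: seminorm_on_def)
        from this[rule_format, OF diff[OF fX] diff[OF fX(2) 2(2)]]
        have "p (\<lambda>\<phi>. f y \<phi> - u \<phi>) \<le> p (\<lambda>\<phi>. f y \<phi> - f x \<phi>) + p (\<lambda>\<phi>. f x \<phi> - u \<phi>)"
          by simp
        also have "\<dots> < e" using U(3)[OF y] by (simp add: r_def)
        finally show ?thesis using 2 fX yY by auto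
      qed
      with U show ?thesis by blast
    qed
    then show ?thesis by (subst openin_subopen) blast
  qed
qed

lemma seminorm_on_0: "seminorm_on X p \<Longrightarrow> u \<in> X \<Longrightarrow> p (\<lambda>\<phi>. u \<phi> - u \<phi>) = 0"
  unfolding seminorm_on_def by (drule conjunct2, drule conjunct2, drule spec[of _ 0]) auto

lemma continuous_map_seminorm_topologyD:
  assumes c: "continuous_map Y (seminorm_topology X Q) f" and x: "x \<in> topspace Y"
    and p: "p \<in> Q" "seminorm_on X p" and e: "0 < e"
  shows "\<exists>U. openin Y U \<and> x \<in> U \<and> (\<forall>y\<in>U. p (\<lambda>\<phi>. f y \<phi> - f x \<phi>) < e)"
proof -
  have fx: "f x \<in> X" using continuous_map_image_subset_topspace[OF c] x by auto
  let ?U = "{y \<in> topspace Y. f y \<in> {v\<in>X. p (\<lambda>\<phi>. v \<phi> - f x \<phi>) < e}}"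
  have "openin Y ?U"
    by (rule openin_continuous_map_preimage[OF c openin_seminorm_ball[OF fx p(1) e]])
  moreover have "x \<in> ?U" using x fx seminorm_on_0[OF p(2) fx] e by simp
  ultimately show ?thesis by (intro exI[of _ ?U]) auto
qed

lemma openin_top_of_set_nhd_iff:
  fixes x :: "'a::metric_space"
  assumes "x \<in> S"
  shows "(\<exists>U. openin (top_of_set S) U \<and> x \<in> U \<and> (\<forall>y\<in>U. P y)) \<longleftrightarrow>
    (\<exists>d>0. \<forall>y\<in>S. dist y x < d \<longrightarrow> P y)"
proof safe
  fix U assume U: "openin (top_of_set S) U" "x \<in> U" "\<forall>y\<in>U. P y"
  then obtain d where "d > 0" "\<And>y. y \<in> S \<Longrightarrow> dist y x < d \<Longrightarrow> y \<in> U"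
    unfolding openin_euclidean_subtopology_iff by (metis dist_commute)
  then show "\<exists>d>0. \<forall>y\<in>S. dist y x < d \<longrightarrow> P y" using U by blast
next
  fix d :: real assume d: "d > 0" "\<forall>y\<in>S. dist y x < d \<longrightarrow> P y"
  show "\<exists>U. openin (top_of_set S) U \<and> x \<in> U \<and> (\<forall>y\<in>U. P y)"
    using d assms by (intro exI[of _ "S \<inter> ball x d"]) (auto simp: openin_open_Int dist_commute)
qed

lemma time_cont_seminormD:
  assumes c: "time_cont T (seminorm_topology X Q) f" and t: "t \<in> {0..T}"
  shows "f t \<in> X" "p \<in> Q \<Longrightarrow> seminorm_on X p \<Longrightarrow> 0 < e \<Longrightarrow>
    \<exists>d>0. \<forall>s\<in>{0..T}. dist s t < d \<longrightarrow> p (\<lambda>\<phi>. f s \<phi> - f t \<phi>) < e"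
proof -
  note c' = c[unfolded time_cont_def]
  show "f t \<in> X" using continuous_map_image_subset_topspace[OF c'] t by auto
  assume "p \<in> Q" "seminorm_on X p" "0 < e"
  from continuous_map_seminorm_topologyD[OF c' _ this, of t] t
  show "\<exists>d>0. \<forall>s\<in>{0..T}. dist s t < d \<longrightarrow> p (\<lambda>\<phi>. f s \<phi> - f t \<phi>) < e"
    using openin_top_of_set_nhd_iff[OF t, of "\<lambda>s. p (\<lambda>\<phi>. f s \<phi> - f t \<phi>) < e"] by simp
qed

lemma compact_finite_cover_balls:
  fixes S :: "'a::metric_space set"
  assumes "compact S" "\<And>t. t \<in> S \<Longrightarrow> 0 < d t"
  obtains D where "D \<subseteq> S" "finite D" "\<And>s. s \<in> S \<Longrightarrow> \<exists>t\<in>D. dist s t < d t"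
proof -
  have "S \<subseteq> (\<Union>t\<in>S. ball t (d t))" using assms by force
  with compactE_image[OF assms(1), of S "\<lambda>t. ball t (d t)"] obtain D where
    "D \<subseteq> S" "finite D" "S \<subseteq> (\<Union>t\<in>D. ball t (d t))" by auto
  then show ?thesis by (intro that[of D]) (auto simp: subset_iff dist_commute)
qed

text \<open>Each time has a neighbourhood on which the seminorm exceeds its central value by at most
  1, and finitely many of them cover the interval.\<close>

lemma time_cont_seminorm_bounded:
  assumes c: "time_cont T (seminorm_topology X Q) f" and p: "p \<in> Q" "seminorm_on X p"
    and diff: "\<And>u v. u \<in> X \<Longrightarrow> v \<in> X \<Longrightarrow> (\<lambda>\<phi>. u \<phi> - v \<phi>) \<in> X"
  obtains M where "M \<ge> 0" "\<And>t. t \<in> {0..T} \<Longrightarrow> p (f t) \<le> M"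
proof -
  note mem = time_cont_seminormD(1)[OF c]
  have nn: "0 \<le> p u" if "u \<in> X" for u using p(2) that by (auto simp: seminorm_on_def)
  have tri: "\<forall>u\<in>X. \<forall>v\<in>X. p (\<lambda>\<phi>. u \<phi> + v \<phi>) \<le> p u + p v" using p(2) by (simp add: seminorm_on_def)
  have "\<exists>d>0. \<forall>s\<in>{0..T}. dist s t < d \<longrightarrow> p (f s) \<le> p (f t) + 1" if t: "t \<in> {0..T}" for t
  proof -
    obtain d where d: "d > 0" "\<And>s. s \<in> {0..T} \<Longrightarrow> dist s t < d \<Longrightarrow> p (\<lambda>\<phi>. f s \<phi> - f t \<phi>) < 1"
      using time_cont_seminormD(2)[OF c t p, of 1] by auto
    have "p (f s) \<le> p (f t) + 1" if s: "s \<in> {0..T}" "dist s t < d" for s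
      using tri[rule_format, OF diff[OF mem[OF s(1)] mem[OF t]] mem[OF t]] d(2)[OF s] by simp
    with d(1) show ?thesis by blast
  qed
  then obtain d where d: "\<And>t. t \<in> {0..T} \<Longrightarrow> d t > 0" "\<And>s t. t \<in> {0..T} \<Longrightarrow> s \<in> {0..T} \<Longrightarrow> dist s t < d t \<Longrightarrow>
      p (f s) \<le> p (f t) + 1"
    by metis
  obtain D where D: "D \<subseteq> {0..T}" "finite D" "\<And>s. s \<in> {0..T} \<Longrightarrow> \<exists>t\<in>D. dist s t < d t"
    using compact_finite_cover_balls[of "{0..T}" d] d(1) by (metis compact_Icc)
  have nnD: "0 \<le> p (f t)" if "t \<in> D" for t using nn mem D that by blast
  have "p (f s) \<le> (\<Sum>t\<in>D. p (f t)) + 1" if s: "s \<in> {0..T}" for s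
  proof -
    obtain t where t: "t \<in> D" "dist s t < d t" using D(3)[OF s] by blast
    then have "p (f s) \<le> p (f t) + 1" using d(2) s D by blast
    also have "p (f t) \<le> (\<Sum>t\<in>D. p (f t))"
      using member_le_sum[of t D "\<lambda>t. p (f t)"] t D nnD by auto
    finally show ?thesis by simp
  qed
  moreover have "0 \<le> (\<Sum>t\<in>D. p (f t)) + 1" by (intro add_nonneg_nonneg sum_nonneg nnD) auto
  ultimately show ?thesis using that by blast
qed

lemma time_cont_seminormI:
  assumes "\<And>t. t \<in> {0..T} \<Longrightarrow> f t \<in> X"
    and diff: "\<And>u v. u \<in> X \<Longrightarrow> v \<in> X \<Longrightarrow> (\<lambda>\<phi>. u \<phi> - v \<phi>) \<in> X"
    and sn: "\<And>p. p \<in> Q \<Longrightarrow> seminorm_on X p"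
    and "\<And>t p e. t \<in> {0..T} \<Longrightarrow> p \<in> Q \<Longrightarrow> 0 < e \<Longrightarrow>
      \<exists>d>0. \<forall>s\<in>{0..T}. dist s t < d \<longrightarrow> p (\<lambda>\<phi>. f s \<phi> - f t \<phi>) < e"
  shows "time_cont T (seminorm_topology X Q) f"
  unfolding time_cont_def
proof (rule continuous_map_seminorm_topologyI[OF _ diff sn])
  fix t p and e :: real assume "t \<in> topspace (top_of_set {0..T})" "p \<in> Q" "0 < e"
  then show "\<exists>U. openin (top_of_set {0..T}) U \<and> t \<in> U \<and> (\<forall>s\<in>U. p (\<lambda>\<phi>. f s \<phi> - f t \<phi>) < e)"
    using assms(4)[of t p e] openin_top_of_set_nhd_iff[of t "{0..T}" "\<lambda>s. p (\<lambda>\<phi>. f s \<phi> - f t \<phi>) < e"] by simp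
qed (use assms(1) in auto)

lemma wt_neq_0 [simp]: "wt \<xi> \<noteq> 0"
  using wt_pos[of \<xi>] by linarith

lemma fourier_coeff_0 [simp]: "fourier_coeff (\<lambda>\<phi>. 0) \<xi> = 0"
  by (simp add: fourier_coeff_def)

lemma summable_on_tail:
  fixes g :: "'a \<Rightarrow> real"
  assumes s: "g summable_on UNIV" and g: "\<And>x. 0 \<le> g x" and e: "0 < e"
  obtains F where "finite F" "\<And>G. finite G \<Longrightarrow> G \<inter> F = {} \<Longrightarrow> sum g G \<le> e"
proof -
  obtain F where F: "finite F" "dist (sum g F) (infsum g UNIV) \<le> e"
    using infsum_finite_approximation[OF s e] by auto
  have "sum g G \<le> e" if G: "finite G" "G \<inter> F = {}" for G
  proof -
    have "sum g (G \<union> F) \<le> infsum g UNIV"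
      by (rule finite_sum_le_infsum[OF s]) (use F G g in auto)
    moreover have "sum g (G \<union> F) = sum g G + sum g F"
      by (intro sum.union_disjoint) (use F G in auto)
    ultimately show ?thesis using F(2) unfolding dist_real_def by linarith
  qed
  with F(1) show ?thesis by (rule that)
qed

section \<open>Sobolev spaces as weighted square summable coefficients\<close>

lemma sobolev_weight_eq: "sobolev_weight r u \<xi> = (norm (fourier_coeff u \<xi>) * wt \<xi> powr r)\<^sup>2"
  by (simp add: sobolev_weight_def wt_def power_mult_distrib power2_eq_square powr_add[symmetric])

lemma sobolev_weight_nonneg [simp]: "0 \<le> sobolev_weight r u \<xi>"
  by (simp add: sobolev_weight_eq)

lemma sum_sobolev_weight_eq:
  "(\<Sum>\<xi>\<in>F. sobolev_weight r u \<xi>) = (L2_set (\<lambda>\<xi>. norm (fourier_coeff u \<xi>) * wt \<xi> powr r) F)\<^sup>2"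
  by (simp add: sobolev_weight_eq L2_set_def sum_nonneg)

lemma sobolevD:
  assumes "u \<in> sobolev r"
  shows "u \<in> distributions" "sobolev_weight r u summable_on UNIV" "0 \<le> sobolev_norm r u"
    "finite F \<Longrightarrow> (\<Sum>\<xi>\<in>F. sobolev_weight r u \<xi>) \<le> (sobolev_norm r u)\<^sup>2"
proof -
  show 1: "u \<in> distributions" "sobolev_weight r u summable_on UNIV" using assms by (auto simp: sobolev_def)
  have 0: "0 \<le> infsum (sobolev_weight r u) UNIV" by (intro infsum_nonneg) simp
  then show "0 \<le> sobolev_norm r u" by (simp add: sobolev_norm_def)
  show "(\<Sum>\<xi>\<in>F. sobolev_weight r u \<xi>) \<le> (sobolev_norm r u)\<^sup>2" if "finite F"
    using finite_sum_le_infsum[OF 1(2) that] 0 by (simp add: sobolev_norm_def)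
qed

lemma sobolevI:
  assumes "u \<in> distributions" "0 \<le> B" "\<And>F. finite F \<Longrightarrow> (\<Sum>\<xi>\<in>F. sobolev_weight r u \<xi>) \<le> B\<^sup>2"
  shows "u \<in> sobolev r" "sobolev_norm r u \<le> B"
proof -
  have s: "sobolev_weight r u summable_on UNIV"
    by (rule nonneg_bdd_above_summable_on) (auto intro!: bdd_aboveI2[where M = "B\<^sup>2"] assms)
  then show "u \<in> sobolev r" using assms by (simp add: sobolev_def)
  have "infsum (sobolev_weight r u) UNIV \<le> B\<^sup>2"
    by (rule infsum_le_finite_sums[OF s]) (use assms in auto)
  then show "sobolev_norm r u \<le> B" using assms(2) by (simp add: sobolev_norm_def real_le_lsqrt)
qed

lemma sobolev_coeff_le:
  assumes "u \<in> sobolev r"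
  shows "norm (fourier_coeff u \<xi>) * wt \<xi> powr r \<le> sobolev_norm r u"
    and "norm (fourier_coeff u \<xi>) \<le> sobolev_norm r u * wt \<xi> powr (- r)"
proof -
  have "sobolev_weight r u \<xi> \<le> (sobolev_norm r u)\<^sup>2"
    using sobolevD(4)[OF assms, of "{\<xi>}"] by simp
  then show *: "norm (fourier_coeff u \<xi>) * wt \<xi> powr r \<le> sobolev_norm r u"
    unfolding sobolev_weight_eq by (rule power2_le_imp_le[OF _ sobolevD(3)[OF assms]])
  have "wt \<xi> powr r * wt \<xi> powr (- r) = 1" by (simp flip: powr_add)
  with mult_right_mono[OF *, of "wt \<xi> powr (- r)"]
  show "norm (fourier_coeff u \<xi>) \<le> sobolev_norm r u * wt \<xi> powr (- r)"
    by (simp add: mult.assoc)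
qed

text \<open>Minkowski's inequality for every finite set of frequencies, transferred to the full sums
  by \<open>sobolevI\<close>.\<close>

lemma
  assumes u: "u \<in> sobolev r" and v: "v \<in> sobolev r"
  shows sobolev_add: "(\<lambda>\<phi>. u \<phi> + v \<phi>) \<in> sobolev r"
    and sobolev_norm_triangle: "sobolev_norm r (\<lambda>\<phi>. u \<phi> + v \<phi>) \<le> sobolev_norm r u + sobolev_norm r v"
proof -
  have "(\<Sum>\<xi>\<in>F. sobolev_weight r (\<lambda>\<phi>. u \<phi> + v \<phi>) \<xi>) \<le> (sobolev_norm r u + sobolev_norm r v)\<^sup>2" if F: "finite F" for F
    unfolding sum_sobolev_weight_eq
  proof (rule power_mono)
    let ?a = "\<lambda>u \<xi>. norm (fourier_coeff u \<xi>) * wt \<xi> powr r"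
    have le: "L2_set (?a u) F \<le> sobolev_norm r u" if "u \<in> sobolev r" for u
      using sobolevD(3,4)[OF that] F unfolding sum_sobolev_weight_eq by (blast intro: power2_le_imp_le)
    have "L2_set (?a (\<lambda>\<phi>. u \<phi> + v \<phi>)) F \<le> L2_set (\<lambda>\<xi>. ?a u \<xi> + ?a v \<xi>) F"
      by (intro L2_set_mono) (auto simp: distrib_right[symmetric] intro!: mult_right_mono norm_triangle_ineq)
    also have "\<dots> \<le> L2_set (?a u) F + L2_set (?a v) F" by (rule L2_set_triangle_ineq)
    also have "\<dots> \<le> sobolev_norm r u + sobolev_norm r v" by (intro add_mono le u v)
    finally show "L2_set (?a (\<lambda>\<phi>. u \<phi> + v \<phi>)) F \<le> sobolev_norm r u + sobolev_norm r v" .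
  qed (rule L2_set_nonneg)
  note * = sobolevI[OF distributions_add[OF sobolevD(1)[OF u] sobolevD(1)[OF v]] _ this]
  show "(\<lambda>\<phi>. u \<phi> + v \<phi>) \<in> sobolev r" "sobolev_norm r (\<lambda>\<phi>. u \<phi> + v \<phi>) \<le> sobolev_norm r u + sobolev_norm r v"
    using sobolevD(3)[OF u] sobolevD(3)[OF v] by (auto intro!: *)
qed

lemma
  assumes u: "u \<in> sobolev r"
  shows sobolev_cmult: "(\<lambda>\<phi>. c * u \<phi>) \<in> sobolev r"
    and sobolev_norm_cmult: "sobolev_norm r (\<lambda>\<phi>. c * u \<phi>) = norm c * sobolev_norm r u"
proof -
  have eq: "sobolev_weight r (\<lambda>\<phi>. c * u \<phi>) = (\<lambda>\<xi>. (norm c)\<^sup>2 * sobolev_weight r u \<xi>)"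
    by (auto simp: sobolev_weight_eq norm_mult power_mult_distrib)
  show "(\<lambda>\<phi>. c * u \<phi>) \<in> sobolev r"
    using u by (auto simp: sobolev_def eq distributions_cmult intro: summable_on_cmult_right)
  show "sobolev_norm r (\<lambda>\<phi>. c * u \<phi>) = norm c * sobolev_norm r u"
    unfolding sobolev_norm_def eq by (simp add: infsum_cmult_right' real_sqrt_mult)
qed

lemma sobolev_diff: "u \<in> sobolev r \<Longrightarrow> v \<in> sobolev r \<Longrightarrow> (\<lambda>\<phi>. u \<phi> - v \<phi>) \<in> sobolev r"
  using sobolev_add[OF _ sobolev_cmult[of v r "-1"]] by simp

lemma seminorm_on_sobolev_norm: "seminorm_on (sobolev r) (sobolev_norm r)"
  unfolding seminorm_on_def
  by (auto simp: sobolevD sobolev_norm_triangle sobolev_norm_cmult)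

lemma topspace_sobolev_top [simp]: "topspace (sobolev_top r) = sobolev r"
  by (simp add: sobolev_top_def)

lemma time_cont_sobolevD:
  assumes c: "time_cont T (sobolev_top r) u" and t: "t \<in> {0..T}"
  shows "u t \<in> sobolev r"
    "0 < e \<Longrightarrow> \<exists>d>0. \<forall>s\<in>{0..T}. dist s t < d \<longrightarrow> sobolev_norm r (\<lambda>\<phi>. u s \<phi> - u t \<phi>) < e"
  using time_cont_seminormD[OF c[unfolded sobolev_top_def] t] seminorm_on_sobolev_norm by auto

lemma norm_add_squared_le: "(norm (a + b))\<^sup>2 \<le> 2 * (norm a)\<^sup>2 + 2 * (norm b)\<^sup>2"
  for a b :: "'a::real_normed_vector"
proof -
  have "(norm (a + b))\<^sup>2 \<le> (norm a + norm b)\<^sup>2" by (intro power_mono norm_triangle_ineq) auto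
  also have "\<dots> \<le> 2 * (norm a)\<^sup>2 + 2 * (norm b)\<^sup>2"
    using sum_squares_bound[of "norm a" "norm b"] by (simp add: power2_sum)
  finally show ?thesis .
qed

lemma sobolev_weight_add_le:
  "sobolev_weight r (\<lambda>\<phi>. u \<phi> + v \<phi>) \<xi> \<le> 2 * sobolev_weight r u \<xi> + 2 * sobolev_weight r v \<xi>"
  using mult_right_mono[OF norm_add_squared_le[of "fourier_coeff u \<xi>" "fourier_coeff v \<xi>"], of "(wt \<xi> powr r)\<^sup>2"]
  by (simp add: sobolev_weight_eq power_mult_distrib algebra_simps)

lemma sobolev_weight_diff_le:
  "sobolev_weight r (\<lambda>\<phi>. u \<phi> - v \<phi>) \<xi> \<le> 2 * sobolev_weight r u \<xi> + 2 * sobolev_weight r v \<xi>"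
  using mult_right_mono[OF norm_add_squared_le[of "fourier_coeff u \<xi>" "- fourier_coeff v \<xi>"], of "(wt \<xi> powr r)\<^sup>2"]
  by (simp add: sobolev_weight_eq power_mult_distrib algebra_simps)

text \<open>The image of the time interval is compact in the norm, so finitely many
  \<open>u t\<close> approximate all of them, and the union of their exceptional sets serves every
  time.\<close>

lemma time_cont_sobolev_tails:
  fixes u :: "real \<Rightarrow> 'n::finite functional"
  assumes c: "time_cont T (sobolev_top r) u" and e: "0 < e"
  obtains F where "finite F" "\<And>t G. t \<in> {0..T} \<Longrightarrow> finite G \<Longrightarrow> G \<inter> F = {} \<Longrightarrow>
    (\<Sum>\<xi>\<in>G. sobolev_weight r (u t) \<xi>) \<le> e"
proof -
  \<comment> \<open>A square of a sum is at most twice the sum of the squares, so an approximation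
    error with square \<open>e / 4\<close> and a tail \<open>e / 4\<close> add up to
    \<open>e\<close>.\<close>
  define e' where "e' = sqrt (e / 4)"
  have e': "e' > 0" "e'\<^sup>2 = e / 4" using e by (auto simp: e'_def)
  have "\<exists>d>0. \<forall>s\<in>{0..T}. dist s t < d \<longrightarrow> sobolev_norm r (\<lambda>\<phi>. u s \<phi> - u t \<phi>) < e'" if "t \<in> {0..T}" for t
    using time_cont_sobolevD(2)[OF c that e'(1)] .
  then obtain d where d: "\<And>t. t \<in> {0..T} \<Longrightarrow> d t > 0"
    "\<And>s t. t \<in> {0..T} \<Longrightarrow> s \<in> {0..T} \<Longrightarrow> dist s t < d t \<Longrightarrow> sobolev_norm r (\<lambda>\<phi>. u s \<phi> - u t \<phi>) < e'"
    by metis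
  have "\<exists>F. finite F \<and> (\<forall>G. finite G \<longrightarrow> G \<inter> F = {} \<longrightarrow> (\<Sum>\<xi>\<in>G. sobolev_weight r (u t) \<xi>) \<le> e / 4)"
    if t: "t \<in> {0..T}" for t
  proof -
    have s: "sobolev_weight r (u t) summable_on UNIV" using sobolevD time_cont_sobolevD(1)[OF c t] by blast
    show ?thesis
      using summable_on_tail[OF s sobolev_weight_nonneg, of "e / 4"] e by (metis zero_less_divide_iff zero_less_numeral)
  qed
  then obtain H where H: "\<And>t. t \<in> {0..T} \<Longrightarrow> finite (H t)"
    "\<And>t G. t \<in> {0..T} \<Longrightarrow> finite G \<Longrightarrow> G \<inter> H t = {} \<Longrightarrow> (\<Sum>\<xi>\<in>G. sobolev_weight r (u t) \<xi>) \<le> e / 4"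
    by metis
  obtain D where D: "D \<subseteq> {0..T}" "finite D" "\<And>s. s \<in> {0..T} \<Longrightarrow> \<exists>t\<in>D. dist s t < d t"
    using compact_finite_cover_balls[of "{0..T}" d] d(1) by (metis compact_Icc)
  have "(\<Sum>\<xi>\<in>G. sobolev_weight r (u s) \<xi>) \<le> e" if s: "s \<in> {0..T}" and G: "finite G" "G \<inter> (\<Union>t\<in>D. H t) = {}" for s G
  proof -
    obtain t where t: "t \<in> D" "dist s t < d t" using D(3)[OF s] by blast
    then have t': "t \<in> {0..T}" using D by blast
    have "G \<inter> H t = {}" using G(2) t(1) by blast
    note ub = H(2)[OF t' G(1) this]
    have us: "u s = (\<lambda>\<phi>. (u s \<phi> - u t \<phi>) + u t \<phi>)" by auto
    have "(\<Sum>\<xi>\<in>G. sobolev_weight r (u s) \<xi>) \<le>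
        (\<Sum>\<xi>\<in>G. 2 * sobolev_weight r (\<lambda>\<phi>. u s \<phi> - u t \<phi>) \<xi> + 2 * sobolev_weight r (u t) \<xi>)"
      by (subst us) (intro sum_mono sobolev_weight_add_le)
    also have "\<dots> = 2 * (\<Sum>\<xi>\<in>G. sobolev_weight r (\<lambda>\<phi>. u s \<phi> - u t \<phi>) \<xi>) + 2 * (\<Sum>\<xi>\<in>G. sobolev_weight r (u t) \<xi>)"
      by (simp add: sum.distrib sum_distrib_left)
    also have "(\<Sum>\<xi>\<in>G. sobolev_weight r (\<lambda>\<phi>. u s \<phi> - u t \<phi>) \<xi>) \<le> (sobolev_norm r (\<lambda>\<phi>. u s \<phi> - u t \<phi>))\<^sup>2"
      by (intro sobolevD(4) sobolev_diff time_cont_sobolevD(1)[OF c] s t' G)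
    also have "\<dots> \<le> e'\<^sup>2"
      using d(2)[OF t' s t(2)] by (intro power_mono less_imp_le sobolevD(3) sobolev_diff time_cont_sobolevD(1)[OF c] s t')
    finally show ?thesis using ub e'(2) by simp
  qed
  moreover have "finite (\<Union>t\<in>D. H t)" using D H by blast
  ultimately show ?thesis using that by blast
qed

text \<open>The converse of \<open>time_cont_sobolev_tails\<close>: outside a finite set of
  frequencies the norm of a difference is small uniformly in time, and on the finite set continuity
  of the single coefficients suffices.\<close>

lemma time_cont_sobolevI:
  fixes u :: "real \<Rightarrow> 'n::finite functional"
  assumes dist: "\<And>t. t \<in> {0..T} \<Longrightarrow> u t \<in> distributions"
    and cont: "\<And>\<xi>. continuous_on {0..T} (\<lambda>t. fourier_coeff (u t) \<xi>)"
    and tails: "\<And>e. 0 < e \<Longrightarrow> \<exists>F. finite F \<and> (\<forall>t G. t \<in> {0..T} \<longrightarrow> finite G \<longrightarrow> G \<inter> F = {} \<longrightarrow>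
      (\<Sum>\<xi>\<in>G. sobolev_weight r (u t) \<xi>) \<le> e)"
  shows "time_cont T (sobolev_top r) u"
proof -
  have mem: "u t \<in> sobolev r" if t: "t \<in> {0..T}" for t
  proof -
    obtain F where F: "finite F" "\<And>G. finite G \<Longrightarrow> G \<inter> F = {} \<Longrightarrow> (\<Sum>\<xi>\<in>G. sobolev_weight r (u t) \<xi>) \<le> 1"
      using tails[of 1] t by (metis zero_less_one)
    define B where "B = sqrt (1 + (\<Sum>\<xi>\<in>F. sobolev_weight r (u t) \<xi>))"
    have B: "B \<ge> 0" "B\<^sup>2 = 1 + (\<Sum>\<xi>\<in>F. sobolev_weight r (u t) \<xi>)"
      unfolding B_def by (auto simp: add_nonneg_nonneg sum_nonneg)
    show ?thesis
    proof (rule sobolevI(1)[OF dist[OF t] B(1)])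
      fix G :: "(int^'n) set" assume G: "finite G"
      have "(\<Sum>\<xi>\<in>G. sobolev_weight r (u t) \<xi>) \<le> (\<Sum>\<xi>\<in>(G - F) \<union> F. sobolev_weight r (u t) \<xi>)"
        by (intro sum_mono2) (use F G in auto)
      also have "\<dots> = (\<Sum>\<xi>\<in>G - F. sobolev_weight r (u t) \<xi>) + (\<Sum>\<xi>\<in>F. sobolev_weight r (u t) \<xi>)"
        by (intro sum.union_disjoint) (use F G in auto)
      also have "\<dots> \<le> B\<^sup>2" unfolding B(2) using F(2)[of "G - F"] G by auto
      finally show "(\<Sum>\<xi>\<in>G. sobolev_weight r (u t) \<xi>) \<le> B\<^sup>2" .
    qed
  qed
  show ?thesis
    unfolding sobolev_top_def
  proof (rule time_cont_seminormI[OF mem sobolev_diff])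
    fix t p and e :: real assume t: "t \<in> {0..T}" and p: "p \<in> {sobolev_norm r :: 'n functional \<Rightarrow> real}" and e: "0 < e"
    \<comment> \<open>The two tails contribute at most \<open>4 * e'\<close> and the finite part
      \<open>e'\<close>; the total, 5/16 of the square of \<open>e\<close>, lies below the square of
      \<open>3/4 * e\<close>, which leaves room for the strict inequality.\<close>
    define e' where "e' = e\<^sup>2 / 16"
    have e': "e' > 0" using e by (simp add: e'_def)
    obtain F where F: "finite F" "\<And>s G. s \<in> {0..T} \<Longrightarrow> finite G \<Longrightarrow> G \<inter> F = {} \<Longrightarrow>
      (\<Sum>\<xi>\<in>G. sobolev_weight r (u s) \<xi>) \<le> e'" using tails[OF e'] by blast
    have "continuous_on {0..T} (\<lambda>s. \<Sum>\<xi>\<in>F. sobolev_weight r (\<lambda>\<phi>. u s \<phi> - u t \<phi>) \<xi>)"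
      unfolding sobolev_weight_eq by (simp, intro continuous_intros cont)
    then obtain d where d: "d > 0" "\<And>s. s \<in> {0..T} \<Longrightarrow> dist s t < d \<Longrightarrow>
       dist (\<Sum>\<xi>\<in>F. sobolev_weight r (\<lambda>\<phi>. u s \<phi> - u t \<phi>) \<xi>) (\<Sum>\<xi>\<in>F. sobolev_weight r (\<lambda>\<phi>. u t \<phi> - u t \<phi>) \<xi>) < e'"
      using t e' unfolding continuous_on_iff by blast
    have "sobolev_norm r (\<lambda>\<phi>. u s \<phi> - u t \<phi>) < e" if s: "s \<in> {0..T}" "dist s t < d" for s
    proof -
      have "(\<Sum>\<xi>\<in>F. sobolev_weight r (\<lambda>\<phi>. u t \<phi> - u t \<phi>) \<xi>) = 0"
        unfolding sobolev_weight_eq by simp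
      then have dF: "(\<Sum>\<xi>\<in>F. sobolev_weight r (\<lambda>\<phi>. u s \<phi> - u t \<phi>) \<xi>) \<le> e'"
        using d(2)[OF s] by (simp add: dist_real_def)
      have "sobolev_norm r (\<lambda>\<phi>. u s \<phi> - u t \<phi>) \<le> 3/4 * e"
      proof (rule sobolevI(2))
        show "(\<lambda>\<phi>. u s \<phi> - u t \<phi>) \<in> distributions" by (intro distributions_diff dist s t)
        show "0 \<le> 3/4 * e" using e by simp
        fix G :: "(int^'n) set" assume G: "finite G"
        let ?w = "sobolev_weight r (\<lambda>\<phi>. u s \<phi> - u t \<phi>)"
        have "sum ?w G \<le> sum ?w ((G - F) \<union> F)"
          by (intro sum_mono2) (use F G in auto)
        also have "\<dots> = sum ?w (G - F) + sum ?w F"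
          by (intro sum.union_disjoint) (use F G in auto)
        also have "sum ?w (G - F) \<le> (\<Sum>\<xi>\<in>G-F. 2 * sobolev_weight r (u s) \<xi> + 2 * sobolev_weight r (u t) \<xi>)"
          by (intro sum_mono sobolev_weight_diff_le)
        also have "\<dots> = 2 * (\<Sum>\<xi>\<in>G-F. sobolev_weight r (u s) \<xi>) + 2 * (\<Sum>\<xi>\<in>G-F. sobolev_weight r (u t) \<xi>)"
          by (simp add: sum.distrib sum_distrib_left)
        finally have "sum ?w G \<le> 5 * e'"
          using F(2)[OF s(1), of "G - F"] F(2)[OF t, of "G - F"] G dF Int_Diff_disjoint by fastforce
        also have "\<dots> \<le> (3/4 * e)\<^sup>2" by (simp add: e'_def power_mult_distrib power2_eq_square)
        finally show "sum ?w G \<le> (3/4 * e)\<^sup>2" .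
      qed
      then show ?thesis using e by simp
    qed
    then show "\<exists>d>0. \<forall>s\<in>{0..T}. dist s t < d \<longrightarrow> p (\<lambda>\<phi>. u s \<phi> - u t \<phi>) < e"
      using d(1) p by blast
  qed (use seminorm_on_sobolev_norm in auto)
qed

section \<open>Distribution-valued functions of time with a uniform order\<close>

lemma sobolev_pairing_bound:
  "\<exists>C\<ge>0. \<exists>k. \<forall>w\<in>sobolev \<rho>. \<forall>\<psi>\<in>torus_smooth. \<forall>B.
    (\<forall>js x. length js \<le> k \<longrightarrow> norm (partial_derivs js \<psi> (x::real^'n::finite)) \<le> B) \<longrightarrow>
    norm (w \<psi>) \<le> C * sobolev_norm \<rho> w * B"
proof (intro exI conjI ballI allI impI)
  define k where "k = nat \<lceil>\<bar>\<rho>\<bar>\<rceil>"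
  let ?K = "(1 + real CARD('n)) ^ Suc (k + 2 * CARD('n)) * infsum (\<lambda>\<xi>::int^'n. 1 / wt \<xi> ^ (2 * CARD('n))) UNIV"
  show "0 \<le> ?K" by (intro mult_nonneg_nonneg infsum_nonneg) auto
  fix w :: "'n functional" and \<psi> :: "real^'n \<Rightarrow> complex" and B
  assume w: "w \<in> sobolev \<rho>" and \<psi>: "\<psi> \<in> torus_smooth"
    and B: "\<forall>js x. length js \<le> k + 2 * CARD('n) \<longrightarrow> norm (partial_derivs js \<psi> x) \<le> B"
  have "norm (fourier_coeff w \<xi>) \<le> sobolev_norm \<rho> w * wt \<xi> ^ k" for \<xi>
  proof -
    have "wt \<xi> powr (-\<rho>) \<le> wt \<xi> powr (real k)"
      unfolding k_def using wt_ge_1[of \<xi>] by (intro powr_mono) linarith+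
    then have "wt \<xi> powr (-\<rho>) \<le> wt \<xi> ^ k" by (simp add: powr_realpow)
    then show ?thesis
      using sobolev_coeff_le(2)[OF w, of \<xi>] sobolevD(3)[OF w] by (meson mult_left_mono order_trans)
  qed
  from pairing_bound(2)[OF this sobolevD(3)[OF w] \<psi> B[rule_format]]
  show "norm (w \<psi>) \<le> ?K * sobolev_norm \<rho> w * B"
    using infsumI[OF distr_has_sum[OF sobolevD(1)[OF w] \<psi>]] by (simp add: mult_ac)
qed

text \<open>Weak continuity with one order \<open>k\<close> and one constant for all times. In
  contrast to continuity into a fixed \<open>sobolev \<rho>\<close>, this class is stable under
  derivatives in x without any bookkeeping of \<rho>, and it can be integrated in time within the
  distributions.\<close>

definition cont_family :: "real \<Rightarrow> (real \<Rightarrow> 'n::finite functional) \<Rightarrow> bool" where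
  "cont_family T w \<longleftrightarrow> (\<forall>t\<in>{0..T}. w t \<in> distributions) \<and>
     (\<forall>\<psi>. continuous_on {0..T} (\<lambda>t. w t \<psi>)) \<and>
     (\<exists>C\<ge>0. \<exists>k. \<forall>t\<in>{0..T}. \<forall>\<psi>\<in>torus_smooth. \<forall>B.
        (\<forall>js x. length js \<le> k \<longrightarrow> norm (partial_derivs js \<psi> x) \<le> B) \<longrightarrow> norm (w t \<psi>) \<le> C * B)"

lemma cont_familyD:
  assumes "cont_family T w"
  shows "t \<in> {0..T} \<Longrightarrow> w t \<in> distributions" "continuous_on {0..T} (\<lambda>t. w t \<psi>)"
  using assms by (auto simp: cont_family_def)

lemma cont_family_bound:
  assumes "cont_family T w"
  obtains C k where "C \<ge> 0" "\<And>t \<psi> B. t \<in> {0..T} \<Longrightarrow> \<psi> \<in> torus_smooth \<Longrightarrow>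
    (\<And>js x. length js \<le> k \<Longrightarrow> norm (partial_derivs js \<psi> x) \<le> B) \<Longrightarrow> norm (w t \<psi>) \<le> C * B"
  using assms unfolding cont_family_def by blast

lemma cont_familyI:
  assumes "\<And>t. t \<in> {0..T} \<Longrightarrow> w t \<in> distributions" "\<And>\<psi>. continuous_on {0..T} (\<lambda>t. w t \<psi>)" "C \<ge> 0"
    "\<And>t \<psi> B. t \<in> {0..T} \<Longrightarrow> \<psi> \<in> torus_smooth \<Longrightarrow>
    (\<And>js x. length js \<le> k \<Longrightarrow> norm (partial_derivs js \<psi> x) \<le> B) \<Longrightarrow> norm (w t \<psi>) \<le> C * B"
  shows "cont_family T w"
  unfolding cont_family_def using assms by blast

lemma cont_family_time_cont:
  fixes u :: "real \<Rightarrow> 'n::finite functional"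
  assumes c: "time_cont T (sobolev_top \<rho>) u"
  shows "cont_family T u"
proof -
  obtain C k where C: "C \<ge> 0" "\<And>w \<psi> B. w \<in> sobolev \<rho> \<Longrightarrow> \<psi> \<in> torus_smooth \<Longrightarrow>
    (\<And>js x. length js \<le> k \<Longrightarrow> norm (partial_derivs js \<psi> (x::real^'n)) \<le> B) \<Longrightarrow>
    norm (w \<psi>) \<le> C * sobolev_norm \<rho> w * B"
    using sobolev_pairing_bound[of \<rho>, where ?'n = 'n] by blast
  note mem = time_cont_sobolevD(1)[OF c]
  obtain M where M: "M \<ge> 0" "\<And>t. t \<in> {0..T} \<Longrightarrow> sobolev_norm \<rho> (u t) \<le> M"
    using time_cont_seminorm_bounded[OF c[unfolded sobolev_top_def] _ seminorm_on_sobolev_norm sobolev_diff] by blast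
  show ?thesis
  proof (rule cont_familyI[where C = "C * M" and k = k])
    show "u t \<in> distributions" if "t \<in> {0..T}" for t using mem[OF that] sobolevD by blast
    show "0 \<le> C * M" using C M by simp
    show "norm (u t \<psi>) \<le> C * M * B" if "t \<in> {0..T}" "\<psi> \<in> torus_smooth"
      "\<And>js x. length js \<le> k \<Longrightarrow> norm (partial_derivs js \<psi> x) \<le> B" for t \<psi> B
    proof -
      have "0 \<le> B" using order_trans[OF norm_ge_zero that(3)[of "[]" 0]] by simp
      then have "C * sobolev_norm \<rho> (u t) * B \<le> C * M * B"
        using C(1) M(2)[OF that(1)] by (intro mult_right_mono mult_left_mono)
      then show ?thesis using C(2)[OF mem[OF that(1)] that(2,3)] by linarith
    qed
    show "continuous_on {0..T} (\<lambda>t. u t \<psi>)" for \<psi>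
    proof (cases "\<psi> \<in> torus_smooth")
      case False
      then have "u t \<psi> = 0" if "t \<in> {0..T}" for t
        using distr_not_smooth[OF sobolevD(1)[OF mem[OF that]]] by blast
      then show ?thesis using continuous_on_cong[of "{0..T}" "{0..T}" "\<lambda>t. u t \<psi>" "\<lambda>_. 0"] by auto
    next
      case True
      obtain B where B: "\<And>js x. length js \<le> k \<Longrightarrow> norm (partial_derivs js \<psi> x) \<le> B"
        using torus_smooth_derivs_bounded[OF True] by blast
      have B0: "0 \<le> B" using order_trans[OF norm_ge_zero B[of "[]" 0]] by simp
      show ?thesis
        unfolding continuous_on_iff
      proof (intro ballI allI impI)
        fix t and e :: real assume t: "t \<in> {0..T}" and e: "0 < e"
        have "0 < e / (C * B + 1)" using e C B0 by (simp add: add_nonneg_pos)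
        from time_cont_sobolevD(2)[OF c t this] obtain d where d: "d > 0"
          "\<And>s. s \<in> {0..T} \<Longrightarrow> dist s t < d \<Longrightarrow> sobolev_norm \<rho> (\<lambda>\<phi>. u s \<phi> - u t \<phi>) < e / (C * B + 1)" by blast
        have "dist (u s \<psi>) (u t \<psi>) < e" if s: "s \<in> {0..T}" "dist s t < d" for s
        proof -
          let ?n = "sobolev_norm \<rho> (\<lambda>\<phi>. u s \<phi> - u t \<phi>)"
          have D: "(\<lambda>\<phi>. u s \<phi> - u t \<phi>) \<in> sobolev \<rho>" by (intro sobolev_diff mem s t)
          have "dist (u s \<psi>) (u t \<psi>) \<le> C * ?n * B"
            unfolding dist_norm by (rule C(2)[OF D True B])
          also have "\<dots> \<le> (C * B + 1) * ?n" using sobolevD(3)[OF D] by (simp add: algebra_simps)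
          also have "\<dots> < e"
          proof -
            have "0 < C * B + 1" using C(1) B0 by (simp add: add_nonneg_pos)
            then show ?thesis using d(2)[OF s] by (simp add: pos_less_divide_eq mult.commute)
          qed
          finally show ?thesis .
        qed
        with d(1) show "\<exists>d>0. \<forall>s\<in>{0..T}. dist s t < d \<longrightarrow> dist (u s \<psi>) (u t \<psi>) < e" by blast
      qed
    qed
  qed
qed

lemma cont_family_add:
  assumes u: "cont_family T u" and v: "cont_family T v"
  shows "cont_family T (\<lambda>t \<psi>. u t \<psi> + v t \<psi>)"
proof -
  obtain C k where C: "C \<ge> 0" "\<And>t \<phi> B. t \<in> {0..T} \<Longrightarrow> \<phi> \<in> torus_smooth \<Longrightarrow>
    (\<And>js x. length js \<le> k \<Longrightarrow> norm (partial_derivs js \<phi> x) \<le> B) \<Longrightarrow> norm (u t \<phi>) \<le> C * B"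
    using cont_family_bound[OF u] by blast
  obtain D l where D: "D \<ge> 0" "\<And>t \<phi> B. t \<in> {0..T} \<Longrightarrow> \<phi> \<in> torus_smooth \<Longrightarrow>
    (\<And>js x. length js \<le> l \<Longrightarrow> norm (partial_derivs js \<phi> x) \<le> B) \<Longrightarrow> norm (v t \<phi>) \<le> D * B"
    using cont_family_bound[OF v] by blast
  show ?thesis
  proof (rule cont_familyI[where C = "C + D" and k = "max k l"])
    show "norm (u t \<phi> + v t \<phi>) \<le> (C + D) * B"
      if "t \<in> {0..T}" "\<phi> \<in> torus_smooth" "\<And>js x. length js \<le> max k l \<Longrightarrow> norm (partial_derivs js \<phi> x) \<le> B" for t \<phi> B
      using C(2)[OF that(1,2), of B] D(2)[OF that(1,2), of B] that(3) norm_triangle_ineq[of "u t \<phi>" "v t \<phi>"]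
      by (simp add: distrib_right)
  qed (use C D in \<open>auto intro!: continuous_intros distributions_add cont_familyD[OF u] cont_familyD[OF v]\<close>)
qed

lemma cont_family_scale:
  assumes u: "cont_family T u" and a: "continuous_on {0..T} a"
  shows "cont_family T (\<lambda>t \<psi>. a t * u t \<psi>)"
proof -
  obtain C k where C: "C \<ge> 0" "\<And>t \<phi> B. t \<in> {0..T} \<Longrightarrow> \<phi> \<in> torus_smooth \<Longrightarrow>
    (\<And>js x. length js \<le> k \<Longrightarrow> norm (partial_derivs js \<phi> x) \<le> B) \<Longrightarrow> norm (u t \<phi>) \<le> C * B"
    using cont_family_bound[OF u] by blast
  have "bounded (a ` {0..T})" by (intro compact_imp_bounded compact_continuous_image a compact_Icc)
  then obtain M where M: "M > 0" "\<And>t. t \<in> {0..T} \<Longrightarrow> norm (a t) \<le> M"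
    unfolding bounded_pos by auto
  show ?thesis
  proof (rule cont_familyI[where C = "M * C" and k = k])
    show "norm (a t * u t \<phi>) \<le> M * C * B"
      if "t \<in> {0..T}" "\<phi> \<in> torus_smooth" "\<And>js x. length js \<le> k \<Longrightarrow> norm (partial_derivs js \<phi> x) \<le> B" for t \<phi> B
      using mult_mono[OF M(2)[OF that(1)] C(2)[OF that]] M by (simp add: norm_mult mult.assoc)
  qed (use C M in \<open>auto intro!: continuous_intros a distributions_cmult cont_familyD[OF u]\<close>)
qed

lemma cont_family_zero: "cont_family T (\<lambda>t \<psi>. 0)"
proof (rule cont_familyI[where C = 0 and k = 0])
  show "(\<lambda>\<psi>. 0) \<in> (distributions :: 'a functional set)"
    by (auto simp: distributions_def intro!: exI[of _ 0])
qed auto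

lemma cont_family_sum:
  "(\<And>i. i \<in> S \<Longrightarrow> cont_family T (w i)) \<Longrightarrow> cont_family T (\<lambda>t \<psi>. \<Sum>i\<in>S. w i t \<psi>)"
  by (induction S rule: infinite_finite_induct) (auto intro: cont_family_zero cont_family_add)

lemma cont_family_partial:
  assumes u: "cont_family T u"
  shows "cont_family T (\<lambda>t. distr_partial j (u t))"
proof -
  obtain C k where C: "C \<ge> 0" "\<And>t \<phi> B. t \<in> {0..T} \<Longrightarrow> \<phi> \<in> torus_smooth \<Longrightarrow>
    (\<And>js x. length js \<le> k \<Longrightarrow> norm (partial_derivs js \<phi> x) \<le> B) \<Longrightarrow> norm (u t \<phi>) \<le> C * B"
    using cont_family_bound[OF u] by blast
  show ?thesis
  proof (rule cont_familyI[where C = C and k = "Suc k"])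
    show "norm (distr_partial j (u t) \<phi>) \<le> C * B"
      if "t \<in> {0..T}" "\<phi> \<in> torus_smooth" "\<And>js x. length js \<le> Suc k \<Longrightarrow> norm (partial_derivs js \<phi> x) \<le> B" for t \<phi> B
    proof -
      have "norm (u t (partial_deriv j \<phi>)) \<le> C * B"
      proof (intro C(2) torus_smooth_partial_deriv that)
        fix js :: "'a list" and x assume "length js \<le> k"
        then show "norm (partial_derivs js (partial_deriv j \<phi>) x) \<le> B"
          using that(3)[of "js @ [j]" x] by (simp add: partial_derivs_append partial_derivs_Cons)
      qed
      then show ?thesis using that by (simp add: distr_partial_def)
    qed
    show "continuous_on {0..T} (\<lambda>t. distr_partial j (u t) \<psi>)" for \<psi>
      by (cases "\<psi> \<in> torus_smooth") (auto simp: distr_partial_def intro!: continuous_intros cont_familyD[OF u])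
  qed (use C in \<open>auto intro!: distr_partial_in cont_familyD[OF u]\<close>)
qed

lemma distr_integral_in:
  assumes w: "cont_family T w" and T: "T \<ge> 0"
  shows "distr_integral T w \<in> distributions"
proof -
  obtain C k where C: "C \<ge> 0" "\<And>t \<phi> B. t \<in> {0..T} \<Longrightarrow> \<phi> \<in> torus_smooth \<Longrightarrow>
    (\<And>js x. length js \<le> k \<Longrightarrow> norm (partial_derivs js \<phi> x) \<le> B) \<Longrightarrow> norm (w t \<phi>) \<le> C * B"
    using cont_family_bound[OF w] by blast
  have int: "(\<lambda>t. w t \<psi>) integrable_on {0..T}" for \<psi>
    by (intro integrable_continuous_real cont_familyD[OF w])
  have cong: "integral {0..T} (\<lambda>t. w t \<phi>) = integral {0..T} g" if "\<And>t. t \<in> {0..T} \<Longrightarrow> w t \<phi> = g t" for \<phi> g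
    using that by (rule integral_cong)
  have "norm (distr_integral T w \<phi>) \<le> (C * T) * B"
    if *: "\<phi> \<in> torus_smooth" "\<forall>js x. length js \<le> k \<longrightarrow> norm (partial_derivs js \<phi> x) \<le> B" for \<phi> B
  proof -
    have "0 \<le> B" using order_trans[OF norm_ge_zero *(2)[rule_format, of "[]" 0]] by simp
    then have "norm (integral (cbox 0 T) (\<lambda>t. w t \<phi>)) \<le> (C * B) * measure lborel (cbox 0 T)"
      using C * int by (intro has_integral_bound[OF _ integrable_integral]) auto
    then show ?thesis using T by (simp add: distr_integral_def mult_ac)
  qed
  then have "\<exists>C k. \<forall>\<phi>\<in>torus_smooth. \<forall>B. (\<forall>js x. length js \<le> k \<longrightarrow> norm (partial_derivs js \<phi> x) \<le> B)
        \<longrightarrow> norm (distr_integral T w \<phi>) \<le> C * B" by blast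
  moreover have "distr_integral T w (\<lambda>x. \<phi> x + \<psi> x) = distr_integral T w \<phi> + distr_integral T w \<psi>"
    if "\<phi> \<in> torus_smooth" "\<psi> \<in> torus_smooth" for \<phi> \<psi>
    unfolding distr_integral_def integral_add[OF int int, symmetric]
    by (rule cong) (use distr_add[OF cont_familyD(1)[OF w]] that in auto)
  moreover have "distr_integral T w (\<lambda>x. c * \<phi> x) = c * distr_integral T w \<phi>" if "\<phi> \<in> torus_smooth" for \<phi> c
    unfolding distr_integral_def integral_mult_right[symmetric]
    by (rule cong) (use distr_cmult[OF cont_familyD(1)[OF w]] that in auto)
  moreover have "distr_integral T w \<phi> = 0" if "\<phi> \<notin> torus_smooth" for \<phi>
    unfolding distr_integral_def
    by (subst cong[of \<phi> "\<lambda>_. 0"]) (use distr_not_smooth[OF cont_familyD(1)[OF w]] that in auto)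
  ultimately show ?thesis by (auto simp: distributions_def)
qed

section \<open>Smooth and Gevrey regularity\<close>

lemma sobolev_rapid:
  assumes "\<And>r. u \<in> sobolev r"
  shows "rapid (fourier_coeff u)"
  unfolding rapid_def
proof
  fix M
  have "norm (fourier_coeff u \<xi>) * wt \<xi> ^ M \<le> sobolev_norm (real M) u" for \<xi>
    using sobolev_coeff_le(1)[OF assms, of \<xi> "real M"] by (simp add: powr_realpow)
  then show "\<exists>B. \<forall>\<xi>. norm (fourier_coeff u \<xi>) * wt \<xi> ^ M \<le> B" by blast
qed

lemma rapid_sobolev:
  fixes u :: "'n::finite functional"
  assumes u: "u \<in> distributions" and c: "rapid (fourier_coeff u)"
  shows "u \<in> sobolev r"
proof -
  \<comment> \<open>Besides the weight of order \<open>r\<close>, N further powers are taken; after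
    squaring they give the exponent that \<open>summable_on_wt_bound\<close> requires.\<close>
  define M where "M = nat \<lceil>\<bar>r\<bar>\<rceil> + CARD('n)"
  obtain B where B: "norm (fourier_coeff u \<xi>) * wt \<xi> ^ M \<le> B" for \<xi>
    using c unfolding rapid_def by blast
  have "sobolev_weight r u \<xi> * wt \<xi> ^ (2 * CARD('n)) \<le> B\<^sup>2" for \<xi>
  proof -
    have "wt \<xi> powr r * wt \<xi> ^ CARD('n) = wt \<xi> powr (r + real CARD('n))"
      by (simp add: powr_add powr_realpow)
    also have "\<dots> \<le> wt \<xi> powr (real M)"
      unfolding M_def using wt_ge_1[of \<xi>] by (intro powr_mono) linarith+
    finally have "wt \<xi> powr r * wt \<xi> ^ CARD('n) \<le> wt \<xi> ^ M" by (simp add: powr_realpow)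
    then have "norm (fourier_coeff u \<xi>) * (wt \<xi> powr r * wt \<xi> ^ CARD('n)) \<le> norm (fourier_coeff u \<xi>) * wt \<xi> ^ M"
      by (intro mult_left_mono) auto
    also note B
    finally have "(norm (fourier_coeff u \<xi>) * (wt \<xi> powr r * wt \<xi> ^ CARD('n)))\<^sup>2 \<le> B\<^sup>2"
      by (intro power_mono) auto
    then show ?thesis
      by (simp add: sobolev_weight_eq power_mult_distrib power_even_eq mult.assoc)
  qed
  then have "sobolev_weight r u summable_on UNIV"
    by (intro summable_on_wt_bound(1)[where B = "B\<^sup>2"]) auto
  with u show ?thesis by (simp add: sobolev_def)
qed

lemma Cinf_iff: "u \<in> Cinf \<longleftrightarrow> u \<in> distributions \<and> rapid (fourier_coeff u)"
  using sobolev_rapid[of u] rapid_sobolev[of u] sobolevD(1)[of u 0] by (auto simp: Cinf_def)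

lemma topspace_Cinf_top [simp]: "topspace Cinf_top = Cinf"
proof -
  have "Cinf \<subseteq> Cinf \<inter> topspace (sobolev_top 0)" by (auto simp: Cinf_def)
  moreover have "Cinf \<inter> topspace (sobolev_top 0) \<in> {Cinf \<inter> U |r U. openin (sobolev_top r) U}"
    by blast
  ultimately show ?thesis unfolding Cinf_top_def topology_generated_by_topspace by blast
qed

lemma time_cont_CinfI:
  fixes f :: "real \<Rightarrow> 'n::finite functional"
  assumes "\<And>r. time_cont T (sobolev_top r) f"
  shows "time_cont T Cinf_top f"
  unfolding time_cont_def Cinf_top_def
proof (rule continuous_on_generated_topo)
  have mem: "f t \<in> Cinf" if "t \<in> {0..T}" for t
    using time_cont_sobolevD(1)[OF assms that] by (simp add: Cinf_def)
  fix V :: "'n functional set" assume "V \<in> {Cinf \<inter> U |r U. openin (sobolev_top r) U}"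
  then obtain r U where V: "V = Cinf \<inter> U" "openin (sobolev_top r) U" by blast
  have "openin (top_of_set {0..T}) {t \<in> topspace (top_of_set {0..T}). f t \<in> U}"
    using assms[of r] V(2) unfolding time_cont_def by (rule openin_continuous_map_preimage)
  moreover have "f -` V \<inter> topspace (top_of_set {0..T}) = {t \<in> topspace (top_of_set {0..T}). f t \<in> U}"
    using mem V by auto
  ultimately show "openin (top_of_set {0..T}) (f -` V \<inter> topspace (top_of_set {0..T}))" by simp
next
  have "f t \<in> Cinf" if "t \<in> {0..T}" for t
    using time_cont_sobolevD(1)[OF assms that] by (simp add: Cinf_def)
  then have "f ` topspace (top_of_set {0..T}) \<subseteq> Cinf" by auto
  also have "(Cinf :: 'n functional set) = topspace Cinf_top" by simp
  finally show "f ` topspace (top_of_set {0..T}) \<subseteq> \<Union> {Cinf \<inter> U |r U. openin (sobolev_top r) U}"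
    by (simp add: Cinf_top_def)
qed

section \<open>Gevrey regularity as exponential decay of the coefficients\<close>

lemma power_le_fact_exp:
  fixes y :: real
  assumes "0 \<le> y"
  shows "y ^ M \<le> fact M * exp y"
proof -
  have "sum (\<lambda>n. y ^ n /\<^sub>R fact n) {M} \<le> exp y"
    unfolding exp_def by (rule sum_le_suminf) (use assms summable_exp_generic[of y] in auto)
  then show ?thesis by (simp add: field_simps)
qed

text \<open>The elementary bound y^M \<le> M! exp y, raised to the power \<open>s\<close>, for y
  equal to \<eta>/s times the \<open>s\<close>-th root of \<open>x\<close>. The power
  \<open>s\<close> produces \<open>fact M powr s\<close> and turns exp y into the given
  exponential.\<close>

lemma powr_exp_decay:
  fixes x :: real
  assumes x: "1 \<le> x" and s: "0 < s" and \<eta>: "0 < \<eta>"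
  shows "x ^ M * exp (- \<eta> * x powr (1 / s)) \<le> ((s / \<eta>) powr s) ^ M * fact M powr s"
proof -
  define y where "y = \<eta> / s * x powr (1 / s)"
  have y: "0 < y" using x s \<eta> by (simp add: y_def)
  have "(y ^ M) powr s \<le> (fact M * exp y) powr s"
    using power_le_fact_exp[of y M] y s by (intro powr_mono2) auto
  also have "\<dots> = fact M powr s * exp (\<eta> * x powr (1 / s))"
    using s by (simp add: powr_mult exp_powr_real y_def)
  also have "(y ^ M) powr s = ((\<eta> / s) powr s) ^ M * x ^ M"
  proof -
    have "(y ^ M) powr s = (y powr s) ^ M"
      using y by (simp add: powr_realpow[symmetric] powr_powr mult.commute)
    also have "y powr s = (\<eta> / s) powr s * x"
      unfolding y_def by (subst powr_mult) (use x s \<eta> in \<open>auto simp: powr_powr\<close>)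
    finally show ?thesis by (simp add: power_mult_distrib)
  qed
  finally have "((\<eta> / s) powr s) ^ M * x ^ M \<le> fact M powr s * exp (\<eta> * x powr (1 / s))" .
  then have "((s / \<eta>) powr s) ^ M * (((\<eta> / s) powr s) ^ M * x ^ M) \<le> ((s / \<eta>) powr s) ^ M * (fact M powr s * exp (\<eta> * x powr (1 / s)))"
    by (intro mult_left_mono) auto
  moreover have "((s / \<eta>) powr s) ^ M * ((\<eta> / s) powr s) ^ M = 1"
    using s \<eta> by (simp flip: power_mult_distrib powr_mult)
  ultimately have "x ^ M \<le> ((s / \<eta>) powr s) ^ M * fact M powr s * exp (\<eta> * x powr (1 / s))"
    by (simp add: mult.assoc[symmetric])
  then have "x ^ M * exp (- \<eta> * x powr (1 / s)) \<le>
      ((s / \<eta>) powr s) ^ M * fact M powr s * exp (\<eta> * x powr (1 / s)) * exp (- \<eta> * x powr (1 / s))"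
    by (intro mult_right_mono) auto
  also have "\<dots> = ((s / \<eta>) powr s) ^ M * fact M powr s"
    by (simp add: mult.assoc flip: exp_add)
  finally show ?thesis .
qed

text \<open>The size of the coefficients that characterises Gevrey order \<open>s\<close>, with rate
  \<eta>; see \<open>gevrey_iff\<close>.\<close>

definition gdecay :: "real \<Rightarrow> real \<Rightarrow> int^'n::finite \<Rightarrow> real" where
  "gdecay s \<eta> \<xi> = exp (- \<eta> * wt \<xi> powr (1 / s))"

lemma gdecay_pos [simp]: "0 < gdecay s \<eta> \<xi>" and gdecay_nonneg [simp]: "0 \<le> gdecay s \<eta> \<xi>"
  and gdecay_neq_0 [simp]: "gdecay s \<eta> \<xi> \<noteq> 0"
  by (auto simp: gdecay_def)

lemma gdecay_add: "gdecay s (\<eta> + \<theta>) \<xi> = gdecay s \<eta> \<xi> * gdecay s \<theta> \<xi>"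
  by (simp add: gdecay_def exp_add[symmetric] algebra_simps)

lemma gdecay_half: "gdecay s \<eta> \<xi> = gdecay s (\<eta> / 2) \<xi> * gdecay s (\<eta> / 2) \<xi>"
  by (simp flip: gdecay_add)

lemma gdecay_bound_nonneg: "norm a \<le> C * gdecay s \<eta> \<xi> \<Longrightarrow> 0 \<le> C"
  using order_trans[OF norm_ge_zero, of a "C * gdecay s \<eta> \<xi>"] zero_le_mult_iff[of C "gdecay s \<eta> \<xi>"]
    gdecay_pos[of s \<eta> \<xi>] by linarith

lemma gdecay_mono: "\<theta> \<le> \<eta> \<Longrightarrow> gdecay s \<eta> \<xi> \<le> gdecay s \<theta> \<xi>"
  using mult_right_mono[of \<theta> \<eta> "wt \<xi> powr (1 / s)"] by (simp add: gdecay_def)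

lemma gdecay_le_1: "0 \<le> \<eta> \<Longrightarrow> gdecay s \<eta> \<xi> \<le> 1"
  using gdecay_mono[of 0 \<eta> s \<xi>] by (simp add: gdecay_def)

lemma gdecay_wt_power:
  assumes "0 < s" "0 < \<eta>"
  shows "gdecay s \<eta> \<xi> * wt \<xi> ^ M \<le> ((s / \<eta>) powr s) ^ M * fact M powr s"
  using powr_exp_decay[OF wt_ge_1[of \<xi>] assms, of M] by (simp add: gdecay_def mult.commute)

lemma gdecay_summable:
  assumes "0 < s" "0 < \<eta>"
  shows "gdecay s \<eta> summable_on (UNIV :: (int^'n::finite) set)"
  by (rule summable_on_wt_bound(1)) (use gdecay_wt_power[OF assms] in auto)

lemma gdecay_rapid:
  assumes c: "\<And>\<xi>. norm (c \<xi>) \<le> C * gdecay s \<eta> \<xi>" and s: "0 < s" "0 < \<eta>"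
  shows "rapid c"
proof -
  have C: "0 \<le> C" by (rule gdecay_bound_nonneg[OF c[of 0]])
  have "norm (c \<xi>) * wt \<xi> ^ M \<le> C * (((s / \<eta>) powr s) ^ M * fact M powr s)" for M \<xi>
  proof -
    have "norm (c \<xi>) * wt \<xi> ^ M \<le> C * gdecay s \<eta> \<xi> * wt \<xi> ^ M" by (intro mult_right_mono c) auto
    also have "\<dots> \<le> C * (((s / \<eta>) powr s) ^ M * fact M powr s)"
      unfolding mult.assoc by (intro mult_left_mono gdecay_wt_power s C)
    finally show ?thesis .
  qed
  then show ?thesis unfolding rapid_def by blast
qed

text \<open>The radius \<open>h\<close> of a Banach step that receives coefficients decaying with
  rate \<eta>. Half of the rate absorbs the powers of \<open>wt \<xi>\<close> produced by
  derivatives; the other half keeps the series summable.\<close>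

definition gradius :: "real \<Rightarrow> real \<Rightarrow> real" where
  "gradius s \<eta> = (s / (\<eta> / 2)) powr s"

lemma gdecay_imp_derivs_bound:
  fixes c :: "int^'n::finite \<Rightarrow> complex"
  assumes c: "\<And>\<xi>. norm (c \<xi>) \<le> C * gdecay s \<eta> \<xi>" and s: "0 < s" "0 < \<eta>"
  shows "norm (partial_derivs js (synth c) x) \<le>
    (C * infsum (gdecay s (\<eta> / 2)) (UNIV :: (int^'n) set)) * gradius s \<eta> ^ length js * fact (length js) powr s"
proof -
  have C: "0 \<le> C" by (rule gdecay_bound_nonneg[OF c[of 0]])
  have r: "rapid c" by (rule gdecay_rapid[OF c s])
  let ?B = "gradius s \<eta> ^ length js * fact (length js) powr s"
  have le: "norm (isym js \<xi> * c \<xi>) \<le> (C * ?B) * gdecay s (\<eta> / 2) \<xi>" for \<xi>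
  proof -
    have "norm (isym js \<xi> * c \<xi>) \<le> wt \<xi> ^ length js * (C * gdecay s \<eta> \<xi>)"
      unfolding norm_mult by (intro mult_mono norm_isym_le c) auto
    also have "\<dots> = C * (gdecay s (\<eta> / 2) \<xi> * wt \<xi> ^ length js) * gdecay s (\<eta> / 2) \<xi>"
      by (subst gdecay_half) (simp add: mult_ac)
    also have "\<dots> \<le> C * ?B * gdecay s (\<eta> / 2) \<xi>"
      unfolding gradius_def using s C
      by (intro mult_right_mono mult_left_mono gdecay_wt_power) auto
    finally show ?thesis .
  qed
  have s1: "(\<lambda>\<xi>. norm (isym js \<xi> * c \<xi>)) summable_on UNIV"
    by (intro rapid_abs_summable rapid_isym_mult r)
  have s2: "(\<lambda>\<xi>::int^'n. (C * ?B) * gdecay s (\<eta> / 2) \<xi>) summable_on UNIV"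
    by (intro summable_on_cmult_right gdecay_summable) (use s in auto)
  have "norm (partial_derivs js (synth c) x) \<le> infsum (\<lambda>\<xi>. norm (isym js \<xi> * c \<xi>)) UNIV"
    unfolding partial_derivs_synth[OF r] by (rule norm_synth_le[OF s1])
  also have "\<dots> \<le> infsum (\<lambda>\<xi>::int^'n. (C * ?B) * gdecay s (\<eta> / 2) \<xi>) UNIV"
    by (rule infsum_mono[OF s1 s2 le])
  also have "\<dots> = (C * ?B) * infsum (gdecay s (\<eta> / 2)) (UNIV :: (int^'n) set)"
    by (simp add: infsum_cmult_right')
  finally show ?thesis by (simp add: mult_ac)
qed

text \<open>The decay follows by optimising the number \<open>M\<close> of derivatives for each frequency.\<close>

lemma derivs_bound_imp_gdecay:
  fixes h s :: real
  assumes h: "0 < h" and s: "1 \<le> s"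
  obtains K \<eta> where "0 \<le> K" "0 < \<eta>"
    "\<And>f C \<xi>. (f :: real^'n::finite \<Rightarrow> complex) \<in> torus_smooth \<Longrightarrow> 0 \<le> C \<Longrightarrow>
      (\<And>js x. norm (partial_derivs js f x) \<le> C * h ^ length js * fact (length js) powr s) \<Longrightarrow>
      norm (fcoef f \<xi>) \<le> K * C * gdecay s \<eta> \<xi>"
proof
  define N where "N = 1 + real CARD('n)"
  \<comment> \<open>The decay estimate needs a bound for all derivatives up to order
    \<open>M\<close> at once. Replacing \<open>h\<close> by \<open>max h 1\<close> makes its powers
    monotone in the order.\<close>
  define b where "b = max h 1 * N"
  have N: "N \<ge> 1" by (simp add: N_def)
  have b: "b > 0" using N by (simp add: b_def)
  define \<eta> where "\<eta> = (1 / (exp 1 * b)) powr (1 / s)"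
  show "0 < \<eta>" using b by (simp add: \<eta>_def)
  show "0 \<le> N * exp 1" using N by simp
  fix f :: "real^'n \<Rightarrow> complex" and C :: real and \<xi>
  assume f: "f \<in> torus_smooth" and C: "0 \<le> C"
    and bd: "\<And>js x. norm (partial_derivs js f x) \<le> C * h ^ length js * fact (length js) powr s"
  have key: "norm (fcoef f \<xi>) * wt \<xi> ^ M \<le> N * C * (b * real M powr s) ^ M" for M
  proof -
    have "norm (fcoef f \<xi>) * wt \<xi> ^ M \<le> N ^ Suc M * (C * max h 1 ^ M * (real M ^ M) powr s)"
      unfolding N_def
    proof (rule norm_fcoef_decay[OF f])
      fix js :: "'n list" and x assume js: "length js \<le> M"
      have "h ^ length js \<le> max h 1 ^ length js" using h by (intro power_mono) auto
      also have "\<dots> \<le> max h 1 ^ M" using js by (intro power_increasing) auto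
      finally have 1: "h ^ length js \<le> max h 1 ^ M" .
      have "(fact (length js) :: real) \<le> fact M" using js by (rule fact_mono)
      also have "\<dots> \<le> real (M ^ M)" using fact_le_power[of M] by (metis of_nat_fact of_nat_mono fact_le_power le_refl)
      finally have 2: "(fact (length js) :: real) powr s \<le> (real M ^ M) powr s"
        using s by (intro powr_mono2) auto
      have "norm (partial_derivs js f x) \<le> C * h ^ length js * fact (length js) powr s" by (rule bd)
      also have "\<dots> \<le> C * max h 1 ^ M * (real M ^ M) powr s"
        using 1 2 C h by (intro mult_mono mult_left_mono) auto
      finally show "norm (partial_derivs js f x) \<le> C * max h 1 ^ M * (real M ^ M) powr s" .
    qed
    also have "(real M ^ M) powr s = (real M powr s) ^ M"
      by (cases "M = 0") (simp_all add: powr_realpow[symmetric] powr_powr mult.commute)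
    finally show ?thesis by (simp add: b_def power_mult_distrib mult_ac)
  qed
  \<comment> \<open>Chosen such that \<open>b * r powr s\<close> equals
    \<open>wt \<xi> / exp 1\<close>. With \<open>M\<close> the integer part of \<open>r\<close>, the
    estimate \<open>key\<close> then gains the factor exp (-M), and passing from \<open>M\<close>
    back to \<open>r\<close> costs at most a factor e.\<close>
  define r where "r = (wt \<xi> / (exp 1 * b)) powr (1 / s)"
  define M where "M = nat \<lfloor>r\<rfloor>"
  have r0: "0 \<le> r" by (simp add: r_def)
  have M: "real M \<le> r" "r < real M + 1" using r0 by (auto simp: M_def)
  have "real M powr s \<le> r powr s" using M s by (intro powr_mono2) auto
  also have "r powr s = wt \<xi> / (exp 1 * b)" using s b by (simp add: r_def powr_powr)
  finally have "b * real M powr s \<le> wt \<xi> / exp 1" using b by (simp add: field_simps)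
  then have "(b * real M powr s) ^ M \<le> (wt \<xi> / exp 1) ^ M" using b by (intro power_mono) auto
  then have "norm (fcoef f \<xi>) * wt \<xi> ^ M \<le> N * C * (wt \<xi> / exp 1) ^ M"
    using key[of M] mult_left_mono[of _ _ "N * C"] N C by (meson mult_nonneg_nonneg order_trans zero_le_one)
  then have "norm (fcoef f \<xi>) \<le> N * C * exp (- real M)"
    by (simp add: power_divide exp_of_nat_mult[symmetric] exp_minus field_simps)
  also have "\<dots> \<le> N * C * (exp 1 * exp (- r))"
    using M N C by (intro mult_left_mono) (auto simp: exp_add[symmetric])
  also have "r = \<eta> * wt \<xi> powr (1 / s)"
    using b unfolding r_def \<eta>_def by (simp add: powr_mult[symmetric] field_simps)
  finally show "norm (fcoef f \<xi>) \<le> N * exp 1 * C * gdecay s \<eta> \<xi>"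
    by (simp add: gdecay_def mult_ac)
qed

lemma Cinf_smooth_rep:
  assumes "u \<in> Cinf"
  shows "smooth_rep u = synth (fourier_coeff u)" "smooth_rep u \<in> torus_smooth"
    "fcoef (smooth_rep u) = fourier_coeff u"
proof -
  have u: "u \<in> distributions" "rapid (fourier_coeff u)" using assms by (auto simp: Cinf_iff)
  show 1: "smooth_rep u = synth (fourier_coeff u)" by (rule smooth_rep_eq[OF u])
  show "smooth_rep u \<in> torus_smooth" unfolding 1 by (rule torus_smooth_synth[OF u(2)])
  show "fcoef (smooth_rep u) = fourier_coeff u"
    unfolding 1 by (rule ext) (rule fcoef_synth[OF rapid_abs_summable[OF u(2)]])
qed

lemma gevrey_iff:
  assumes s: "1 \<le> s"
  shows "u \<in> gevrey s \<longleftrightarrow> u \<in> distributions \<and> (\<exists>C \<eta>. 0 < \<eta> \<and> (\<forall>\<xi>. norm (fourier_coeff u \<xi>) \<le> C * gdecay s \<eta> \<xi>))"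
proof safe
  assume "u \<in> gevrey s"
  then obtain C h where u: "u \<in> Cinf" "C > 0" "h > 0" and
    bd: "\<And>js x. norm (partial_derivs js (smooth_rep u) x) \<le> C * h ^ length js * fact (length js) powr s"
    unfolding gevrey_def by blast
  show "u \<in> distributions" using u by (simp add: Cinf_iff)
  obtain K \<eta> where K: "0 \<le> K" "0 < \<eta>"
    "\<And>f C \<xi>. (f :: real^'a \<Rightarrow> complex) \<in> torus_smooth \<Longrightarrow> 0 \<le> C \<Longrightarrow>
      (\<And>js x. norm (partial_derivs js f x) \<le> C * h ^ length js * fact (length js) powr s) \<Longrightarrow>
      norm (fcoef f \<xi>) \<le> K * C * gdecay s \<eta> \<xi>"
    using derivs_bound_imp_gdecay[OF u(3) s, where ?'n = 'a] by metis
  have "norm (fourier_coeff u \<xi>) \<le> K * C * gdecay s \<eta> \<xi>" for \<xi>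
    using K(3)[OF Cinf_smooth_rep(2)[OF u(1)] _ bd] u by (simp add: Cinf_smooth_rep(3))
  with K(2) show "\<exists>C \<eta>. 0 < \<eta> \<and> (\<forall>\<xi>. norm (fourier_coeff u \<xi>) \<le> C * gdecay s \<eta> \<xi>)" by blast
next
  fix C \<eta> assume u: "u \<in> distributions" and \<eta>: "0 < \<eta>" and c: "\<forall>\<xi>. norm (fourier_coeff u \<xi>) \<le> C * gdecay s \<eta> \<xi>"
  have s0: "0 < s" using s by simp
  have C: "0 \<le> C" by (rule gdecay_bound_nonneg[OF c[rule_format, of 0]])
  have Cinf: "u \<in> Cinf" using u gdecay_rapid[OF _ s0 \<eta>] c by (auto simp: Cinf_iff)
  define A where "A = C * infsum (gdecay s (\<eta> / 2)) (UNIV :: (int^'a) set)"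
  have A: "0 \<le> A" unfolding A_def by (intro mult_nonneg_nonneg C infsum_nonneg) auto
  \<comment> \<open>The definition of \<open>gevrey\<close> demands a strictly positive constant,
    while \<open>A\<close> may be zero.\<close>
  have "norm (partial_derivs js (smooth_rep u) x) \<le> (A + 1) * gradius s \<eta> ^ length js * fact (length js) powr s" for js x
  proof -
    have "norm (partial_derivs js (smooth_rep u) x) \<le> A * gradius s \<eta> ^ length js * fact (length js) powr s"
      unfolding Cinf_smooth_rep(1)[OF Cinf] A_def using gdecay_imp_derivs_bound[OF _ s0 \<eta>] c by blast
    also have "\<dots> \<le> (A + 1) * gradius s \<eta> ^ length js * fact (length js) powr s"
      by (intro mult_right_mono) (auto simp: gradius_def)
    finally show ?thesis .
  qed
  moreover have "gradius s \<eta> > 0" using s0 \<eta> by (simp add: gradius_def)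
  ultimately show "u \<in> gevrey s" using Cinf A unfolding gevrey_def
    by (intro CollectI conjI exI[of _ "A + 1"] exI[of _ "gradius s \<eta>"] allI) auto
qed

section \<open>The Banach spaces of fixed radius\<close>

lemma gevrey_h_iff:
  assumes "0 < h"
  shows "u \<in> gevrey_h h s \<longleftrightarrow> u \<in> Cinf \<and>
    (\<exists>C. \<forall>js x. norm (partial_derivs js (smooth_rep u) x) \<le> C * h ^ length js * fact (length js) powr s)"
proof -
  have "0 < h ^ length js * fact (length js) powr s" for js :: "'a list" using assms by simp
  then show ?thesis
    by (auto simp: gevrey_h_def bdd_above_def gevrey_quotient_def pos_divide_le_eq mult.assoc)
qed

lemma gevrey_h_norm_bound:
  assumes u: "u \<in> gevrey_h h s" and h: "0 < h"
  shows "norm (partial_derivs js (smooth_rep u) x) \<le> gevrey_h_norm h s u * h ^ length js * fact (length js) powr s"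
    and "0 \<le> gevrey_h_norm h s u"
proof -
  have bdd: "bdd_above (range (gevrey_quotient h s u))" using u by (simp add: gevrey_h_def)
  have le: "gevrey_quotient h s u (js, x) \<le> gevrey_h_norm h s u" for js x
    unfolding gevrey_h_norm_def by (rule cSUP_upper[OF UNIV_I bdd])
  have pos: "0 < h ^ length js * fact (length js) powr s" for js :: "'a list" using h by simp
  show "norm (partial_derivs js (smooth_rep u) x) \<le> gevrey_h_norm h s u * h ^ length js * fact (length js) powr s"
    using le[of js x] pos[of js] by (simp add: gevrey_quotient_def pos_divide_le_eq mult.assoc)
  have "0 \<le> gevrey_quotient h s u ([], 0)" by (simp add: gevrey_quotient_def)
  then show "0 \<le> gevrey_h_norm h s u" using le[of "[]" 0] by linarith
qed

lemma gevrey_h_norm_le: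
  fixes u :: "'n::finite functional"
  assumes bd: "\<And>js x. norm (partial_derivs js (smooth_rep u) x) \<le> C * h ^ length js * fact (length js) powr s"
    and h: "0 < h"
  shows "gevrey_h_norm h s u \<le> C"
  unfolding gevrey_h_norm_def
proof (rule cSUP_least)
  fix z :: "'n list \<times> (real^'n)"
  obtain js x where z: "z = (js, x)" by (cases z)
  have "0 < h ^ length js * fact (length js) powr s" using h by simp
  then show "gevrey_quotient h s u z \<le> C"
    using bd[of js x] by (simp add: z gevrey_quotient_def pos_divide_le_eq mult.assoc)
qed simp

lemma gevrey_h_subset_gevrey: "0 < h \<Longrightarrow> u \<in> gevrey_h h s \<Longrightarrow> u \<in> gevrey s"
proof -
  assume h: "0 < h" and u: "u \<in> gevrey_h h s"
  have "norm (partial_derivs js (smooth_rep u) x) \<le> (gevrey_h_norm h s u + 1) * h ^ length js * fact (length js) powr s" for js x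
  proof -
    have "norm (partial_derivs js (smooth_rep u) x) \<le> gevrey_h_norm h s u * h ^ length js * fact (length js) powr s"
      by (rule gevrey_h_norm_bound(1)[OF u h])
    also have "\<dots> \<le> (gevrey_h_norm h s u + 1) * h ^ length js * fact (length js) powr s"
      using h by (intro mult_right_mono) auto
    finally show ?thesis .
  qed
  moreover have "0 < gevrey_h_norm h s u + 1" using gevrey_h_norm_bound(2)[OF u h] by simp
  moreover have "u \<in> Cinf" using u by (simp add: gevrey_h_def)
  ultimately show "u \<in> gevrey s" using h unfolding gevrey_def by blast
qed

text \<open>\<open>K\<close> and \<eta> depend on \<open>h\<close> and \<open>s\<close> only, so
  this is a bound for the norm topology of the whole step. It is what makes seminorms built from
  coefficients continuous on the inductive limit.\<close>

lemma gevrey_h_coeff_bound: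
  assumes h: "0 < h" and s: "1 \<le> s"
  obtains K \<eta> where "0 \<le> K" "0 < \<eta>" "\<And>(u :: 'n::finite functional) \<xi>. u \<in> gevrey_h h s \<Longrightarrow>
      norm (fourier_coeff u \<xi>) \<le> K * gevrey_h_norm h s u * gdecay s \<eta> \<xi>"
proof -
  obtain K \<eta> where K: "0 \<le> K" "0 < \<eta>"
    "\<And>f C \<xi>. (f :: real^'n \<Rightarrow> complex) \<in> torus_smooth \<Longrightarrow> 0 \<le> C \<Longrightarrow>
      (\<And>js x. norm (partial_derivs js f x) \<le> C * h ^ length js * fact (length js) powr s) \<Longrightarrow>
      norm (fcoef f \<xi>) \<le> K * C * gdecay s \<eta> \<xi>"
    using derivs_bound_imp_gdecay[OF h s, where ?'n = 'n] by metis
  have "norm (fourier_coeff u \<xi>) \<le> K * gevrey_h_norm h s u * gdecay s \<eta> \<xi>" if u: "u \<in> gevrey_h h s"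
    for u :: "'n functional" and \<xi>
  proof -
    have Cinf: "u \<in> Cinf" using u by (simp add: gevrey_h_def)
    show ?thesis
      using K(3)[OF Cinf_smooth_rep(2)[OF Cinf] gevrey_h_norm_bound(2)[OF u h] gevrey_h_norm_bound(1)[OF u h]]
      by (simp add: Cinf_smooth_rep(3)[OF Cinf])
  qed
  with K show ?thesis using that by blast
qed

lemma gdecay_gevrey_h:
  fixes u :: "'n::finite functional"
  assumes u: "u \<in> distributions" and c: "\<And>\<xi>. norm (fourier_coeff u \<xi>) \<le> C * gdecay s \<eta> \<xi>"
    and s: "0 < s" "0 < \<eta>"
  shows "u \<in> gevrey_h (gradius s \<eta>) s"
    "gevrey_h_norm (gradius s \<eta>) s u \<le> C * infsum (gdecay s (\<eta> / 2)) (UNIV :: (int^'n) set)"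
proof -
  have Cinf: "u \<in> Cinf" using u gdecay_rapid[OF c s] by (auto simp: Cinf_iff)
  have h: "gradius s \<eta> > 0" using s by (simp add: gradius_def)
  have bd: "norm (partial_derivs js (smooth_rep u) x) \<le> (C * infsum (gdecay s (\<eta> / 2)) (UNIV :: (int^'n) set))
      * gradius s \<eta> ^ length js * fact (length js) powr s" for js x
    unfolding Cinf_smooth_rep(1)[OF Cinf] by (rule gdecay_imp_derivs_bound[OF c s])
  then show "u \<in> gevrey_h (gradius s \<eta>) s" unfolding gevrey_h_iff[OF h] using Cinf by blast
  show "gevrey_h_norm (gradius s \<eta>) s u \<le> C * infsum (gdecay s (\<eta> / 2)) (UNIV :: (int^'n) set)"
    by (rule gevrey_h_norm_le[OF bd h])
qed

lemma Cinf_add: "u \<in> Cinf \<Longrightarrow> v \<in> Cinf \<Longrightarrow> (\<lambda>\<phi>. u \<phi> + v \<phi>) \<in> Cinf"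
  and Cinf_cmult: "u \<in> Cinf \<Longrightarrow> (\<lambda>\<phi>. c * u \<phi>) \<in> Cinf"
  by (simp_all add: Cinf_def sobolev_add sobolev_cmult)

text \<open>Linearity of \<open>smooth_rep\<close> is not visible in its definition as an inverse
  function; it is read off from this series.\<close>

lemma partial_derivs_smooth_rep:
  assumes "u \<in> Cinf"
  shows "partial_derivs js (smooth_rep u) x = infsum (\<lambda>\<xi>. isym js \<xi> * fourier_coeff u \<xi> * expo \<xi> x) UNIV"
    and "(\<lambda>\<xi>. isym js \<xi> * fourier_coeff u \<xi> * expo \<xi> x) summable_on UNIV"
proof -
  have u: "rapid (fourier_coeff u)" using assms by (simp add: Cinf_iff)
  show "partial_derivs js (smooth_rep u) x = infsum (\<lambda>\<xi>. isym js \<xi> * fourier_coeff u \<xi> * expo \<xi> x) UNIV"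
    unfolding Cinf_smooth_rep(1)[OF assms] partial_derivs_synth[OF u] by (simp add: synth_def)
  show "(\<lambda>\<xi>. isym js \<xi> * fourier_coeff u \<xi> * expo \<xi> x) summable_on UNIV"
    by (intro abs_summable_on_synth(2) rapid_abs_summable rapid_isym_mult u)
qed

lemma partial_derivs_smooth_rep_add:
  assumes "u \<in> Cinf" "v \<in> Cinf"
  shows "partial_derivs js (smooth_rep (\<lambda>\<phi>. u \<phi> + v \<phi>)) x =
    partial_derivs js (smooth_rep u) x + partial_derivs js (smooth_rep v) x"
  unfolding partial_derivs_smooth_rep(1)[OF Cinf_add[OF assms]] partial_derivs_smooth_rep(1)[OF assms(1)]
    partial_derivs_smooth_rep(1)[OF assms(2)]
  by (simp add: distrib_left distrib_right infsum_add partial_derivs_smooth_rep(2) assms)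

lemma partial_derivs_smooth_rep_cmult:
  assumes "u \<in> Cinf"
  shows "partial_derivs js (smooth_rep (\<lambda>\<phi>. c * u \<phi>)) x = c * partial_derivs js (smooth_rep u) x"
proof -
  have "(\<lambda>\<xi>. isym js \<xi> * (c * fourier_coeff u \<xi>) * expo \<xi> x) = (\<lambda>\<xi>. c * (isym js \<xi> * fourier_coeff u \<xi> * expo \<xi> x))"
    by (simp add: mult_ac)
  then show ?thesis
    unfolding partial_derivs_smooth_rep(1)[OF Cinf_cmult[OF assms]] partial_derivs_smooth_rep(1)[OF assms]
    by (simp add: infsum_cmult_right')
qed

lemma
  assumes u: "u \<in> gevrey_h h s" and v: "v \<in> gevrey_h h s" and h: "0 < h"
  shows gevrey_h_add: "(\<lambda>\<phi>. u \<phi> + v \<phi>) \<in> gevrey_h h s"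
    and gevrey_h_norm_triangle: "gevrey_h_norm h s (\<lambda>\<phi>. u \<phi> + v \<phi>) \<le> gevrey_h_norm h s u + gevrey_h_norm h s v"
proof -
  have Cinf: "u \<in> Cinf" "v \<in> Cinf" using u v by (auto simp: gevrey_h_def)
  have bd: "norm (partial_derivs js (smooth_rep (\<lambda>\<phi>. u \<phi> + v \<phi>)) x) \<le>
     (gevrey_h_norm h s u + gevrey_h_norm h s v) * h ^ length js * fact (length js) powr s" for js x
    unfolding partial_derivs_smooth_rep_add[OF Cinf] distrib_right
    by (intro norm_triangle_le add_mono gevrey_h_norm_bound u v h)
  show "gevrey_h_norm h s (\<lambda>\<phi>. u \<phi> + v \<phi>) \<le> gevrey_h_norm h s u + gevrey_h_norm h s v"
    by (rule gevrey_h_norm_le[OF bd h])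
  show "(\<lambda>\<phi>. u \<phi> + v \<phi>) \<in> gevrey_h h s"
    unfolding gevrey_h_iff[OF h] using bd Cinf_add[OF Cinf] by blast
qed

lemma
  assumes u: "u \<in> gevrey_h h s" and h: "0 < h"
  shows gevrey_h_cmult: "(\<lambda>\<phi>. c * u \<phi>) \<in> gevrey_h h s"
    and gevrey_h_norm_cmult_le: "gevrey_h_norm h s (\<lambda>\<phi>. c * u \<phi>) \<le> norm c * gevrey_h_norm h s u"
proof -
  have Cinf: "u \<in> Cinf" using u by (auto simp: gevrey_h_def)
  have bd: "norm (partial_derivs js (smooth_rep (\<lambda>\<phi>. c * u \<phi>)) x) \<le>
     (norm c * gevrey_h_norm h s u) * h ^ length js * fact (length js) powr s" for js x
    using mult_left_mono[OF gevrey_h_norm_bound(1)[OF u h, of js x], of "norm c"]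
    unfolding partial_derivs_smooth_rep_cmult[OF Cinf] norm_mult by (simp add: mult.assoc)
  show "gevrey_h_norm h s (\<lambda>\<phi>. c * u \<phi>) \<le> norm c * gevrey_h_norm h s u"
    by (rule gevrey_h_norm_le[OF bd h])
  show "(\<lambda>\<phi>. c * u \<phi>) \<in> gevrey_h h s"
    unfolding gevrey_h_iff[OF h] using bd Cinf_cmult[OF Cinf] by blast
qed

lemma gevrey_h_diff:
  "u \<in> gevrey_h h s \<Longrightarrow> v \<in> gevrey_h h s \<Longrightarrow> 0 < h \<Longrightarrow> (\<lambda>\<phi>. u \<phi> - v \<phi>) \<in> gevrey_h h s"
  using gevrey_h_add[OF _ gevrey_h_cmult[of v h s "-1"]] by simp

text \<open>The inequality already known for \<open>c\<close>, applied once more with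
  \<open>1 / c\<close> to the multiple.\<close>

lemma gevrey_h_norm_cmult:
  assumes u: "u \<in> gevrey_h h s" and h: "0 < h"
  shows "gevrey_h_norm h s (\<lambda>\<phi>. c * u \<phi>) = norm c * gevrey_h_norm h s u"
proof (cases "c = 0")
  case True
  have "gevrey_h_norm h s (\<lambda>\<phi>. c * u \<phi>) \<le> 0"
    using gevrey_h_norm_cmult_le[OF u h, of c] True by simp
  then show ?thesis using gevrey_h_norm_bound(2)[OF gevrey_h_cmult[OF u h, of c] h] True by simp
next
  case False
  have "gevrey_h_norm h s (\<lambda>\<phi>. (1 / c) * (c * u \<phi>)) \<le> norm (1 / c) * gevrey_h_norm h s (\<lambda>\<phi>. c * u \<phi>)"
    by (rule gevrey_h_norm_cmult_le[OF gevrey_h_cmult[OF u h] h])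
  then have "norm c * gevrey_h_norm h s u \<le> gevrey_h_norm h s (\<lambda>\<phi>. c * u \<phi>)"
    using False by (simp add: norm_divide field_simps)
  then show ?thesis using gevrey_h_norm_cmult_le[OF u h, of c] by linarith
qed

lemma seminorm_on_gevrey_h_norm: "0 < h \<Longrightarrow> seminorm_on (gevrey_h h s) (gevrey_h_norm h s)"
  unfolding seminorm_on_def
  by (auto simp: gevrey_h_norm_bound(2) gevrey_h_norm_triangle gevrey_h_norm_cmult)

lemma gevrey_add:
  assumes "1 \<le> s" "u \<in> gevrey s" "v \<in> gevrey s"
  shows "(\<lambda>\<phi>. u \<phi> + v \<phi>) \<in> gevrey s"
proof -
  obtain C \<eta> where C: "0 < \<eta>" "\<And>\<xi>. norm (fourier_coeff u \<xi>) \<le> C * gdecay s \<eta> \<xi>"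
    using assms by (auto simp: gevrey_iff)
  obtain D \<theta> where D: "0 < \<theta>" "\<And>\<xi>. norm (fourier_coeff v \<xi>) \<le> D * gdecay s \<theta> \<xi>"
    using assms by (auto simp: gevrey_iff)
  have C0: "0 \<le> C" by (rule gdecay_bound_nonneg[OF C(2)[of 0]])
  have D0: "0 \<le> D" by (rule gdecay_bound_nonneg[OF D(2)[of 0]])
  have "norm (fourier_coeff (\<lambda>\<phi>. u \<phi> + v \<phi>) \<xi>) \<le> (C + D) * gdecay s (min \<eta> \<theta>) \<xi>" for \<xi>
  proof -
    have "gdecay s \<eta> \<xi> \<le> gdecay s (min \<eta> \<theta>) \<xi>" "gdecay s \<theta> \<xi> \<le> gdecay s (min \<eta> \<theta>) \<xi>"
      by (auto intro: gdecay_mono)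
    then have "C * gdecay s \<eta> \<xi> + D * gdecay s \<theta> \<xi> \<le> (C + D) * gdecay s (min \<eta> \<theta>) \<xi>"
      unfolding distrib_right by (intro add_mono mult_left_mono C0 D0)
    then show ?thesis
      using norm_triangle_ineq[of "fourier_coeff u \<xi>" "fourier_coeff v \<xi>"] C(2)[of \<xi>] D(2)[of \<xi>] by simp
  qed
  moreover have "0 < min \<eta> \<theta>" using C D by simp
  moreover have "u \<in> distributions" "v \<in> distributions" using assms by (auto simp: gevrey_iff)
  ultimately show ?thesis unfolding gevrey_iff[OF assms(1)] using distributions_add by blast
qed

lemma gevrey_cmult:
  assumes "1 \<le> s" "u \<in> gevrey s"
  shows "(\<lambda>\<phi>. c * u \<phi>) \<in> gevrey s"
proof -
  obtain C \<eta> where C: "0 < \<eta>" "\<And>\<xi>. norm (fourier_coeff u \<xi>) \<le> C * gdecay s \<eta> \<xi>"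
    using assms by (auto simp: gevrey_iff)
  have "norm (fourier_coeff (\<lambda>\<phi>. c * u \<phi>) \<xi>) \<le> (norm c * C) * gdecay s \<eta> \<xi>" for \<xi>
    using mult_left_mono[OF C(2), of "norm c" \<xi>] by (simp add: norm_mult mult.assoc)
  moreover have "u \<in> distributions" using assms by (auto simp: gevrey_iff)
  ultimately show ?thesis unfolding gevrey_iff[OF assms(1)] using distributions_cmult C(1) by blast
qed

lemma gevrey_diff: "1 \<le> s \<Longrightarrow> u \<in> gevrey s \<Longrightarrow> v \<in> gevrey s \<Longrightarrow> (\<lambda>\<phi>. u \<phi> - v \<phi>) \<in> gevrey s"
  using gevrey_add[OF _ _ gevrey_cmult[of s v "-1"]] by simp

text \<open>A seminorm bounded by a multiple of the norm of the step is continuous on it.\<close>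

lemma continuous_map_gevrey_h_top:
  fixes Q :: "('n::finite functional \<Rightarrow> real) set"
  assumes h: "0 < h" and s: "1 \<le> s" and p: "\<And>p. p \<in> Q \<Longrightarrow> seminorm_on (gevrey s) p"
    and K: "\<And>p. p \<in> Q \<Longrightarrow> \<exists>K. \<forall>u\<in>gevrey_h h s. p u \<le> K * gevrey_h_norm h s u"
  shows "continuous_map (gevrey_h_top h s) (seminorm_topology (gevrey s) Q) (\<lambda>u. u)"
proof (rule continuous_map_seminorm_topologyI[OF _ gevrey_diff[OF s] p])
  show "(\<lambda>u :: 'n functional. u) ` topspace (gevrey_h_top h s) \<subseteq> gevrey s"
    using gevrey_h_subset_gevrey[OF h] by (auto simp: gevrey_h_top_def)
  fix u :: "'n functional" and p and e :: real assume u: "u \<in> topspace (gevrey_h_top h s)" and p: "p \<in> Q" and e: "0 < e"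
  have uh: "u \<in> gevrey_h h s" using u by (simp add: gevrey_h_top_def)
  obtain K where K': "\<And>u. u \<in> gevrey_h h s \<Longrightarrow> p u \<le> K * gevrey_h_norm h s u" using K[OF p] by blast
  define r where "r = e / (\<bar>K\<bar> + 1)"
  have r: "0 < r" using e by (simp add: r_def)
  let ?U = "{v \<in> gevrey_h h s. gevrey_h_norm h s (\<lambda>\<phi>. v \<phi> - u \<phi>) < r}"
  have "openin (gevrey_h_top h s) ?U"
    unfolding gevrey_h_top_def by (rule openin_seminorm_ball[OF uh _ r]) simp
  moreover have "u \<in> ?U"
    using uh r seminorm_on_0[OF seminorm_on_gevrey_h_norm[OF h] uh] by simp
  moreover have "p (\<lambda>\<phi>. v \<phi> - u \<phi>) < e" if v: "v \<in> ?U" for v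
  proof -
    let ?n = "gevrey_h_norm h s (\<lambda>\<phi>. v \<phi> - u \<phi>)"
    have d: "(\<lambda>\<phi>. v \<phi> - u \<phi>) \<in> gevrey_h h s" using v uh h by (auto intro: gevrey_h_diff)
    have n0: "0 \<le> ?n" by (rule gevrey_h_norm_bound(2)[OF d h])
    have "p (\<lambda>\<phi>. v \<phi> - u \<phi>) \<le> K * ?n" by (rule K'[OF d])
    also have "\<dots> \<le> (\<bar>K\<bar> + 1) * ?n" using n0 by (intro mult_right_mono) auto
    also have "\<dots> < e" using v by (simp add: r_def pos_less_divide_eq mult.commute add_nonneg_pos)
    finally show ?thesis .
  qed
  ultimately show "\<exists>U. openin (gevrey_h_top h s) U \<and> u \<in> U \<and> (\<forall>v\<in>U. p (\<lambda>\<phi>. v \<phi> - u \<phi>) < e)" by blast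
qed

section \<open>Continuity in time for the inductive limit topology\<close>

lemma openin_gevrey_top:
  assumes "locally_convex_topology (gevrey s) \<tau>"
    "\<And>h. 0 < h \<Longrightarrow> continuous_map (gevrey_h_top h s) \<tau> (\<lambda>u. u)" "openin \<tau> U"
  shows "openin (gevrey_top s) U"
  unfolding gevrey_top_def by (rule topology_generated_by_Basis) (use assms in blast)

lemma locally_convex_topology_seminorm:
  "(\<And>p. p \<in> Q \<Longrightarrow> seminorm_on X p) \<Longrightarrow> locally_convex_topology X (seminorm_topology X Q)"
  unfolding locally_convex_topology_def by blast

text \<open>The indiscrete topology, generated by the empty family of seminorms, is one of the
  admissible topologies and already makes the whole space open.\<close>

lemma topspace_gevrey_top [simp]:
  assumes s: "1 \<le> s"
  shows "topspace (gevrey_top s) = gevrey s"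
proof
  have "openin (gevrey_top s) (gevrey s)"
  proof (rule openin_gevrey_top)
    show "locally_convex_topology (gevrey s) (seminorm_topology (gevrey s) {})"
      by (rule locally_convex_topology_seminorm) simp
    show "continuous_map (gevrey_h_top h s) (seminorm_topology (gevrey s) {}) (\<lambda>u. u)" if "0 < h" for h
      by (rule continuous_map_gevrey_h_top[OF that s]) auto
    have "openin (seminorm_topology (gevrey s) {}) (topspace (seminorm_topology (gevrey s) {}))" by (rule openin_topspace)
    then show "openin (seminorm_topology (gevrey s) {}) (gevrey s)" by simp
  qed
  then show "gevrey s \<subseteq> topspace (gevrey_top s)" by (rule openin_subset)
  show "topspace (gevrey_top s) \<subseteq> gevrey s"
    unfolding gevrey_top_def topology_generated_by_topspace
    by (auto simp: locally_convex_topology_def dest!: openin_subset)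
qed

text \<open>Giving up half of the rate makes the coefficients small relative to the weaker decay,
  uniformly in time, at all but finitely many frequencies; the remaining ones are continuous. Thus
  \<open>f\<close> is continuous into a single Banach step, and from there into every topology over
  which the supremum is taken.\<close>

lemma time_cont_gevreyI:
  fixes f :: "real \<Rightarrow> 'n::finite functional"
  assumes s: "1 \<le> s" and \<eta>: "0 < \<eta>"
    and dist: "\<And>t. t \<in> {0..T} \<Longrightarrow> f t \<in> distributions"
    and cont: "\<And>\<xi>. continuous_on {0..T} (\<lambda>t. fourier_coeff (f t) \<xi>)"
    and bd: "\<And>t \<xi>. t \<in> {0..T} \<Longrightarrow> norm (fourier_coeff (f t) \<xi>) \<le> C * gdecay s \<eta> \<xi>"
  shows "time_cont T (gevrey_top s) f"
proof -
  have s0: "0 < s" using s by simp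
  define \<theta> where "\<theta> = \<eta> / 2"
  have \<theta>: "0 < \<theta>" using \<eta> by (simp add: \<theta>_def)
  define h where "h = gradius s \<theta>"
  have h: "0 < h" using s0 \<theta> by (simp add: h_def gradius_def)
  have C0: "0 \<le> C" if "t \<in> {0..T}" for t
    by (rule gdecay_bound_nonneg[OF bd[OF that, of 0]])
  have mem: "f t \<in> gevrey_h h s" if t: "t \<in> {0..T}" for t
    unfolding h_def
  proof (rule gdecay_gevrey_h(1)[OF dist[OF t] _ s0 \<theta>])
    fix \<xi> :: "int^'n"
    have "gdecay s \<eta> \<xi> \<le> gdecay s \<theta> \<xi>" using \<eta> by (intro gdecay_mono) (simp add: \<theta>_def)
    then show "norm (fourier_coeff (f t) \<xi>) \<le> C * gdecay s \<theta> \<xi>"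
      using bd[OF t, of \<xi>] C0[OF t] by (meson mult_left_mono order_trans)
  qed
  define A where "A = infsum (gdecay s (\<theta> / 2)) (UNIV :: (int^'n) set)"
  have A: "0 \<le> A" unfolding A_def by (intro infsum_nonneg) auto
  have "time_cont T (seminorm_topology (gevrey_h h s) {gevrey_h_norm h s}) f"
  proof (rule time_cont_seminormI[OF mem])
    fix t p and e :: real assume t: "t \<in> {0..T}" and p: "p \<in> {gevrey_h_norm h s :: 'n functional \<Rightarrow> real}" and e: "0 < e"
    define e' where "e' = e / (2 * (A + 1))"
    have e': "0 < e'" using e A by (simp add: e'_def add_nonneg_pos)
    have "0 < e' / (2 * (C + 1))" using e' C0[OF t] by (simp add: add_nonneg_pos)
    from summable_on_tail[OF gdecay_summable[OF s0 \<theta>] _ this]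
    obtain F :: "(int^'n) set" where F: "finite F" "\<And>G. finite G \<Longrightarrow> G \<inter> F = {} \<Longrightarrow> sum (gdecay s \<theta>) G \<le> e' / (2 * (C + 1))"
      by auto
    have "continuous_on {0..T} (\<lambda>r. \<Sum>\<xi>\<in>F. norm (fourier_coeff (f r) \<xi> - fourier_coeff (f t) \<xi>) / gdecay s \<theta> \<xi>)"
      by (intro continuous_intros cont) auto
    then obtain d where d: "d > 0" "\<And>r. r \<in> {0..T} \<Longrightarrow> dist r t < d \<Longrightarrow>
       dist (\<Sum>\<xi>\<in>F. norm (fourier_coeff (f r) \<xi> - fourier_coeff (f t) \<xi>) / gdecay s \<theta> \<xi>)
         (\<Sum>\<xi>\<in>F. norm (fourier_coeff (f t) \<xi> - fourier_coeff (f t) \<xi>) / gdecay s \<theta> \<xi>) < e'"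
      using t e' unfolding continuous_on_iff by blast
    have "gevrey_h_norm h s (\<lambda>\<phi>. f r \<phi> - f t \<phi>) < e" if r: "r \<in> {0..T}" "dist r t < d" for r
    proof -
      have "norm (fourier_coeff (\<lambda>\<phi>. f r \<phi> - f t \<phi>) \<xi>) \<le> e' * gdecay s \<theta> \<xi>" for \<xi>
      proof (cases "\<xi> \<in> F")
        case True
        have "norm (fourier_coeff (f r) \<xi> - fourier_coeff (f t) \<xi>) / gdecay s \<theta> \<xi> \<le>
            (\<Sum>\<xi>\<in>F. norm (fourier_coeff (f r) \<xi> - fourier_coeff (f t) \<xi>) / gdecay s \<theta> \<xi>)"
          by (rule member_le_sum[OF True _ F(1)]) auto
        also have "\<dots> < e'" using d(2)[OF r] by (simp add: dist_real_def sum_nonneg)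
        finally show ?thesis by (simp add: pos_divide_less_eq less_imp_le)
      next
        case False
        then have "gdecay s \<theta> \<xi> \<le> e' / (2 * (C + 1))" using F(2)[of "{\<xi>}"] by simp
        then have "2 * (C + 1) * gdecay s \<theta> \<xi> \<le> e'" using C0[OF t] by (simp add: pos_le_divide_eq add_nonneg_pos mult.commute)
        moreover have "2 * C * gdecay s \<theta> \<xi> \<le> 2 * (C + 1) * gdecay s \<theta> \<xi>" by (intro mult_right_mono) auto
        ultimately have le: "2 * C * gdecay s \<theta> \<xi> \<le> e'" by linarith
        have "norm (fourier_coeff (f r) \<xi> - fourier_coeff (f t) \<xi>) \<le> 2 * C * gdecay s \<eta> \<xi>"
          using norm_triangle_ineq4[of "fourier_coeff (f r) \<xi>" "fourier_coeff (f t) \<xi>"] bd[OF r(1), of \<xi>] bd[OF t, of \<xi>] by simp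
        also have "\<dots> = 2 * C * gdecay s \<theta> \<xi> * gdecay s \<theta> \<xi>"
          by (simp add: gdecay_half[of s \<eta> \<xi>] \<theta>_def)
        also have "\<dots> \<le> e' * gdecay s \<theta> \<xi>" by (intro mult_right_mono le) simp
        finally show ?thesis by simp
      qed
      from gdecay_gevrey_h(2)[OF distributions_diff[OF dist[OF r(1)] dist[OF t]] this s0 \<theta>]
      have "gevrey_h_norm h s (\<lambda>\<phi>. f r \<phi> - f t \<phi>) \<le> e' * A" by (simp add: h_def A_def)
      also have "\<dots> \<le> e' * (A + 1)" using e' by (intro mult_left_mono) auto
      also have "\<dots> < e" using e A by (simp add: e'_def field_simps add_pos_nonneg)
      finally show ?thesis .
    qed
    then show "\<exists>d>0. \<forall>r\<in>{0..T}. dist r t < d \<longrightarrow> p (\<lambda>\<phi>. f r \<phi> - f t \<phi>) < e"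
      using d(1) p by blast
  qed (use seminorm_on_gevrey_h_norm[OF h] gevrey_h_diff h in auto)
  then have fh: "continuous_map (top_of_set {0..T}) (gevrey_h_top h s) f"
    by (simp add: time_cont_def gevrey_h_top_def)
  show ?thesis
    unfolding time_cont_def
  proof (subst gevrey_top_def, rule continuous_on_generated_topo)
    have "f ` topspace (top_of_set {0..T}) \<subseteq> topspace (gevrey_top s)"
      using mem s by (auto intro: gevrey_h_subset_gevrey[OF h])
    then show "f ` topspace (top_of_set {0..T}) \<subseteq> \<Union> {U. \<exists>\<tau>. locally_convex_topology (gevrey s) \<tau> \<and>
        (\<forall>h>0. continuous_map (gevrey_h_top h s) \<tau> (\<lambda>u. u)) \<and> openin \<tau> U}"
      by (simp add: gevrey_top_def)
    fix U :: "'n functional set"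
    assume "U \<in> {U. \<exists>\<tau>. locally_convex_topology (gevrey s) \<tau> \<and>
        (\<forall>h>0. continuous_map (gevrey_h_top h s) \<tau> (\<lambda>u. u)) \<and> openin \<tau> U}"
    then obtain \<tau> where \<tau>: "continuous_map (gevrey_h_top h s) \<tau> (\<lambda>u. u)" "openin \<tau> U" using h by blast
    have "continuous_map (top_of_set {0..T}) \<tau> f"
      using continuous_map_compose[OF fh \<tau>(1)] by (simp add: o_def)
    from openin_continuous_map_preimage[OF this \<tau>(2)]
    show "openin (top_of_set {0..T}) (f -` U \<inter> topspace (top_of_set {0..T}))"
      by (simp add: vimage_def Int_def conj_commute)
  qed
qed

text \<open>The topology generated by \<open>p\<close> alone is locally convex and admits all the
  inclusions continuously, hence it is coarser than the inductive limit topology.\<close>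

lemma time_cont_gevrey_seminorm:
  fixes f :: "real \<Rightarrow> 'n::finite functional"
  assumes f: "time_cont T (gevrey_top s) f" and s: "1 \<le> s" and p: "seminorm_on (gevrey s) p"
    and K: "\<And>h. 0 < h \<Longrightarrow> \<exists>K. \<forall>u\<in>gevrey_h h s. p u \<le> K * gevrey_h_norm h s u"
  shows "time_cont T (seminorm_topology (gevrey s) {p}) f"
proof -
  let ?S = "seminorm_topology (gevrey s) {p}"
  have "continuous_map (gevrey_top s) ?S (\<lambda>u. u)"
    unfolding continuous_map_def
  proof safe
    fix u :: "'n functional" assume "u \<in> topspace (gevrey_top s)"
    then show "u \<in> topspace ?S" using s by simp
  next
    fix U assume U: "openin ?S U"
    have "openin (gevrey_top s) U"
      by (rule openin_gevrey_top[OF locally_convex_topology_seminorm continuous_map_gevrey_h_top U])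
        (use p K s in auto)
    moreover have "{u \<in> topspace (gevrey_top s). u \<in> U} = U"
      using openin_subset[OF U] s by auto
    ultimately show "openin (gevrey_top s) {u \<in> topspace (gevrey_top s). u \<in> U}" by simp
  qed
  from continuous_map_compose[OF f[unfolded time_cont_def] this]
  show ?thesis by (simp add: time_cont_def o_def)
qed

text \<open>A compact set in the inductive limit lies in one step: otherwise there are points \<open>f (t n)\<close>
  violating the decay with rate \<open>1 / (n + 1)\<close> at a frequency \<open>z n\<close>, and the supremum over \<open>n\<close> of the
  correspondingly weighted coefficients is a continuous seminorm that is unbounded on the compact set.\<close>

lemma time_cont_gevreyD:
  fixes f :: "real \<Rightarrow> 'n::finite functional"
  assumes f: "time_cont T (gevrey_top s) f" and s: "1 \<le> s"
  shows "t \<in> {0..T} \<Longrightarrow> f t \<in> distributions"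
    and "continuous_on {0..T} (\<lambda>t. fourier_coeff (f t) \<xi>)"
    and "\<exists>C \<eta>. 0 < \<eta> \<and> (\<forall>t\<in>{0..T}. \<forall>\<xi>. norm (fourier_coeff (f t) \<xi>) \<le> C * gdecay s \<eta> \<xi>)"
proof -
  have mem: "f t \<in> gevrey s" if "t \<in> {0..T}" for t
    using continuous_map_image_subset_topspace[OF f[unfolded time_cont_def]] that s by auto
  then show "t \<in> {0..T} \<Longrightarrow> f t \<in> distributions" by (auto simp: gevrey_iff[OF s])
  have le_gdecay: "K * N * gdecay s \<eta> \<xi> \<le> K * N" if "0 \<le> K" "0 \<le> N" "0 < \<eta>" for K N \<eta> and \<xi> :: "int^'n"
  proof -
    have "gdecay s \<eta> \<xi> \<le> 1" using that by (simp add: gdecay_le_1)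
    then show ?thesis using that by (simp add: mult_left_le)
  qed
  \<comment> \<open>The modulus of a single coefficient is a continuous seminorm on the limit, which
    gives continuity of that coefficient in time.\<close>
  define p where "p = (\<lambda>u :: 'n functional. norm (fourier_coeff u \<xi>))"
  have sn: "seminorm_on (gevrey s) p"
    unfolding seminorm_on_def p_def by (auto simp: norm_mult norm_triangle_ineq)
  have "time_cont T (seminorm_topology (gevrey s) {p}) f"
  proof (rule time_cont_gevrey_seminorm[OF f s sn])
    fix h :: real assume h: "0 < h"
    obtain K \<eta> where K: "0 \<le> K" "0 < \<eta>" "\<And>(u :: 'n functional) \<xi>. u \<in> gevrey_h h s \<Longrightarrow>
      norm (fourier_coeff u \<xi>) \<le> K * gevrey_h_norm h s u * gdecay s \<eta> \<xi>"
      using gevrey_h_coeff_bound[OF h s, where ?'n = 'n] by blast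
    have "p u \<le> K * gevrey_h_norm h s u" if u: "u \<in> gevrey_h h s" for u
      using K(3)[OF u, of \<xi>] le_gdecay[OF K(1) gevrey_h_norm_bound(2)[OF u h] K(2), of \<xi>] by (simp add: p_def)
    then show "\<exists>K. \<forall>u\<in>gevrey_h h s. p u \<le> K * gevrey_h_norm h s u" by blast
  qed
  note this' = time_cont_seminormD(2)[OF this _ singletonI sn]
  show "continuous_on {0..T} (\<lambda>t. fourier_coeff (f t) \<xi>)"
    unfolding continuous_on_iff using this' by (simp add: p_def dist_norm)
  show "\<exists>C \<eta>. 0 < \<eta> \<and> (\<forall>t\<in>{0..T}. \<forall>\<xi>. norm (fourier_coeff (f t) \<xi>) \<le> C * gdecay s \<eta> \<xi>)"
  proof (rule ccontr)
    assume no: "\<not> ?thesis"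
    have "\<exists>t \<xi>. t \<in> {0..T} \<and> norm (fourier_coeff (f t) \<xi>) > real n * gdecay s (1 / real (Suc n)) \<xi>" for n
      using no by (metis not_le of_nat_0_less_iff zero_less_Suc zero_less_divide_1_iff)
    then obtain \<tau> z where \<tau>: "\<And>n. \<tau> n \<in> {0..T}"
      and z: "\<And>n. norm (fourier_coeff (f (\<tau> n)) (z n)) > real n * gdecay s (1 / real (Suc n)) (z n)" by metis
    define q where "q u n = norm (fourier_coeff u (z n)) / gdecay s (1 / real (Suc n)) (z n)"
      for u :: "'n functional" and n
    define p where "p u = (SUP n. q u n)" for u :: "'n functional"
    have q0: "0 \<le> q u n" for u n by (simp add: q_def)
    have bound: "\<exists>L. \<forall>u C. 0 \<le> C \<longrightarrow> (\<forall>\<xi>. norm (fourier_coeff u \<xi>) \<le> C * gdecay s \<eta> \<xi>) \<longrightarrow> (\<forall>n. q u n \<le> L * C)"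
      if \<eta>: "0 < \<eta>" for \<eta>
    proof -
      \<comment> \<open>For a fixed rate \<eta> only finitely many of the rates 1/(n + 1) are larger
        than \<eta>. The weights at those indices are collected in \<open>L\<close>; at all other
        indices the quotient of the weights is at most 1. So the supremum is bounded on each Banach
        step.\<close>
      obtain n0 where n0: "1 / \<eta> < real n0" using reals_Archimedean2 by blast
      define L where "L = 1 + (\<Sum>n<n0. 1 / gdecay s (1 / real (Suc n)) (z n))"
      have sum0: "0 \<le> (\<Sum>n<n0. 1 / gdecay s (1 / real (Suc n)) (z n))" by (intro sum_nonneg) auto
      have "q u n \<le> L * C" if C: "0 \<le> C" and u: "\<forall>\<xi>. norm (fourier_coeff u \<xi>) \<le> C * gdecay s \<eta> \<xi>" for u C n
      proof -
        have "gdecay s \<eta> (z n) / gdecay s (1 / real (Suc n)) (z n) \<le> L"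
        proof (cases "n < n0")
          case True
          have "gdecay s \<eta> (z n) \<le> 1" using \<eta> by (simp add: gdecay_le_1)
          then have "gdecay s \<eta> (z n) / gdecay s (1 / real (Suc n)) (z n) \<le> 1 / gdecay s (1 / real (Suc n)) (z n)"
            by (intro divide_right_mono) auto
          also have "\<dots> \<le> (\<Sum>n<n0. 1 / gdecay s (1 / real (Suc n)) (z n))"
            by (rule member_le_sum[of n "{..<n0}" "\<lambda>n. 1 / gdecay s (1 / real (Suc n)) (z n)"]) (use True in auto)
          finally show ?thesis by (simp add: L_def)
        next
          case False
          have "1 / real (Suc n) \<le> \<eta>"
          proof -
            have "1 / \<eta> \<le> real (Suc n)" using n0 False by simp
            then show ?thesis using \<eta> by (simp add: field_simps)
          qed
          then have "gdecay s \<eta> (z n) \<le> gdecay s (1 / real (Suc n)) (z n)"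
            by (rule gdecay_mono)
          then have "gdecay s \<eta> (z n) / gdecay s (1 / real (Suc n)) (z n) \<le> 1" by (subst pos_divide_le_eq) auto
          then show ?thesis using sum0 unfolding L_def by linarith
        qed
        then have "C * (gdecay s \<eta> (z n) / gdecay s (1 / real (Suc n)) (z n)) \<le> C * L" using C by (intro mult_left_mono)
        moreover have "q u n \<le> C * (gdecay s \<eta> (z n) / gdecay s (1 / real (Suc n)) (z n))"
          using u unfolding q_def by (simp add: divide_right_mono)
        ultimately show ?thesis by (simp add: mult.commute)
      qed
      then show ?thesis by blast
    qed
    have bdd: "bdd_above (range (q u))" if u: "u \<in> gevrey s" for u
    proof -
      obtain C \<eta> where C: "0 < \<eta>" "\<And>\<xi>. norm (fourier_coeff u \<xi>) \<le> C * gdecay s \<eta> \<xi>"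
        using u by (auto simp: gevrey_iff[OF s])
      have C0: "0 \<le> C" by (rule gdecay_bound_nonneg[OF C(2)[of 0]])
      obtain L where "\<forall>n. q u n \<le> L * C" using bound[OF C(1)] C0 C(2) by blast
      then show ?thesis by (auto simp: bdd_above_def)
    qed
    have q_le: "q u n \<le> p u" if "u \<in> gevrey s" for u n
      unfolding p_def by (rule cSUP_upper[OF _ bdd[OF that]]) simp
    have p_le: "p u \<le> B" if "\<And>n. q u n \<le> B" for u B
      unfolding p_def by (rule cSUP_least) (use that in auto)
    have cm_le: "p (\<lambda>\<phi>. c * u \<phi>) \<le> norm c * p u" if u: "u \<in> gevrey s" for c u
      by (rule p_le) (use mult_left_mono[OF q_le[OF u], of "norm c"] in \<open>simp add: q_def norm_mult\<close>)
    have p0: "0 \<le> p u" if "u \<in> gevrey s" for u using q_le[OF that, of 0] q0[of u 0] by linarith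
    have sn: "seminorm_on (gevrey s) p"
      unfolding seminorm_on_def
    proof (intro conjI ballI allI)
      fix u v :: "'n functional" assume uv: "u \<in> gevrey s" "v \<in> gevrey s"
      show "p (\<lambda>\<phi>. u \<phi> + v \<phi>) \<le> p u + p v"
      proof (rule p_le)
        fix n
        have "q (\<lambda>\<phi>. u \<phi> + v \<phi>) n \<le> q u n + q v n"
          unfolding q_def by (simp add: add_divide_distrib[symmetric] divide_right_mono norm_triangle_ineq)
        then show "q (\<lambda>\<phi>. u \<phi> + v \<phi>) n \<le> p u + p v" using q_le[OF uv(1), of n] q_le[OF uv(2), of n] by linarith
      qed
    next
      fix c and u :: "'n functional" assume u: "u \<in> gevrey s"
      show "p (\<lambda>\<phi>. c * u \<phi>) = norm c * p u"
      proof (cases "c = 0")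
        case True
        then show ?thesis using cm_le[OF u, of c] p0[OF gevrey_cmult[OF s u, of c]] by simp
      next
        case False
        have "p (\<lambda>\<phi>. (1 / c) * (c * u \<phi>)) \<le> norm (1 / c) * p (\<lambda>\<phi>. c * u \<phi>)"
          by (rule cm_le[OF gevrey_cmult[OF s u]])
        then have "norm c * p u \<le> p (\<lambda>\<phi>. c * u \<phi>)" using False by (simp add: norm_divide field_simps)
        then show ?thesis using cm_le[OF u, of c] by linarith
      qed
    qed (rule p0)
    have "time_cont T (seminorm_topology (gevrey s) {p}) f"
    proof (rule time_cont_gevrey_seminorm[OF f s sn])
      fix h :: real assume h: "0 < h"
      obtain K \<eta> where K: "0 \<le> K" "0 < \<eta>" "\<And>(u :: 'n functional) \<xi>. u \<in> gevrey_h h s \<Longrightarrow>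
        norm (fourier_coeff u \<xi>) \<le> K * gevrey_h_norm h s u * gdecay s \<eta> \<xi>"
        using gevrey_h_coeff_bound[OF h s, where ?'n = 'n] by blast
      obtain L where L: "\<And>u C n. 0 \<le> C \<Longrightarrow> (\<forall>\<xi>. norm (fourier_coeff u \<xi>) \<le> C * gdecay s \<eta> \<xi>) \<Longrightarrow> q u n \<le> L * C"
        using bound[OF K(2)] by blast
      have "p u \<le> (L * K) * gevrey_h_norm h s u" if u: "u \<in> gevrey_h h s" for u
        using L[of "K * gevrey_h_norm h s u" u] K(1) K(3)[OF u] gevrey_h_norm_bound(2)[OF u h]
        by (intro p_le) (simp add: mult.assoc)
      then show "\<exists>K. \<forall>u\<in>gevrey_h h s. p u \<le> K * gevrey_h_norm h s u" by blast
    qed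
    from time_cont_seminorm_bounded[OF this singletonI sn gevrey_diff[OF s]]
    obtain M where M: "\<And>t. t \<in> {0..T} \<Longrightarrow> p (f t) \<le> M" by blast
    obtain n where n: "M < real n" using reals_Archimedean2 by blast
    have "real n < q (f (\<tau> n)) n" using z[of n] by (simp add: q_def pos_less_divide_eq del: of_nat_Suc)
    also have "\<dots> \<le> M" using q_le[OF mem[OF \<tau>], of n n] M[OF \<tau>, of n] by linarith
    finally show False using n by simp
  qed
qed

section \<open>Scalar equations in the weak sense\<close>

text \<open>The classical bump exp (-1/(x (1 - x))) with an additional rational factor. The factor
  makes the class of all \<open>bump P m\<close> closed under differentiation, so smoothness follows
  from one derivative formula.\<close>

definition bump :: "real poly \<Rightarrow> nat \<Rightarrow> real \<Rightarrow> real" where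
  "bump P m x = (if 0 < x \<and> x < 1 then poly P x / (x * (1 - x)) ^ m * exp (- 1 / (x * (1 - x))) else 0)"

text \<open>With q = x (1 - x), the numerator of the derivative over the common denominator
  \<open>q ^ (m + 2)\<close>; the three terms come from the polynomial, from the power of q and from
  the exponential.\<close>

definition bump_deriv_poly :: "real poly \<Rightarrow> nat \<Rightarrow> real poly" where
  "bump_deriv_poly P m = pderiv P * [:0, 1, -1:] ^ 2 - smult (real m) (P * [:1, -2:] * [:0, 1, -1:]) + P * [:1, -2:]"

text \<open>The inequality \<open>power_le_fact_exp\<close> at 1/q shows that the exponential
  absorbs \<open>m + 2\<close> negative powers of q. The resulting quadratic bounds at both end
  points give differentiability there with derivative 0.\<close>

lemma bump_bound:
  obtains K where "K \<ge> 0" "\<And>x. \<bar>bump P m x\<bar> \<le> K * x\<^sup>2" "\<And>x. \<bar>bump P m x\<bar> \<le> K * (x - 1)\<^sup>2"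
proof -
  have "bounded (poly P ` {0..1})"
    by (intro compact_imp_bounded compact_continuous_image continuous_intros compact_Icc)
  then obtain K0 where K0: "K0 > 0" "\<And>x. x \<in> {0..1} \<Longrightarrow> \<bar>poly P x\<bar> \<le> K0"
    unfolding bounded_pos by auto
  define K where "K = K0 * fact (m + 2)"
  have main: "\<bar>bump P m x\<bar> \<le> K * (x * (1 - x))\<^sup>2" if x: "0 < x" "x < 1" for x
  proof -
    define q where "q = x * (1 - x)"
    have q: "q > 0" using x by (simp add: q_def)
    have "(1 / q) ^ (m + 2) * exp (- 1 / q) \<le> fact (m + 2) * exp (1 / q) * exp (- 1 / q)"
      using q by (intro mult_right_mono power_le_fact_exp) auto
    also have "\<dots> = fact (m + 2)" by (simp add: mult.assoc exp_add[symmetric])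
    finally have le: "(1 / q) ^ m * exp (- 1 / q) \<le> fact (m + 2) * q\<^sup>2"
      using q by (simp add: power_add power_divide field_simps power2_eq_square)
    have "\<bar>poly P x\<bar> * ((1 / q) ^ m * exp (- 1 / q)) \<le> K0 * (fact (m + 2) * q\<^sup>2)"
      by (rule mult_mono[OF K0(2) le]) (use K0 x q in auto)
    then show ?thesis using x q by (simp add: bump_def K_def q_def[symmetric] abs_mult power_divide mult_ac)
  qed
  have K: "K \<ge> 0" using K0 by (simp add: K_def)
  have "\<bar>bump P m x\<bar> \<le> K * x\<^sup>2 \<and> \<bar>bump P m x\<bar> \<le> K * (x - 1)\<^sup>2" for x
  proof (cases "0 < x \<and> x < 1")
    case True
    have "(x * (1 - x))\<^sup>2 \<le> x\<^sup>2" using True by (intro power_mono) (auto simp: mult_left_le)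
    moreover have "(x * (1 - x))\<^sup>2 \<le> (1 - x)\<^sup>2" using True by (intro power_mono) (auto simp: mult_left_le_one_le)
    ultimately show ?thesis using main[of x] True K
      by (smt (verit) mult_left_mono power2_commute)
  next
    case False
    then have "bump P m x = 0" unfolding bump_def by (rule if_not_P)
    then show ?thesis using K by simp
  qed
  with K show ?thesis by (intro that) auto
qed

lemma has_derivative_zero_of_square_bound:
  fixes f :: "real \<Rightarrow> real"
  assumes "\<And>x. \<bar>f x\<bar> \<le> K * (x - a)\<^sup>2"
  shows "(f has_real_derivative 0) (at a)"
proof -
  have fa: "f a = 0" using assms[of a] by simp
  have lim: "((\<lambda>h. K * \<bar>h\<bar>) \<longlongrightarrow> 0) (at 0)" by (rule tendsto_eq_intros refl | simp)+
  have "((\<lambda>h. (f (a + h) - f a) / h) \<longlongrightarrow> 0) (at 0)"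
  proof (rule Lim_null_comparison[OF _ lim])
    have "norm ((f (a + h) - f a) / h) \<le> K * \<bar>h\<bar>" if "h \<noteq> 0" for h
    proof -
      have "\<bar>f (a + h)\<bar> \<le> (K * \<bar>h\<bar>) * \<bar>h\<bar>" using assms[of "a + h"] by (simp add: power2_eq_square mult.assoc)
      then show ?thesis using that fa by (simp add: divide_le_eq)
    qed
    then show "\<forall>\<^sub>F h in at 0. norm ((f (a + h) - f a) / h) \<le> K * \<bar>h\<bar>"
      by (auto simp: eventually_at_filter)
  qed
  then show ?thesis by (simp add: DERIV_def)
qed

lemma quotient_rule_identity:
  fixes q :: real
  assumes q: "q \<noteq> 0"
  shows "(A * q ^ m - B * (real m * L * q ^ (m - 1))) / (q ^ m * q ^ m) + L / q\<^sup>2 * (B / q ^ m)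
    = (A * q\<^sup>2 - real m * (B * L * q) + B * L) / q ^ (m + 2)"
proof (cases m)
  case 0
  then show ?thesis using q by (simp add: power2_eq_square field_simps)
next
  case (Suc k)
  define Q where "Q = q ^ k"
  have Q: "Q \<noteq> 0" using q by (simp add: Q_def)
  have pw: "q ^ m = q * Q" "q ^ (m - 1) = Q" "q ^ (m + 2) = q * q * (q * Q)"
    by (simp_all add: Suc Q_def power_add power2_eq_square)
  show ?thesis unfolding pw power2_eq_square using q Q by (simp add: divide_simps) (simp add: algebra_simps)
qed

lemma bump_has_derivative:
  "(bump P m has_real_derivative bump (bump_deriv_poly P m) (m + 2) x) (at x)"
proof -
  consider "x < 0" | "x > 1" | "x = 0" | "x = 1" | "0 < x" "x < 1" by linarith
  then show ?thesis
  proof cases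
    case 1
    have "((\<lambda>_. 0) has_real_derivative 0) (at x)" by simp
    then have "(bump P m has_real_derivative 0) (at x)"
      by (rule has_field_derivative_transform_within_open[where S = "{..<0}"]) (use 1 in \<open>auto simp: bump_def\<close>)
    then show ?thesis using 1 by (simp add: bump_def)
  next
    case 2
    have "((\<lambda>_. 0) has_real_derivative 0) (at x)" by simp
    then have "(bump P m has_real_derivative 0) (at x)"
      by (rule has_field_derivative_transform_within_open[where S = "{1<..}"]) (use 2 in \<open>auto simp: bump_def\<close>)
    then show ?thesis using 2 by (simp add: bump_def)
  next
    case 3
    obtain K where "\<And>x. \<bar>bump P m x\<bar> \<le> K * x\<^sup>2" using bump_bound by blast
    then have "(bump P m has_real_derivative 0) (at 0)"
      by (intro has_derivative_zero_of_square_bound[where K = K]) simp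
    then show ?thesis using 3 by (simp add: bump_def)
  next
    case 4
    obtain K where "\<And>x. \<bar>bump P m x\<bar> \<le> K * (x - 1)\<^sup>2" using bump_bound by blast
    then have "(bump P m has_real_derivative 0) (at 1)"
      by (intro has_derivative_zero_of_square_bound[where K = K]) simp
    then show ?thesis using 4 by (simp add: bump_def)
  next
    case 5
    define q where "q = x * (1 - x)"
    have q: "q \<noteq> 0" using 5 by (simp add: q_def)
    have dq: "((\<lambda>x. x * (1 - x)) has_real_derivative (1 - 2 * x)) (at x)"
      by (auto intro!: derivative_eq_intros simp: algebra_simps)
    have dP: "(poly P has_real_derivative poly (pderiv P) x) (at x)" by (rule poly_DERIV)
    have d1: "((\<lambda>x. (x * (1 - x)) ^ m) has_real_derivative (real m * (1 - 2 * x) * q ^ (m - 1))) (at x)"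
      using DERIV_power[OF dq, of m] by (simp add: q_def mult_ac)
    have "((\<lambda>x. - 1 / (x * (1 - x))) has_real_derivative (1 - 2 * x) / q\<^sup>2) (at x)"
      using DERIV_divide[OF DERIV_const[of "-1"] dq] q by (simp add: q_def power2_eq_square)
    from DERIV_chain2[OF DERIV_exp this]
    have d2: "((\<lambda>x. exp (- 1 / (x * (1 - x)))) has_real_derivative exp (- 1 / q) * ((1 - 2 * x) / q\<^sup>2)) (at x)"
      by (simp add: q_def)
    have "((\<lambda>x. poly P x / (x * (1 - x)) ^ m * exp (- 1 / (x * (1 - x)))) has_real_derivative
       (poly (pderiv P) x * q ^ m - poly P x * (real m * (1 - 2 * x) * q ^ (m - 1))) / (q ^ m * q ^ m) * exp (- 1 / q)
       + exp (- 1 / q) * ((1 - 2 * x) / q\<^sup>2) * (poly P x / q ^ m)) (at x)"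
      using DERIV_mult[OF DERIV_divide[OF dP d1] d2] q by (simp add: q_def)
    also have "(poly (pderiv P) x * q ^ m - poly P x * (real m * (1 - 2 * x) * q ^ (m - 1))) / (q ^ m * q ^ m) * exp (- 1 / q)
       + exp (- 1 / q) * ((1 - 2 * x) / q\<^sup>2) * (poly P x / q ^ m) = bump (bump_deriv_poly P m) (m + 2) x"
    proof -
      have Q: "poly [:0, 1, -1:] x = q" by (simp add: q_def algebra_simps)
      have L: "poly [:1, -2:] x = 1 - 2 * x" by simp
      have factor: "X * e + e * Y * Z = (X + Y * Z) * e" for X Y Z e :: real by (simp add: algebra_simps)
      have "poly (bump_deriv_poly P m) x =
          poly (pderiv P) x * q\<^sup>2 - real m * (poly P x * (1 - 2 * x) * q) + poly P x * (1 - 2 * x)"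
        unfolding bump_deriv_poly_def poly_add poly_diff poly_mult poly_smult poly_power Q L ..
      then show ?thesis
        unfolding factor quotient_rule_identity[OF q] using 5 by (simp add: bump_def q_def[symmetric])
    qed
    finally show ?thesis
      by (rule has_field_derivative_transform_within_open[where S = "{0<..<1}"]) (use 5 in \<open>auto simp: bump_def\<close>)
  qed
qed

section \<open>Smooth steps as test functions in time\<close>

abbreviation rho :: "real \<Rightarrow> real" where "rho \<equiv> bump 1 0"

lemma continuous_on_bump': "continuous_on S (bump P m)"
  by (auto intro!: continuous_at_imp_continuous_on DERIV_isCont[OF bump_has_derivative])

lemma continuous_on_bump [continuous_intros]:
  "continuous_on S f \<Longrightarrow> continuous_on S (\<lambda>x. bump P m (f x))"
  by (rule continuous_on_compose2[OF continuous_on_bump']) auto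

lemma rho_nonneg: "0 \<le> rho x"
  by (simp add: bump_def)

text \<open>A smooth step that is not normalised: it equals \<open>step 1\<close> instead of 1 from
  the point 1 onwards. Starting the integral at -1, before the support of \<open>rho\<close>, makes
  the two-sided derivative at 0 available.\<close>

definition step :: "real \<Rightarrow> real" where
  "step x = integral {-1..x} rho"

lemma step_eq_0: "x \<le> 0 \<Longrightarrow> step x = 0"
  unfolding step_def by (subst integral_cong[of _ _ "\<lambda>_. 0"]) (auto simp: bump_def)

lemma step_has_derivative: "(step has_real_derivative rho x) (at x)"
proof (cases "x > -1")
  case True
  have "((\<lambda>u. integral {-1..u} rho) has_real_derivative rho x) (at x within {-1..x+1})"
    by (rule integral_has_real_derivative) (use True continuous_on_bump' in auto)
  moreover have "at x within {-1..x+1} = at x" by (rule at_within_interior) (use True in auto)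
  ultimately show ?thesis by (simp add: step_def[abs_def])
next
  case False
  have "((\<lambda>_. 0) has_real_derivative 0) (at x)" by simp
  then have "(step has_real_derivative 0) (at x)"
    by (rule has_field_derivative_transform_within_open[where S = "{..<0}"]) (use False step_eq_0 in auto)
  then show ?thesis using False by (simp add: bump_def)
qed

lemma step_eq_1: "1 \<le> x \<Longrightarrow> step x = step 1"
proof -
  assume x: "1 \<le> x"
  have "step x = step 1 + integral {1..x} rho"
    unfolding step_def
    by (rule Henstock_Kurzweil_Integration.integral_combine[symmetric])
      (use x in \<open>auto intro!: integrable_continuous_real continuous_on_bump'\<close>)
  also have "integral {1..x} rho = 0"
    by (subst integral_cong[of _ _ "\<lambda>_. 0"]) (auto simp: bump_def)
  finally show ?thesis by simp
qed

lemma step_1_pos: "0 < step 1"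
proof -
  have "integral {-1..1} rho \<noteq> 0"
  proof
    assume "integral {-1..1} rho = 0"
    then have "rho (1/2) = 0"
      using integral_eq_0_iff[of "-1" 1 rho] rho_nonneg continuous_on_bump' by auto
    then show False by (simp add: bump_def)
  qed
  moreover have "0 \<le> integral {-1..1} rho"
    by (intro integral_nonneg integrable_continuous_real continuous_on_bump' rho_nonneg)
  ultimately show ?thesis by (simp add: step_def)
qed

lemma smooth_funpow:
  fixes f :: "real \<Rightarrow> complex"
  assumes f: "f \<in> A" and A: "\<And>g. g \<in> A \<Longrightarrow> \<exists>g'\<in>A. \<forall>x. (g has_vector_derivative g' x) (at x)"
  shows "((\<lambda>f s. vector_derivative f (at s)) ^^ k) f \<in> A"
proof (induction k)
  case (Suc k)
  obtain g' where "g' \<in> A" "\<And>x. (((\<lambda>f s. vector_derivative f (at s)) ^^ k) f has_vector_derivative g' x) (at x)"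
    using A[OF Suc] by blast
  then have "((\<lambda>f s. vector_derivative f (at s)) ^^ Suc k) f = g'"
    by (auto simp: vector_derivative_at)
  with \<open>g' \<in> A\<close> show ?case by simp
qed (use f in simp)

lemma has_derivative_rescale:
  fixes f :: "real \<Rightarrow> real"
  assumes "(f has_real_derivative D) (at ((x - a) / \<epsilon>))"
  shows "((\<lambda>x. c * f ((x - a) / \<epsilon>)) has_real_derivative c / \<epsilon> * D) (at x)"
proof -
  have "((\<lambda>x. (x - a) / \<epsilon>) has_real_derivative 1 / \<epsilon>) (at x)"
    using DERIV_cdivide[OF DERIV_diff[OF DERIV_ident DERIV_const[of a]], of \<epsilon> x] by simp
  from DERIV_cmult[OF DERIV_chain2[OF assms this], of c] show ?thesis by simp
qed

text \<open>The derivative of this test function is the difference of two approximate identities, of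
  mass \<open>step 1\<close>, located just to the right of \<open>a\<close> and of \<open>b\<close>.
  Testing with it compares two averages.\<close>

lemma step_difference_time_test:
  assumes \<epsilon>: "0 < \<epsilon>" and ab: "0 < a" "a \<le> b" "b + \<epsilon> < T"
  defines "\<phi> \<equiv> \<lambda>x. complex_of_real (step ((x - a) / \<epsilon>) - step ((x - b) / \<epsilon>))"
  shows "\<phi> \<in> time_test T"
    and "vector_derivative \<phi> (at x) = of_real (1 / \<epsilon> * rho ((x - a) / \<epsilon>) - 1 / \<epsilon> * rho ((x - b) / \<epsilon>))"
proof -
  define B where "B P m c = (\<lambda>x. complex_of_real (c * bump P m ((x - a) / \<epsilon>) - c * bump P m ((x - b) / \<epsilon>)))" for P m c
  \<comment> \<open>\<phi> itself is not of the form \<open>B P m c\<close>, but its derivative is,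
    so it is added to make the class closed under differentiation.\<close>
  define A where "A = insert \<phi> {g. \<exists>P m c. g = B P m c}"
  have d\<phi>: "(\<phi> has_vector_derivative B 1 0 (1 / \<epsilon>) x) (at x)" for x
  proof -
    have "((\<lambda>x. 1 * step ((x - a) / \<epsilon>) - 1 * step ((x - b) / \<epsilon>)) has_real_derivative
        1 / \<epsilon> * rho ((x - a) / \<epsilon>) - 1 / \<epsilon> * rho ((x - b) / \<epsilon>)) (at x)"
      by (intro DERIV_diff has_derivative_rescale step_has_derivative)
    from has_vector_derivative_of_real[OF this] show ?thesis unfolding \<phi>_def B_def mult_1 .
  qed
  then show "vector_derivative \<phi> (at x) = of_real (1 / \<epsilon> * rho ((x - a) / \<epsilon>) - 1 / \<epsilon> * rho ((x - b) / \<epsilon>))"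
    unfolding B_def by (rule vector_derivative_at)
  have db: "(B P m c has_vector_derivative B (bump_deriv_poly P m) (m + 2) (c / \<epsilon>) x) (at x)" for P m c x
    unfolding B_def
    by (rule has_vector_derivative_of_real[OF DERIV_diff[OF has_derivative_rescale[OF bump_has_derivative]
          has_derivative_rescale[OF bump_has_derivative]]])
  have closed: "\<exists>g'\<in>A. \<forall>x. (g has_vector_derivative g' x) (at x)" if "g \<in> A" for g
    using that d\<phi> db unfolding A_def by blast
  have "((\<lambda>f s. vector_derivative f (at s)) ^^ k) \<phi> differentiable (at t)" for k t
    using closed[OF smooth_funpow[of \<phi> A k, OF _ closed]]
    by (auto simp: A_def intro: differentiableI_vector)
  moreover have "closure {t. \<phi> t \<noteq> 0} \<subseteq> {a..b + \<epsilon>}"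
  proof (rule closure_minimal)
    show "{t. \<phi> t \<noteq> 0} \<subseteq> {a..b + \<epsilon>}"
    proof (rule subsetI, rule ccontr)
      fix t assume t: "t \<in> {t. \<phi> t \<noteq> 0}" "t \<notin> {a..b + \<epsilon>}"
      then consider "t < a" | "t > b + \<epsilon>" by force
      then show False
      proof cases
        case 1
        then have "(t - a) / \<epsilon> \<le> 0" "(t - b) / \<epsilon> \<le> 0" using \<epsilon> ab by (auto simp: divide_le_0_iff)
        then show False using t by (simp add: \<phi>_def step_eq_0)
      next
        case 2
        then have "1 \<le> (t - a) / \<epsilon>" "1 \<le> (t - b) / \<epsilon>" using \<epsilon> ab by (auto simp: pos_le_divide_eq)
        then show False using t step_eq_1[of "(t - a) / \<epsilon>"] step_eq_1[of "(t - b) / \<epsilon>"] by (simp add: \<phi>_def)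
      qed
    qed
  qed simp
  ultimately show "\<phi> \<in> time_test T" using ab by (auto simp: time_test_def)
qed

text \<open>The hypothesis says that the averages of \<open>v\<close> near \<open>a\<close> and near
  \<open>b\<close> coincide. For small \<epsilon> they are close to \<open>step 1\<close> times the
  values \<open>v a\<close> and \<open>v b\<close>.\<close>

lemma du_Bois_Reymond_interior:
  fixes v :: "real \<Rightarrow> complex"
  assumes v: "continuous_on {0..T} v"
    and 0: "\<And>\<phi>. \<phi> \<in> time_test T \<Longrightarrow> integral {0..T} (\<lambda>t. vector_derivative \<phi> (at t) * v t) = 0"
    and ab: "0 < a" "a \<le> b" "b < T"
  shows "v a = v b"
proof -
  have "dist (v a) (v b) \<le> 2 * e" if e: "0 < e" for e
  proof -
    have near: "\<exists>d>0. \<forall>t\<in>{0..T}. dist t c < d \<longrightarrow> dist (v t) (v c) < e" if "c \<in> {0..T}" for c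
      using v e that unfolding continuous_on_iff by blast
    obtain d1 where d1: "d1 > 0" "\<And>t. t \<in> {0..T} \<Longrightarrow> dist t a < d1 \<Longrightarrow> dist (v t) (v a) < e" using near[of a] ab by auto
    obtain d2 where d2: "d2 > 0" "\<And>t. t \<in> {0..T} \<Longrightarrow> dist t b < d2 \<Longrightarrow> dist (v t) (v b) < e" using near[of b] ab by auto
    define \<epsilon> where "\<epsilon> = min (min d1 d2) (T - b) / 2"
    have \<epsilon>: "0 < \<epsilon>" "\<epsilon> < d1" "\<epsilon> < d2" "b + \<epsilon> < T"
      using d1(1) d2(1) ab unfolding \<epsilon>_def min_def by (auto split: if_splits simp: field_simps)
    define w where "w c t = 1 / \<epsilon> * rho ((t - c) / \<epsilon>)" for c t
    have w0: "0 \<le> w c t" for c t using \<epsilon> rho_nonneg by (simp add: w_def)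
    have w_supp: "w c t = 0" if "t \<le> c \<or> c + \<epsilon> \<le> t" for c t
      using that \<epsilon> by (auto simp: w_def bump_def divide_less_eq zero_less_divide_iff)
    have w_cont: "continuous_on S (w c)" for S c unfolding w_def using \<epsilon> by (intro continuous_intros) auto
    have w_int: "(w c has_integral step 1) {0..T}" if c: "0 < c" "c + \<epsilon> < T" for c
    proof -
      have "((\<lambda>t. step ((t - c) / \<epsilon>)) has_vector_derivative w c t) (at t within {0..T})" for t
        using has_derivative_rescale[OF step_has_derivative, where x = t and a = c and \<epsilon> = \<epsilon> and c = 1]
        unfolding w_def has_real_derivative_iff_has_vector_derivative mult_1
        by (rule has_vector_derivative_at_within)
      then have "(w c has_integral step ((T - c) / \<epsilon>) - step ((0 - c) / \<epsilon>)) {0..T}"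
        using c \<epsilon> by (intro fundamental_theorem_of_calculus) auto
      moreover have "step ((T - c) / \<epsilon>) = step 1" using c \<epsilon> by (intro step_eq_1) (simp add: pos_le_divide_eq)
      moreover have "step ((0 - c) / \<epsilon>) = 0" using c \<epsilon> by (intro step_eq_0) (simp add: divide_le_0_iff)
      ultimately show ?thesis by simp
    qed
    have approx: "norm (integral {0..T} (\<lambda>t. of_real (w c t) * v t) - of_real (step 1) * v c) \<le> e * step 1"
      if c: "0 < c" "c + \<epsilon> < T" and near: "\<And>t. t \<in> {0..T} \<Longrightarrow> dist t c < d \<Longrightarrow> dist (v t) (v c) < e" and d: "\<epsilon> < d" for c d
    proof -
      have "((\<lambda>t. of_real (w c t) * v c) has_integral of_real (step 1) * v c) {0..T}"
        by (intro has_integral_mult_left has_integral_of_real w_int c)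
      moreover have "((\<lambda>t. of_real (w c t) * v t) has_integral integral {0..T} (\<lambda>t. of_real (w c t) * v t)) {0..T}"
        by (intro integrable_integral integrable_continuous_real continuous_intros w_cont v)
      ultimately have "((\<lambda>t. of_real (w c t) * v t - of_real (w c t) * v c) has_integral
          integral {0..T} (\<lambda>t. of_real (w c t) * v t) - of_real (step 1) * v c) {0..T}"
        by (rule has_integral_diff[rotated])
      then have 1: "((\<lambda>t. of_real (w c t) * (v t - v c)) has_integral
          integral {0..T} (\<lambda>t. of_real (w c t) * v t) - of_real (step 1) * v c) {0..T}"
        by (simp add: algebra_simps)
      have 2: "((\<lambda>t. e * w c t) has_integral e * step 1) {0..T}" by (intro has_integral_mult_right w_int c)
      have "norm (of_real (w c t) * (v t - v c)) \<le> e * w c t" if t: "t \<in> {0..T}" for t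
      proof (cases "t \<le> c \<or> c + \<epsilon> \<le> t")
        case True
        then show ?thesis by (simp add: w_supp)
      next
        case False
        then have "dist t c < d" using d by (auto simp: dist_real_def)
        from near[OF t this] have "norm (v t - v c) \<le> e" by (simp add: dist_norm)
        then show ?thesis using w0[of c t] by (simp add: norm_mult mult.commute[of e] mult_left_mono)
      qed
      then have "norm (integral {0..T} (\<lambda>t. of_real (w c t) * (v t - v c))) \<le> integral {0..T} (\<lambda>t. e * w c t)"
        using 1 2 by (intro integral_norm_bound_integral) (auto simp: has_integral_integrable)
      then show ?thesis unfolding integral_unique[OF 1] integral_unique[OF 2] .
    qed
    have "integral {0..T} (\<lambda>t. of_real (w a t - w b t) * v t) = 0"
      using 0[OF step_difference_time_test(1)[OF \<epsilon>(1) ab(1,2) \<epsilon>(4)]]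
      unfolding step_difference_time_test(2)[OF \<epsilon>(1) ab(1,2) \<epsilon>(4)] by (simp add: w_def)
    moreover have "integral {0..T} (\<lambda>t. of_real (w a t - w b t) * v t) =
       integral {0..T} (\<lambda>t. of_real (w a t) * v t) - integral {0..T} (\<lambda>t. of_real (w b t) * v t)"
      unfolding of_real_diff left_diff_distrib
      by (intro integral_diff integrable_continuous_real continuous_intros w_cont v)
    ultimately have eq: "integral {0..T} (\<lambda>t. of_real (w a t) * v t) = integral {0..T} (\<lambda>t. of_real (w b t) * v t)" by simp
    have "norm (integral {0..T} (\<lambda>t. of_real (w a t) * v t) - of_real (step 1) * v a) \<le> e * step 1"
      using ab \<epsilon> by (intro approx[OF _ _ d1(2) \<epsilon>(2)]) auto
    moreover have "norm (integral {0..T} (\<lambda>t. of_real (w b t) * v t) - of_real (step 1) * v b) \<le> e * step 1"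
      using ab \<epsilon> by (intro approx[OF _ _ d2(2) \<epsilon>(3)]) auto
    ultimately have "dist (of_real (step 1) * v a) (of_real (step 1) * v b) \<le> e * step 1 + e * step 1"
      unfolding eq by (metis dist_norm dist_commute dist_triangle_le add_mono)
    then have "step 1 * dist (v a) (v b) \<le> step 1 * (2 * e)"
      using step_1_pos by (simp add: dist_norm flip: right_diff_distrib) (simp add: norm_mult mult_ac)
    then show ?thesis using step_1_pos by simp
  qed
  then have "dist (v a) (v b) \<le> 0 + e" if "0 < e" for e using that by (metis add_0 field_sum_of_halves half_gt_zero mult_2)
  then have "dist (v a) (v b) \<le> 0" by (rule field_le_epsilon)
  then show ?thesis by simp
qed

lemma du_Bois_Reymond:
  fixes v :: "real \<Rightarrow> complex"
  assumes v: "continuous_on {0..T} v" and T: "0 < T"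
    and 0: "\<And>\<phi>. \<phi> \<in> time_test T \<Longrightarrow> integral {0..T} (\<lambda>t. vector_derivative \<phi> (at t) * v t) = 0"
    and t: "t \<in> {0..T}"
  shows "v t = v 0"
proof -
  have cl: "closure {0<..<T} = {0..T}" using T by simp
  have "v s = v (T / 2)" if "s \<in> {0..T}" for s
  proof (rule continuous_constant_on_closure[where S = "{0<..<T}"])
    show "continuous_on (closure {0<..<T}) v" using v cl by simp
    show "v r = v (T / 2)" if "r \<in> {0<..<T}" for r
      using du_Bois_Reymond_interior[OF v 0, of r "T / 2"] du_Bois_Reymond_interior[OF v 0, of "T / 2" r] that T
      by (cases "r \<le> T / 2") auto
    show "s \<in> closure {0<..<T}" using that cl by simp
  qed
  from this[OF t] this[of 0] T show ?thesis by simp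
qed

lemma time_testD:
  assumes \<phi>: "\<phi> \<in> time_test T"
  shows "(\<phi> has_vector_derivative vector_derivative \<phi> (at t)) (at t within S)"
    and "continuous_on S (\<lambda>t. vector_derivative \<phi> (at t))" "continuous_on S \<phi>" "\<phi> 0 = 0" "\<phi> T = 0"
proof -
  have d: "((\<lambda>f s. vector_derivative f (at s)) ^^ k) \<phi> differentiable (at t)" for k t
    using \<phi> by (simp add: time_test_def)
  show *: "(\<phi> has_vector_derivative vector_derivative \<phi> (at t)) (at t within S)" for t S
    using d[of 0 t] by (simp add: vector_derivative_works has_vector_derivative_at_within)
  show "continuous_on S (\<lambda>t. vector_derivative \<phi> (at t))"
    using d[of 1] by (auto intro!: continuous_at_imp_continuous_on differentiable_imp_continuous_within)
  show "continuous_on S \<phi>"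
    using d[of 0] by (auto intro!: continuous_at_imp_continuous_on differentiable_imp_continuous_within)
  have "\<phi> t = 0" if "t \<notin> {0<..<T}" for t
    using \<phi> that closure_subset[of "{t. \<phi> t \<noteq> 0}"] by (auto simp: time_test_def)
  then show "\<phi> 0 = 0" "\<phi> T = 0" by auto
qed

section \<open>Variation of constants and its weak characterisation\<close>

lemma time_test_by_parts:
  assumes \<phi>: "\<phi> \<in> time_test T" and T: "0 \<le> T"
    and g: "\<And>t. t \<in> {0..T} \<Longrightarrow> (g has_vector_derivative g' t) (at t within {0..T})"
  shows "((\<lambda>t. \<phi> t * g' t + vector_derivative \<phi> (at t) * g t) has_integral 0) {0..T}"
proof -
  have "((\<lambda>t. \<phi> t * g' t + vector_derivative \<phi> (at t) * g t) has_integral \<phi> T * g T - \<phi> 0 * g 0) {0..T}"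
    using T g time_testD(1)[OF \<phi>] by (intro fundamental_theorem_of_calculus has_vector_derivative_mult) auto
  then show ?thesis by (simp add: time_testD[OF \<phi>])
qed

definition primitive :: "(real \<Rightarrow> complex) \<Rightarrow> real \<Rightarrow> complex" where
  "primitive b t = integral {0..t} b"

lemma primitive_has_derivative:
  "continuous_on {0..T} b \<Longrightarrow> t \<in> {0..T} \<Longrightarrow> (primitive b has_vector_derivative b t) (at t within {0..T})"
  unfolding primitive_def[abs_def] by (rule integral_has_vector_derivative)

lemma continuous_on_primitive [continuous_intros]:
  "continuous_on {0..T} b \<Longrightarrow> continuous_on {0..T} (primitive b)"
  by (rule continuous_on_vector_derivative) (rule primitive_has_derivative)

definition duhamel :: "(real \<Rightarrow> complex) \<Rightarrow> (real \<Rightarrow> complex) \<Rightarrow> complex \<Rightarrow> real \<Rightarrow> complex" where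
  "duhamel b F w0 t = exp (- \<i> * primitive b t) *
     (w0 + primitive (\<lambda>s. \<i> * exp (\<i> * primitive b s) * F s) t)"

lemma has_vector_derivative_exp_comp:
  fixes f :: "real \<Rightarrow> complex"
  assumes "(f has_vector_derivative f') (at t within S)"
  shows "((\<lambda>t. exp (c * f t)) has_vector_derivative c * f' * exp (c * f t)) (at t within S)"
proof -
  have "((exp \<circ> (\<lambda>t. c * f t)) has_vector_derivative (c * f') * exp (c * f t)) (at t within S)"
    by (rule field_vector_diff_chain_within)
      (auto intro!: has_vector_derivative_mult_right assms DERIV_exp has_field_derivative_at_within)
  then show ?thesis by (simp add: o_def)
qed

lemma duhamel_has_derivative:
  assumes b: "continuous_on {0..T} b" and F: "continuous_on {0..T} F" and t: "t \<in> {0..T}"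
  shows "(duhamel b F w0 has_vector_derivative - \<i> * b t * duhamel b F w0 t + \<i> * F t) (at t within {0..T})"
proof -
  let ?G = "\<lambda>s. \<i> * exp (\<i> * primitive b s) * F s"
  have G: "continuous_on {0..T} ?G" by (intro continuous_intros b F)
  have "((\<lambda>t. exp (- \<i> * primitive b t) * (w0 + primitive ?G t)) has_vector_derivative
     exp (- \<i> * primitive b t) * (0 + ?G t) + (- \<i> * b t * exp (- \<i> * primitive b t)) * (w0 + primitive ?G t)) (at t within {0..T})"
    by (intro has_vector_derivative_mult has_vector_derivative_add has_vector_derivative_const
        has_vector_derivative_exp_comp primitive_has_derivative b G t)
  moreover have key: "exp (- \<i> * primitive b t) * ?G t = \<i> * F t"
    by (simp add: exp_minus field_simps)
  have "exp (- \<i> * primitive b t) * (0 + ?G t) + (- \<i> * b t * exp (- \<i> * primitive b t)) * (w0 + primitive ?G t)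
      = - \<i> * b t * duhamel b F w0 t + \<i> * F t"
    unfolding add_0 key duhamel_def by (simp only: add.commute mult.assoc)
  ultimately show ?thesis unfolding duhamel_def[abs_def] by (simp only:)
qed

lemma duhamel_0: "duhamel b F w0 0 = w0"
  by (simp add: duhamel_def primitive_def)

lemma continuous_on_duhamel:
  assumes "continuous_on {0..T} b" "continuous_on {0..T} F"
  shows "continuous_on {0..T} (duhamel b F w0)"
  by (rule continuous_on_vector_derivative) (rule duhamel_has_derivative[OF assms])

lemma duhamel_weak:
  assumes b: "continuous_on {0..T} b" and F: "continuous_on {0..T} F" and T: "0 \<le> T" and \<phi>: "\<phi> \<in> time_test T"
  shows "((\<lambda>t. - ((1 / \<i>) * vector_derivative \<phi> (at t)) * duhamel b F w0 t
      + \<phi> t * (b t * duhamel b F w0 t) - \<phi> t * F t) has_integral 0) {0..T}"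
proof -
  have "((\<lambda>t. \<i> * (\<phi> t * (- \<i> * b t * duhamel b F w0 t + \<i> * F t) + vector_derivative \<phi> (at t) * duhamel b F w0 t))
     has_integral \<i> * 0) {0..T}"
    by (intro has_integral_mult_right time_test_by_parts[OF \<phi> T] duhamel_has_derivative[OF b F])
  then show ?thesis by (simp add: algebra_simps)
qed

text \<open>Adding to \<open>w\<close> a primitive of \<open>h\<close> gives a function with
  vanishing weak derivative, hence a constant. So \<open>w\<close> is differentiable in the
  classical sense, and its difference to Duhamel's formula, multiplied by the integrating factor,
  has derivative 0 and vanishes initially.\<close>

lemma weak_imp_duhamel:
  assumes w: "continuous_on {0..T} w" and b: "continuous_on {0..T} b" and F: "continuous_on {0..T} F" and T: "0 < T"
    and weak: "\<And>\<phi>. \<phi> \<in> time_test T \<Longrightarrow> ((\<lambda>t. - ((1 / \<i>) * vector_derivative \<phi> (at t)) * w t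
      + \<phi> t * (b t * w t) - \<phi> t * F t) has_integral 0) {0..T}"
    and t: "t \<in> {0..T}"
  shows "w t = duhamel b F (w 0) t"
proof -
  define h where "h t = \<i> * (b t * w t - F t)" for t
  have h: "continuous_on {0..T} h" unfolding h_def by (intro continuous_intros w b F)
  have const: "w s + primitive h s = w 0 + primitive h 0" if s: "s \<in> {0..T}" for s
  proof (rule du_Bois_Reymond[OF _ T _ s])
    show "continuous_on {0..T} (\<lambda>s. w s + primitive h s)" by (intro continuous_intros w h)
    fix \<phi> assume \<phi>: "\<phi> \<in> time_test T"
    have "((\<lambda>t. (- \<i>) * (- ((1 / \<i>) * vector_derivative \<phi> (at t)) * w t
      + \<phi> t * (b t * w t) - \<phi> t * F t) + (\<phi> t * h t + vector_derivative \<phi> (at t) * primitive h t)) has_integral (- \<i>) * 0 + 0) {0..T}"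
      using T by (intro has_integral_add has_integral_mult_right weak \<phi> time_test_by_parts[OF \<phi>] primitive_has_derivative h) auto
    then have "((\<lambda>t. vector_derivative \<phi> (at t) * (w t + primitive h t)) has_integral 0) {0..T}"
      by (simp add: h_def algebra_simps)
    then show "integral {0..T} (\<lambda>t. vector_derivative \<phi> (at t) * (w t + primitive h t)) = 0"
      by (rule integral_unique)
  qed
  have dw: "(w has_vector_derivative - h s) (at s within {0..T})" if s: "s \<in> {0..T}" for s
  proof -
    have "((\<lambda>s. (w 0 + primitive h 0) - primitive h s) has_vector_derivative 0 - h s) (at s within {0..T})"
      by (intro has_vector_derivative_diff has_vector_derivative_const primitive_has_derivative h s)
    then have "((\<lambda>s. (w 0 + primitive h 0) - primitive h s) has_vector_derivative - h s) (at s within {0..T})" by simp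
    then show ?thesis
      by (rule has_vector_derivative_transform[OF s, rotated]) (simp only: const[symmetric] add_diff_cancel_right')
  qed
  have zero: "((\<lambda>s. exp (\<i> * primitive b s) * (w s - duhamel b F (w 0) s)) has_vector_derivative 0) (at s within {0..T})"
    if s: "s \<in> {0..T}" for s
  proof -
    have "((\<lambda>s. exp (\<i> * primitive b s) * (w s - duhamel b F (w 0) s)) has_vector_derivative
      exp (\<i> * primitive b s) * (- h s - (- \<i> * b s * duhamel b F (w 0) s + \<i> * F s))
      + (\<i> * b s * exp (\<i> * primitive b s)) * (w s - duhamel b F (w 0) s)) (at s within {0..T})"
      by (intro has_vector_derivative_mult has_vector_derivative_diff has_vector_derivative_exp_comp
          primitive_has_derivative dw duhamel_has_derivative b F s)
    moreover have "e * (- h s - (- \<i> * b s * D + \<i> * F s)) + (\<i> * b s * e) * (w s - D) = 0" for e D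
      by (simp add: h_def algebra_simps)
    ultimately show ?thesis by (simp only:)
  qed
  obtain c where "\<And>s. s \<in> {0..T} \<Longrightarrow> exp (\<i> * primitive b s) * (w s - duhamel b F (w 0) s) = c"
    using has_vector_derivative_zero_constant[OF convex_real_interval(5) zero] by metis
  then have "exp (\<i> * primitive b t) * (w t - duhamel b F (w 0) t) = exp (\<i> * primitive b 0) * (w 0 - duhamel b F (w 0) 0)"
    using T t by simp
  then show ?thesis by (simp add: duhamel_0)
qed

section \<open>The Cauchy problem on the Fourier side\<close>

definition symb :: "(real \<Rightarrow> complex) \<Rightarrow> ('n::finite \<Rightarrow> real \<Rightarrow> complex) \<Rightarrow> (real \<Rightarrow> complex) \<Rightarrow> int^'n \<Rightarrow> real \<Rightarrow> complex" where
  "symb a2 a1 a0 \<xi> t = a2 t * (\<Sum>j\<in>UNIV. (of_int (\<xi> $ j))\<^sup>2) + (\<Sum>j\<in>UNIV. a1 j t * of_int (\<xi> $ j)) + a0 t"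

lemma fourier_coeff_spatial_op:
  assumes "v \<in> distributions"
  shows "fourier_coeff (spatial_op a2 a1 a0 t v) \<xi> = symb a2 a1 a0 \<xi> t * fourier_coeff v \<xi>"
proof -
  have "fourier_coeff (spatial_op a2 a1 a0 t v) \<xi> =
     - a2 t * (\<Sum>j\<in>UNIV. fourier_coeff (distr_partial j (distr_partial j v)) \<xi>)
     + (\<Sum>j\<in>UNIV. a1 j t * ((1 / \<i>) * fourier_coeff (distr_partial j v) \<xi>)) + a0 t * fourier_coeff v \<xi>"
    by (simp only: fourier_coeff_def spatial_op_def distr_laplacian_def distr_D_def)
  also have "(\<Sum>j\<in>UNIV. fourier_coeff (distr_partial j (distr_partial j v)) \<xi>) =
      - (\<Sum>j\<in>UNIV. (of_int (\<xi> $ j))\<^sup>2) * fourier_coeff v \<xi>"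
    by (simp add: fourier_coeff_distr_partial distr_partial_in assms sum_distrib_left sum_negf power2_eq_square mult_ac)
  also have "(\<Sum>j\<in>UNIV. a1 j t * ((1 / \<i>) * fourier_coeff (distr_partial j v) \<xi>)) =
      (\<Sum>j\<in>UNIV. a1 j t * of_int (\<xi> $ j)) * fourier_coeff v \<xi>"
    by (simp add: fourier_coeff_distr_partial assms sum_distrib_left mult_ac)
  also have "- a2 t * (- (\<Sum>j\<in>UNIV. (of_int (\<xi> $ j))\<^sup>2) * fourier_coeff v \<xi>)
      + (\<Sum>j\<in>UNIV. a1 j t * of_int (\<xi> $ j)) * fourier_coeff v \<xi> + a0 t * fourier_coeff v \<xi>
      = symb a2 a1 a0 \<xi> t * fourier_coeff v \<xi>"
    by (simp only: symb_def distrib_right mult_minus_left mult_minus_right minus_minus mult.assoc)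
  finally show ?thesis .
qed

lemma cont_family_spatial_op:
  assumes u: "cont_family T u" and a: "continuous_on {0..T} a2" "\<And>j. continuous_on {0..T} (a1 j)" "continuous_on {0..T} a0"
  shows "cont_family T (\<lambda>t. spatial_op a2 a1 a0 t (u t))"
proof -
  have "cont_family T (\<lambda>t \<psi>. - a2 t * (\<Sum>j\<in>UNIV. distr_partial j (distr_partial j (u t)) \<psi>)
     + (\<Sum>j\<in>UNIV. a1 j t * ((1 / \<i>) * distr_partial j (u t) \<psi>)) + a0 t * u t \<psi>)"
    by (intro cont_family_add cont_family_scale cont_family_sum cont_family_partial u a continuous_intros)
  then show ?thesis by (simp add: spatial_op_def[abs_def] distr_laplacian_def distr_D_def)
qed

lemma continuous_on_symb [continuous_intros]:
  assumes a: "continuous_on {0..T} a2" "\<And>j. continuous_on {0..T} (a1 j)" "continuous_on {0..T} a0"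
  shows "continuous_on {0..T} (symb a2 a1 a0 \<xi>)"
  unfolding symb_def[abs_def] by (intro continuous_intros a)

lemma cont_family_coeff_continuous:
  "cont_family T u \<Longrightarrow> continuous_on {0..T} (\<lambda>t. fourier_coeff (u t) \<xi>)"
  unfolding fourier_coeff_def by (rule cont_familyD(2))

lemma cont_family_coeff_bound:
  assumes "cont_family T u"
  obtains C k where "C \<ge> 0" "\<And>t \<xi>. t \<in> {0..T} \<Longrightarrow> norm (fourier_coeff (u t) \<xi>) \<le> C * wt \<xi> ^ k"
proof -
  obtain C k where C: "C \<ge> 0" "\<And>t \<phi> B. t \<in> {0..T} \<Longrightarrow> \<phi> \<in> torus_smooth \<Longrightarrow>
    (\<And>js x. length js \<le> k \<Longrightarrow> norm (partial_derivs js \<phi> x) \<le> B) \<Longrightarrow> norm (u t \<phi>) \<le> C * B"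
    using cont_family_bound[OF assms] by blast
  have "norm (fourier_coeff (u t) \<xi>) \<le> C * wt \<xi> ^ k" if t: "t \<in> {0..T}" for t \<xi>
    unfolding fourier_coeff_eq
  proof (rule C(2)[OF t])
    fix js :: "'a list" and x :: "real^'a"
    assume "length js \<le> k"
    then have "wt (-\<xi>) ^ length js \<le> wt (-\<xi>) ^ k" by (intro power_increasing wt_ge_1)
    then show "norm (partial_derivs js (expo (-\<xi>)) x) \<le> wt \<xi> ^ k"
      using norm_isym_le[of js "-\<xi>"] by (simp add: partial_derivs_expo norm_mult)
  qed simp
  with C(1) show ?thesis by (rule that)
qed

lemma has_integral_const_0: "0 \<le> T \<Longrightarrow> ((\<lambda>s. c :: real) has_integral T * c) {0..T}"
  using has_integral_const_real[of c 0 T] by simp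

lemma integral_le_const_bound:
  fixes h :: "real \<Rightarrow> real"
  assumes "h integrable_on {0..T}" "\<And>s. s \<in> {0..T} \<Longrightarrow> h s \<le> K" "0 \<le> T"
  shows "integral {0..T} h \<le> T * K"
  using has_integral_le[OF integrable_integral[OF assms(1)] has_integral_const_0[OF assms(3)] assms(2)] .

lemma fourier_coeff_distr_integral:
  "fourier_coeff (distr_integral T w) \<xi> = integral {0..T} (\<lambda>t. fourier_coeff (w t) \<xi>)"
  by (simp add: fourier_coeff_def distr_integral_def)

section \<open>Existence, uniqueness and nonexistence from bounds on the symbol\<close>

context
  fixes T :: real and a2 a0 :: "real \<Rightarrow> complex" and a1 :: "'n::finite \<Rightarrow> real \<Rightarrow> complex"
  assumes T: "0 < T"
    and a: "continuous_on {0..T} a2" "\<And>j. continuous_on {0..T} (a1 j)" "continuous_on {0..T} a0"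
begin

abbreviation "symbol \<equiv> symb a2 a1 a0"

text \<open>Both sides of the tested equation are distributions, so their equality can be checked on
  coefficients, where it is the weak scalar equation for \<open>symbol \<xi>\<close>. The latter is
  equivalent to Duhamel's formula together with the initial value.\<close>

lemma solves_CP_iff:
  fixes f u :: "real \<Rightarrow> 'n functional"
  assumes f: "cont_family T f" and g: "g \<in> distributions"
  shows "solves_CP T a2 a1 a0 f g u \<longleftrightarrow> (\<exists>\<rho>. time_cont T (sobolev_top \<rho>) u) \<and>
    (\<forall>t\<in>{0..T}. \<forall>\<xi>. fourier_coeff (u t) \<xi> =
      duhamel (symbol \<xi>) (\<lambda>s. fourier_coeff (f s) \<xi>) (fourier_coeff g \<xi>) t)"
    (is "?L \<longleftrightarrow> _ \<and> ?R")
proof (cases "\<exists>\<rho>. time_cont T (sobolev_top \<rho>) u")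
  case True
  then have u: "cont_family T u" using cont_family_time_cont by blast
  have u0: "u 0 \<in> distributions" using cont_familyD(1)[OF u, of 0] T by simp
  note cf = cont_family_coeff_continuous
  have sp: "cont_family T (\<lambda>t. spatial_op a2 a1 a0 t (u t))" by (rule cont_family_spatial_op[OF u a])
  have sc: "continuous_on {0..T} (symbol \<xi>)" for \<xi> by (rule continuous_on_symb[OF a])
  show ?thesis
  proof -
    have eq: "((\<lambda>\<psi>. weak_Dt T u \<phi> \<psi> + distr_integral T (\<lambda>t \<psi>. \<phi> t * spatial_op a2 a1 a0 t (u t) \<psi>) \<psi>)
        = distr_integral T (\<lambda>t \<psi>. \<phi> t * f t \<psi>)) \<longleftrightarrow>
        (\<forall>\<xi>. ((\<lambda>t. - ((1 / \<i>) * vector_derivative \<phi> (at t)) * fourier_coeff (u t) \<xi>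
        + \<phi> t * (symbol \<xi> t * fourier_coeff (u t) \<xi>) - \<phi> t * fourier_coeff (f t) \<xi>) has_integral 0) {0..T})"
      (is "?l = ?r \<longleftrightarrow> (\<forall>\<xi>. ?H \<xi>)") if \<phi>: "\<phi> \<in> time_test T" for \<phi>
    proof -
      note c\<phi> = time_testD(2,3)[OF \<phi>]
      have w1: "cont_family T (\<lambda>t \<psi>. - ((1 / \<i>) * vector_derivative \<phi> (at t)) * u t \<psi>)"
        by (intro cont_family_scale u continuous_intros c\<phi>)
      have w2: "cont_family T (\<lambda>t \<psi>. \<phi> t * spatial_op a2 a1 a0 t (u t) \<psi>)"
        by (intro cont_family_scale sp c\<phi>)
      have w3: "cont_family T (\<lambda>t \<psi>. \<phi> t * f t \<psi>)" by (intro cont_family_scale f c\<phi>)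
      have l: "?l \<in> distributions"
        unfolding weak_Dt_def using T by (intro distributions_add distr_integral_in w1 w2) auto
      have r: "?r \<in> distributions" using T by (intro distr_integral_in w3) auto
      have hi: "((\<lambda>t. fourier_coeff (w t) \<xi>) has_integral fourier_coeff (distr_integral T w) \<xi>) {0..T}"
        if "cont_family T w" for w :: "real \<Rightarrow> 'n functional" and \<xi>
        unfolding fourier_coeff_distr_integral by (intro integrable_integral integrable_continuous_real cf that)
      have H_iff: "?H \<xi> \<longleftrightarrow> fourier_coeff ?l \<xi> = fourier_coeff ?r \<xi>" for \<xi>
      proof -
        let ?g = "\<lambda>t. fourier_coeff (\<lambda>\<psi>. - ((1 / \<i>) * vector_derivative \<phi> (at t)) * u t \<psi>) \<xi>
          + fourier_coeff (\<lambda>\<psi>. \<phi> t * spatial_op a2 a1 a0 t (u t) \<psi>) \<xi> - fourier_coeff (\<lambda>\<psi>. \<phi> t * f t \<psi>) \<xi>"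
        have A: "(?g has_integral (fourier_coeff ?l \<xi> - fourier_coeff ?r \<xi>)) {0..T}"
          using has_integral_diff[OF has_integral_add[OF hi[OF w1] hi[OF w2]] hi[OF w3]]
          unfolding fourier_coeff_linear(1) weak_Dt_def .
        have B: "?H \<xi> \<longleftrightarrow> (?g has_integral 0) {0..T}"
        proof (rule has_integral_cong)
          fix t assume t: "t \<in> {0..T}"
          show "- ((1 / \<i>) * vector_derivative \<phi> (at t)) * fourier_coeff (u t) \<xi>
            + \<phi> t * (symbol \<xi> t * fourier_coeff (u t) \<xi>) - \<phi> t * fourier_coeff (f t) \<xi> = ?g t"
            using fourier_coeff_spatial_op[OF cont_familyD(1)[OF u t], of a2 a1 a0 t \<xi>]
            unfolding fourier_coeff_def by (simp only:)
        qed
        show ?thesis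
        proof
          assume "?H \<xi>"
          then have "(?g has_integral 0) {0..T}" by (simp only: B)
          from has_integral_unique[OF A this] show "fourier_coeff ?l \<xi> = fourier_coeff ?r \<xi>"
            by (simp only: right_minus_eq)
        next
          assume "fourier_coeff ?l \<xi> = fourier_coeff ?r \<xi>"
          then show "?H \<xi>" using A by (simp only: B diff_self)
        qed
      qed
      show ?thesis
      proof
        assume "?l = ?r"
        then show "\<forall>\<xi>. ?H \<xi>" by (simp only: H_iff) simp
      next
        assume "\<forall>\<xi>. ?H \<xi>"
        then show "?l = ?r" by (intro distr_eqI[OF l r]) (simp only: H_iff)
      qed
    qed
    show ?thesis
    proof
      assume L: ?L
      then have g0: "u 0 = g" by (simp add: solves_CP_def)
      have "fourier_coeff (u t) \<xi> = duhamel (symbol \<xi>) (\<lambda>s. fourier_coeff (f s) \<xi>) (fourier_coeff (u 0) \<xi>) t"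
        if t: "t \<in> {0..T}" for t \<xi>
      proof (rule weak_imp_duhamel[OF cf[OF u] sc cf[OF f] T _ t])
        fix \<phi> assume \<phi>: "\<phi> \<in> time_test T"
        then show "((\<lambda>t. - ((1 / \<i>) * vector_derivative \<phi> (at t)) * fourier_coeff (u t) \<xi>
          + \<phi> t * (symbol \<xi> t * fourier_coeff (u t) \<xi>) - \<phi> t * fourier_coeff (f t) \<xi>) has_integral 0) {0..T}"
          using L eq[OF \<phi>] by (simp add: solves_CP_def)
      qed
      then show "(\<exists>\<rho>. time_cont T (sobolev_top \<rho>) u) \<and> ?R" using True g0 by simp
    next
      assume R: "(\<exists>\<rho>. time_cont T (sobolev_top \<rho>) u) \<and> ?R"
      have "u 0 = g" using R T by (intro distr_eqI[OF u0 g]) (simp add: duhamel_0)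
      moreover have "((\<lambda>t. - ((1 / \<i>) * vector_derivative \<phi> (at t)) * fourier_coeff (u t) \<xi>
          + \<phi> t * (symbol \<xi> t * fourier_coeff (u t) \<xi>) - \<phi> t * fourier_coeff (f t) \<xi>) has_integral 0) {0..T}"
        if \<phi>: "\<phi> \<in> time_test T" for \<phi> \<xi>
      proof -
        have "?thesis \<longleftrightarrow> ((\<lambda>t. - ((1 / \<i>) * vector_derivative \<phi> (at t)) * duhamel (symbol \<xi>) (\<lambda>s. fourier_coeff (f s) \<xi>) (fourier_coeff g \<xi>) t
          + \<phi> t * (symbol \<xi> t * duhamel (symbol \<xi>) (\<lambda>s. fourier_coeff (f s) \<xi>) (fourier_coeff g \<xi>) t)
          - \<phi> t * fourier_coeff (f t) \<xi>) has_integral 0) {0..T}"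
          by (rule has_integral_cong) (use R in simp)
        also have "\<dots>" using T by (intro duhamel_weak sc cf[OF f] \<phi>) simp
        finally show ?thesis by simp
      qed
      ultimately show ?L using True eq unfolding solves_CP_def by blast
    qed
  qed
next
  case False
  then show ?thesis by (auto simp: solves_CP_def)
qed

lemma Im_primitive_symbol:
  assumes "0 \<le> s" "s \<le> t" "t \<le> T"
  shows "Im (primitive (symbol \<xi>) t) - Im (primitive (symbol \<xi>) s) = integral {s..t} (\<lambda>r. Im (symbol \<xi> r))"
proof -
  have int: "symbol \<xi> integrable_on {0..t}"
    using assms by (intro integrable_continuous_real continuous_on_subset[OF continuous_on_symb[OF a]]) auto
  have "integral {0..s} (symbol \<xi>) + integral {s..t} (symbol \<xi>) = integral {0..t} (symbol \<xi>)"
    using assms by (intro Henstock_Kurzweil_Integration.integral_combine int) auto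
  then have "Im (primitive (symbol \<xi>) t) - Im (primitive (symbol \<xi>) s) = Im (integral {s..t} (symbol \<xi>))"
    unfolding primitive_def by (simp add: complex_eq_iff)
  also have "\<dots> = integral {s..t} (\<lambda>r. Im (symbol \<xi> r))"
  proof -
    have "symbol \<xi> integrable_on {s..t}" using int assms by (intro integrable_on_subinterval[OF int]) auto
    then show ?thesis using integral_linear[OF _ bounded_linear_Im, of "symbol \<xi>" "{s..t}"] by (simp add: o_def)
  qed
  finally show ?thesis .
qed

text \<open>A source at time s reaches time t multiplied by a factor of modulus exp (Im B(t) - Im
  B(s)), B being \<open>primitive b\<close>. Hence the increments between all pairs of times have to
  be bounded, not only those starting at 0.\<close>

lemma norm_duhamel_le:
  assumes b: "continuous_on {0..T} b" and F: "continuous_on {0..T} F" and t: "t \<in> {0..T}"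
    and L: "\<And>s t. 0 \<le> s \<Longrightarrow> s \<le> t \<Longrightarrow> t \<le> T \<Longrightarrow> Im (primitive b t) - Im (primitive b s) \<le> L"
  shows "norm (duhamel b F w0 t) \<le> exp L * (norm w0 + integral {0..T} (\<lambda>s. norm (F s)))"
proof -
  let ?G = "\<lambda>s. \<i> * exp (\<i> * primitive b s) * F s"
  have sub: "{0..t} \<subseteq> {0..T}" using t by auto
  have cont: "continuous_on {0..T} (\<lambda>s. exp (- \<i> * primitive b t) * ?G s)" by (intro continuous_intros b F)
  have int: "(\<lambda>s. norm (F s)) integrable_on {0..T}" by (intro integrable_continuous_real continuous_intros F)
  have int': "(\<lambda>s. norm (F s)) integrable_on {0..t}"
    by (rule integrable_on_subinterval[OF int sub])
  have eq: "duhamel b F w0 t = exp (- \<i> * primitive b t) * w0 + integral {0..t} (\<lambda>s. exp (- \<i> * primitive b t) * ?G s)"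
    unfolding duhamel_def primitive_def[of ?G] integral_mult_right by (rule distrib_left)
  have "norm (exp (- \<i> * primitive b t) * w0) = exp (Im (primitive b t) - Im (primitive b 0)) * norm w0"
    by (simp add: norm_mult primitive_def[of _ 0])
  also have "\<dots> \<le> exp L * norm w0" using L[of 0 t] t by (intro mult_right_mono) auto
  finally have 1: "norm (exp (- \<i> * primitive b t) * w0) \<le> exp L * norm w0" .
  have "norm (integral {0..t} (\<lambda>s. exp (- \<i> * primitive b t) * ?G s)) \<le> integral {0..t} (\<lambda>s. exp L * norm (F s))"
  proof (rule integral_norm_bound_integral)
    show "(\<lambda>s. exp (- \<i> * primitive b t) * ?G s) integrable_on {0..t}"
      by (intro integrable_continuous_real continuous_on_subset[OF cont sub])
    show "(\<lambda>s. exp L * norm (F s)) integrable_on {0..t}" by (intro integrable_on_mult_right int')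
    fix s assume s: "s \<in> {0..t}"
    have "norm (exp (- \<i> * primitive b t) * ?G s) = exp (Im (primitive b t)) * exp (- Im (primitive b s)) * norm (F s)"
      by (simp add: norm_mult)
    also have "\<dots> = exp (Im (primitive b t) - Im (primitive b s)) * norm (F s)"
      by (simp add: exp_diff exp_minus divide_inverse)
    also have "\<dots> \<le> exp L * norm (F s)" using L[of s t] s t by (intro mult_right_mono) auto
    finally show "norm (exp (- \<i> * primitive b t) * ?G s) \<le> exp L * norm (F s)" .
  qed
  also have "\<dots> = exp L * integral {0..t} (\<lambda>s. norm (F s))" by simp
  also have "\<dots> \<le> exp L * integral {0..T} (\<lambda>s. norm (F s))"
    by (intro mult_left_mono integral_subset_le sub int int') auto
  finally have 2: "norm (integral {0..t} (\<lambda>s. exp (- \<i> * primitive b t) * ?G s)) \<le> exp L * integral {0..T} (\<lambda>s. norm (F s))" .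
  show ?thesis unfolding eq distrib_left by (rule norm_triangle_le[OF add_mono[OF 1 2]])
qed

text \<open>The Cauchy-Schwarz inequality against the constant 1, from the nonnegative integral of
  the squared deviation of \<open>h\<close> from its mean.\<close>

lemma integral_squared_le:
  fixes h :: "real \<Rightarrow> real"
  assumes h: "continuous_on {0..T} h"
  shows "(integral {0..T} h)\<^sup>2 \<le> T * integral {0..T} (\<lambda>s. (h s)\<^sup>2)"
proof -
  define A where "A = integral {0..T} h"
  have i1: "(h has_integral A) {0..T}"
    unfolding A_def by (intro integrable_integral integrable_continuous_real h)
  have i2: "((\<lambda>s. (h s)\<^sup>2) has_integral integral {0..T} (\<lambda>s. (h s)\<^sup>2)) {0..T}"
    by (intro integrable_integral integrable_continuous_real continuous_intros h)
  have "((\<lambda>s. (h s)\<^sup>2 - 2 * (A / T) * h s + (A / T)\<^sup>2) has_integral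
     (integral {0..T} (\<lambda>s. (h s)\<^sup>2) - 2 * (A / T) * A + T * (A / T)\<^sup>2)) {0..T}"
    using T by (intro has_integral_add has_integral_diff i2 has_integral_mult_right i1 has_integral_const_0) auto
  then have "0 \<le> integral {0..T} (\<lambda>s. (h s)\<^sup>2) - 2 * (A / T) * A + T * (A / T)\<^sup>2"
  proof (rule has_integral_nonneg)
    fix s
    have "0 \<le> (h s - A / T)\<^sup>2" by simp
    also have "\<dots> = (h s)\<^sup>2 - 2 * (A / T) * h s + (A / T)\<^sup>2" by (simp add: power2_diff)
    finally show "0 \<le> (h s)\<^sup>2 - 2 * (A / T) * h s + (A / T)\<^sup>2" .
  qed
  then have "0 \<le> T * (integral {0..T} (\<lambda>s. (h s)\<^sup>2) - 2 * (A / T) * A + T * (A / T)\<^sup>2)" using T by simp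
  also have "\<dots> = T * integral {0..T} (\<lambda>s. (h s)\<^sup>2) - A\<^sup>2"
    using T by (simp add: field_simps power2_eq_square)
  finally show ?thesis by (simp add: A_def)
qed

lemma time_cont_imp_unique:
  fixes f u v :: "real \<Rightarrow> 'n functional"
  assumes f: "cont_family T f" and g: "g \<in> distributions"
    and u: "solves_CP T a2 a1 a0 f g u" and v: "solves_CP T a2 a1 a0 f g v" and t: "t \<in> {0..T}"
  shows "v t = u t"
proof (rule distr_eqI)
  have "cont_family T u" "cont_family T v"
    using u v cont_family_time_cont unfolding solves_CP_def by blast+
  then show "v t \<in> distributions" "u t \<in> distributions" using t cont_familyD(1) by blast+
  show "fourier_coeff (v t) \<xi> = fourier_coeff (u t) \<xi>" for \<xi>
    using u v t unfolding solves_CP_iff[OF f g] by simp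
qed

definition solution :: "(real \<Rightarrow> 'n functional) \<Rightarrow> 'n functional \<Rightarrow> real \<Rightarrow> 'n functional" where
  "solution f g t = distr_of_coeffs (\<lambda>\<xi>. duhamel (symbol \<xi>) (\<lambda>s. fourier_coeff (f s) \<xi>) (fourier_coeff g \<xi>) t)"

text \<open>Since \<open>L\<close> does not depend on \<xi>, the coefficients of the solution are
  controlled by those of the data with the same weight, so no derivatives are lost and uniformly
  small tails of the data pass on to the solution.\<close>

lemma well_posed_sobolev:
  assumes L: "\<And>\<xi> s t. 0 \<le> s \<Longrightarrow> s \<le> t \<Longrightarrow> t \<le> T \<Longrightarrow>
      Im (primitive (symbol \<xi>) t) - Im (primitive (symbol \<xi>) s) \<le> L"
  shows "well_posed_in (sobolev_top r) T a2 a1 a0"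
  unfolding well_posed_in_def
proof (intro allI impI, elim conjE)
  fix f :: "real \<Rightarrow> 'n functional" and g :: "'n functional"
  assume f: "time_cont T (sobolev_top r) f" and g': "g \<in> topspace (sobolev_top r)"
  have g: "g \<in> sobolev r" using g' by simp
  note gd = sobolevD(1)[OF g]
  have cf: "cont_family T f" by (rule cont_family_time_cont[OF f])
  note fc = cont_family_coeff_continuous[OF cf]
  have sc: "continuous_on {0..T} (symbol \<xi>)" for \<xi> by (rule continuous_on_symb[OF a])
  define D where "D \<xi> = duhamel (symbol \<xi>) (\<lambda>s. fourier_coeff (f s) \<xi>) (fourier_coeff g \<xi>)" for \<xi>
  have D: "norm (D \<xi> t) \<le> exp L * (norm (fourier_coeff g \<xi>) + integral {0..T} (\<lambda>s. norm (fourier_coeff (f s) \<xi>)))"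
    if "t \<in> {0..T}" for t \<xi> unfolding D_def by (rule norm_duhamel_le[OF sc fc that L])
  obtain C k where C: "C \<ge> 0" "\<And>\<xi>. norm (fourier_coeff g \<xi>) \<le> C * wt \<xi> ^ k" using fourier_coeff_bound[OF gd] by blast
  obtain C' k' where C': "C' \<ge> 0" "\<And>t \<xi>. t \<in> {0..T} \<Longrightarrow> norm (fourier_coeff (f t) \<xi>) \<le> C' * wt \<xi> ^ k'"
    using cont_family_coeff_bound[OF cf] by blast
  \<comment> \<open>Polynomial growth is what turns the scalar solutions into the coefficients of a
    distribution at each time.\<close>
  have poly: "norm (D \<xi> t) \<le> exp L * (C + T * C') * wt \<xi> ^ max k k'" if t: "t \<in> {0..T}" for t \<xi>
  proof -
    have "integral {0..T} (\<lambda>s. norm (fourier_coeff (f s) \<xi>)) \<le> T * (C' * wt \<xi> ^ k')"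
      using T by (intro integral_le_const_bound integrable_continuous_real continuous_intros fc C'(2)) auto
    also have "\<dots> \<le> T * (C' * wt \<xi> ^ max k k')"
      using T C' by (intro mult_left_mono power_increasing wt_ge_1) auto
    finally have "integral {0..T} (\<lambda>s. norm (fourier_coeff (f s) \<xi>)) \<le> T * (C' * wt \<xi> ^ max k k')" .
    moreover have "norm (fourier_coeff g \<xi>) \<le> C * wt \<xi> ^ max k k'"
      using C(2)[of \<xi>] mult_left_mono[OF power_increasing[OF _ wt_ge_1[of \<xi>], of k "max k k'"] C(1)] by simp
    ultimately have "norm (fourier_coeff g \<xi>) + integral {0..T} (\<lambda>s. norm (fourier_coeff (f s) \<xi>)) \<le> (C + T * C') * wt \<xi> ^ max k k'"
      by (simp add: distrib_right mult.assoc)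
    then show ?thesis unfolding mult.assoc[of "exp L"] by (intro order_trans[OF D[OF t]] mult_left_mono) auto
  qed
  define u where "u = solution f g"
  have u_eq: "u t = distr_of_coeffs (\<lambda>\<xi>. D \<xi> t)" for t by (simp add: u_def solution_def D_def)
  have ud: "u t \<in> distributions" and uc: "fourier_coeff (u t) \<xi> = D \<xi> t" if "t \<in> {0..T}" for t \<xi>
    unfolding u_eq using distr_of_coeffs_in[OF poly[OF that]] fourier_coeff_distr_of_coeffs[OF poly[OF that]] by auto
  have tails: "\<exists>F. finite F \<and> (\<forall>t G. t \<in> {0..T} \<longrightarrow> finite G \<longrightarrow> G \<inter> F = {} \<longrightarrow>
      (\<Sum>\<xi>\<in>G. sobolev_weight r (u t) \<xi>) \<le> e)" if e: "0 < e" for e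
  proof -
    \<comment> \<open>\<open>M\<close> collects the squared amplification and the 2 from squaring a
      sum. In the definition of \<open>e'\<close>, the summand 1 belongs to \<open>g\<close>, and
      the square of \<open>T\<close> belongs to \<open>f\<close>: one factor from Cauchy-Schwarz and
      one from integrating the tail over time.\<close>
    define M where "M = 2 * (exp L)\<^sup>2"
    define e' where "e' = e / (M * (1 + T\<^sup>2))"
    have M: "M > 0" by (simp add: M_def)
    have e': "e' > 0" using e M T by (simp add: e'_def add_pos_pos)
    obtain F1 where F1: "finite F1" "\<And>G. finite G \<Longrightarrow> G \<inter> F1 = {} \<Longrightarrow> sum (sobolev_weight r g) G \<le> e'"
      using summable_on_tail[OF sobolevD(2)[OF g] sobolev_weight_nonneg e'] by blast
    obtain F2 where F2: "finite F2" "\<And>t G. t \<in> {0..T} \<Longrightarrow> finite G \<Longrightarrow> G \<inter> F2 = {} \<Longrightarrow>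
      (\<Sum>\<xi>\<in>G. sobolev_weight r (f t) \<xi>) \<le> e'"
      using time_cont_sobolev_tails[OF f e'] by blast
    have "(\<Sum>\<xi>\<in>G. sobolev_weight r (u t) \<xi>) \<le> e"
      if t: "t \<in> {0..T}" and G: "finite G" "G \<inter> (F1 \<union> F2) = {}" for t G
    proof -
      define W where "W \<xi> = (wt \<xi> powr r)\<^sup>2" for \<xi> :: "int^'n"
      have sw: "sobolev_weight r v \<xi> = (norm (fourier_coeff v \<xi>))\<^sup>2 * W \<xi>" for v \<xi>
        by (simp add: sobolev_weight_eq W_def power_mult_distrib)
      have le: "sobolev_weight r (u t) \<xi> \<le> M * (sobolev_weight r g \<xi> + T * integral {0..T} (\<lambda>s. sobolev_weight r (f s) \<xi>))" for \<xi>
      proof -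
        let ?I = "integral {0..T} (\<lambda>s. norm (fourier_coeff (f s) \<xi>))"
        have "(norm (D \<xi> t))\<^sup>2 \<le> (exp L * (norm (fourier_coeff g \<xi>) + ?I))\<^sup>2"
          using D[OF t] by (intro power_mono) auto
        also have "\<dots> = (exp L)\<^sup>2 * (norm (fourier_coeff g \<xi>) + ?I)\<^sup>2" by (simp add: power_mult_distrib)
        also have "(norm (fourier_coeff g \<xi>) + ?I)\<^sup>2 \<le> 2 * (norm (fourier_coeff g \<xi>))\<^sup>2 + 2 * ?I\<^sup>2"
          using norm_add_squared_le[of "norm (fourier_coeff g \<xi>)" ?I] by simp
        also have "?I\<^sup>2 \<le> T * integral {0..T} (\<lambda>s. (norm (fourier_coeff (f s) \<xi>))\<^sup>2)"
          by (intro integral_squared_le continuous_intros fc)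
        finally have "(norm (D \<xi> t))\<^sup>2 \<le> M * ((norm (fourier_coeff g \<xi>))\<^sup>2 + T * integral {0..T} (\<lambda>s. (norm (fourier_coeff (f s) \<xi>))\<^sup>2))"
          by (simp add: M_def algebra_simps)
        then have "(norm (D \<xi> t))\<^sup>2 * W \<xi> \<le> M * ((norm (fourier_coeff g \<xi>))\<^sup>2 + T * integral {0..T} (\<lambda>s. (norm (fourier_coeff (f s) \<xi>))\<^sup>2)) * W \<xi>"
          by (intro mult_right_mono) (simp_all add: W_def)
        also have "\<dots> = M * ((norm (fourier_coeff g \<xi>))\<^sup>2 * W \<xi> + T * integral {0..T} (\<lambda>s. (norm (fourier_coeff (f s) \<xi>))\<^sup>2 * W \<xi>))"
          unfolding integral_mult_left by (simp add: algebra_simps)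
        finally show ?thesis unfolding sw uc[OF t] .
      qed
      have "(\<Sum>\<xi>\<in>G. sobolev_weight r (u t) \<xi>) \<le>
          (\<Sum>\<xi>\<in>G. M * (sobolev_weight r g \<xi> + T * integral {0..T} (\<lambda>s. sobolev_weight r (f s) \<xi>)))"
        by (intro sum_mono le)
      also have "\<dots> = M * (sum (sobolev_weight r g) G + T * (\<Sum>\<xi>\<in>G. integral {0..T} (\<lambda>s. sobolev_weight r (f s) \<xi>)))"
        by (simp only: sum_distrib_left[symmetric] sum.distrib)
      also have "(\<Sum>\<xi>\<in>G. integral {0..T} (\<lambda>s. sobolev_weight r (f s) \<xi>)) = integral {0..T} (\<lambda>s. \<Sum>\<xi>\<in>G. sobolev_weight r (f s) \<xi>)"
        unfolding sw by (intro integral_sum[symmetric] G integrable_continuous_real continuous_intros fc)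
      also have "\<dots> \<le> T * e'"
      proof (rule integral_le_const_bound)
        show "(\<lambda>s. \<Sum>\<xi>\<in>G. sobolev_weight r (f s) \<xi>) integrable_on {0..T}"
          unfolding sw by (intro integrable_continuous_real continuous_intros fc)
      qed (use F2(2) G T in auto)
      also have "sum (sobolev_weight r g) G \<le> e'" using F1(2)[of G] G by blast
      finally have "(\<Sum>\<xi>\<in>G. sobolev_weight r (u t) \<xi>) \<le> M * (e' + T * (T * e'))" using M T by simp
      also have "\<dots> = M * (1 + T\<^sup>2) * e'" by (simp add: algebra_simps power2_eq_square)
      also have "\<dots> = e" using M T by (simp add: e'_def add_pos_pos less_imp_neq[THEN not_sym])
      finally show ?thesis .
    qed
    then show ?thesis using F1(1) F2(1) by (intro exI[of _ "F1 \<union> F2"]) blast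
  qed
  have "continuous_on {0..T} (D \<xi>)" for \<xi> unfolding D_def by (rule continuous_on_duhamel[OF sc fc])
  then have ucont: "continuous_on {0..T} (\<lambda>t. fourier_coeff (u t) \<xi>)" for \<xi>
    using continuous_on_cong[of "{0..T}" "{0..T}" "\<lambda>t. fourier_coeff (u t) \<xi>" "D \<xi>"] uc by simp
  have tc: "time_cont T (sobolev_top r) u" by (rule time_cont_sobolevI[OF ud ucont tails])
  have sol: "solves_CP T a2 a1 a0 f g u"
    unfolding solves_CP_iff[OF cf gd] using tc uc by (auto simp: D_def)
  show "\<exists>u. time_cont T (sobolev_top r) u \<and> solves_CP T a2 a1 a0 f g u \<and>
      (\<forall>v. time_cont T (sobolev_top r) v \<and> solves_CP T a2 a1 a0 f g v \<longrightarrow> (\<forall>t\<in>{0..T}. v t = u t))"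
    using tc sol time_cont_imp_unique[OF cf gd sol] by blast
qed

text \<open>The coefficients are dominated, uniformly in time, by those of one fixed distribution
  lying in all Sobolev spaces; its tails bound the tails of all \<open>f t\<close>.\<close>

lemma gdecay_time_cont_sobolev:
  fixes f :: "real \<Rightarrow> 'n functional"
  assumes s: "0 < s" "0 < \<eta>"
    and dist: "\<And>t. t \<in> {0..T} \<Longrightarrow> f t \<in> distributions"
    and cont: "\<And>\<xi>. continuous_on {0..T} (\<lambda>t. fourier_coeff (f t) \<xi>)"
    and bd: "\<And>t \<xi>. t \<in> {0..T} \<Longrightarrow> norm (fourier_coeff (f t) \<xi>) \<le> C * gdecay s \<eta> \<xi>"
  shows "time_cont T (sobolev_top r) f"
proof (rule time_cont_sobolevI[OF dist cont])
  fix e :: real assume e: "0 < e"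
  define c where "c \<xi> = complex_of_real (\<bar>C\<bar> * gdecay s \<eta> \<xi>)" for \<xi> :: "int^'n"
  have rc: "rapid c" by (rule gdecay_rapid[where C = "\<bar>C\<bar>" and s = s and \<eta> = \<eta>]) (use s in \<open>auto simp: c_def norm_mult\<close>)
  obtain B where B: "norm (c \<xi>) * wt \<xi> ^ 0 \<le> B" for \<xi> using rc unfolding rapid_def by blast
  have B': "norm (c \<xi>) \<le> B * wt \<xi> ^ 0" for \<xi> using B[of \<xi>] by simp
  let ?v = "distr_of_coeffs c"
  note v = distr_of_coeffs_in[OF B'] fourier_coeff_distr_of_coeffs[OF B']
  have "?v \<in> sobolev r" by (rule rapid_sobolev[OF v(1)]) (use rc v(2) in \<open>simp add: rapid_def\<close>)
  from summable_on_tail[OF sobolevD(2)[OF this] sobolev_weight_nonneg e]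
  obtain F where F: "finite F" "\<And>G. finite G \<Longrightarrow> G \<inter> F = {} \<Longrightarrow> sum (sobolev_weight r ?v) G \<le> e" by blast
  have "sobolev_weight r (f t) \<xi> \<le> sobolev_weight r ?v \<xi>" if t: "t \<in> {0..T}" for t \<xi>
  proof -
    have "norm (fourier_coeff (f t) \<xi>) \<le> \<bar>C\<bar> * gdecay s \<eta> \<xi>"
      by (rule order_trans[OF bd[OF t] mult_right_mono[OF abs_ge_self]]) simp
    also have "\<dots> = norm (fourier_coeff ?v \<xi>)" by (simp add: v(2) c_def norm_mult)
    finally show ?thesis unfolding sobolev_weight_eq by (intro power_mono mult_right_mono) auto
  qed
  then have "(\<Sum>\<xi>\<in>G. sobolev_weight r (f t) \<xi>) \<le> e" if "t \<in> {0..T}" "finite G" "G \<inter> F = {}" for t G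
    using F(2)[OF that(2,3)] sum_mono[of G "sobolev_weight r (f t)" "sobolev_weight r ?v"] that(1) by (meson order_trans)
  with F(1) show "\<exists>F. finite F \<and> (\<forall>t G. t \<in> {0..T} \<longrightarrow> finite G \<longrightarrow> G \<inter> F = {} \<longrightarrow>
      (\<Sum>\<xi>\<in>G. sobolev_weight r (f t) \<xi>) \<le> e)" by blast
qed

section \<open>Gevrey well-posedness and its failure\<close>

lemma powr_absorb:
  fixes A B \<sigma> \<sigma>' :: real
  assumes "0 \<le> A" "0 < B" "0 \<le> \<sigma>" "\<sigma> < \<sigma>'"
  obtains D where "\<And>x. 1 \<le> x \<Longrightarrow> A * x powr \<sigma> \<le> B * x powr \<sigma>' + D"
proof
  \<comment> \<open>The base point is the crossover of the two powers: beyond it the larger exponent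
    dominates, and below it the left-hand side is at most its value at \<open>x0\<close>.\<close>
  define x0 where "x0 = (A / B) powr (1 / (\<sigma>' - \<sigma>)) + 1"
  fix x :: real assume x: "1 \<le> x"
  show "A * x powr \<sigma> \<le> B * x powr \<sigma>' + A * x0 powr \<sigma>"
  proof (cases "x \<le> x0")
    case True
    have "A * x powr \<sigma> \<le> A * x0 powr \<sigma>" using assms x True by (intro mult_left_mono powr_mono2) auto
    then show ?thesis using assms by (simp add: add_increasing)
  next
    case False
    have "A / B = ((A / B) powr (1 / (\<sigma>' - \<sigma>))) powr (\<sigma>' - \<sigma>)"
      using assms by (cases "A = 0") (auto simp: powr_powr)
    also have "\<dots> \<le> x powr (\<sigma>' - \<sigma>)"
      using False assms by (intro powr_mono2) (auto simp: x0_def)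
    finally have "A \<le> B * x powr (\<sigma>' - \<sigma>)" using assms by (simp add: field_simps)
    then have "A * x powr \<sigma> \<le> B * x powr (\<sigma>' - \<sigma>) * x powr \<sigma>" by (intro mult_right_mono) auto
    also have "\<dots> = B * x powr \<sigma>'" by (simp add: mult.assoc flip: powr_add)
    finally show ?thesis using assms by (simp add: add_increasing2)
  qed
qed

text \<open>As \<sigma> < 1/\<tau>, the amplification exp (A wt^\<sigma>) is at most a constant
  times the inverse of a decay factor of any positive rate. Half of the rate of the data is spent on
  it and the solution keeps the other half.\<close>

lemma well_posed_gevrey:
  assumes \<tau>: "1 \<le> \<tau>" and \<sigma>: "0 \<le> \<sigma>" "\<sigma> < 1 / \<tau>" and A: "0 \<le> A"
    and L: "\<And>\<xi> s t. 0 \<le> s \<Longrightarrow> s \<le> t \<Longrightarrow> t \<le> T \<Longrightarrow>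
      Im (primitive (symbol \<xi>) t) - Im (primitive (symbol \<xi>) s) \<le> A * wt \<xi> powr \<sigma>"
  shows "well_posed_in (gevrey_top \<tau>) T a2 a1 a0"
  unfolding well_posed_in_def
proof (intro allI impI, elim conjE)
  fix f :: "real \<Rightarrow> 'n functional" and g :: "'n functional"
  assume f: "time_cont T (gevrey_top \<tau>) f" and g': "g \<in> topspace (gevrey_top \<tau>)"
  have \<tau>0: "0 < \<tau>" using \<tau> by simp
  have gv: "g \<in> gevrey \<tau>" using g' \<tau> by simp
  then have gd: "g \<in> distributions" by (simp add: gevrey_iff[OF \<tau>])
  obtain C1 \<eta>1 where g: "0 < \<eta>1" "\<And>\<xi>. norm (fourier_coeff g \<xi>) \<le> C1 * gdecay \<tau> \<eta>1 \<xi>"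
    using gv by (auto simp: gevrey_iff[OF \<tau>])
  note fd = time_cont_gevreyD(1)[OF f \<tau>] and fc = time_cont_gevreyD(2)[OF f \<tau>]
  obtain C2 \<eta>2 where f2: "0 < \<eta>2" "\<And>t \<xi>. t \<in> {0..T} \<Longrightarrow> norm (fourier_coeff (f t) \<xi>) \<le> C2 * gdecay \<tau> \<eta>2 \<xi>"
    using time_cont_gevreyD(3)[OF f \<tau>] by blast
  have cf: "cont_family T f"
    by (rule cont_family_time_cont[OF gdecay_time_cont_sobolev[OF \<tau>0 f2(1) fd fc f2(2), where r = 0]])
  have sc: "continuous_on {0..T} (symbol \<xi>)" for \<xi> by (rule continuous_on_symb[OF a])
  define \<eta> where "\<eta> = min \<eta>1 \<eta>2"
  have \<eta>: "0 < \<eta>" using g(1) f2(1) by (simp add: \<eta>_def)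
  have C12: "0 \<le> C1" "0 \<le> C2" using gdecay_bound_nonneg[OF g(2)] gdecay_bound_nonneg[OF f2(2)[of 0]] T by auto
  obtain D where D: "\<And>x. 1 \<le> x \<Longrightarrow> A * x powr \<sigma> \<le> \<eta> / 2 * x powr (1 / \<tau>) + D"
    using powr_absorb[OF A _ \<sigma>, of "\<eta> / 2"] \<eta> by auto
  define E where "E \<xi> = duhamel (symbol \<xi>) (\<lambda>s. fourier_coeff (f s) \<xi>) (fourier_coeff g \<xi>)" for \<xi>
  define C where "C = exp D * (C1 + T * C2)"
  have E: "norm (E \<xi> t) \<le> C * gdecay \<tau> (\<eta> / 2) \<xi>" if t: "t \<in> {0..T}" for t \<xi>
  proof -
    have "integral {0..T} (\<lambda>s. norm (fourier_coeff (f s) \<xi>)) \<le> T * (C2 * gdecay \<tau> \<eta>2 \<xi>)"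
      using T by (intro integral_le_const_bound integrable_continuous_real continuous_intros fc f2(2)) auto
    also have "\<dots> \<le> T * C2 * gdecay \<tau> \<eta> \<xi>"
      using T C12 gdecay_mono[of \<eta> \<eta>2 \<tau> \<xi>] by (simp add: \<eta>_def mult.assoc mult_left_mono)
    finally have 1: "integral {0..T} (\<lambda>s. norm (fourier_coeff (f s) \<xi>)) \<le> T * C2 * gdecay \<tau> \<eta> \<xi>" .
    have "C1 * gdecay \<tau> \<eta>1 \<xi> \<le> C1 * gdecay \<tau> \<eta> \<xi>"
      using C12 by (intro mult_left_mono gdecay_mono) (auto simp: \<eta>_def)
    with g(2)[of \<xi>] 1 have "norm (fourier_coeff g \<xi>) + integral {0..T} (\<lambda>s. norm (fourier_coeff (f s) \<xi>)) \<le> (C1 + T * C2) * gdecay \<tau> \<eta> \<xi>"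
      by (simp add: distrib_right)
    moreover have "0 \<le> norm (fourier_coeff g \<xi>) + integral {0..T} (\<lambda>s. norm (fourier_coeff (f s) \<xi>))"
      by (intro add_nonneg_nonneg integral_nonneg integrable_continuous_real continuous_intros fc) auto
    ultimately have "exp (A * wt \<xi> powr \<sigma>) * (norm (fourier_coeff g \<xi>) + integral {0..T} (\<lambda>s. norm (fourier_coeff (f s) \<xi>)))
       \<le> exp (\<eta> / 2 * wt \<xi> powr (1 / \<tau>) + D) * ((C1 + T * C2) * gdecay \<tau> \<eta> \<xi>)"
      using D[OF wt_ge_1[of \<xi>]] by (intro mult_mono) auto
    also have "exp (\<eta> / 2 * wt \<xi> powr (1 / \<tau>) + D) = exp D / gdecay \<tau> (\<eta> / 2) \<xi>"
    proof -
      have "exp (X + D) = exp D / exp (- X)" for X :: real by (simp add: exp_add exp_minus divide_inverse)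
      then show ?thesis unfolding gdecay_def by (simp only: mult_minus_left)
    qed
    also have "exp D / gdecay \<tau> (\<eta> / 2) \<xi> * ((C1 + T * C2) * gdecay \<tau> \<eta> \<xi>) = C * gdecay \<tau> (\<eta> / 2) \<xi>"
      by (simp add: C_def gdecay_half[of \<tau> \<eta>])
    finally show ?thesis
      unfolding E_def using norm_duhamel_le[OF sc fc t L, of \<xi> \<xi> "fourier_coeff g \<xi>"] by linarith
  qed
  have \<eta>2: "0 < \<eta> / 2" using \<eta> by simp
  have bd: "norm (E \<xi> t) \<le> C * wt \<xi> ^ 0" if t: "t \<in> {0..T}" for t \<xi>
    using E[OF t, of \<xi>] gdecay_le_1[of "\<eta> / 2" \<tau> \<xi>] \<eta>2 gdecay_bound_nonneg[OF E[OF t, of \<xi>]]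
    by (simp add: mult_left_le order_trans)
  define u where "u = solution f g"
  have u_eq: "u t = distr_of_coeffs (\<lambda>\<xi>. E \<xi> t)" for t by (simp add: u_def solution_def E_def)
  have ud: "u t \<in> distributions" and uc: "fourier_coeff (u t) \<xi> = E \<xi> t" if "t \<in> {0..T}" for t \<xi>
    unfolding u_eq using distr_of_coeffs_in[OF bd[OF that]] fourier_coeff_distr_of_coeffs[OF bd[OF that]] by auto
  have "continuous_on {0..T} (E \<xi>)" for \<xi> unfolding E_def by (rule continuous_on_duhamel[OF sc fc])
  then have ucont: "continuous_on {0..T} (\<lambda>t. fourier_coeff (u t) \<xi>)" for \<xi>
    using continuous_on_cong[of "{0..T}" "{0..T}" "\<lambda>t. fourier_coeff (u t) \<xi>" "E \<xi>"] uc by simp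
  have ub: "norm (fourier_coeff (u t) \<xi>) \<le> C * gdecay \<tau> (\<eta> / 2) \<xi>" if "t \<in> {0..T}" for t \<xi>
    using E[OF that] uc[OF that] by simp
  have tc: "time_cont T (gevrey_top \<tau>) u" by (rule time_cont_gevreyI[OF \<tau> \<eta>2 ud ucont ub])
  have tc0: "time_cont T (sobolev_top 0) u" by (rule gdecay_time_cont_sobolev[OF \<tau>0 \<eta>2 ud ucont ub])
  have sol: "solves_CP T a2 a1 a0 f g u"
    unfolding solves_CP_iff[OF cf gd] using tc0 uc by (auto simp: E_def)
  show "\<exists>u. time_cont T (gevrey_top \<tau>) u \<and> solves_CP T a2 a1 a0 f g u \<and>
      (\<forall>v. time_cont T (gevrey_top \<tau>) v \<and> solves_CP T a2 a1 a0 f g v \<longrightarrow> (\<forall>t\<in>{0..T}. v t = u t))"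
    using tc sol time_cont_imp_unique[OF cf gd sol] by blast
qed

text \<open>The phase of \<open>f\<close> is chosen such that all contributions to the solution at time \<open>ts \<xi>\<close>
  add up without cancellation.\<close>

lemma no_solution:
  fixes ts :: "int^'n \<Rightarrow> real"
  assumes s: "1 \<le> s" and h: "0 < h" and ts: "\<And>\<xi>. ts \<xi> \<in> {0..T}"
    and big: "\<And>C k. \<exists>\<xi>. C * wt \<xi> ^ k < gdecay s h \<xi> * integral {0..ts \<xi>}
      (\<lambda>r. exp (Im (primitive (symbol \<xi>) (ts \<xi>)) - Im (primitive (symbol \<xi>) r)))"
  obtains f :: "real \<Rightarrow> 'n functional" where "time_cont T Cinf_top f"
    "\<And>\<tau>. s \<le> \<tau> \<Longrightarrow> time_cont T (gevrey_top \<tau>) f"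
    "\<And>u. \<not> solves_CP T a2 a1 a0 f (\<lambda>_. 0) u"
proof -
  have sc: "continuous_on {0..T} (symbol \<xi>)" for \<xi> by (rule continuous_on_symb[OF a])
  have s0: "0 < s" using s by simp
  define c where "c \<xi> r = of_real (gdecay s h \<xi>) * (- \<i> *
    exp (\<i> * of_real (Re (primitive (symbol \<xi>) (ts \<xi>)) - Re (primitive (symbol \<xi>) r))))" for \<xi> r
  have nc: "norm (c \<xi> r) = gdecay s h \<xi>" for \<xi> r by (simp add: c_def norm_mult)
  define f where "f r = distr_of_coeffs (\<lambda>\<xi>. c \<xi> r)" for r
  have bd: "norm (c \<xi> r) \<le> 1 * wt \<xi> ^ 0" for \<xi> r using gdecay_le_1[of h s \<xi>] h by (simp add: nc)
  have fd: "f r \<in> distributions" and fcoeff: "fourier_coeff (f r) \<xi> = c \<xi> r" for r \<xi>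
    unfolding f_def using distr_of_coeffs_in[OF bd] fourier_coeff_distr_of_coeffs[OF bd] by auto
  have cc: "continuous_on {0..T} (c \<xi>)" for \<xi>
    unfolding c_def by (intro continuous_intros sc)
  have fc: "continuous_on {0..T} (\<lambda>r. fourier_coeff (f r) \<xi>)" for \<xi>
    unfolding fcoeff using cc by simp
  have fb: "norm (fourier_coeff (f r) \<xi>) \<le> 1 * gdecay s h \<xi>" for r \<xi> by (simp add: fcoeff nc)
  have sob: "time_cont T (sobolev_top r) f" for r
    by (rule gdecay_time_cont_sobolev[OF s0 h fd fc fb])
  have cf: "cont_family T f" by (rule cont_family_time_cont[OF sob[of 0]])
  have zd: "(\<lambda>_. 0) \<in> (distributions :: 'n functional set)"
    by (auto simp: distributions_def intro!: exI[of _ 0])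
  \<comment> \<open>Raising the Gevrey order weakens the required decay since
    \<open>wt \<xi> \<ge> 1\<close>; the same source therefore serves all orders from
    \<open>s\<close> on, \<open>s\<close> included.\<close>
  have gev: "time_cont T (gevrey_top \<tau>) f" if \<tau>: "s \<le> \<tau>" for \<tau>
  proof (rule time_cont_gevreyI[OF _ h fd fc])
    show "1 \<le> \<tau>" using s \<tau> by simp
    fix r and \<xi> :: "int^'n"
    have "wt \<xi> powr (1 / \<tau>) \<le> wt \<xi> powr (1 / s)"
      using s \<tau> wt_ge_1[of \<xi>] by (intro powr_mono) (auto simp: field_simps)
    then have "gdecay s h \<xi> \<le> gdecay \<tau> h \<xi>" using h by (simp add: gdecay_def)
    then show "norm (fourier_coeff (f r) \<xi>) \<le> 1 * gdecay \<tau> h \<xi>" using fb[of r \<xi>] by simp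
  qed
  have "\<not> solves_CP T a2 a1 a0 f (\<lambda>_. 0) u" for u
  proof
    assume sol: "solves_CP T a2 a1 a0 f (\<lambda>_. 0) u"
    then have cu: "cont_family T u" using cont_family_time_cont unfolding solves_CP_def by blast
    \<comment> \<open>A solution is by definition continuous into some Sobolev space, so its
      coefficients grow at most polynomially, uniformly in time. This is the only property that the
      contradiction uses, hence it excludes solutions in every regularity class.\<close>
    obtain C k where C: "C \<ge> 0" "\<And>t \<xi>. t \<in> {0..T} \<Longrightarrow> norm (fourier_coeff (u t) \<xi>) \<le> C * wt \<xi> ^ k"
      using cont_family_coeff_bound[OF cu] by blast
    obtain \<xi> where \<xi>: "C * wt \<xi> ^ k < gdecay s h \<xi> * integral {0..ts \<xi>}
      (\<lambda>r. exp (Im (primitive (symbol \<xi>) (ts \<xi>)) - Im (primitive (symbol \<xi>) r)))" using big by blast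
    let ?p = "primitive (symbol \<xi>)" and ?t = "ts \<xi>"
    have phase: "exp (- \<i> * ?p ?t) * (\<i> * exp (\<i> * ?p r) * c \<xi> r) =
        of_real (gdecay s h \<xi> * exp (Im (?p ?t) - Im (?p r)))" for r
    proof -
      have "exp (- \<i> * ?p ?t) * (\<i> * exp (\<i> * ?p r) * c \<xi> r) = of_real (gdecay s h \<xi>) *
         (exp (- \<i> * ?p ?t) * exp (\<i> * ?p r) * exp (\<i> * of_real (Re (?p ?t) - Re (?p r))))"
        unfolding c_def by (simp add: mult_ac)
      also have "exp (- \<i> * ?p ?t) * exp (\<i> * ?p r) * exp (\<i> * of_real (Re (?p ?t) - Re (?p r)))
         = exp (of_real (Im (?p ?t) - Im (?p r)))"
        unfolding exp_add[symmetric] by (rule arg_cong[of _ _ exp]) (simp add: complex_eq_iff)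
      finally show ?thesis by (simp only: exp_of_real of_real_mult)
    qed
    have "fourier_coeff (u ?t) \<xi> = duhamel (symbol \<xi>) (\<lambda>r. c \<xi> r) 0 ?t"
      using sol ts[of \<xi>] unfolding solves_CP_iff[OF cf zd] by (simp add: fcoeff)
    also have "\<dots> = integral {0..?t} (\<lambda>r. exp (- \<i> * ?p ?t) * (\<i> * exp (\<i> * ?p r) * c \<xi> r))"
      unfolding duhamel_def primitive_def[of "\<lambda>s. \<i> * exp (\<i> * primitive (symbol \<xi>) s) * c \<xi> s"]
        integral_mult_right by simp
    also have "\<dots> = of_real (integral {0..?t} (\<lambda>r. gdecay s h \<xi> * exp (Im (?p ?t) - Im (?p r))))"
    proof -
      have "continuous_on {0..T} (\<lambda>r. gdecay s h \<xi> * exp (Im (?p ?t) - Im (?p r)))"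
        by (intro continuous_intros sc)
      then have "(\<lambda>r. gdecay s h \<xi> * exp (Im (?p ?t) - Im (?p r))) integrable_on {0..?t}"
        using ts[of \<xi>] by (intro integrable_continuous_real) (auto elim: continuous_on_subset)
      from has_integral_of_real[OF integrable_integral[OF this]]
      show ?thesis unfolding phase by (rule integral_unique)
    qed
    finally have "fourier_coeff (u ?t) \<xi> = of_real (gdecay s h \<xi> * integral {0..?t} (\<lambda>r. exp (Im (?p ?t) - Im (?p r))))"
      unfolding integral_mult_right .
    then have "norm (fourier_coeff (u ?t) \<xi>) \<ge> gdecay s h \<xi> * integral {0..?t} (\<lambda>r. exp (Im (?p ?t) - Im (?p r)))"
      by (simp only: norm_of_real abs_ge_self)
    with C(2)[OF ts, of \<xi> \<xi>] \<xi> show False by linarith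
  qed
  then show ?thesis using that time_cont_CinfI[OF sob] gev by blast
qed

end

section \<open>Growth at the degenerate times\<close>

lemma rpow_pos_eq: "0 < x \<Longrightarrow> rpow x a = x powr a"
  by (simp add: rpow_def)

lemma rpow_nonneg: "0 \<le> rpow x a"
  by (simp add: rpow_def)

lemma rpow_mono: "0 \<le> a \<Longrightarrow> 0 \<le> x \<Longrightarrow> x \<le> y \<Longrightarrow> rpow x a \<le> rpow y a"
  by (simp add: rpow_def powr_mono2)

lemma rpow_le_rpow:
  assumes "0 \<le> x" "x \<le> d" "0 \<le> a" "a \<le> b"
  shows "rpow x b \<le> (1 + d) powr (b - a) * rpow x a"
proof (cases "x = 0")
  case True
  then show ?thesis using assms by (auto simp: rpow_def)
next
  case False
  then have x: "x > 0" using assms by simp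
  have "x powr b = x powr (b - a) * x powr a" by (simp flip: powr_add)
  also have "\<dots> \<le> (1 + d) powr (b - a) * x powr a"
    using assms x by (intro mult_right_mono powr_mono2) auto
  finally show ?thesis using x by (simp add: rpow_pos_eq)
qed

lemma quadratic_bound:
  fixes e b X :: real
  assumes "0 < e"
  shows "- e * X\<^sup>2 + b * X \<le> b\<^sup>2 / (4 * e)"
proof -
  have "0 \<le> (2 * e * X - b)\<^sup>2" by simp
  then have "(- e * X\<^sup>2 + b * X) * (4 * e) \<le> b\<^sup>2"
    by (simp add: power2_eq_square algebra_simps)
  then show ?thesis using assms by (simp add: pos_le_divide_eq)
qed

text \<open>The positive part of \<open>- \<epsilon> r\<^sup>p X\<^sup>2 + C r\<^sup>q X\<close> lives on \<open>r \<le> R\<close> with \<open>R\<close> proportional to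
  \<open>X\<close> to the power \<open>-1/(p - q)\<close>, where it is at most \<open>M\<close>; the product \<open>M R\<close> carries the
  growth rate \<open>(p - 2 q - 1)/(p - q)\<close>.\<close>

lemma degenerate_growth:
  fixes \<epsilon> C d p q \<sigma> :: real
  assumes \<epsilon>: "0 < \<epsilon>" and C: "0 < C" and d: "0 < d" and p: "0 < p" and q: "0 \<le> q" and \<sigma>: "0 \<le> \<sigma>"
    and pq: "p \<le> 2 * q + 1 \<or> (p - 2 * q - 1) / (p - q) \<le> \<sigma>"
  obtains K where "0 \<le> K" "\<And>X. 1 \<le> X \<Longrightarrow> \<exists>M R. 0 \<le> M \<and> 0 \<le> R \<and> M * R \<le> K * X powr \<sigma> \<and>
    (\<forall>r. 0 \<le> r \<longrightarrow> r \<le> d \<longrightarrow> - \<epsilon> * rpow r p * X\<^sup>2 + C * rpow r q * X \<le> K + (if r \<le> R then M else 0))"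
proof (cases "p \<le> q")
  case True
  \<comment> \<open>If p \<le> q, the first order term vanishes at least as fast as the damping. The
    common factor r^p can be taken out and the remaining quadratic in X is bounded, so no growth
    window is needed.\<close>
  define D where "D = C * (1 + d) powr (q - p)"
  define K where "K = (1 + d) powr p * (D\<^sup>2 / (4 * \<epsilon>))"
  have K: "0 \<le> K" using \<epsilon> by (simp add: K_def)
  have "- \<epsilon> * rpow r p * X\<^sup>2 + C * rpow r q * X \<le> K" if X: "1 \<le> X" and r: "0 \<le> r" "r \<le> d" for X r
  proof -
    have "C * rpow r q * X \<le> C * ((1 + d) powr (q - p) * rpow r p) * X"
      using C X rpow_le_rpow[OF r less_imp_le[OF p] True] by (intro mult_right_mono mult_left_mono) auto
    then have "- \<epsilon> * rpow r p * X\<^sup>2 + C * rpow r q * X \<le> rpow r p * (- \<epsilon> * X\<^sup>2 + D * X)"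
      by (simp add: D_def algebra_simps)
    also have "\<dots> \<le> rpow r p * (D\<^sup>2 / (4 * \<epsilon>))"
      by (intro mult_left_mono quadratic_bound \<epsilon> rpow_nonneg)
    also have "\<dots> \<le> K"
    proof -
      have "rpow r p \<le> (1 + d) powr p" using r p by (simp add: rpow_def powr_mono2)
      then show ?thesis unfolding K_def using \<epsilon> by (intro mult_right_mono) auto
    qed
    finally show ?thesis .
  qed
  then show ?thesis using K by (intro that[of K]) (auto intro!: exI[of _ 0])
next
  case False
  \<comment> \<open>The product \<open>M * R\<close> is C X R^(q + 1), and \<open>R\<close> is
    proportional to X^(-1/(p - q)). This gives the power 1 - \<gamma>, which equals (p - 2q - 1)/(p
    - q).\<close>
  define \<gamma> where "\<gamma> = (q + 1) / (p - q)"
  define K where "K = C * (C / \<epsilon>) powr \<gamma>"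
  have pq0: "p - q > 0" using False by simp
  have K: "0 \<le> K" using C by (simp add: K_def)
  have "\<exists>M R. 0 \<le> M \<and> 0 \<le> R \<and> M * R \<le> K * X powr \<sigma> \<and>
    (\<forall>r. 0 \<le> r \<longrightarrow> r \<le> d \<longrightarrow> - \<epsilon> * rpow r p * X\<^sup>2 + C * rpow r q * X \<le> K + (if r \<le> R then M else 0))"
    if X: "1 \<le> X" for X
  proof -
    define R where "R = (C / (\<epsilon> * X)) powr (1 / (p - q))"
    define M where "M = C * X * rpow R q"
    have R: "0 < R" using C \<epsilon> X by (simp add: R_def)
    have M: "0 \<le> M" using C X by (simp add: M_def rpow_nonneg)
    have "M * R = C * X * R powr (q + 1)"
      using R by (simp add: M_def rpow_pos_eq powr_add mult.assoc)
    also have "R powr (q + 1) = (C / (\<epsilon> * X)) powr \<gamma>"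
      by (simp add: R_def powr_powr \<gamma>_def)
    also have "\<dots> = (C / \<epsilon>) powr \<gamma> * X powr (- \<gamma>)"
      using C \<epsilon> X by (simp add: powr_divide powr_mult powr_minus field_simps)
    also have "C * X * ((C / \<epsilon>) powr \<gamma> * X powr (- \<gamma>)) = K * X powr (1 - \<gamma>)"
      using X by (simp add: K_def powr_diff powr_minus field_simps)
    also have "\<dots> \<le> K * X powr \<sigma>"
    proof -
      have "1 - \<gamma> = (p - 2 * q - 1) / (p - q)" using pq0 by (simp add: \<gamma>_def field_simps)
      also have "\<dots> \<le> \<sigma>" using pq
      proof
        assume "p \<le> 2 * q + 1"
        then have "(p - 2 * q - 1) / (p - q) \<le> 0" using pq0 by (intro divide_nonpos_pos) auto
        then show ?thesis using \<sigma> by linarith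
      qed
      finally show ?thesis using K X by (intro mult_left_mono powr_mono) auto
    qed
    finally have MR: "M * R \<le> K * X powr \<sigma>" .
    have "- \<epsilon> * rpow r p * X\<^sup>2 + C * rpow r q * X \<le> K + (if r \<le> R then M else 0)" if r: "0 \<le> r" for r
    proof (cases "r \<le> R")
      case True
      have "C * X * rpow r q \<le> M" unfolding M_def using C X r True q by (intro mult_left_mono rpow_mono) auto
      moreover have "0 \<le> \<epsilon> * rpow r p * X\<^sup>2" using \<epsilon> by (simp add: rpow_nonneg)
      ultimately show ?thesis using True K by (simp add: mult_ac)
    next
      case False
      then have r0: "0 < r" using R by simp
      have "C / (\<epsilon> * X) = R powr (p - q)"
        using C \<epsilon> X pq0 by (simp add: R_def powr_powr)
      also have "\<dots> \<le> r powr (p - q)" using False R pq0 by (intro powr_mono2) auto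
      finally have "C \<le> \<epsilon> * X * r powr (p - q)" using \<epsilon> X by (simp add: pos_divide_le_eq mult_ac)
      then have "C * (r powr q * X) \<le> \<epsilon> * X * r powr (p - q) * (r powr q * X)"
        using X by (intro mult_right_mono) auto
      also have "\<dots> = \<epsilon> * (r powr (p - q) * r powr q) * X\<^sup>2" by (simp add: power2_eq_square mult_ac)
      also have "r powr (p - q) * r powr q = r powr p" by (simp flip: powr_add)
      finally have "- \<epsilon> * rpow r p * X\<^sup>2 + C * rpow r q * X \<le> 0"
        using r0 by (simp add: rpow_pos_eq mult_ac)
      then show ?thesis using False K by simp
    qed
    then show ?thesis using M R MR by (intro exI[of _ M] exI[of _ R]) auto
  qed
  then show ?thesis using K that by blast
qed

lemma integral_near_le:
  fixes c :: real
  assumes "0 \<le> R" "0 \<le> M" "s \<le> u"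
  shows "(\<lambda>r. if \<bar>r - c\<bar> \<le> R then M else 0) integrable_on {s..u}"
    and "integral {s..u} (\<lambda>r. if \<bar>r - c\<bar> \<le> R then M else 0) \<le> 2 * R * M"
proof -
  let ?S = "{max s (c - R)..min u (c + R)}"
  have "((\<lambda>r. if r \<in> ?S then M else 0) has_integral measure lborel ?S *\<^sub>R M) {s..u}"
    by (subst has_integral_restrict) (simp, rule has_integral_const_real)
  moreover have "(if r \<in> ?S then M else 0) = (if \<bar>r - c\<bar> \<le> R then M else 0)" if "r \<in> {s..u}" for r
    using that by (auto simp: abs_le_iff)
  ultimately have *: "((\<lambda>r. if \<bar>r - c\<bar> \<le> R then M else 0) has_integral measure lborel ?S *\<^sub>R M) {s..u}"
    by (rule has_integral_eq[rotated])
  then show "(\<lambda>r. if \<bar>r - c\<bar> \<le> R then M else 0) integrable_on {s..u}" by blast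
  have "measure lborel ?S \<le> 2 * R" using assms by (simp add: min_def max_def)
  then show "integral {s..u} (\<lambda>r. if \<bar>r - c\<bar> \<le> R then M else 0) \<le> 2 * R * M"
    unfolding integral_unique[OF *] using assms by (simp add: mult_right_mono)
qed

section \<open>Upper bound for the growth under the hypotheses on the zeros\<close>

locale degenerate_cauchy =
  fixes T \<delta> :: real
    and a2 a0 :: "real \<Rightarrow> complex"
    and a1 :: "'n::finite \<Rightarrow> real \<Rightarrow> complex"
    and m :: nat
    and t :: "nat \<Rightarrow> real"
    and p :: "nat \<Rightarrow> real"
    and q :: "'n \<Rightarrow> nat \<Rightarrow> real"
    and \<alpha> :: "nat \<Rightarrow> real \<Rightarrow> real"
    and \<beta> :: "'n \<Rightarrow> nat \<Rightarrow> real \<Rightarrow> real"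
    and I :: "nat \<Rightarrow> real set"
    and qmin :: "nat \<Rightarrow> real"
  assumes T: "T > 0"
    and cont: "continuous_on {0..T} a2" "\<And>j. continuous_on {0..T} (a1 j)" "continuous_on {0..T} a0"
    and nonpos: "\<And>s. s \<in> {0..T} \<Longrightarrow> Im (a2 s) \<le> 0"
    and t_mem: "t ` {1..m} \<subseteq> {0..T}"
    and zeros: "\<And>s. s \<in> {0..T} \<Longrightarrow> Im (a2 s) = 0 \<longleftrightarrow> s \<in> t ` {1..m}"
    and \<delta>: "\<delta> > 0"
    and I_eq: "\<And>k. I k = {t k - \<delta>..t k + \<delta>} \<inter> {0..T}"
    and h3: "\<And>k. k \<in> {1..m} \<Longrightarrow> p k > 0 \<and> bounded (\<alpha> k ` I k) \<and>
      (\<exists>\<epsilon>>0. \<forall>s\<in>I k. \<alpha> k s \<le> - \<epsilon>) \<and>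
      (\<forall>s\<in>I k. Im (a2 s) = \<alpha> k s * rpow \<bar>s - t k\<bar> (p k))"
    and h4: "\<And>j k. k \<in> {1..m} \<Longrightarrow> q j k \<ge> 0 \<and> bounded (\<beta> j k ` I k) \<and>
      (\<forall>s\<in>I k. \<beta> j k s \<noteq> 0) \<and>
      (\<forall>s\<in>I k. Im (a1 j s) = \<beta> j k s * rpow \<bar>s - t k\<bar> (q j k))"
    and qmin_eq: "\<And>k. qmin k = Min (range (\<lambda>j. q j k))"
begin

abbreviation "psym \<equiv> symb a2 a1 a0"

definition freq :: "int^'n \<Rightarrow> real" where
  "freq \<xi> = norm (\<chi> j. real_of_int (\<xi> $ j))"

definition b :: "real \<Rightarrow> real" where
  "b s = (\<Sum>j\<in>UNIV. \<bar>Im (a1 j s)\<bar>)"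

lemma freq_squared: "(freq \<xi>)\<^sup>2 = (\<Sum>j\<in>UNIV. (real_of_int (\<xi> $ j))\<^sup>2)"
  unfolding freq_def power2_norm_eq_inner inner_vec_def by (simp add: power2_eq_square)

lemma Im_psym: "Im (psym \<xi> s) = Im (a2 s) * (freq \<xi>)\<^sup>2 + (\<Sum>j\<in>UNIV. Im (a1 j s) * real_of_int (\<xi> $ j)) + Im (a0 s)"
proof -
  have "(\<Sum>j\<in>UNIV. (of_int (\<xi> $ j))\<^sup>2) = complex_of_real ((freq \<xi>)\<^sup>2)"
    by (simp add: freq_squared)
  then show ?thesis unfolding symb_def by simp
qed

lemma Im_psym_le: "Im (psym \<xi> s) \<le> Im (a2 s) * (freq \<xi>)\<^sup>2 + b s * freq \<xi> + Im (a0 s)"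
proof -
  have "Im (a1 j s) * real_of_int (\<xi> $ j) \<le> \<bar>Im (a1 j s)\<bar> * freq \<xi>" for j
  proof -
    have "\<bar>real_of_int (\<xi> $ j)\<bar> \<le> freq \<xi>"
      using component_le_norm_cart[of "\<chi> j. real_of_int (\<xi> $ j)" j] by (simp add: freq_def)
    then have "\<bar>Im (a1 j s)\<bar> * \<bar>real_of_int (\<xi> $ j)\<bar> \<le> \<bar>Im (a1 j s)\<bar> * freq \<xi>" by (intro mult_left_mono) auto
    then show ?thesis by (metis abs_ge_self abs_mult order_trans)
  qed
  then have "(\<Sum>j\<in>UNIV. Im (a1 j s) * real_of_int (\<xi> $ j)) \<le> b s * freq \<xi>"
    unfolding b_def sum_distrib_right by (intro sum_mono)
  then show ?thesis by (simp add: Im_psym)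
qed

text \<open>The lattice has no nonzero point of length below 1, so estimates for X \<ge> 1 cover all
  frequencies except 0.\<close>

lemma freq_cases: "freq \<xi> = 0 \<or> 1 \<le> freq \<xi>"
proof (cases "\<xi> = 0")
  case True
  have "(\<chi> j. real_of_int ((0 :: int^'n) $ j)) = 0" by (simp add: vec_eq_iff)
  then show ?thesis using True by (simp add: freq_def)
next
  case False
  then obtain j where "\<xi> $ j \<noteq> 0" by (auto simp: vec_eq_iff)
  then have "1 \<le> \<bar>real_of_int (\<xi> $ j)\<bar>" by linarith
  also have "\<dots> \<le> freq \<xi>"
    using component_le_norm_cart[of "\<chi> j. real_of_int (\<xi> $ j)" j] by (simp add: freq_def)
  finally show ?thesis by simp
qed

lemma freq_le_wt: "freq \<xi> \<le> wt \<xi>" and freq_nonneg: "0 \<le> freq \<xi>"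
  by (simp_all add: freq_def wt_def)

lemma qmin_le: "qmin k \<le> q j k" and qmin_nonneg: "k \<in> {1..m} \<Longrightarrow> 0 \<le> qmin k"
  and qmin_attained: "\<exists>j. qmin k = q j k"
proof -
  show "qmin k \<le> q j k" unfolding qmin_eq by (rule Min_le) auto
  have "qmin k \<in> range (\<lambda>j. q j k)" unfolding qmin_eq by (rule Min_in) auto
  then show ex: "\<exists>j. qmin k = q j k" by auto
  show "0 \<le> qmin k" if "k \<in> {1..m}" using ex h4[OF that] by auto
qed

lemma near_bound:
  assumes k: "k \<in> {1..m}" and \<sigma>: "0 \<le> \<sigma>"
    and pq: "p k \<le> 2 * qmin k + 1 \<or> (p k - 2 * qmin k - 1) / (p k - qmin k) \<le> \<sigma>"
  obtains K where "0 \<le> K" "\<And>X. 1 \<le> X \<Longrightarrow> \<exists>M R. 0 \<le> M \<and> 0 \<le> R \<and> M * R \<le> K * X powr \<sigma> \<and>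
    (\<forall>s\<in>I k. Im (a2 s) * X\<^sup>2 + b s * X \<le> K + (if \<bar>s - t k\<bar> \<le> R then M else 0))"
proof -
  obtain \<epsilon> where \<epsilon>: "0 < \<epsilon>" "\<And>s. s \<in> I k \<Longrightarrow> \<alpha> k s \<le> - \<epsilon>" using h3[OF k] by blast
  have "\<exists>B. \<forall>s\<in>I k. \<bar>\<beta> j k s\<bar> \<le> B" for j using h4[OF k, of j] by (auto simp: bounded_iff)
  then obtain B where B: "\<And>j s. s \<in> I k \<Longrightarrow> \<bar>\<beta> j k s\<bar> \<le> B j" by metis
  \<comment> \<open>Near \<open>t k\<close> the components with larger exponents are compared with
    the smallest one; on distances up to \<delta> this costs a power of 1 + \<delta>. The summand 1
    makes the constant positive.\<close>
  define C where "C = 1 + (\<Sum>j\<in>UNIV. \<bar>B j\<bar> * (1 + \<delta>) powr (q j k - qmin k))"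
  have C: "0 < C" unfolding C_def by (intro add_pos_nonneg sum_nonneg) auto
  have bs: "b s \<le> C * rpow \<bar>s - t k\<bar> (qmin k)" if s: "s \<in> I k" for s
  proof -
    let ?r = "\<bar>s - t k\<bar>"
    have r: "0 \<le> ?r" "?r \<le> \<delta>" using s by (auto simp: I_eq abs_le_iff)
    have "\<bar>Im (a1 j s)\<bar> \<le> (\<bar>B j\<bar> * (1 + \<delta>) powr (q j k - qmin k)) * rpow ?r (qmin k)" for j
    proof -
      have "\<bar>Im (a1 j s)\<bar> = \<bar>\<beta> j k s\<bar> * rpow ?r (q j k)"
        using h4[OF k, of j] s by (simp add: abs_mult rpow_nonneg)
      also have "\<dots> \<le> \<bar>B j\<bar> * ((1 + \<delta>) powr (q j k - qmin k) * rpow ?r (qmin k))"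
        using B[OF s, of j] by (intro mult_mono rpow_le_rpow r qmin_nonneg[OF k] qmin_le) (auto simp: rpow_nonneg)
      finally show ?thesis by (simp add: mult.assoc)
    qed
    then have "b s \<le> (\<Sum>j\<in>UNIV. (\<bar>B j\<bar> * (1 + \<delta>) powr (q j k - qmin k)) * rpow ?r (qmin k))"
      unfolding b_def by (rule sum_mono)
    also have "\<dots> \<le> C * rpow ?r (qmin k)"
      by (simp add: C_def sum_distrib_right[symmetric] distrib_right rpow_nonneg)
    finally show ?thesis .
  qed
  obtain K where K: "0 \<le> K" "\<And>X. 1 \<le> X \<Longrightarrow> \<exists>M R. 0 \<le> M \<and> 0 \<le> R \<and> M * R \<le> K * X powr \<sigma> \<and>
    (\<forall>r. 0 \<le> r \<longrightarrow> r \<le> \<delta> \<longrightarrow> - \<epsilon> * rpow r (p k) * X\<^sup>2 + C * rpow r (qmin k) * X \<le> K + (if r \<le> R then M else 0))"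
    using degenerate_growth[OF \<epsilon>(1) C \<delta> _ qmin_nonneg[OF k] \<sigma> pq] h3[OF k] by blast
  show ?thesis
  proof (rule that[OF K(1)])
    fix X :: real assume X: "1 \<le> X"
    obtain M R where MR: "0 \<le> M" "0 \<le> R" "M * R \<le> K * X powr \<sigma>" "\<And>r. 0 \<le> r \<Longrightarrow> r \<le> \<delta> \<Longrightarrow>
      - \<epsilon> * rpow r (p k) * X\<^sup>2 + C * rpow r (qmin k) * X \<le> K + (if r \<le> R then M else 0)"
      using K(2)[OF X] by blast
    have "Im (a2 s) * X\<^sup>2 + b s * X \<le> K + (if \<bar>s - t k\<bar> \<le> R then M else 0)" if s: "s \<in> I k" for s
    proof -
      let ?r = "\<bar>s - t k\<bar>"
      have r: "0 \<le> ?r" "?r \<le> \<delta>" using s by (auto simp: I_eq abs_le_iff)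
      have "Im (a2 s) \<le> - \<epsilon> * rpow ?r (p k)"
        using h3[OF k] s mult_right_mono[OF \<epsilon>(2)[OF s] rpow_nonneg[of ?r "p k"]] by simp
      then have "Im (a2 s) * X\<^sup>2 + b s * X \<le> - \<epsilon> * rpow ?r (p k) * X\<^sup>2 + C * rpow ?r (qmin k) * X"
        using bs[OF s] X by (intro add_mono mult_right_mono) auto
      with MR(4)[OF r] show ?thesis by linarith
    qed
    then show "\<exists>M R. 0 \<le> M \<and> 0 \<le> R \<and> M * R \<le> K * X powr \<sigma> \<and>
      (\<forall>s\<in>I k. Im (a2 s) * X\<^sup>2 + b s * X \<le> K + (if \<bar>s - t k\<bar> \<le> R then M else 0))"
      using MR by blast
  qed
qed

lemma b_bounded: "\<exists>B\<ge>0. \<forall>s\<in>{0..T}. 0 \<le> b s \<and> b s \<le> B \<and> \<bar>Im (a0 s)\<bar> \<le> B"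
proof -
  have bnd: "\<exists>B. \<forall>s\<in>{0..T}. \<bar>f s\<bar> \<le> B" if "continuous_on {0..T} f" for f :: "real \<Rightarrow> real"
    using compact_imp_bounded[OF compact_continuous_image[OF that compact_Icc]] by (simp add: bounded_iff)
  have "continuous_on {0..T} b" unfolding b_def[abs_def] by (intro continuous_intros cont)
  from bnd[OF this] obtain B1 where B1: "\<forall>s\<in>{0..T}. \<bar>b s\<bar> \<le> B1" by (rule exE)
  have "continuous_on {0..T} (\<lambda>s. Im (a0 s))" by (intro continuous_intros cont)
  from bnd[OF this] obtain B2 where B2: "\<forall>s\<in>{0..T}. \<bar>Im (a0 s)\<bar> \<le> B2" by (rule exE)
  have b0: "0 \<le> b s" for s unfolding b_def by (intro sum_nonneg) simp
  have "0 \<le> b s \<and> b s \<le> max 0 (max B1 B2) \<and> \<bar>Im (a0 s)\<bar> \<le> max 0 (max B1 B2)" if s: "s \<in> {0..T}" for s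
    using b0[of s] bspec[OF B1 s] bspec[OF B2 s] by linarith
  then show ?thesis by (intro exI[of _ "max 0 (max B1 B2)"]) simp
qed

text \<open>Removing open balls around the zeros leaves a compact set on which
  \<open>Im (a2 s)\<close> has a negative maximum -e, and then the damping dominates the first order
  term by completing the square.\<close>

lemma away_bound:
  obtains K where "0 \<le> K" "\<And>X s. s \<in> {0..T} \<Longrightarrow> (\<forall>k\<in>{1..m}. s \<notin> I k) \<Longrightarrow> Im (a2 s) * X\<^sup>2 + b s * \<bar>X\<bar> \<le> K"
proof -
  obtain B where B: "0 \<le> B" "\<And>s. s \<in> {0..T} \<Longrightarrow> 0 \<le> b s \<and> b s \<le> B" using b_bounded by blast
  define S where "S = {0..T} - (\<Union>k\<in>{1..m}. ball (t k) \<delta>)"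
  have S: "compact S" unfolding S_def by (intro compact_diff compact_Icc open_UN ballI open_ball)
  show ?thesis
  proof (cases "S = {}")
    case True
    have "\<exists>k\<in>{1..m}. s \<in> I k" if "s \<in> {0..T}" for s
      using that True by (force simp: S_def I_eq dist_real_def abs_less_iff)
    then show ?thesis by (intro that[of 0]) auto
  next
    case False
    have "continuous_on S (\<lambda>s. Im (a2 s))" by (intro continuous_intros continuous_on_subset[OF cont(1)]) (auto simp: S_def)
    from continuous_attains_sup[OF S False this]
    obtain s0 where s0: "s0 \<in> S" "\<And>s. s \<in> S \<Longrightarrow> Im (a2 s) \<le> Im (a2 s0)" by blast
    have "s0 \<notin> t ` {1..m}" using s0(1) \<delta> by (auto simp: S_def)
    then have neg: "Im (a2 s0) < 0" using nonpos[of s0] zeros[of s0] s0(1) by (auto simp: S_def)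
    define e where "e = - Im (a2 s0)"
    have e: "0 < e" using neg by (simp add: e_def)
    have "Im (a2 s) * X\<^sup>2 + b s * \<bar>X\<bar> \<le> B\<^sup>2 / (4 * e)" if s: "s \<in> {0..T}" "\<forall>k\<in>{1..m}. s \<notin> I k" for X s
    proof -
      have "s \<in> S" using s by (auto simp: S_def I_eq dist_real_def abs_less_iff)
      then have "Im (a2 s) \<le> - e" using s0(2) by (simp add: e_def)
      then have "Im (a2 s) * X\<^sup>2 \<le> - e * X\<^sup>2" by (intro mult_right_mono) auto
      moreover have "b s * \<bar>X\<bar> \<le> B * \<bar>X\<bar>" using B(2)[OF s(1)] by (intro mult_right_mono) auto
      ultimately have "Im (a2 s) * X\<^sup>2 + b s * \<bar>X\<bar> \<le> - e * \<bar>X\<bar>\<^sup>2 + B * \<bar>X\<bar>" by simp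
      also have "\<dots> \<le> B\<^sup>2 / (4 * e)" by (rule quadratic_bound[OF e])
      finally show ?thesis .
    qed
    then show ?thesis using e by (intro that[of "B\<^sup>2 / (4 * e)"]) auto
  qed
qed

text \<open>Pointwise, the imaginary part of the symbol is at most a constant plus one plateau for
  each zero, of height \<open>M k\<close> and half-width \<open>R k\<close>. Each plateau integrates
  to at most 2 M R, which has order wt^\<sigma>; the constants are absorbed because the weight is at
  least 1.\<close>

lemma primitive_growth:
  assumes \<sigma>: "0 \<le> \<sigma>"
    and pq: "\<And>k. k \<in> {1..m} \<Longrightarrow> p k \<le> 2 * qmin k + 1 \<or> (p k - 2 * qmin k - 1) / (p k - qmin k) \<le> \<sigma>"
  obtains A where "0 \<le> A" "\<And>\<xi> s u. 0 \<le> s \<Longrightarrow> s \<le> u \<Longrightarrow> u \<le> T \<Longrightarrow>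
    Im (primitive (psym \<xi>) u) - Im (primitive (psym \<xi>) s) \<le> A * wt \<xi> powr \<sigma>"
proof -
  have "\<exists>K\<ge>0. \<forall>X\<ge>1. \<exists>M R. 0 \<le> M \<and> 0 \<le> R \<and> M * R \<le> K * X powr \<sigma> \<and>
    (\<forall>s\<in>I k. Im (a2 s) * X\<^sup>2 + b s * X \<le> K + (if \<bar>s - t k\<bar> \<le> R then M else 0))" if "k \<in> {1..m}" for k
    using near_bound[OF that \<sigma> pq[OF that]] by metis
  then obtain K where K: "\<And>k. k \<in> {1..m} \<Longrightarrow> 0 \<le> K k" "\<And>k X. k \<in> {1..m} \<Longrightarrow> 1 \<le> X \<Longrightarrow>
    \<exists>M R. 0 \<le> M \<and> 0 \<le> R \<and> M * R \<le> K k * X powr \<sigma> \<and>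
    (\<forall>s\<in>I k. Im (a2 s) * X\<^sup>2 + b s * X \<le> K k + (if \<bar>s - t k\<bar> \<le> R then M else 0))"
    by metis
  obtain K0 where K0: "0 \<le> K0" "\<And>X s. s \<in> {0..T} \<Longrightarrow> (\<forall>k\<in>{1..m}. s \<notin> I k) \<Longrightarrow> Im (a2 s) * X\<^sup>2 + b s * \<bar>X\<bar> \<le> K0"
    using away_bound by blast
  obtain B where B: "0 \<le> B" "\<And>s. s \<in> {0..T} \<Longrightarrow> \<bar>Im (a0 s)\<bar> \<le> B" using b_bounded by blast
  define S where "S = (\<Sum>k\<in>{1..m}. K k)"
  have S: "0 \<le> S" unfolding S_def by (intro sum_nonneg K)
  define D where "D = K0 + S + B"
  have D: "0 \<le> D" using K0 S B by (simp add: D_def)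
  define A where "A = T * D + 2 * S"
  have A: "0 \<le> A" using T D S by (simp add: A_def)
  have "Im (primitive (psym \<xi>) u) - Im (primitive (psym \<xi>) s) \<le> A * wt \<xi> powr \<sigma>" if su: "0 \<le> s" "s \<le> u" "u \<le> T" for \<xi> s u
  proof -
    define X where "X = freq \<xi>"
    have "\<exists>M R. \<forall>k\<in>{1..m}. 0 \<le> M k \<and> 0 \<le> R k \<and> M k * R k \<le> K k * wt \<xi> powr \<sigma> \<and>
      (\<forall>s\<in>I k. Im (a2 s) * X\<^sup>2 + b s * X \<le> K k + (if \<bar>s - t k\<bar> \<le> R k then M k else 0))"
    \<comment> \<open>At frequency 0 both leading terms vanish and empty plateaus do.\<close>
    proof (cases "X = 0")
      case True
      then show ?thesis using K(1) by (intro exI[of _ "\<lambda>_. 0"]) auto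
    next
      case False
      then have X: "1 \<le> X" using freq_cases[of \<xi>] by (simp add: X_def)
      have "X powr \<sigma> \<le> wt \<xi> powr \<sigma>" using X freq_le_wt[of \<xi>] \<sigma> by (intro powr_mono2) (auto simp: X_def)
      then have "K k * X powr \<sigma> \<le> K k * wt \<xi> powr \<sigma>" if "k \<in> {1..m}" for k using K(1)[OF that] by (intro mult_left_mono)
      then have "\<exists>M R. 0 \<le> M \<and> 0 \<le> R \<and> M * R \<le> K k * wt \<xi> powr \<sigma> \<and>
        (\<forall>s\<in>I k. Im (a2 s) * X\<^sup>2 + b s * X \<le> K k + (if \<bar>s - t k\<bar> \<le> R then M else 0))" if "k \<in> {1..m}" for k
        using K(2)[OF that X] that by (meson order_trans)
      then show ?thesis by metis
    qed
    then obtain M R where MR: "\<And>k. k \<in> {1..m} \<Longrightarrow> 0 \<le> M k" "\<And>k. k \<in> {1..m} \<Longrightarrow> 0 \<le> R k"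
      "\<And>k. k \<in> {1..m} \<Longrightarrow> M k * R k \<le> K k * wt \<xi> powr \<sigma>"
      "\<And>k s. k \<in> {1..m} \<Longrightarrow> s \<in> I k \<Longrightarrow> Im (a2 s) * X\<^sup>2 + b s * X \<le> K k + (if \<bar>s - t k\<bar> \<le> R k then M k else 0)"
      by blast
    let ?n = "\<lambda>k r. if \<bar>r - t k\<bar> \<le> R k then M k else 0"
    have n0: "0 \<le> ?n k r" if "k \<in> {1..m}" for k r using MR(1)[OF that] by simp
    have pt: "Im (psym \<xi> r) \<le> D + (\<Sum>k\<in>{1..m}. ?n k r)" if r: "r \<in> {0..T}" for r
    proof -
      have N0: "0 \<le> (\<Sum>k\<in>{1..m}. ?n k r)" by (intro sum_nonneg n0)
      have "Im (a2 r) * X\<^sup>2 + b r * X \<le> K0 + S + (\<Sum>k\<in>{1..m}. ?n k r)"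
      proof (cases "\<exists>k\<in>{1..m}. r \<in> I k")
        case True
        then obtain k where k: "k \<in> {1..m}" "r \<in> I k" by blast
        have "K k \<le> S" unfolding S_def using k K(1) by (intro member_le_sum) auto
        moreover have "?n k r \<le> (\<Sum>k\<in>{1..m}. ?n k r)"
          by (rule member_le_sum[of k "{1..m}" "\<lambda>k. ?n k r"]) (use k n0 in auto)
        ultimately show ?thesis using MR(4)[OF k] K0(1) by linarith
      next
        case False
        then show ?thesis using K0(2)[OF r, of X] S N0 freq_nonneg[of \<xi>] by (simp add: X_def)
      qed
      moreover have "Im (a0 r) \<le> B" using B(2)[OF r] by simp
      ultimately show ?thesis using Im_psym_le[of \<xi> r] by (simp add: D_def X_def)
    qed
    have sub: "{s..u} \<subseteq> {0..T}" using su by auto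
    have i1: "(\<lambda>r. Im (psym \<xi> r)) integrable_on {s..u}"
      by (intro integrable_continuous_real continuous_intros continuous_on_subset[OF continuous_on_symb[OF cont] sub])
    have i2: "?n k integrable_on {s..u}" if "k \<in> {1..m}" for k
      by (rule integral_near_le(1)[OF MR(2)[OF that] MR(1)[OF that] su(2)])
    have i3: "(\<lambda>r. \<Sum>k\<in>{1..m}. ?n k r) integrable_on {s..u}" by (intro integrable_sum i2) auto
    have "integral {s..u} (\<lambda>r. Im (psym \<xi> r)) \<le> integral {s..u} (\<lambda>r. D + (\<Sum>k\<in>{1..m}. ?n k r))"
      by (rule integral_le[OF i1 integrable_add[OF integrable_const_ivl i3]]) (use pt sub in auto)
    also have "\<dots> = (u - s) * D + (\<Sum>k\<in>{1..m}. integral {s..u} (?n k))"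
    proof -
      have "integral {s..u} (\<lambda>r. D + (\<Sum>k\<in>{1..m}. ?n k r)) = integral {s..u} (\<lambda>r. D) + integral {s..u} (\<lambda>r. \<Sum>k\<in>{1..m}. ?n k r)"
        by (rule integral_add[OF integrable_const_ivl i3])
      also have "integral {s..u} (\<lambda>r. \<Sum>k\<in>{1..m}. ?n k r) = (\<Sum>k\<in>{1..m}. integral {s..u} (?n k))"
        by (intro integral_sum i2) auto
      finally show ?thesis using su by simp
    qed
    also have "\<dots> \<le> T * D + (\<Sum>k\<in>{1..m}. 2 * (K k * wt \<xi> powr \<sigma>))"
    proof (intro add_mono mult_right_mono sum_mono)
      fix k assume k: "k \<in> {1..m}"
      have "integral {s..u} (?n k) \<le> 2 * R k * M k"
        by (rule integral_near_le(2)[OF MR(2)[OF k] MR(1)[OF k] su(2)])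
      then show "integral {s..u} (?n k) \<le> 2 * (K k * wt \<xi> powr \<sigma>)" using MR(3)[OF k] by (simp add: mult_ac)
    qed (use su D in auto)
    also have "\<dots> = T * D * 1 + 2 * S * wt \<xi> powr \<sigma>"
      by (simp add: S_def sum_distrib_left sum_distrib_right mult.assoc)
    also have "\<dots> \<le> T * D * wt \<xi> powr \<sigma> + 2 * S * wt \<xi> powr \<sigma>"
      using T D S \<sigma> ge_one_powr_ge_zero[OF wt_ge_1 \<sigma>, of \<xi>] by (intro add_mono mult_left_mono) auto
    finally show ?thesis
      using Im_primitive_symbol[OF T cont su, where \<xi> = \<xi>] by (simp add: A_def distrib_right)
  qed
  with A show ?thesis by (rule that)
qed

section \<open>Lower bound for the growth along a coordinate axis\<close>

lemma constant_sign:
  fixes f :: "real \<Rightarrow> real"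
  assumes "connected S" "continuous_on S f" "\<And>x. x \<in> S \<Longrightarrow> f x \<noteq> 0"
  obtains c :: int where "c = 1 \<or> c = -1" "\<And>x. x \<in> S \<Longrightarrow> \<bar>f x\<bar> = of_int c * f x"
proof (cases "\<exists>x\<in>S. 0 < f x")
  case True
  then obtain x where x: "x \<in> S" "0 < f x" by blast
  have "0 < f y" if y: "y \<in> S" for y
  proof (rule ccontr)
    assume "\<not> 0 < f y"
    then have "f y \<le> 0" by simp
    moreover have "{f y..f x} \<subseteq> f ` S"
      using connected_continuous_image[OF assms(2,1)] x y by (intro connected_contains_Icc) auto
    ultimately have "0 \<in> f ` S" using x(2) by auto
    then show False using assms(3) by auto
  qed
  then show ?thesis by (intro that[of 1]) (auto simp: less_imp_le)
next
  case False
  then show ?thesis by (intro that[of "-1"]) (auto simp: not_less)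
qed

text \<open>At distance about n^(-1/(P - Q)) from \<open>t k\<close> the damping is at most half of
  the first order term in a direction \<open>j\<close> of minimal exponent. The sign of the
  frequency is chosen so that this term is positive. The lower bound on |\<beta>| supplies its size
  \<epsilon> r^Q n; the boundedness of \<alpha> limits the damping.\<close>

lemma growth_interval:
  assumes k: "k \<in> {1..m}" and pq: "p k > 2 * qmin k + 1"
    and \<beta>: "\<And>j. \<exists>\<epsilon>>0. \<forall>s\<in>I k. \<epsilon> \<le> \<bar>\<beta> j k s\<bar>"
  defines "\<sigma> \<equiv> (p k - 2 * qmin k - 1) / (p k - qmin k)"
  obtains j :: 'n and c \<kappa> \<rho> :: real and n0 :: nat and sg :: int and u :: "nat \<Rightarrow> real" where
    "0 < c" "0 < \<kappa>" "0 \<le> \<rho>" "1 \<le> n0" "sg = 1 \<or> sg = -1"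
    "\<And>n. n \<ge> n0 \<Longrightarrow> \<kappa> * real n powr (- \<rho>) \<le> u n \<and> u n \<le> T"
    "\<And>n r. n \<ge> n0 \<Longrightarrow> u n - 2 * (\<kappa> * real n powr (- \<rho>)) \<le> r \<Longrightarrow> r \<le> u n - \<kappa> * real n powr (- \<rho>) \<Longrightarrow>
      0 \<le> r \<and> c * real n powr \<sigma> \<le> integral {r..u n} (\<lambda>s. Im (a2 s) * (real n)\<^sup>2 + Im (a1 j s) * of_int sg * real n)"
proof -
  define Q where "Q = qmin k"
  define P where "P = p k"
  have Q: "0 \<le> Q" using qmin_nonneg[OF k] by (simp add: Q_def)
  have PQ: "P > 2 * Q + 1" using pq by (simp add: P_def Q_def)
  then have PQ0: "P - Q > 0" using Q by simp
  obtain j where j: "q j k = Q" using qmin_attained[of k] by (auto simp: Q_def)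
  have tk: "t k \<in> {0..T}" by (rule subsetD[OF t_mem imageI[OF k]])
  obtain \<epsilon> where \<epsilon>: "0 < \<epsilon>" "\<And>s. s \<in> I k \<Longrightarrow> \<epsilon> \<le> \<bar>\<beta> j k s\<bar>" using \<beta>[of j] by blast
  obtain A where A: "0 < A" "\<And>s. s \<in> I k \<Longrightarrow> \<bar>\<alpha> k s\<bar> \<le> A"
    using h3[OF k] unfolding bounded_pos by auto
  \<comment> \<open>\<open>t k\<close> may be an end point of [0, T], so the window is placed on one
    side: to the right whenever there is room, otherwise to the left.\<close>
  obtain sd d :: real where sd: "sd = 1 \<or> sd = -1" and d: "0 < d" "d \<le> \<delta>"
    and side: "\<And>r. 0 < r \<Longrightarrow> r \<le> d \<Longrightarrow> t k + sd * r \<in> {0..T}"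
  proof (cases "t k < T")
    case True
    then show ?thesis using tk \<delta> by (intro that[of 1 "min \<delta> (T - t k)"]) auto
  next
    case False
    then have "t k = T" using tk by simp
    then show ?thesis using T \<delta> by (intro that[of "-1" "min \<delta> T"]) auto
  qed
  have inI: "t k + sd * r \<in> I k" if "0 < r" "r \<le> d" for r
    using side[OF that] that d sd by (auto simp: I_eq)
  have contf: "continuous_on {0<..d} (\<lambda>r. Im (a1 j (t k + sd * r)))"
    by (intro continuous_intros continuous_on_compose2[OF cont(2)]) (use side in auto)
  have nz: "Im (a1 j (t k + sd * r)) \<noteq> 0" if r: "r \<in> {0<..d}" for r
    using h4[OF k, of j] inI[of r] r sd by (auto simp: abs_mult rpow_pos_eq)
  \<comment> \<open>On one side of \<open>t k\<close> the coefficient is continuous and has no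
    zeros, hence a constant sign. It is an integer because it becomes the sign of the
    frequency.\<close>
  obtain sg :: int where sg: "sg = 1 \<or> sg = -1"
    "\<And>r. r \<in> {0<..d} \<Longrightarrow> \<bar>Im (a1 j (t k + sd * r))\<bar> = of_int sg * Im (a1 j (t k + sd * r))"
    by (rule constant_sign[OF _ contf nz]) (auto simp: connected_Ioc)
  define \<rho> where "\<rho> = 1 / (P - Q)"
  define \<kappa> where "\<kappa> = (\<epsilon> / (2 * A)) powr \<rho> / 4"
  have \<rho>: "0 < \<rho>" using PQ0 by (simp add: \<rho>_def)
  have \<kappa>: "0 < \<kappa>" using \<epsilon> A by (simp add: \<kappa>_def)
  define R where "R n = \<kappa> * real n powr (- \<rho>)" for n :: nat
  have "((\<lambda>n. \<kappa> * real n powr (- \<rho>)) \<longlongrightarrow> \<kappa> * 0) sequentially"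
    by (intro tendsto_mult tendsto_const tendsto_neg_powr filterlim_real_sequentially) (use \<rho> in auto)
  then have "eventually (\<lambda>n. R n < d / 4) sequentially"
    using d by (intro order_tendstoD(2)[of _ 0]) (auto simp: R_def[abs_def])
  then obtain n1 where n1: "\<And>n. n \<ge> n1 \<Longrightarrow> R n < d / 4" by (auto simp: eventually_sequentially)
  define n0 where "n0 = max 1 n1"
  define c where "c = \<epsilon> / 2 * \<kappa> powr (Q + 1)"
  have c: "0 < c" using \<epsilon> \<kappa> by (simp add: c_def)
  text \<open>The growth window is \<open>2 R \<le> \<bar>s - t k\<bar> \<le> 4 R\<close>; it is traversed towards \<open>t k\<close> or away
    from it, according to the side.\<close>
  define u where "u n = (if sd = 1 then t k + 4 * R n else t k - 2 * R n)" for n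
  have Rpos: "0 < R n" "R n < d / 4" if "n \<ge> n0" for n
    using that n1[of n] \<kappa> by (auto simp: n0_def R_def)
  have win: "\<exists>r. s = t k + sd * r \<and> 2 * R n \<le> r \<and> r \<le> 4 * R n"
    if "n \<ge> n0" "u n - 2 * R n \<le> s" "s \<le> u n" for n s
    using sd that by (intro exI[of _ "sd * (s - t k)"]) (auto simp: u_def)
  \<comment> \<open>The surviving half of the first order term is estimated at the inner end of the
    window, where r is at least R.\<close>
  have low: "\<epsilon> / 2 * R n powr Q * real n \<le> Im (a2 s) * (real n)\<^sup>2 + Im (a1 j s) * of_int sg * real n \<and> s \<in> {0..T}"
    if n: "n \<ge> n0" and s: "u n - 2 * R n \<le> s" "s \<le> u n" for n s
  proof -
    obtain r where r: "s = t k + sd * r" "2 * R n \<le> r" "r \<le> 4 * R n" using win[OF n s] by blast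
    have n': "1 \<le> real n" using n by (simp add: n0_def)
    have r0: "0 < r" "r \<le> d" using r Rpos[OF n] by auto
    have sI: "s \<in> I k" using inI[OF r0] r by simp
    have abs: "\<bar>s - t k\<bar> = r" using r sd r0 by (auto simp: abs_mult)
    have a2s: "Im (a2 s) \<ge> - A * r powr P"
    proof -
      have "Im (a2 s) = \<alpha> k s * r powr P" using h3[OF k] sI abs r0 by (simp add: rpow_pos_eq P_def)
      moreover have "- A * r powr P \<le> \<alpha> k s * r powr P"
        using A(2)[OF sI] by (intro mult_right_mono) (auto simp: abs_le_iff)
      ultimately show ?thesis by simp
    qed
    have a1s: "Im (a1 j s) * of_int sg \<ge> \<epsilon> * r powr Q"
    proof -
      have "of_int sg * Im (a1 j s) = \<bar>Im (a1 j s)\<bar>" using sg(2)[of r] r0 r by simp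
      also have "\<dots> = \<bar>\<beta> j k s\<bar> * r powr Q"
        using h4[OF k, of j] sI abs r0 j by (simp add: rpow_pos_eq abs_mult)
      also have "\<dots> \<ge> \<epsilon> * r powr Q" using \<epsilon>(2)[OF sI] by (intro mult_right_mono) auto
      finally show ?thesis by (simp add: mult.commute)
    qed
    have "r powr (P - Q) \<le> (4 * R n) powr (P - Q)" using r r0 PQ0 by (intro powr_mono2) auto
    also have "4 * R n = (\<epsilon> / (2 * A) / real n) powr \<rho>"
    proof -
      have "(\<epsilon> / (2 * A) / real n) powr \<rho> = (\<epsilon> / (2 * A)) powr \<rho> / real n powr \<rho>"
        by (rule powr_divide)
      then show ?thesis by (simp add: R_def \<kappa>_def powr_minus_divide)
    qed
    also have "\<dots> powr (P - Q) = \<epsilon> / (2 * A) / real n"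
      using \<epsilon> A n' PQ0 by (simp add: powr_powr \<rho>_def)
    finally have "A * r powr (P - Q) * real n \<le> \<epsilon> / 2" using A n' by (simp add: field_simps)
    then have "A * r powr (P - Q) * real n * (r powr Q * real n) \<le> \<epsilon> / 2 * (r powr Q * real n)"
      using n' by (intro mult_right_mono) auto
    also have "A * r powr (P - Q) * real n * (r powr Q * real n) = A * (r powr (P - Q) * r powr Q) * (real n)\<^sup>2"
      by (simp add: power2_eq_square mult_ac)
    also have "r powr (P - Q) * r powr Q = r powr P" by (simp flip: powr_add)
    finally have 1: "A * r powr P * (real n)\<^sup>2 \<le> \<epsilon> / 2 * (r powr Q * real n)" .
    have 2: "- (A * r powr P * (real n)\<^sup>2) \<le> Im (a2 s) * (real n)\<^sup>2"
      using mult_right_mono[OF a2s, of "(real n)\<^sup>2"] by simp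
    have 3: "\<epsilon> * (r powr Q * real n) \<le> Im (a1 j s) * of_int sg * real n"
      using mult_right_mono[OF a1s, of "real n"] by (simp add: mult.assoc)
    have "R n powr Q \<le> r powr Q" using r Rpos[OF n] Q by (intro powr_mono2) auto
    then have "\<epsilon> / 2 * R n powr Q * real n \<le> \<epsilon> / 2 * (r powr Q * real n)"
      using \<epsilon> by (simp add: mult.assoc mult_left_mono mult_right_mono)
    then show ?thesis using 1 2 3 sI by (simp add: I_eq)
  qed
  \<comment> \<open>Length times height: R^(Q + 1) n is a multiple of n^(1 - \<rho> (Q + 1)), and
    this exponent equals \<sigma>.\<close>
  have cn: "R n * (\<epsilon> / 2 * R n powr Q * real n) = c * real n powr \<sigma>" if n: "n \<ge> n0" for n
  proof -
    have n': "1 \<le> real n" using n by (simp add: n0_def)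
    have "R n * (\<epsilon> / 2 * R n powr Q * real n) = \<epsilon> / 2 * R n powr (Q + 1) * real n"
      using Rpos[OF n] by (simp add: powr_add mult_ac)
    also have "R n powr (Q + 1) = \<kappa> powr (Q + 1) * real n powr (- \<rho> * (Q + 1))"
      using \<kappa> by (simp add: R_def powr_mult powr_powr)
    also have "\<epsilon> / 2 * (\<kappa> powr (Q + 1) * real n powr (- \<rho> * (Q + 1))) * real n = c * real n powr (- \<rho> * (Q + 1) + 1)"
    proof -
      have "real n powr (- \<rho> * (Q + 1) + 1) = real n powr (- \<rho> * (Q + 1)) * real n"
        using n' by (simp only: powr_add powr_one)
      then show ?thesis unfolding c_def by (simp only: mult_ac)
    qed
    also have "- \<rho> * (Q + 1) + 1 = \<sigma>" using PQ0 by (simp add: \<rho>_def \<sigma>_def P_def Q_def field_simps)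
    finally show ?thesis .
  qed
  have main: "0 \<le> r \<and> c * real n powr \<sigma> \<le> integral {r..u n} (\<lambda>s. Im (a2 s) * (real n)\<^sup>2 + Im (a1 j s) * of_int sg * real n)"
    if n: "n \<ge> n0" and r: "u n - 2 * R n \<le> r" "r \<le> u n - R n" for n r
  proof -
    let ?l = "\<epsilon> / 2 * R n powr Q * real n" and ?f = "\<lambda>s. Im (a2 s) * (real n)\<^sup>2 + Im (a1 j s) * of_int sg * real n"
    have sub: "{r..u n} \<subseteq> {0..T}" using low[OF n] r by force
    have ru: "r \<le> u n" using r Rpos[OF n] by simp
    have l0: "0 \<le> ?l" using \<epsilon> by simp
    have "c * real n powr \<sigma> = R n * ?l" using cn[OF n] by simp
    also have "\<dots> \<le> (u n - r) * ?l" using r l0 by (intro mult_right_mono) auto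
    also have "\<dots> = integral {r..u n} (\<lambda>_. ?l)" using ru by simp
    also have "\<dots> \<le> integral {r..u n} ?f"
    proof (rule integral_le[OF integrable_const_ivl])
      show "?f integrable_on {r..u n}"
        by (intro integrable_continuous_real continuous_intros continuous_on_subset[OF cont(1) sub] continuous_on_subset[OF cont(2) sub])
      show "?l \<le> ?f s" if "s \<in> {r..u n}" for s using low[OF n, of s] that r by simp
    qed
    finally show ?thesis using sub ru by auto
  qed
  have un: "R n \<le> u n \<and> u n \<le> T" if n: "n \<ge> n0" for n
  proof -
    have "u n - 2 * R n \<in> {0..T}" "u n \<in> {0..T}"
      using low[OF n, of "u n - 2 * R n"] low[OF n, of "u n"] Rpos[OF n] by auto
    then show ?thesis using Rpos[OF n] by auto
  qed
  show ?thesis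
    using that[of c \<kappa> \<rho> n0 sg u j] c \<kappa> \<rho> sg(1) un main by (simp add: R_def n0_def)
qed

text \<open>The test frequencies are \<open>z n\<close>, of length n on the axis supplied by
  \<open>growth_interval\<close>. With s = 1/\<sigma>, the decay of a Gevrey source of order s and
  the growth have the same exponent n^\<sigma>, so a small rate \<open>h\<close> decides in favour
  of the growth. This settles the borderline order as well.\<close>

lemma no_solution_gevrey:
  assumes k: "k \<in> {1..m}" and pq: "p k > 2 * qmin k + 1"
    and \<beta>: "\<And>j. \<exists>\<epsilon>>0. \<forall>s\<in>I k. \<epsilon> \<le> \<bar>\<beta> j k s\<bar>"
  obtains f :: "real \<Rightarrow> 'n functional" where "time_cont T Cinf_top f"
    "\<And>\<tau>. (p k - qmin k) / (p k - 2 * qmin k - 1) \<le> \<tau> \<Longrightarrow> time_cont T (gevrey_top \<tau>) f"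
    "\<And>u. \<not> solves_CP T a2 a1 a0 f (\<lambda>_. 0) u"
proof -
  define \<sigma> where "\<sigma> = (p k - 2 * qmin k - 1) / (p k - qmin k)"
  have Q: "0 \<le> qmin k" by (rule qmin_nonneg[OF k])
  have \<sigma>: "0 < \<sigma>" "\<sigma> \<le> 1" using pq Q by (auto simp: \<sigma>_def divide_le_eq)
  define s where "s = (p k - qmin k) / (p k - 2 * qmin k - 1)"
  have s\<sigma>: "1 / s = \<sigma>" using pq Q by (simp add: s_def \<sigma>_def)
  have s1: "1 \<le> s" using pq Q by (simp add: s_def le_divide_eq)
  obtain j :: 'n and c \<kappa> \<rho> :: real and n0 :: nat and sg :: int and u :: "nat \<Rightarrow> real" where
    c: "0 < c" and \<kappa>: "0 < \<kappa>" and \<rho>: "0 \<le> \<rho>" and n0: "1 \<le> n0" and sg: "sg = 1 \<or> sg = -1" and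
    u: "\<And>n. n \<ge> n0 \<Longrightarrow> \<kappa> * real n powr (- \<rho>) \<le> u n \<and> u n \<le> T" and
    grow: "\<And>n r. n \<ge> n0 \<Longrightarrow> u n - 2 * (\<kappa> * real n powr (- \<rho>)) \<le> r \<Longrightarrow> r \<le> u n - \<kappa> * real n powr (- \<rho>) \<Longrightarrow>
      0 \<le> r \<and> c * real n powr \<sigma> \<le> integral {r..u n} (\<lambda>s. Im (a2 s) * (real n)\<^sup>2 + Im (a1 j s) * of_int sg * real n)"
    by (rule growth_interval[OF k pq \<beta>, folded \<sigma>_def]) (rule that)
  obtain B where B: "0 \<le> B" "\<And>s. s \<in> {0..T} \<Longrightarrow> \<bar>Im (a0 s)\<bar> \<le> B" using b_bounded by blast
  define z where "z n = axis j (sg * int n)" for n :: nat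
  \<comment> \<open>\<open>no_solution\<close> expects an observation time for every frequency. Only
    its values on the \<open>z n\<close> matter, where it is the end point of the growth
    window.\<close>
  define ts where "ts \<xi> = (if n0 \<le> nat \<bar>\<xi> $ j\<bar> then u (nat \<bar>\<xi> $ j\<bar>) else 0)" for \<xi> :: "int^'n"
  have zj: "nat \<bar>z n $ j\<bar> = n" for n using sg by (auto simp: z_def axis_def abs_mult)
  have tsz: "ts (z n) = u n" if "n \<ge> n0" for n using that by (simp add: ts_def zj)
  have ts: "ts \<xi> \<in> {0..T}" for \<xi>
  proof (cases "n0 \<le> nat \<bar>\<xi> $ j\<bar>")
    case True
    have "0 \<le> \<kappa> * real (nat \<bar>\<xi> $ j\<bar>) powr (- \<rho>)" using \<kappa> by simp
    then show ?thesis using u[OF True] True by (simp add: ts_def)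
  qed (use T in \<open>simp add: ts_def\<close>)
  have freqz: "freq (z n) = real n" for n
  proof -
    have "(freq (z n))\<^sup>2 = (\<Sum>i\<in>UNIV. if i = j then (real n)\<^sup>2 else 0)"
      unfolding freq_squared using sg by (intro sum.cong) (auto simp: z_def axis_def)
    then show ?thesis using freq_nonneg[of "z n"] by simp
  qed
  have wtz: "wt (z n) = 1 + real n" for n using freqz[of n] by (simp add: wt_def freq_def)
  have symz: "Im (psym (z n) r) = Im (a2 r) * (real n)\<^sup>2 + Im (a1 j r) * of_int sg * real n + Im (a0 r)" for n r
  proof -
    have "(\<Sum>i\<in>UNIV. Im (a1 i r) * real_of_int (z n $ i)) = (\<Sum>i\<in>UNIV. if i = j then Im (a1 j r) * (of_int sg * real n) else 0)"
      by (intro sum.cong) (auto simp: z_def axis_def)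
    then show ?thesis by (simp add: Im_psym freqz mult.assoc)
  qed
  \<comment> \<open>Because (1 + n)^\<sigma> \<le> 2 n^\<sigma>, the decay of the source costs at
    most exp (-(c/2) n^\<sigma>), half of the available growth.\<close>
  define h where "h = c / 4"
  have h: "0 < h" using c by (simp add: h_def)
  have sc: "continuous_on {0..T} (psym \<xi>)" for \<xi> by (rule continuous_on_symb[OF cont])
  \<comment> \<open>A source acting anywhere between u - 2 R and u - R has at least time R left to
    grow before u, so the integrand is bounded below on an interval of length R. That length
    supplies the factor \<kappa> n^(-\<rho>); the zeroth order coefficient costs at most the factor
    exp (-T B).\<close>
  have big: "gdecay s h (z n) * integral {0..ts (z n)} (\<lambda>r. exp (Im (primitive (psym (z n)) (ts (z n))) - Im (primitive (psym (z n)) r)))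
      \<ge> \<kappa> * real n powr (- \<rho>) * exp (- T * B) * exp (c / 2 * real n powr \<sigma>)" if n: "n \<ge> n0" for n
  proof -
    let ?p = "primitive (psym (z n))" and ?R = "\<kappa> * real n powr (- \<rho>)"
    let ?e = "exp (c * real n powr \<sigma> - T * B)"
    have n': "1 \<le> real n" using n n0 by simp
    have R0: "0 \<le> ?R" using \<kappa> by simp
    have un: "?R \<le> u n" "u n \<le> T" using u[OF n] by auto
    have lo: "0 \<le> u n - 2 * ?R" using grow[OF n, of "u n - 2 * ?R"] R0 by simp
    have sub: "{u n - 2 * ?R..u n - ?R} \<subseteq> {0..u n}" using lo R0 by auto
    have int: "(\<lambda>r. exp (Im (?p (u n)) - Im (?p r))) integrable_on {0..u n}"
    proof (rule integrable_continuous_real)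
      have "continuous_on {0..T} (\<lambda>r. exp (Im (?p (u n)) - Im (?p r)))" by (intro continuous_intros sc)
      then show "continuous_on {0..u n} (\<lambda>r. exp (Im (?p (u n)) - Im (?p r)))"
        by (rule continuous_on_subset) (use un in auto)
    qed
    have pt: "?e \<le> exp (Im (?p (u n)) - Im (?p r))" if r: "r \<in> {u n - 2 * ?R..u n - ?R}" for r
    proof -
      have g: "0 \<le> r" "c * real n powr \<sigma> \<le> integral {r..u n} (\<lambda>s. Im (a2 s) * (real n)\<^sup>2 + Im (a1 j s) * of_int sg * real n)"
        using grow[OF n, of r] r by auto
      have ru: "r \<le> u n" using r R0 by auto
      have sub': "{r..u n} \<subseteq> {0..T}" using g un by auto
      note cs = continuous_on_subset[OF cont(1) sub'] continuous_on_subset[OF cont(2) sub'] continuous_on_subset[OF cont(3) sub']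
      have "Im (?p (u n)) - Im (?p r) = integral {r..u n} (\<lambda>s. Im (psym (z n) s))"
        by (rule Im_primitive_symbol[OF T cont g(1) ru un(2)])
      also have "\<dots> = integral {r..u n} (\<lambda>s. Im (a2 s) * (real n)\<^sup>2 + Im (a1 j s) * of_int sg * real n) + integral {r..u n} (\<lambda>s. Im (a0 s))"
        unfolding symz by (intro integral_add integrable_continuous_real continuous_intros cs)
      finally have 1: "Im (?p (u n)) - Im (?p r) \<ge> c * real n powr \<sigma> + integral {r..u n} (\<lambda>s. Im (a0 s))" using g(2) by simp
      have "integral {r..u n} (\<lambda>_. - B) \<le> integral {r..u n} (\<lambda>s. Im (a0 s))"
      proof (rule integral_le[OF integrable_const_ivl])
        show "(\<lambda>s. Im (a0 s)) integrable_on {r..u n}" by (intro integrable_continuous_real continuous_intros cs)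
        show "- B \<le> Im (a0 s)" if "s \<in> {r..u n}" for s using B(2)[of s] sub' that by (auto simp: abs_le_iff)
      qed
      then have "- ((u n - r) * B) \<le> integral {r..u n} (\<lambda>s. Im (a0 s))" using ru by simp
      moreover have "(u n - r) * B \<le> T * B" using g(1) un B(1) by (intro mult_right_mono) auto
      ultimately show ?thesis using 1 by simp
    qed
    have "?R * ?e = integral {u n - 2 * ?R..u n - ?R} (\<lambda>_. ?e)" using R0 by simp
    also have "\<dots> \<le> integral {u n - 2 * ?R..u n - ?R} (\<lambda>r. exp (Im (?p (u n)) - Im (?p r)))"
      by (intro integral_le pt integrable_const_ivl integrable_on_subinterval[OF int sub])
    also have "\<dots> \<le> integral {0..u n} (\<lambda>r. exp (Im (?p (u n)) - Im (?p r)))"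
      by (intro integral_subset_le sub int integrable_on_subinterval[OF int sub]) auto
    finally have 2: "?R * ?e \<le> integral {0..u n} (\<lambda>r. exp (Im (?p (u n)) - Im (?p r)))" .
    have 3: "exp (- (c / 2 * real n powr \<sigma>)) \<le> gdecay s h (z n)"
    proof -
      have "(1 + real n) powr \<sigma> \<le> (2 * real n) powr \<sigma>" using n' \<sigma> by (intro powr_mono2) auto
      also have "\<dots> = 2 powr \<sigma> * real n powr \<sigma>" by (simp add: powr_mult)
      also have "\<dots> \<le> 2 powr 1 * real n powr \<sigma>" using \<sigma> by (intro mult_right_mono powr_mono) auto
      finally have "(1 + real n) powr \<sigma> \<le> 2 * real n powr \<sigma>" by simp
      then have "h * (1 + real n) powr \<sigma> \<le> h * (2 * real n powr \<sigma>)" using h by (intro mult_left_mono) auto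
      then show ?thesis unfolding gdecay_def s\<sigma> wtz by (simp add: h_def)
    qed
    have "?R * exp (- T * B) * exp (c / 2 * real n powr \<sigma>) = exp (- (c / 2 * real n powr \<sigma>)) * (?R * ?e)"
    proof -
      have "exp (- T * B) * exp (c / 2 * real n powr \<sigma>) = exp (- (c / 2 * real n powr \<sigma>)) * ?e"
        by (simp add: exp_add[symmetric])
      then show ?thesis by (simp add: mult_ac)
    qed
    also have "\<dots> \<le> gdecay s h (z n) * integral {0..u n} (\<lambda>r. exp (Im (?p (u n)) - Im (?p r)))"
      using 2 3 R0 by (intro mult_mono) auto
    finally show ?thesis unfolding tsz[OF n] .
  qed
  \<comment> \<open>The exponential is replaced by a single term of its series, whose order
    \<open>N\<close> is so large that \<sigma> N exceeds the polynomial degree, the loss \<rho> and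
    one more power.\<close>
  have unbounded: "\<exists>n\<ge>n0. C * (1 + real n) ^ l < \<kappa> * real n powr (- \<rho>) * exp (- T * B) * exp (c / 2 * real n powr \<sigma>)" for C l
  proof -
    obtain N :: nat where N: "(real l + \<rho> + 1) / \<sigma> \<le> real N" using real_arch_simple by blast
    then have N': "real l + \<rho> + 1 \<le> \<sigma> * real N" using \<sigma> by (simp add: pos_divide_le_eq mult.commute)
    define E where "E = \<kappa> * exp (- T * B) * ((c / 2) ^ N / fact N)"
    have E: "0 < E" using \<kappa> c by (simp add: E_def)
    obtain n1 :: nat where n1: "\<bar>C\<bar> * 2 ^ l / E < real n1" using reals_Archimedean2 by blast
    define n where "n = max n0 n1"
    have n: "n \<ge> n0" "1 \<le> real n" "\<bar>C\<bar> * 2 ^ l / E < real n" using n0 n1 by (auto simp: n_def)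
    have "C * (1 + real n) ^ l \<le> \<bar>C\<bar> * (2 * real n) ^ l"
      using n by (intro mult_mono power_mono) auto
    also have "\<dots> = \<bar>C\<bar> * 2 ^ l * real n ^ l" by (simp add: power_mult_distrib)
    also have "\<dots> < (E * real n) * real n ^ l"
      using n E by (intro mult_strict_right_mono) (auto simp: pos_divide_less_eq mult.commute)
    also have "\<dots> = E * (real n powr (- \<rho>) * real n powr (real l + \<rho> + 1))"
      using n by (simp add: powr_add[symmetric]) (simp add: powr_add powr_realpow mult_ac)
    also have "\<dots> \<le> E * (real n powr (- \<rho>) * real n powr (\<sigma> * real N))"
      using n E N' by (intro mult_left_mono powr_mono) auto
    also have "real n powr (\<sigma> * real N) = (real n powr \<sigma>) ^ N"
      using n by (simp add: powr_realpow[symmetric] powr_powr)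
    also have "E * (real n powr (- \<rho>) * (real n powr \<sigma>) ^ N) = \<kappa> * real n powr (- \<rho>) * exp (- T * B) * ((c / 2 * real n powr \<sigma>) ^ N / fact N)"
      unfolding power_mult_distrib[of "c / 2"] by (simp add: E_def)
    also have "\<dots> \<le> \<kappa> * real n powr (- \<rho>) * exp (- T * B) * exp (c / 2 * real n powr \<sigma>)"
      using power_le_fact_exp[of "c / 2 * real n powr \<sigma>" N] c \<kappa>
      by (intro mult_left_mono) (auto simp: pos_divide_le_eq mult.commute)
    finally show ?thesis using n by blast
  qed
  have "\<exists>\<xi>. C * wt \<xi> ^ l < gdecay s h \<xi> * integral {0..ts \<xi>}
      (\<lambda>r. exp (Im (primitive (psym \<xi>) (ts \<xi>)) - Im (primitive (psym \<xi>) r)))" for C l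
  proof -
    obtain n where n: "n \<ge> n0" "C * (1 + real n) ^ l < \<kappa> * real n powr (- \<rho>) * exp (- T * B) * exp (c / 2 * real n powr \<sigma>)"
      using unbounded by blast
    have "C * wt (z n) ^ l = C * (1 + real n) ^ l" by (simp only: wtz)
    also note n(2)
    also note big[OF n(1)]
    finally show ?thesis by blast
  qed
  from no_solution[OF T cont s1 h ts this]
  show ?thesis using that unfolding s_def by blast
qed

lemma gevrey_zero: "1 \<le> \<tau> \<Longrightarrow> (\<lambda>_. 0) \<in> (gevrey \<tau> :: 'n functional set)" and Cinf_zero: "(\<lambda>_. 0) \<in> (Cinf :: 'n functional set)"
proof -
  have zd: "(\<lambda>_. 0) \<in> (distributions :: 'n functional set)" using cont_familyD(1)[OF cont_family_zero, of 0 1] by simp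
  show "1 \<le> \<tau> \<Longrightarrow> (\<lambda>_. 0) \<in> (gevrey \<tau> :: 'n functional set)"
    using zd by (auto simp: gevrey_iff intro!: exI[of _ 0] exI[of _ 1])
  show "(\<lambda>_. 0) \<in> (Cinf :: 'n functional set)" using zd by (auto simp: Cinf_iff rapid_def)
qed

end

theorem theorem7p3:
  fixes T \<delta> :: real
    and a2 a0 :: "real \<Rightarrow> complex"
    and a1 :: "'n::finite \<Rightarrow> real \<Rightarrow> complex"
    and m :: nat
    and t :: "nat \<Rightarrow> real"
    and p :: "nat \<Rightarrow> real"
    and q :: "'n \<Rightarrow> nat \<Rightarrow> real"
    and \<alpha> :: "nat \<Rightarrow> real \<Rightarrow> real"
    and \<beta> :: "'n \<Rightarrow> nat \<Rightarrow> real \<Rightarrow> real"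
    and I :: "nat \<Rightarrow> real set"
    and qmin :: "nat \<Rightarrow> real"
    and K :: "nat set"
  assumes "T > 0"
    and "continuous_on {0..T} a2" and "\<And>j. continuous_on {0..T} (a1 j)"
    and "continuous_on {0..T} a0"
    and h1: "\<And>s. s \<in> {0..T} \<Longrightarrow> Im (a2 s) \<le> 0"
    and h2: "strict_mono_on {1..m} t" "t ` {1..m} \<subseteq> {0..T}"
      "\<And>s. s \<in> {0..T} \<Longrightarrow> Im (a2 s) = 0 \<longleftrightarrow> s \<in> t ` {1..m}"
    and "\<delta> > 0"
    and I_eq: "\<And>k. I k = {t k - \<delta>..t k + \<delta>} \<inter> {0..T}"
    and h3: "\<And>k. k \<in> {1..m} \<Longrightarrow> p k > 0 \<and> bounded (\<alpha> k ` I k) \<and>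
      (\<exists>\<epsilon>>0. \<forall>s\<in>I k. \<alpha> k s \<le> - \<epsilon>) \<and>
      (\<forall>s\<in>I k. Im (a2 s) = \<alpha> k s * rpow \<bar>s - t k\<bar> (p k))"
    and h4: "\<And>j k. k \<in> {1..m} \<Longrightarrow> q j k \<ge> 0 \<and> bounded (\<beta> j k ` I k) \<and>
      (\<forall>s\<in>I k. \<beta> j k s \<noteq> 0) \<and>
      (\<forall>s\<in>I k. Im (a1 j s) = \<beta> j k s * rpow \<bar>s - t k\<bar> (q j k))"
    and qmin_eq: "\<And>k. qmin k = Min (range (\<lambda>j. q j k))"
    and K_eq: "K = {k \<in> {1..m}. p k > 2 * qmin k + 1}"
  shows "((\<forall>k\<in>{1..m}. p k \<le> 2 * qmin k + 1) \<longrightarrow> well_posed_Hr T a2 a1 a0)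
    \<and> ((\<forall>j. \<forall>k\<in>{1..m}. \<exists>\<epsilon>>0. \<forall>s\<in>I k. \<epsilon> \<le> \<bar>\<beta> j k s\<bar>) \<longrightarrow>
       (\<exists>k\<in>{1..m}. p k > 2 * qmin k + 1) \<longrightarrow>
         \<not> well_posed_Cinf T a2 a1 a0 \<and>
         (\<forall>\<tau>\<ge>1. well_posed_Gevrey \<tau> T a2 a1 a0 \<longleftrightarrow>
            \<tau> < Min ((\<lambda>k. (p k - qmin k) / (p k - 2 * qmin k - 1)) ` K)))"
proof -
  interpret degenerate_cauchy T \<delta> a2 a0 a1 m t p q \<alpha> \<beta> I qmin
    by (rule degenerate_cauchy.intro) (fact assms | rule assms, assumption)+
  show ?thesis
  proof (intro conjI impI allI)
    assume "\<forall>k\<in>{1..m}. p k \<le> 2 * qmin k + 1"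
    \<comment> \<open>With \<sigma> = 0 the growth bound becomes independent of the
      frequency.\<close>
    then obtain A where A: "\<And>\<xi> s u. 0 \<le> s \<Longrightarrow> s \<le> u \<Longrightarrow> u \<le> T \<Longrightarrow>
        Im (primitive (psym \<xi>) u) - Im (primitive (psym \<xi>) s) \<le> A * wt \<xi> powr 0"
      using primitive_growth[of 0] by (metis order_refl)
    show "well_posed_Hr T a2 a1 a0"
      unfolding well_posed_Hr_def
    proof
      fix r
      have "Im (primitive (psym \<xi>) u) - Im (primitive (psym \<xi>) s) \<le> A" if "0 \<le> s" "s \<le> u" "u \<le> T" for \<xi> s u
        using A[OF that, of \<xi>] wt_ge_1[of \<xi>] by simp
      then show "well_posed_in (sobolev_top r) T a2 a1 a0" by (rule well_posed_sobolev[OF T cont])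
    qed
  next
    assume \<beta>: "\<forall>j. \<forall>k\<in>{1..m}. \<exists>\<epsilon>>0. \<forall>s\<in>I k. \<epsilon> \<le> \<bar>\<beta> j k s\<bar>"
      and "\<exists>k\<in>{1..m}. p k > 2 * qmin k + 1"
    then obtain k where k: "k \<in> {1..m}" "p k > 2 * qmin k + 1" by blast
    from no_solution_gevrey[OF k] \<beta> k(1) obtain f :: "real \<Rightarrow> 'n functional" where
      "time_cont T Cinf_top f" "\<And>u. \<not> solves_CP T a2 a1 a0 f (\<lambda>_. 0) u" by metis
    then show "\<not> well_posed_Cinf T a2 a1 a0"
      unfolding well_posed_Cinf_def well_posed_in_def using Cinf_zero by (metis topspace_Cinf_top)
  next
    fix \<tau> :: real
    assume \<beta>: "\<forall>j. \<forall>k\<in>{1..m}. \<exists>\<epsilon>>0. \<forall>s\<in>I k. \<epsilon> \<le> \<bar>\<beta> j k s\<bar>"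
      and ex: "\<exists>k\<in>{1..m}. p k > 2 * qmin k + 1" and \<tau>: "1 \<le> \<tau>"
    let ?s = "\<lambda>k. (p k - qmin k) / (p k - 2 * qmin k - 1)"
    let ?\<sigma> = "\<lambda>k. (p k - 2 * qmin k - 1) / (p k - qmin k)"
    have K: "finite K" "K \<noteq> {}" using ex by (auto simp: K_eq)
    have Kpos: "0 < ?\<sigma> k" "0 < ?s k" "?\<sigma> k = 1 / ?s k" if "k \<in> K" for k
      using that qmin_nonneg[of k] by (auto simp: K_eq)
    show "well_posed_Gevrey \<tau> T a2 a1 a0 \<longleftrightarrow> \<tau> < Min (?s ` K)"
    proof
      assume less: "\<tau> < Min (?s ` K)"
      \<comment> \<open>The worst zero determines the growth. The largest exponent is the reciprocal
        of the smallest critical order, so \<tau> < \<open>?s k\<close> becomes the strict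
        inequality \<sigma> < 1/\<tau> that the absorption needs.\<close>
      define \<sigma> where "\<sigma> = Max (?\<sigma> ` K)"
      have "\<sigma> \<in> ?\<sigma> ` K" unfolding \<sigma>_def using K by (intro Max_in) auto
      then obtain k where k: "k \<in> K" "\<sigma> = ?\<sigma> k" by blast
      have "\<tau> < ?s k" using less K k by (simp add: Min_gr_iff)
      then have \<sigma>\<tau>: "\<sigma> < 1 / \<tau>" unfolding k(2) Kpos(3)[OF k(1)] using \<tau> Kpos(2)[OF k(1)] by (intro divide_strict_left_mono mult_pos_pos) linarith+
      have \<sigma>0: "0 \<le> \<sigma>" using Kpos(1)[OF k(1)] k by simp
      have "p i \<le> 2 * qmin i + 1 \<or> ?\<sigma> i \<le> \<sigma>" if "i \<in> {1..m}" for i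
      proof (cases "p i \<le> 2 * qmin i + 1")
        case False
        then have "i \<in> K" using that by (simp add: K_eq)
        then show ?thesis unfolding \<sigma>_def using K by (intro disjI2 Max_ge) auto
      qed simp
      then obtain A where A: "0 \<le> A" "\<And>\<xi> s u. 0 \<le> s \<Longrightarrow> s \<le> u \<Longrightarrow> u \<le> T \<Longrightarrow>
          Im (primitive (psym \<xi>) u) - Im (primitive (psym \<xi>) s) \<le> A * wt \<xi> powr \<sigma>"
        using primitive_growth[OF \<sigma>0] by metis
      from \<tau> \<sigma>0 \<sigma>\<tau> A show "well_posed_Gevrey \<tau> T a2 a1 a0"
        unfolding well_posed_Gevrey_def by (rule well_posed_gevrey[OF T cont])
    next
      assume wp: "well_posed_Gevrey \<tau> T a2 a1 a0"
      show "\<tau> < Min (?s ` K)"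
      proof (rule ccontr)
        assume "\<not> \<tau> < Min (?s ` K)"
        \<comment> \<open>Equality is included here: the source of \<open>no_solution_gevrey\<close>
          already belongs to the critical order \<open>?s k\<close>, so the bound on \<tau> must be
          strict.\<close>
        then obtain k where k: "k \<in> K" "?s k \<le> \<tau>" using K by (auto simp: Min_gr_iff not_less)
        then have k': "k \<in> {1..m}" "p k > 2 * qmin k + 1" by (auto simp: K_eq)
        from no_solution_gevrey[OF k'] \<beta> k'(1) k(2) obtain f :: "real \<Rightarrow> 'n functional" where
          "time_cont T (gevrey_top \<tau>) f" "\<And>u. \<not> solves_CP T a2 a1 a0 f (\<lambda>_. 0) u" by metis
        then show False
          using wp gevrey_zero[OF \<tau>] topspace_gevrey_top[OF \<tau>, where ?'a = 'n]
          unfolding well_posed_Gevrey_def well_posed_in_def by metis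
      qed
    qed
  qed
qed

end
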